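(* Suppose that for every $r\ge4$ there is an exact sequence of weight-graded $\mathbb{Q}$-vector spaces with weight-preserving maps \[ 0\rightarrow\mathbb{P}^{\vee}\otimes gr_{r-4}^{\mathfrak{D}}\mathcal{A}\rightarrow gr_r^{\mathfrak{D}}\mathcal{A}\rightarrow gr_1^{\mathfrak{D}}\mathcal{A}^{odd}\otimes gr_{r-1}^{\mathfrak{D}}\mathcal{A}\rightarrow \mathbb{P}^{\vee}\otimes gr_{r-2}^{\mathfrak{D}}\mathcal{A}\rightarrow0. \] Then, writing $gr^{\mathfrak{D}}_r\mathcal{H}_N$ for the weight-$N$ part of $gr^{\mathfrak{D}}_r\mathcal{H}$, \[ 1+\sum_{N,r>0}\dim_{\mathbb{Q}}(gr_r^{\mathfrak{D}}\mathcal{H}_N)x^Ny^r=\frac{1+\mathbb{E}(x)y}{1-\mathbb{O}(x)y+\mathbb{S}(x)y^2-\mathbb{S}(x)y^4}, \] where $\mathbb{E}(x)=\frac{x^2}{1-x^2}$, $\mathbb{O}(x)=\frac{x^3}{1-x^2}$, $\mathbb{S}(x)=\frac{x^{12}}{(1-x^4)(1-x^6)}$.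
   Context: Let $\mathcal{H}$ be Brown's algebra of motivic multiple zeta values, spanned by $\zeta^{\mathfrak{m}}(n_1,\dots,n_r)$ (images of $e^1(e^0)^{n_1-1}\cdots e^1(e^0)^{n_r-1}$ in the quotient of the shuffle algebra $\mathbb{Q}\langle e^0,e^1\rangle\cong\mathcal{O}({}_0\Pi_1)$ by the largest graded ideal contained in the kernel of the period map and stable under the coaction of $\mathcal{O}(U^{dR})$, where $\mathbb{G}_m\ltimes U^{dR}$ is the de Rham motivic Galois group of mixed Tate motives over $\mathbb{Z}$); weight of $\zeta^{\mathfrak{m}}(n_1,\dots,n_r)$ is $\sum n_i$. $\mathfrak{D}_r\mathcal{H}$ is the span of $\zeta^{\mathfrak{m}}(n_1,\dots,n_s)$ with $s\le r$, $gr^{\mathfrak{D}}_r\mathcal{H}=\mathfrak{D}_r\mathcal{H}/\mathfrak{D}_{r-1}\mathcal{H}$. $\mathcal{A}=\mathcal{H}/\zeta^{\mathfrak{m}}(2)\mathcal{H}$, $\mathfrak{D}_r\mathcal{A}$ the image of $\mathfrak{D}_r\mathcal{H}$, $gr^{\mathfrak{D}}_r\mathcal{A}=\mathfrak{D}_r\mathcal{A}/\mathfrak{D}_{r-1}\mathcal{A}$, $gr^{\mathfrak{D}}_0\mathcal{A}=\mathbb{Q}$; $gr^{\mathfrak{D}}_1\mathcal{A}^{odd}$ is spanned by the images of $\zeta^{\mathfrak{m}}(n)$, $n\ge3$ odd. $\mathbb{P}^{\vee}=\bigoplus_{N\ge3}\mathbb{P}_N^{\vee}$ (weight $N$ in degree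 $N$), where $\mathbb{P}_N$ is the space of homogeneous $p(x_1,x_2)$ of degree $N-2$ with $p(x_1,0)=0$, $p(\pm x_1,\pm x_2)=p(x_1,x_2)$, $p(x_1,x_2)+p(x_1-x_2,x_1)-p(x_1-x_2,x_2)=0$. Weights on tensor products are additive. *)

theory Defs
  imports
    "HOL-Analysis.Analysis"
    "HOL-Library.Poly_Mapping"
    "HOL-Computational_Algebra.Formal_Power_Series"
begin

section \<open>Rational vector spaces with a basis\<close>

text \<open>The type \<open>'k \<Rightarrow>\<^sub>0 rat\<close> is the rational vector space with basis \<open>'k\<close>; the tensor product of the
  spaces with bases \<open>'k\<close> and \<open>'l\<close> is the space with basis \<open>'k \<times> 'l\<close>.\<close>

definition qscale :: "rat \<Rightarrow> ('k \<Rightarrow>\<^sub>0 rat) \<Rightarrow> ('k \<Rightarrow>\<^sub>0 rat)" where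
  "qscale c p = Poly_Mapping.map ((*) c) p"

lemma lookup_qscale [simp]: "Poly_Mapping.lookup (qscale c p) k = c * Poly_Mapping.lookup p k"
  unfolding qscale_def by transfer (auto simp: when_def)

interpretation qvs: vector_space "qscale :: rat \<Rightarrow> ('k \<Rightarrow>\<^sub>0 rat) \<Rightarrow> ('k \<Rightarrow>\<^sub>0 rat)"
  by unfold_locales (auto intro!: poly_mapping_eqI simp: lookup_add algebra_simps)

abbreviation qlinear :: "(('k \<Rightarrow>\<^sub>0 rat) \<Rightarrow> ('l \<Rightarrow>\<^sub>0 rat)) \<Rightarrow> bool" where
  "qlinear \<equiv> Vector_Spaces.linear qscale qscale"

abbreviation bas :: "'k \<Rightarrow> ('k \<Rightarrow>\<^sub>0 rat)" where
  "bas k \<equiv> Poly_Mapping.single k 1"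

definition lin_ext :: "('k \<Rightarrow> ('l \<Rightarrow>\<^sub>0 rat)) \<Rightarrow> ('k \<Rightarrow>\<^sub>0 rat) \<Rightarrow> ('l \<Rightarrow>\<^sub>0 rat)" where
  "lin_ext f p = (\<Sum>k\<in>Poly_Mapping.keys p. qscale (Poly_Mapping.lookup p k) (f k))"

definition bilin_ext ::
  "('k \<Rightarrow> 'l \<Rightarrow> ('m \<Rightarrow>\<^sub>0 rat)) \<Rightarrow> ('k \<Rightarrow>\<^sub>0 rat) \<Rightarrow> ('l \<Rightarrow>\<^sub>0 rat) \<Rightarrow> ('m \<Rightarrow>\<^sub>0 rat)" where
  "bilin_ext f p q = lin_ext (\<lambda>k. lin_ext (f k) q) p"

definition tensor :: "('k \<Rightarrow>\<^sub>0 rat) \<Rightarrow> ('l \<Rightarrow>\<^sub>0 rat) \<Rightarrow> ('k \<times> 'l \<Rightarrow>\<^sub>0 rat)" where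
  "tensor = bilin_ext (\<lambda>k l. bas (k, l))"

definition tensor_map ::
  "(('k \<Rightarrow>\<^sub>0 rat) \<Rightarrow> ('m \<Rightarrow>\<^sub>0 rat)) \<Rightarrow> (('l \<Rightarrow>\<^sub>0 rat) \<Rightarrow> ('n \<Rightarrow>\<^sub>0 rat)) \<Rightarrow>
   ('k \<times> 'l \<Rightarrow>\<^sub>0 rat) \<Rightarrow> ('m \<times> 'n \<Rightarrow>\<^sub>0 rat)" where
  "tensor_map f g = lin_ext (\<lambda>(k, l). tensor (f (bas k)) (g (bas l)))"

definition homog :: "('k \<Rightarrow> nat) \<Rightarrow> nat \<Rightarrow> ('k \<Rightarrow>\<^sub>0 rat) set" where
  "homog wt N = {p. \<forall>k\<in>Poly_Mapping.keys p. wt k = N}"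

definition homog_part :: "('k \<Rightarrow> nat) \<Rightarrow> nat \<Rightarrow> ('k \<Rightarrow>\<^sub>0 rat) \<Rightarrow> ('k \<Rightarrow>\<^sub>0 rat)" where
  "homog_part wt N = lin_ext (\<lambda>k. if wt k = N then bas k else 0)"

definition graded_subspace :: "('k \<Rightarrow> nat) \<Rightarrow> ('k \<Rightarrow>\<^sub>0 rat) set \<Rightarrow> bool" where
  "graded_subspace wt V \<longleftrightarrow> qvs.subspace V \<and> (\<forall>p\<in>V. \<forall>N. homog_part wt N p \<in> V)"


section \<open>Graded subquotients\<close>

text \<open>A record \<open>X\<close> stands for the weight-graded vector space \<open>num X / den X\<close>, where
  \<open>den X \<subseteq> num X\<close> are graded subspaces of a space graded by the weights \<open>wt X\<close> of its basis.\<close>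

record 'k subquot =
  wt :: "'k \<Rightarrow> nat"
  num :: "('k \<Rightarrow>\<^sub>0 rat) set"
  den :: "('k \<Rightarrow>\<^sub>0 rat) set"

text \<open>The weight \<open>N\<close> part of \<open>V/W\<close> is \<open>V\<^sub>N/W\<^sub>N\<close>. Natural number subtraction is
  harmless: \<open>W\<^sub>N \<subseteq> V\<^sub>N\<close> and, in the cases of interest, \<open>V\<^sub>N\<close> is finite-dimensional.\<close>

definition wt_dim :: "'k subquot \<Rightarrow> nat \<Rightarrow> nat" where
  "wt_dim X N = qvs.dim (num X \<inter> homog (wt X) N) - qvs.dim (den X \<inter> homog (wt X) N)"

text \<open>\<open>V/W \<otimes> V'/W' = (V \<otimes> V') / (W \<otimes> V' + V \<otimes> W')\<close>\<close>

definition tensor_sq :: "'k subquot \<Rightarrow> 'l subquot \<Rightarrow> ('k \<times> 'l) subquot" (infixr \<open>\<otimes>\<^sub>s\<close> 70) where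
  "X \<otimes>\<^sub>s Y = \<lparr>
     wt = (\<lambda>(k, l). wt X k + wt Y l),
     num = qvs.span {tensor v v' | v v'. v \<in> num X \<and> v' \<in> num Y},
     den = qvs.span ({tensor w v' | w v'. w \<in> den X \<and> v' \<in> num Y} \<union>
                     {tensor v w' | v w'. v \<in> num X \<and> w' \<in> den Y})\<rparr>"

text \<open>\<open>f\<close> induces a weight-preserving linear map \<open>num X / den X \<rightarrow> num Y / den Y\<close>. Every such map of
  quotients is induced by a linear map of the ambient spaces.\<close>

definition sq_map :: "'k subquot \<Rightarrow> 'l subquot \<Rightarrow> (('k \<Rightarrow>\<^sub>0 rat) \<Rightarrow> ('l \<Rightarrow>\<^sub>0 rat)) \<Rightarrow> bool" where
  "sq_map X Y f \<longleftrightarrow> qlinear f \<and> f ` num X \<subseteq> num Y \<and> f ` den X \<subseteq> den Y \<and>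
     (\<forall>N. \<forall>v \<in> num X \<inter> homog (wt X) N. \<exists>v' \<in> num Y \<inter> homog (wt Y) N. f v - v' \<in> den Y)"

definition sq_inj :: "'k subquot \<Rightarrow> 'l subquot \<Rightarrow> (('k \<Rightarrow>\<^sub>0 rat) \<Rightarrow> ('l \<Rightarrow>\<^sub>0 rat)) \<Rightarrow> bool" where
  "sq_inj X Y f \<longleftrightarrow> (\<forall>v\<in>num X. f v \<in> den Y \<longrightarrow> v \<in> den X)"

definition sq_exact_at ::
  "'k subquot \<Rightarrow> 'l subquot \<Rightarrow> 'm subquot \<Rightarrow>
   (('k \<Rightarrow>\<^sub>0 rat) \<Rightarrow> ('l \<Rightarrow>\<^sub>0 rat)) \<Rightarrow> (('l \<Rightarrow>\<^sub>0 rat) \<Rightarrow> ('m \<Rightarrow>\<^sub>0 rat)) \<Rightarrow> bool" where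
  "sq_exact_at X Y Z f g \<longleftrightarrow>
     (\<forall>v\<in>num Y. g v \<in> den Z \<longleftrightarrow> (\<exists>u\<in>num X. v - f u \<in> den Y))"

definition sq_surj :: "'k subquot \<Rightarrow> 'l subquot \<Rightarrow> (('k \<Rightarrow>\<^sub>0 rat) \<Rightarrow> ('l \<Rightarrow>\<^sub>0 rat)) \<Rightarrow> bool" where
  "sq_surj X Y f \<longleftrightarrow> (\<forall>v\<in>num Y. \<exists>u\<in>num X. v - f u \<in> den Y)"

text \<open>There is an exact sequence \<open>0 \<rightarrow> A \<rightarrow> B \<rightarrow> C \<rightarrow> D \<rightarrow> 0\<close>.\<close>

definition exists_exact_seq :: "'a subquot \<Rightarrow> 'b subquot \<Rightarrow> 'c subquot \<Rightarrow> 'd subquot \<Rightarrow> bool" where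
  "exists_exact_seq A B C D \<longleftrightarrow>
     (\<exists>f g h. sq_map A B f \<and> sq_map B C g \<and> sq_map C D h \<and>
        sq_inj A B f \<and> sq_exact_at A B C f g \<and> sq_exact_at B C D g h \<and> sq_surj C D h)"


section \<open>The shuffle algebra\<close>

fun shuffle_words :: "'a list \<Rightarrow> 'a list \<Rightarrow> ('a list \<Rightarrow>\<^sub>0 rat)" where
  "shuffle_words [] v = bas v"
| "shuffle_words u [] = bas u"
| "shuffle_words (a # u) (b # v) =
     lin_ext (\<lambda>w. bas (a # w)) (shuffle_words u (b # v)) +
     lin_ext (\<lambda>w. bas (b # w)) (shuffle_words (a # u) v)"

definition shuffle :: "('a list \<Rightarrow>\<^sub>0 rat) \<Rightarrow> ('a list \<Rightarrow>\<^sub>0 rat) \<Rightarrow> ('a list \<Rightarrow>\<^sub>0 rat)" (infixl \<open>\<diamondop>\<close> 70) where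
  "shuffle = bilin_ext shuffle_words"

text \<open>The letters of \<open>\<O>(\<^sub>0\<Pi>\<^sub>1) = \<rat>\<langle>e\<^sup>0,e\<^sup>1\<rangle>\<close>. They also serve as names of the points \<open>0\<close>, \<open>1\<close>.\<close>

datatype letter = E0 | E1

text \<open>The weight of a word in \<open>e\<^sup>0\<close>, \<open>e\<^sup>1\<close> is its length.\<close>

type_synonym pialg = "letter list \<Rightarrow>\<^sub>0 rat"


section \<open>The period map\<close>

text \<open>The period of \<open>a\<^sub>1\<dots>a\<^sub>n\<close> is the iterated integral of \<open>\<omega>\<^bsub>a\<^sub>1\<^esub>\<dots>\<omega>\<^bsub>a\<^sub>n\<^esub>\<close> over
  \<open>0 < t\<^sub>1 < \<dots> < t\<^sub>n < 1\<close>, with \<open>\<omega>\<^sub>0 = dt/t\<close>, \<open>\<omega>\<^sub>1 = dt/(1-t)\<close>, regularised with respect to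
  the unit tangential base points at \<open>0\<close> and \<open>1\<close>: the integral from \<open>\<epsilon>\<close> to \<open>1-\<epsilon>\<close> is a polynomial in
  \<open>ln \<epsilon>\<close> up to an error tending to \<open>0\<close>, and one takes the constant term of that polynomial.\<close>

fun form :: "letter \<Rightarrow> real \<Rightarrow> real" where
  "form E0 t = 1 / t"
| "form E1 t = 1 / (1 - t)"

fun iter_int :: "letter list \<Rightarrow> real \<Rightarrow> real \<Rightarrow> real" where
  "iter_int [] x y = 1"
| "iter_int (a # w) x y = integral {x..y} (\<lambda>t. form a t * iter_int w t y)"

definition per_word :: "letter list \<Rightarrow> real" where
  "per_word w = (THE c. \<exists>p::real poly. poly p 0 = c \<and>
     ((\<lambda>\<epsilon>. iter_int w \<epsilon> (1 - \<epsilon>) - poly p (ln \<epsilon>)) \<longlongrightarrow> 0) (at_right 0))"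

definition per :: "pialg \<Rightarrow> real" where
  "per p = (\<Sum>w\<in>Poly_Mapping.keys p. of_rat (Poly_Mapping.lookup p w) * per_word w)"


section \<open>The action of the motivic Galois group\<close>

text \<open>The function \<open>I(a; w; b)\<close> on the torsor of paths from \<open>a\<close> to \<open>b\<close>, as an element of
  \<open>\<O>(\<^sub>0\<Pi>\<^sub>1)\<close>: the canonical path is the identity if \<open>a = b\<close>, and paths from \<open>1\<close> to \<open>0\<close> are the
  inverses of paths from \<open>0\<close> to \<open>1\<close>.\<close>

fun path_fun :: "letter \<Rightarrow> letter list \<Rightarrow> letter \<Rightarrow> pialg" where
  "path_fun a [] b = bas []"
| "path_fun E0 w E1 = bas w"
| "path_fun E1 w E0 = qscale ((-1) ^ length w) (bas (rev w))"
| "path_fun _ w _ = 0"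

text \<open>The Ihara action \<open>\<^sub>0\<Pi>\<^sub>1 \<times> \<^sub>0\<Pi>\<^sub>1 \<rightarrow> \<^sub>0\<Pi>\<^sub>1\<close>, in the form of Goncharov's formula
  \<open>I(a\<^sub>0;a\<^sub>1\<dots>a\<^sub>n;a\<^bsub>n+1\<^esub>) \<mapsto>
    \<Sum> (\<Prod>\<^sub>p I(a\<^bsub>i\<^sub>p\<^esub>; a\<^bsub>i\<^sub>p+1\<^esub> \<dots>; a\<^bsub>i\<^bsub>p+1\<^esub>\<^esub>)) \<otimes> I(a\<^sub>0;a\<^bsub>i\<^sub>1\<^esub>\<dots>a\<^bsub>i\<^sub>k\<^esub>;a\<^bsub>n+1\<^esub>)\<close>,
  summed over \<open>0 = i\<^sub>0 < i\<^sub>1 < \<dots> < i\<^sub>k < i\<^bsub>k+1\<^esub> = n+1\<close>, with \<open>a\<^sub>0 = 0\<close>, \<open>a\<^bsub>n+1\<^esub> = 1\<close>. Below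
  \<open>S = {i\<^sub>1,\<dots>,i\<^sub>k}\<close>.\<close>

definition segment_prod :: "letter list \<Rightarrow> nat set \<Rightarrow> pialg" where
  "segment_prod w S =
     (let a = E0 # w @ [E1];
          ps = 0 # sorted_list_of_set S @ [length w + 1]
      in foldr (\<diamondop>)
           (map (\<lambda>(p, q). path_fun (a ! p) (drop (Suc p) (take q a)) (a ! q)) (zip ps (tl ps)))
           (bas []))"

definition ihara :: "pialg \<Rightarrow> (letter list \<times> letter list \<Rightarrow>\<^sub>0 rat)" where
  "ihara = lin_ext (\<lambda>w. \<Sum>S\<in>Pow {1..length w}.
     tensor (segment_prod w S) (bas (nths (E0 # w @ [E1]) S)))"

text \<open>Every extension group \<open>Ext\<^sup>1(\<rat>(0),\<rat>(n))\<close> of mixed Tate motives over \<open>\<int>\<close> has dimension \<open>1\<close> for odd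
  \<open>n \<ge> 3\<close> and \<open>0\<close> otherwise, and \<open>Ext\<^sup>2\<close> vanishes. So the graded Lie algebra of \<open>U\<^sup>d\<^sup>R\<close> is free with one
  generator for each odd \<open>n \<ge> 3\<close>. After a choice of generators, \<open>\<O>(U\<^sup>d\<^sup>R)\<close> is the shuffle algebra on
  letters \<open>f\<^sub>n\<close>, \<open>n \<ge> 3\<close> odd, of weight \<open>n\<close>, with deconcatenation as coproduct. The letter \<open>f\<^sub>n\<close> is
  represented by the number \<open>n\<close>.\<close>

definition OU :: "(nat list \<Rightarrow>\<^sub>0 rat) set" where
  "OU = {p. Poly_Mapping.keys p \<subseteq> lists {n. odd n \<and> 3 \<le> n}}"

definition deconc :: "(nat list \<Rightarrow>\<^sub>0 rat) \<Rightarrow> (nat list \<times> nat list \<Rightarrow>\<^sub>0 rat)" where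
  "deconc = lin_ext (\<lambda>w. \<Sum>i\<le>length w. bas (take i w, drop i w))"

text \<open>The ring \<open>\<O>(U\<^sup>d\<^sup>R) \<otimes> \<rat>[f\<^sub>2]\<close> of (effective, real) motivic periods of mixed Tate motives over \<open>\<int>\<close>,
  where \<open>f\<^sub>2\<close> is the motivic period with value \<open>\<zeta>(2)\<close>. The basis element \<open>(w, k)\<close> stands for \<open>w f\<^sub>2\<^sup>k\<close>.\<close>

definition PM :: "(nat list \<times> nat \<Rightarrow>\<^sub>0 rat) set" where
  "PM = {p. fst ` Poly_Mapping.keys p \<subseteq> lists {n. odd n \<and> 3 \<le> n}}"

definition PM_wt :: "nat list \<times> nat \<Rightarrow> nat" where
  "PM_wt = (\<lambda>(w, k). sum_list w + 2 * k)"

definition PM_mult :: "(nat list \<times> nat \<Rightarrow>\<^sub>0 rat) \<Rightarrow> (nat list \<times> nat \<Rightarrow>\<^sub>0 rat) \<Rightarrow> (nat list \<times> nat \<Rightarrow>\<^sub>0 rat)" where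
  "PM_mult = bilin_ext (\<lambda>(u, k) (v, l). lin_ext (\<lambda>w. bas (w, k + l)) (shuffle_words u v))"

definition PM_coact :: "(nat list \<times> nat \<Rightarrow>\<^sub>0 rat) \<Rightarrow> (nat list \<times> (nat list \<times> nat) \<Rightarrow>\<^sub>0 rat)" where
  "PM_coact = lin_ext (\<lambda>(w, k). \<Sum>i\<le>length w. bas (take i w, (drop i w, k)))"

text \<open>The data supplied by the theory of mixed Tate motives over \<open>\<int>\<close>:
  \<^item> \<open>\<psi> : \<O>(\<^sub>0\<Pi>\<^sub>1) \<rightarrow> \<O>(U\<^sup>d\<^sup>R)\<close>, dual to the map \<open>g \<mapsto> g(1)\<close> from \<open>U\<^sup>d\<^sup>R\<close> to \<open>\<^sub>0\<Pi>\<^sub>1\<close>. It is a weight-preserving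
    homomorphism of Hopf algebras, \<open>\<^sub>0\<Pi>\<^sub>1\<close> being a group under the Ihara action, and it determines the
    action of \<open>U\<^sup>d\<^sup>R\<close> on \<open>\<^sub>0\<Pi>\<^sub>1\<close>.
  \<^item> \<open>\<phi>\<close>, sending a word to the motivic period of \<open>\<^sub>0\<Pi>\<^sub>1\<close> that it defines along the straight path from \<open>0\<close>
    to \<open>1\<close>. It is a \<open>U\<^sup>d\<^sup>R\<close>-equivariant weight-preserving homomorphism of algebras.
  \<^item> \<open>\<rho>\<close>, the homomorphism from motivic periods to real numbers.

  The category of mixed Tate motives is not constructed here; these properties are what its theory
  (Deligne and Goncharov) provides. The data depend on the choice of generators of the Lie algebra
  and of a splitting of the ring of motivic periods, but the ideal \<open>motivic_ideal\<close> below does not.\<close>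

locale mixed_tate_Z =
  fixes \<psi> :: "pialg \<Rightarrow> (nat list \<Rightarrow>\<^sub>0 rat)"
    and \<phi> :: "pialg \<Rightarrow> (nat list \<times> nat \<Rightarrow>\<^sub>0 rat)"
    and \<rho> :: "(nat list \<times> nat \<Rightarrow>\<^sub>0 rat) \<Rightarrow> real"
  assumes psi_linear: "qlinear \<psi>"
    and psi_OU: "\<And>x. \<psi> x \<in> OU"
    and psi_weight: "\<And>N x. x \<in> homog length N \<Longrightarrow> \<psi> x \<in> homog sum_list N"
    and psi_one: "\<psi> (bas []) = bas []"
    and psi_mult: "\<And>x y. \<psi> (x \<diamondop> y) = \<psi> x \<diamondop> \<psi> y"
    and psi_comult: "\<And>x. deconc (\<psi> x) = tensor_map \<psi> \<psi> (ihara x)"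
    and phi_linear: "qlinear \<phi>"
    and phi_PM: "\<And>x. \<phi> x \<in> PM"
    and phi_weight: "\<And>N x. x \<in> homog length N \<Longrightarrow> \<phi> x \<in> homog PM_wt N"
    and phi_one: "\<phi> (bas []) = bas ([], 0)"
    and phi_mult: "\<And>x y. \<phi> (x \<diamondop> y) = PM_mult (\<phi> x) (\<phi> y)"
    and phi_coact: "\<And>x. PM_coact (\<phi> x) = tensor_map \<psi> \<phi> (ihara x)"
    and rho_add: "\<And>x y. x \<in> PM \<Longrightarrow> y \<in> PM \<Longrightarrow> \<rho> (x + y) = \<rho> x + \<rho> y"
    and rho_scale: "\<And>c x. x \<in> PM \<Longrightarrow> \<rho> (qscale c x) = of_rat c * \<rho> x"
    and rho_one: "\<rho> (bas ([], 0)) = 1"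
    and rho_mult: "\<And>x y. x \<in> PM \<Longrightarrow> y \<in> PM \<Longrightarrow> \<rho> (PM_mult x y) = \<rho> x * \<rho> y"
    and rho_f2: "\<rho> (bas ([], 1)) = pi\<^sup>2 / 6"
    and per_rho_phi: "\<And>x. per x = \<rho> (\<phi> x)"

definition coaction :: "(pialg \<Rightarrow> (nat list \<Rightarrow>\<^sub>0 rat)) \<Rightarrow> pialg \<Rightarrow> (nat list \<times> letter list \<Rightarrow>\<^sub>0 rat)" where
  "coaction \<psi> x = tensor_map \<psi> (\<lambda>y. y) (ihara x)"


section \<open>Motivic multiple zeta values\<close>

definition graded_ideal :: "pialg set \<Rightarrow> bool" where
  "graded_ideal J \<longleftrightarrow> graded_subspace length J \<and> (\<forall>x\<in>J. \<forall>y. y \<diamondop> x \<in> J)"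

definition coaction_stable :: "(pialg \<Rightarrow> (nat list \<Rightarrow>\<^sub>0 rat)) \<Rightarrow> pialg set \<Rightarrow> bool" where
  "coaction_stable \<psi> J \<longleftrightarrow> coaction \<psi> ` J \<subseteq> qvs.span {tensor u x | u x. u \<in> OU \<and> x \<in> J}"

definition motivic_ideal :: "(pialg \<Rightarrow> (nat list \<Rightarrow>\<^sub>0 rat)) \<Rightarrow> pialg set" where
  "motivic_ideal \<psi> =
     (GREATEST J. graded_ideal J \<and> J \<subseteq> {x. per x = 0} \<and> coaction_stable \<psi> J)"

text \<open>\<open>\<H>\<close> is the quotient of \<open>pialg\<close> by \<open>motivic_ideal \<psi>\<close>, and \<open>\<zeta>\<^sup>\<mm>(n\<^sub>1,\<dots>,n\<^sub>r)\<close> is the image of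
  \<open>zeta_elt [n\<^sub>1,\<dots>,n\<^sub>r]\<close>. Subspaces of \<open>\<H>\<close> and of \<open>\<A>\<close> are represented by their preimages in \<open>pialg\<close>.\<close>

definition zeta_elt :: "nat list \<Rightarrow> pialg" where
  "zeta_elt ns = bas (concat (map (\<lambda>n. E1 # replicate (n - 1) E0) ns))"

definition depth_H :: "(pialg \<Rightarrow> (nat list \<Rightarrow>\<^sub>0 rat)) \<Rightarrow> nat \<Rightarrow> pialg set" where
  "depth_H \<psi> r =
     qvs.span ({zeta_elt ns | ns. length ns \<le> r \<and> (\<forall>n\<in>set ns. 1 \<le> n)} \<union> motivic_ideal \<psi>)"

definition gr_H :: "(pialg \<Rightarrow> (nat list \<Rightarrow>\<^sub>0 rat)) \<Rightarrow> nat \<Rightarrow> letter list subquot" where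
  "gr_H \<psi> r = \<lparr>wt = length, num = depth_H \<psi> r,
     den = (if r = 0 then motivic_ideal \<psi> else depth_H \<psi> (r - 1))\<rparr>"

text \<open>The kernel of \<open>pialg \<rightarrow> \<A> = \<H>/\<zeta>\<^sup>\<mm>(2)\<H>\<close>.\<close>

definition ideal_A :: "(pialg \<Rightarrow> (nat list \<Rightarrow>\<^sub>0 rat)) \<Rightarrow> pialg set" where
  "ideal_A \<psi> = qvs.span (motivic_ideal \<psi> \<union> {zeta_elt [2] \<diamondop> x | x. True})"

definition depth_A :: "(pialg \<Rightarrow> (nat list \<Rightarrow>\<^sub>0 rat)) \<Rightarrow> nat \<Rightarrow> pialg set" where
  "depth_A \<psi> r = qvs.span (depth_H \<psi> r \<union> ideal_A \<psi>)"

definition gr_A :: "(pialg \<Rightarrow> (nat list \<Rightarrow>\<^sub>0 rat)) \<Rightarrow> nat \<Rightarrow> letter list subquot" where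
  "gr_A \<psi> r = \<lparr>wt = length, num = depth_A \<psi> r,
     den = (if r = 0 then ideal_A \<psi> else depth_A \<psi> (r - 1))\<rparr>"

definition gr1_A_odd :: "(pialg \<Rightarrow> (nat list \<Rightarrow>\<^sub>0 rat)) \<Rightarrow> letter list subquot" where
  "gr1_A_odd \<psi> = \<lparr>wt = length,
     num = qvs.span ({zeta_elt [n] | n. 3 \<le> n \<and> odd n} \<union> depth_A \<psi> 0),
     den = depth_A \<psi> 0\<rparr>"


section \<open>Even period polynomials\<close>

text \<open>A polynomial in \<open>x\<^sub>1\<close>, \<open>x\<^sub>2\<close> is represented by its coefficients: the basis element \<open>(i, j)\<close> is the monomial
  \<open>x\<^sub>1\<^sup>i x\<^sub>2\<^sup>j\<close>. Polynomial identities over \<open>\<rat>\<close> may be checked on rational points.\<close>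

definition eval2 :: "(nat \<times> nat \<Rightarrow>\<^sub>0 rat) \<Rightarrow> rat \<Rightarrow> rat \<Rightarrow> rat" where
  "eval2 p a b = (\<Sum>(i, j)\<in>Poly_Mapping.keys p. Poly_Mapping.lookup p (i, j) * a ^ i * b ^ j)"

definition period_polys :: "nat \<Rightarrow> (nat \<times> nat \<Rightarrow>\<^sub>0 rat) set" where
  "period_polys N = {p.
     (\<forall>(i, j)\<in>Poly_Mapping.keys p. i + j = N - 2) \<and>
     (\<forall>a. eval2 p a 0 = 0) \<and>
     (\<forall>a b. eval2 p (- a) b = eval2 p a b \<and> eval2 p a (- b) = eval2 p a b) \<and>
     (\<forall>a b. eval2 p a b + eval2 p (a - b) a - eval2 p (a - b) b = 0)}"

text \<open>The graded dual \<open>\<Oplus>\<^bsub>N\<ge>3\<^esub> \<P>\<^sub>N\<^sup>\<or>\<close> is the quotient of the graded dual of the polynomial ring, with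
  basis dual to the monomials, by the functionals that vanish on all \<open>\<P>\<^sub>N\<close>, \<open>N \<ge> 3\<close>. Functionals on
  \<open>\<P>\<^sub>N\<close>, which consists of polynomials of degree \<open>N - 2\<close>, have weight \<open>N\<close>.\<close>

definition pairing :: "('k \<Rightarrow>\<^sub>0 rat) \<Rightarrow> ('k \<Rightarrow>\<^sub>0 rat) \<Rightarrow> rat" where
  "pairing l p = (\<Sum>k\<in>Poly_Mapping.keys l. Poly_Mapping.lookup l k * Poly_Mapping.lookup p k)"

definition P_dual :: "(nat \<times> nat) subquot" where
  "P_dual = \<lparr>wt = (\<lambda>(i, j). i + j + 2), num = UNIV,
     den = {l. \<forall>N\<ge>3. \<forall>p\<in>period_polys N. pairing l p = 0}\<rparr>"


section \<open>Generating series\<close>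

definition Even_series :: "rat fps" where
  "Even_series = fps_X ^ 2 / (1 - fps_X ^ 2)"

definition Odd_series :: "rat fps" where
  "Odd_series = fps_X ^ 3 / (1 - fps_X ^ 2)"

definition Cusp_series :: "rat fps" where
  "Cusp_series = fps_X ^ 12 / ((1 - fps_X ^ 4) * (1 - fps_X ^ 6))"

text \<open>The power series \<open>\<Sum>\<^bsub>N,r>0\<^esub> d N r x\<^sup>N y\<^sup>r\<close>, as a power series in \<open>y\<close> over the power series in \<open>x\<close>.\<close>

definition gen_series :: "(nat \<Rightarrow> nat \<Rightarrow> nat) \<Rightarrow> rat fps fps" where
  "gen_series d =
     Abs_fps (\<lambda>r. Abs_fps (\<lambda>N. if 0 < N \<and> 0 < r then of_nat (d N r) else 0))"

end

theory Submission
  imports Defs "HOL-Library.Function_Algebras"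
begin

text \<open>The motivic ideal is the kernel of \<open>\<phi>\<close>, and \<open>\<A>\<close> is the range of \<open>\<psi>\<close>, a subalgebra of the shuffle algebra
  \<open>\<O>(U\<^sup>d\<^sup>R)\<close>. Moreover \<open>\<H> = \<A> \<otimes> \<rat>[\<zeta>\<^sup>\<mm>(2)]\<close>, and every power of \<open>\<zeta>\<^sup>\<mm>(2)\<close> is a multiple of a single zeta value, hence of
  depth one; this gives the factor \<open>1 + \<E>(x) y\<close>. Let \<open>A\<^sub>r\<close> be the dimension series of the depth \<open>r\<close> part of \<open>\<A>\<close>.
  Then \<open>A\<^sub>0 = 1\<close> and \<open>A\<^sub>1 = \<O>\<close>. The coaction on double zeta values shows that the relations in depth two are dual to
  the even period polynomials, so \<open>A\<^sub>2 = \<O>\<^sup>2 - \<S>\<close>; the dimensions of the spaces of period polynomials come from the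
  invariants of a symmetric group. The exact sequences give
  \<open>A\<^sub>r = \<O> A\<^bsub>r-1\<^esub> - \<S> A\<^bsub>r-2\<^esub> + \<S> A\<^bsub>r-4\<^esub>\<close> for \<open>r \<ge> 4\<close> and say nothing about \<open>A\<^sub>3\<close>.

  To find \<open>A\<^sub>3\<close>, sum the recursion over \<open>r\<close>: with \<open>B = \<Sum> A\<^sub>r\<close>, the coefficients of \<open>\<O> B - B\<close> grow at most
  quadratically. If \<open>\<A>\<close> were smaller than \<open>\<O>(U\<^sup>d\<^sup>R)\<close>, a word \<open>n a\<close> not in \<open>\<A>\<close> with \<open>a\<close> in \<open>\<A>\<close>, together with the
  products of letters of large weight, would make these coefficients grow faster. So \<open>\<A> = \<O>(U\<^sup>d\<^sup>R)\<close>,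
  \<open>B = 1 / (1 - \<O>)\<close>, and comparison with the summed recursion yields \<open>A\<^sub>3 = \<O> A\<^sub>2 - \<S> \<O>\<close>.\<close>

subsection \<open>Dimensions of finitely spanned subspaces\<close>

text \<open>The elements known to lie in \<A> come from analysis: positivity of the real numbers
  \<zeta>(n) puts every letter f_n into \<A> and makes \<zeta>(2k) a nonzero multiple of f_2^k. That
  a positive power of f_2 costs a full unit of depth is a property of Goncharov's formula: the right
  factor of the coaction that yields f_2^k must contain an e^1, because powers of e^0 have no
  motivic period.

  The obstacle is that depth three must be known before \<A> is. The growth argument gets around it
  because, in the summed recursion, the terms -\<S> B and \<S> B cancel, and the unknown A_3 enters
  \<O> B - B with a minus sign; so \<O> A_2 alone bounds the coefficients from above, whatever A_3
  is. Against a quadratic bound one needs products of four large letters: L^4 patterns of exponents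
  spread over a number of weights linear in L, so some weight carries a number cubic in L.\<close>

context vector_space
begin

text \<open>The ambient spaces have infinite bases, for which \<open>dim\<close> is 0. Dimension
  statements therefore ask for a finite \<open>S\<close> whose span contains the subspace; for a
  weight space the basis words of that weight serve.\<close>

lemma finite_basis_in_span:
  assumes "V \<subseteq> span S" "finite S"
  obtains B where "B \<subseteq> V" "independent B" "finite B" "V \<subseteq> span B" "card B = dim V"
proof -
  obtain B where B: "B \<subseteq> V" "independent B" "V \<subseteq> span B" "card B = dim V"
    by (rule basis_exists)
  moreover have "finite B"
    using independent_span_bound[OF assms(2) B(2)] B(1) assms(1) by auto
  ultimately show ?thesis using that by blast
qed

lemma card_le_dim_in_span:
  assumes "independent B" "B \<subseteq> W" "W \<subseteq> span S" "finite S"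
  shows "finite B" "card B \<le> dim W"
proof -
  show fB: "finite B"
    using independent_span_bound[OF assms(4,1)] assms(2,3) by auto
  obtain C where C: "C \<subseteq> W" "independent C" "finite C" "W \<subseteq> span C" "card C = dim W"
    by (rule finite_basis_in_span[OF assms(3,4)])
  show "card B \<le> dim W"
    using independent_span_bound[OF C(3) assms(1)] assms(2) C(4,5) by auto
qed

lemma dim_mono_in_span:
  assumes "V \<subseteq> W" "W \<subseteq> span S" "finite S"
  shows "dim V \<le> dim W"
proof -
  obtain B where B: "B \<subseteq> V" "independent B" "finite B" "V \<subseteq> span B" "card B = dim V"
    by (rule finite_basis_in_span[of V S]) (use assms in auto)
  show ?thesis
    using card_le_dim_in_span(2)[OF B(2) _ assms(2,3)] B assms(1) by auto
qed

text \<open>Take a projection \<open>p\<close> onto \<open>W\<close> along a complement, and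
  subtract it from the identity. Composing with \<open>q\<close> computes modulo \<open>W\<close>
  without a quotient space.\<close>

lemma subspace_kernel_of_endomorphism:
  assumes "subspace W"
  obtains q where "Vector_Spaces.linear scale scale q" "\<And>v. q v = 0 \<longleftrightarrow> v \<in> W"
proof -
  interpret vp: vector_space_pair scale scale ..
  obtain D where D: "D \<subseteq> W" "independent D" "W \<subseteq> span D"
    by (rule basis_exists)
  obtain B where B: "D \<subseteq> B" "independent B" "span B = UNIV"
    using maximal_independent_subset_extend[OF subset_UNIV D(2)] by (metis top.extremum_uniqueI)
  obtain p where p: "Vector_Spaces.linear scale scale p" "\<And>b. b \<in> B \<Longrightarrow> p b = (if b \<in> D then b else 0)"
    using vp.linear_independent_extend[OF B(2), of "\<lambda>b. if b \<in> D then b else 0"] by blast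
  interpret p: Vector_Spaces.linear scale scale p by (rule p(1))
  have spanD: "span D = W"
    using D assms span_minimal by blast
  have pW: "p v = v" if "v \<in> W" for v
    using that unfolding spanD[symmetric]
    by (induction rule: span_induct_alt) (use p(2) B(1) in \<open>auto simp: p.zero p.add p.scale\<close>)
  have pin: "p v \<in> W" for v
  proof -
    have "v \<in> span B" using B by auto
    then show ?thesis
      by (induction rule: span_induct_alt)
         (use p(2) D assms in \<open>auto simp: p.zero p.add p.scale subspace_0 intro!: subspace_add subspace_scale\<close>)
  qed
  define q where "q = (\<lambda>v. v - p v)"
  have "Vector_Spaces.linear scale scale q"
    unfolding q_def by unfold_locales (auto simp: p.add p.scale scale_right_diff_distrib)
  moreover have "q v = 0 \<longleftrightarrow> v \<in> W" for v
    using pW[of v] pin[of v] by (auto simp: q_def)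
  ultimately show ?thesis by (rule that)
qed

text \<open>A basis of \<open>W\<close> together with \<open>v\<close> is independent, so values on
  it can be prescribed. Used for the independence of tensors and to detect a word outside
  \<A>.\<close>

lemma functional_separating:
  assumes "subspace W" "v \<notin> W"
  obtains l where "Vector_Spaces.linear scale (*) l" "\<And>w. w \<in> W \<Longrightarrow> l w = 0" "l v = 1"
proof -
  interpret vp: vector_space_pair scale "(*)"
    by unfold_locales (auto simp: algebra_simps)
  obtain D where D: "D \<subseteq> W" "independent D" "W \<subseteq> span D"
    by (rule basis_exists)
  have spanD: "span D = W"
    using D assms span_minimal by blast
  have "independent (insert v D)"
    using D assms spanD by (auto simp: independent_insert)
  then obtain l where l: "Vector_Spaces.linear scale (*) l"
      "\<And>b. b \<in> insert v D \<Longrightarrow> l b = (if b = v then 1 else 0)"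
    using vp.linear_independent_extend[of "insert v D" "\<lambda>b. if b = v then 1 else 0"] by blast
  interpret l: Vector_Spaces.linear scale "(*)" l by (rule l(1))
  have "v \<notin> D" using D assms by auto
  have "l w = 0" if "w \<in> W" for w
    using that unfolding spanD[symmetric]
    by (induction rule: span_induct_alt) (use l(2) \<open>v \<notin> D\<close> in \<open>auto simp: l.zero l.add l.scale\<close>)
  then show ?thesis using that l by simp
qed

end

section \<open>Rank and nullity in finitely spanned subspaces\<close>

context vector_space_pair
begin

lemma rank_nullity:
  assumes f: "Vector_Spaces.linear s1 s2 f" and V: "vs1.subspace V" "V \<subseteq> vs1.span S" "finite S"
  shows "vs1.dim V = vs2.dim (f ` V) + vs1.dim {v \<in> V. f v = 0}"
proof -
  interpret f: Vector_Spaces.linear s1 s2 f by (rule f)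
  let ?K = "{v \<in> V. f v = 0}"
  have subK: "vs1.subspace ?K"
    using vs1.subspace_inter[OF V(1) f.subspace_kernel] by (simp add: Int_def)
  obtain D where D: "D \<subseteq> ?K" "vs1.independent D" "finite D" "?K \<subseteq> vs1.span D" "card D = vs1.dim ?K"
    by (rule vs1.finite_basis_in_span[of ?K S]) (use V in auto)
  obtain B where B: "D \<subseteq> B" "B \<subseteq> V" "vs1.independent B" "V \<subseteq> vs1.span B"
    using vs1.maximal_independent_subset_extend[of D V] D by auto
  have finB: "finite B" "card B = vs1.dim V"
    using vs1.card_le_dim_in_span(1)[OF B(3,2) V(2,3)] vs1.basis_card_eq_dim[OF B(2,4,3)] by auto
  have spanD: "vs1.span D = ?K"
    using D vs1.span_minimal[OF D(1) subK] by auto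
  have inj: "inj_on f (vs1.span (B - D))"
  proof (subst f.inj_on_iff_eq_0)
    show "vs1.subspace (vs1.span (B - D))" by simp
    show "\<forall>x\<in>vs1.span (B - D). f x = 0 \<longrightarrow> x = 0"
    proof (intro ballI impI)
      fix x assume x: "x \<in> vs1.span (B - D)" "f x = 0"
      have "x \<in> V"
        using x(1) vs1.span_minimal[of "B - D" V] B(2) V(1) by auto
      then have "x \<in> vs1.span D" using x spanD by auto
      have "vs1.span (B - D) \<inter> vs1.span D = {0}"
      proof -
        have "y = 0" if y1: "y \<in> vs1.span (B - D)" and y2: "y \<in> vs1.span D" for y
        proof -
          have fin: "finite (B - D)" using finB by auto
          obtain u where u: "y = (\<Sum>v\<in>B - D. s1 (u v) v)"
            using y1 vs1.span_finite[OF fin] by auto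
          obtain w where w: "y = (\<Sum>v\<in>D. s1 (w v) v)"
            using y2 vs1.span_finite[OF D(3)] by auto
          \<comment> \<open>The difference of the two expansions of \<open>y\<close>, as one family
            of coefficients on \<open>B\<close>; independence of \<open>B\<close> makes both
            expansions trivial.\<close>
          define z where "z v = (if v \<in> D then - w v else u v)" for v
          have "(\<Sum>v\<in>B. s1 (z v) v) = (\<Sum>v\<in>B - D. s1 (z v) v) + (\<Sum>v\<in>D. s1 (z v) v)"
            using sum.subset_diff[OF B(1) finB(1)] by blast
          also have "(\<Sum>v\<in>B - D. s1 (z v) v) = y"
            unfolding u by (rule sum.cong) (auto simp: z_def)
          also have "(\<Sum>v\<in>D. s1 (z v) v) = - y"
            unfolding w sum_negf[symmetric] by (rule sum.cong) (auto simp: z_def)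
          finally have "(\<Sum>v\<in>B. s1 (z v) v) = 0" by simp
          then have "\<forall>v\<in>B. z v = 0"
            using vs1.independentD[OF B(3) finB(1)] by auto
          then show "y = 0" unfolding u by (auto simp: z_def intro!: sum.neutral)
        qed
        then show ?thesis by (auto simp: vs1.span_zero)
      qed
      then show "x = 0" using x \<open>x \<in> vs1.span D\<close> by auto
    qed
  qed
  have ind: "vs2.independent (f ` (B - D))"
    by (rule f.independent_injective_image[OF vs1.independent_mono[OF B(3)] inj]) auto
  have "f ` V \<subseteq> vs2.span (f ` (B - D))"
  proof -
    have "f ` V \<subseteq> vs2.span (f ` B)" by (rule f.spans_image[OF B(4)])
    also have "vs2.span (f ` B) \<subseteq> vs2.span (f ` (B - D))"
    proof (rule vs2.span_minimal)
      show "f ` B \<subseteq> vs2.span (f ` (B - D))"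
      proof safe
        fix b assume "b \<in> B"
        then consider "b \<in> B - D" | "f b = 0" using D(1) by blast
        then show "f b \<in> vs2.span (f ` (B - D))"
          by cases (auto simp: vs2.span_zero vs2.span_base)
      qed
    qed simp
    finally show ?thesis .
  qed
  then have "card (f ` (B - D)) = vs2.dim (f ` V)"
    by (intro vs2.basis_card_eq_dim ind) (use B in auto)
  also have "card (f ` (B - D)) = card (B - D)"
    by (rule card_image, rule inj_on_subset[OF inj]) (auto simp: vs1.span_base)
  also have "card (B - D) = card B - card D"
    using B(1) D(3) card_Diff_subset by blast
  finally show ?thesis
    using finB D(5) B(1) card_mono[OF finB(1) B(1)] by linarith
qed

lemma dim_image_injective:
  assumes f: "Vector_Spaces.linear s1 s2 f" and V: "vs1.subspace V" "V \<subseteq> vs1.span S" "finite S"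
    and inj: "\<And>v. v \<in> V \<Longrightarrow> f v = 0 \<Longrightarrow> v = 0"
  shows "vs2.dim (f ` V) = vs1.dim V"
proof -
  interpret f: Vector_Spaces.linear s1 s2 f by (rule f)
  have "{v \<in> V. f v = 0} = {0}"
    using inj vs1.subspace_0[OF V(1)] by auto
  then have "vs1.dim {v \<in> V. f v = 0} = 0"
    using vs1.dim_le_card[of "{v \<in> V. f v = 0}" "{}"] by simp
  then show ?thesis using rank_nullity[OF f V] by simp
qed

lemma dim_preimage:
  assumes f: "Vector_Spaces.linear s1 s2 f" and V: "vs1.subspace V" "V \<subseteq> vs1.span S" "finite S"
    and W: "vs2.subspace W" "W \<subseteq> vs2.span T" "finite T"
  shows "vs1.dim V + vs2.dim W = vs1.dim {v \<in> V. f v \<in> W} + vs2.dim {f v + w |v w. v \<in> V \<and> w \<in> W}"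
proof -
  interpret f: Vector_Spaces.linear s1 s2 f by (rule f)
  interpret vp2: vector_space_pair s2 s2 ..
  obtain q where q: "Vector_Spaces.linear s2 s2 q" "\<And>v. q v = 0 \<longleftrightarrow> v \<in> W"
    using vs2.subspace_kernel_of_endomorphism[OF W(1)] by blast
  interpret q: Vector_Spaces.linear s2 s2 q by (rule q(1))
  have qf: "Vector_Spaces.linear s1 s2 (\<lambda>v. q (f v))"
    by unfold_locales (auto simp: f.add q.add f.scale q.scale)
  let ?I = "{f v + w |v w. v \<in> V \<and> w \<in> W}"
  have subI: "vs2.subspace ?I"
    using vs2.subspace_sums[OF f.subspace_image[OF V(1)] W(1)] by (auto simp: image_iff elim!: back_subst[of vs2.subspace])
  have "?I \<subseteq> vs2.span (f ` S \<union> T)"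
  proof safe
    fix v w assume "v \<in> V" "w \<in> W"
    then have "f v \<in> vs2.span (f ` S)" "w \<in> vs2.span T"
      using f.spans_image[OF V(2)] W(2) by auto
    then show "f v + w \<in> vs2.span (f ` S \<union> T)"
      by (intro vs2.span_add) (meson Un_upper1 Un_upper2 subsetD vs2.span_mono)+
  qed
  then have "vs2.dim ?I = vs2.dim (q ` ?I) + vs2.dim {v \<in> ?I. q v = 0}"
    using V(3) W(3) by (intro vp2.rank_nullity[OF q(1) subI, of "f ` S \<union> T"]) auto
  also have "{v \<in> ?I. q v = 0} = W"
  proof (intro equalityI subsetI)
    fix w assume "w \<in> W"
    then have "w = f 0 + w" "0 \<in> V" using V(1) vs1.subspace_0 by auto
    then show "w \<in> {v \<in> ?I. q v = 0}" using \<open>w \<in> W\<close> q(2) by blast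
  qed (use q(2) in auto)
  also have "q ` ?I = (\<lambda>v. q (f v)) ` V"
  proof (intro equalityI subsetI)
    fix y assume "y \<in> (\<lambda>v. q (f v)) ` V"
    then obtain v where v: "v \<in> V" "y = q (f v + 0)" by auto
    then show "y \<in> q ` ?I" using vs2.subspace_0[OF W(1)] by blast
  next
    fix y assume "y \<in> q ` ?I"
    then obtain v w where vw: "v \<in> V" "w \<in> W" "y = q (f v + w)" by auto
    then have "y = q (f v)" using q(2)[of w] by (simp add: q.add)
    then show "y \<in> (\<lambda>v. q (f v)) ` V" using vw by blast
  qed
  finally show ?thesis
    using rank_nullity[OF qf V] q(2) by simp
qed

end

subsection \<open>Linear maps on spaces with a basis\<close>

abbreviation lookup :: "('a \<Rightarrow>\<^sub>0 'b::zero) \<Rightarrow> 'a \<Rightarrow> 'b" where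
  "lookup \<equiv> Poly_Mapping.lookup"

abbreviation keys :: "('a \<Rightarrow>\<^sub>0 'b::zero) \<Rightarrow> 'a set" where
  "keys \<equiv> Poly_Mapping.keys"

interpretation qvp: vector_space_pair
  "qscale :: rat \<Rightarrow> ('k \<Rightarrow>\<^sub>0 rat) \<Rightarrow> ('k \<Rightarrow>\<^sub>0 rat)" "qscale :: rat \<Rightarrow> ('l \<Rightarrow>\<^sub>0 rat) \<Rightarrow> ('l \<Rightarrow>\<^sub>0 rat)" ..

lemma vector_space_rat: "vector_space ((*) :: rat \<Rightarrow> rat \<Rightarrow> rat)"
  by unfold_locales (simp_all add: distrib_left distrib_right mult.assoc)

abbreviation qfunctional :: "(('k \<Rightarrow>\<^sub>0 rat) \<Rightarrow> rat) \<Rightarrow> bool" where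
  "qfunctional \<equiv> Vector_Spaces.linear qscale (*)"

lemma qlinear_iff: "qlinear f \<longleftrightarrow> (\<forall>x y. f (x + y) = f x + f y) \<and> (\<forall>c x. f (qscale c x) = qscale c (f x))"
  by (simp add: Vector_Spaces.linear_iff qvs.vector_space_axioms)

lemma qfunctional_iff: "qfunctional f \<longleftrightarrow> (\<forall>x y. f (x + y) = f x + f y) \<and> (\<forall>c x. f (qscale c x) = c * f x)"
  by (simp add: Vector_Spaces.linear_iff qvs.vector_space_axioms vector_space_rat)

lemma qlinearI:
  "(\<And>x y. f (x + y) = f x + f y) \<Longrightarrow> (\<And>c x. f (qscale c x) = qscale c (f x)) \<Longrightarrow> qlinear f"
  by (simp add: qlinear_iff)

lemma qfunctionalI:
  "(\<And>x y. f (x + y) = f x + f y) \<Longrightarrow> (\<And>c x. f (qscale c x) = c * f x) \<Longrightarrow> qfunctional f"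
  by (simp add: qfunctional_iff)

lemma qlinear_add: "qlinear f \<Longrightarrow> f (x + y) = f x + f y"
  and qlinear_scale: "qlinear f \<Longrightarrow> f (qscale c x) = qscale c (f x)"
  by (simp_all add: qlinear_iff)

lemma qlinear_sum: "qlinear f \<Longrightarrow> f (sum g A) = (\<Sum>a\<in>A. f (g a))"
  and qlinear_zero: "qlinear f \<Longrightarrow> f 0 = 0"
  and qlinear_diff: "qlinear f \<Longrightarrow> f (x - y) = f x - f y"
  by (simp_all add: qvp.linear_sum qvp.linear_0 qvp.linear_diff)

lemma qfunctional_add: "qfunctional f \<Longrightarrow> f (x + y) = f x + f y"
  and qfunctional_scale: "qfunctional f \<Longrightarrow> f (qscale c x) = c * f x"
  by (simp_all add: qfunctional_iff)

lemma qfunctional_zero: "qfunctional f \<Longrightarrow> f 0 = 0"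
  using qfunctional_scale[of f 0 0] by simp

lemma qfunctional_sum: "qfunctional f \<Longrightarrow> f (sum g A) = (\<Sum>a\<in>A. f (g a))"
  by (induction A rule: infinite_finite_induct) (simp_all add: qfunctional_zero qfunctional_add)

lemma qlinear_compose: "qlinear f \<Longrightarrow> qlinear g \<Longrightarrow> qlinear (\<lambda>x. g (f x))"
  by (intro qlinearI) (simp_all add: qlinear_add qlinear_scale)

lemma qfunctional_compose: "qlinear f \<Longrightarrow> qfunctional g \<Longrightarrow> qfunctional (\<lambda>x. g (f x))"
  by (intro qfunctionalI) (simp_all add: qlinear_add qlinear_scale qfunctional_add qfunctional_scale)

lemma qlinear_id: "qlinear (\<lambda>x. x)"
  by (rule qlinearI) auto

lemma qfunctional_lookup: "qfunctional (\<lambda>p. lookup p k)"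
  by (rule qfunctionalI) (auto simp: lookup_add)

lemma lin_ext_superset:
  assumes "finite A" "keys p \<subseteq> A"
  shows "lin_ext f p = (\<Sum>k\<in>A. qscale (lookup p k) (f k))"
  unfolding lin_ext_def
  by (rule sum.mono_neutral_left) (use assms in \<open>auto simp: in_keys_iff\<close>)

lemma qlinear_lin_ext: "qlinear (lin_ext f)"
proof (rule qlinearI)
  fix x y :: "'a \<Rightarrow>\<^sub>0 rat"
  have "lin_ext f z = (\<Sum>k\<in>keys x \<union> keys y. qscale (lookup z k) (f k))" if "z \<in> {x, y, x + y}" for z
    by (rule lin_ext_superset) (use that keys_add[of x y] in auto)
  then show "lin_ext f (x + y) = lin_ext f x + lin_ext f y"
    by (simp add: lookup_add qvs.scale_left_distrib sum.distrib)
next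
  fix c and x :: "'a \<Rightarrow>\<^sub>0 rat"
  have "lin_ext f (qscale c x) = (\<Sum>k\<in>keys x. qscale (lookup (qscale c x) k) (f k))"
    by (rule lin_ext_superset) (auto simp: in_keys_iff)
  then show "lin_ext f (qscale c x) = qscale c (lin_ext f x)"
    by (simp add: lin_ext_def qvs.scale_sum_right)
qed

lemma lin_ext_bas [simp]: "lin_ext f (bas k) = f k"
  by (simp add: lin_ext_def)

lemma sum_bas: "p = (\<Sum>k\<in>keys p. qscale (lookup p k) (bas k))"
  by (rule poly_mapping_eqI) (auto simp: lookup_sum lookup_single when_def in_keys_iff if_distrib cong: if_cong)

lemma qlinear_expand: "qlinear f \<Longrightarrow> f p = (\<Sum>k\<in>keys p. qscale (lookup p k) (f (bas k)))"
  by (subst sum_bas[of p]) (simp add: qlinear_sum qlinear_scale)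

lemma qfunctional_expand: "qfunctional f \<Longrightarrow> f p = (\<Sum>k\<in>keys p. lookup p k * f (bas k))"
  by (subst sum_bas[of p]) (simp add: qfunctional_sum qfunctional_scale)

lemma qlinear_eq_lin_ext: "qlinear f \<Longrightarrow> f p = lin_ext (\<lambda>k. f (bas k)) p"
  unfolding lin_ext_def by (rule qlinear_expand)

lemma qlinear_eqI: "qlinear f \<Longrightarrow> qlinear g \<Longrightarrow> (\<And>k. f (bas k) = g (bas k)) \<Longrightarrow> f p = g p"
  by (simp add: qlinear_expand[of f p] qlinear_expand[of g p])

lemma qfunctional_eqI: "qfunctional f \<Longrightarrow> qfunctional g \<Longrightarrow> (\<And>k. f (bas k) = g (bas k)) \<Longrightarrow> f p = g p"
  by (simp add: qfunctional_expand[of f p] qfunctional_expand[of g p])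

lemma in_span_bas: "keys p \<subseteq> K \<Longrightarrow> p \<in> qvs.span (bas ` K)"
  by (subst sum_bas) (blast intro: qvs.span_sum qvs.span_scale qvs.span_base)

lemma span_bas: "qvs.span (bas ` K) = {p. keys p \<subseteq> K}"
proof (intro equalityI subsetI)
  fix p :: "'a \<Rightarrow>\<^sub>0 rat" assume "p \<in> qvs.span (bas ` K)"
  then show "p \<in> {p. keys p \<subseteq> K}"
  proof (induction rule: qvs.span_induct_alt)
    case (step c x y)
    have "keys (qscale c x + y) \<subseteq> keys x \<union> keys y"
      by (auto simp: in_keys_iff lookup_add)
    then show ?case using step by auto
  qed auto
qed (auto intro: in_span_bas)

lemma subspace_keys: "qvs.subspace {p. keys p \<subseteq> K}"
  unfolding span_bas[symmetric] by simp

lemma inj_bas: "inj bas"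
  by (rule injI) (metis lookup_single_eq lookup_single_not_eq one_neq_zero)

lemma independent_bas: "qvs.independent (bas ` K)"
  unfolding qvs.independent_explicit_finite_subsets
proof (intro allI impI ballI)
  fix A and u :: "('a \<Rightarrow>\<^sub>0 rat) \<Rightarrow> rat" and v
  assume A: "A \<subseteq> bas ` K" "finite A" "(\<Sum>v\<in>A. qscale (u v) v) = 0" "v \<in> A"
  obtain k where k: "v = bas k" using A by auto
  have "0 = lookup (\<Sum>v\<in>A. qscale (u v) v) k" using A by simp
  also have "\<dots> = (\<Sum>w\<in>A. if w = v then u v else 0)"
    unfolding lookup_sum
    by (rule sum.cong) (use A(1) k in \<open>auto simp: lookup_single when_def split: if_splits dest!: subsetD\<close>)
  also have "\<dots> = u v" using A by simp
  finally show "u v = 0" by simp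
qed

lemma dim_keys: "finite K \<Longrightarrow> qvs.dim {p. keys p \<subseteq> K} = card K"
  unfolding span_bas[symmetric] qvs.dim_span_eq_card_independent[OF independent_bas]
  by (rule card_image, rule inj_on_subset[OF inj_bas]) auto

lemma subspace_image_qlinear: "qlinear f \<Longrightarrow> qvs.subspace V \<Longrightarrow> qvs.subspace (f ` V)"
  by (rule qvp.linear_subspace_image)

lemma span_image_qlinear: "qlinear f \<Longrightarrow> qvs.span (f ` V) = f ` qvs.span V"
  by (rule qvp.linear_span_image)

subsection \<open>Tensor products\<close>

lemma lin_ext_add: "lin_ext f (p + q) = lin_ext f p + lin_ext f q"
  and lin_ext_scale: "lin_ext f (qscale c p) = qscale c (lin_ext f p)"
  and lin_ext_zero [simp]: "lin_ext f 0 = 0"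
  by (simp_all add: qlinear_add[OF qlinear_lin_ext] qlinear_scale[OF qlinear_lin_ext]
      qlinear_zero[OF qlinear_lin_ext])

lemma lin_ext_fun_add: "lin_ext (\<lambda>k. f k + g k) p = lin_ext f p + lin_ext g p"
  and lin_ext_fun_scale: "lin_ext (\<lambda>k. qscale c (f k)) p = qscale c (lin_ext f p)"
  by (simp_all add: lin_ext_def qvs.scale_right_distrib sum.distrib qvs.scale_sum_right mult.commute)

lemma lin_ext_bas_self: "lin_ext bas p = p"
  using sum_bas[of p] by (simp add: lin_ext_def)

lemma qlinear_lin_ext_lin_ext: "qlinear g \<Longrightarrow> g (lin_ext f p) = lin_ext (\<lambda>k. g (f k)) p"
  by (simp add: lin_ext_def qlinear_sum qlinear_scale)

lemma qfunctional_lin_ext: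
  "qfunctional g \<Longrightarrow> g (lin_ext f p) = (\<Sum>k\<in>keys p. lookup p k * g (f k))"
  by (simp add: lin_ext_def qfunctional_sum qfunctional_scale)

lemma lin_ext_in_subspace:
  "qvs.subspace V \<Longrightarrow> (\<And>k. k \<in> keys p \<Longrightarrow> f k \<in> V) \<Longrightarrow> lin_ext f p \<in> V"
  unfolding lin_ext_def by (intro qvs.subspace_sum qvs.subspace_scale)

lemma bilin_ext_bas [simp]: "bilin_ext f (bas k) (bas l) = f k l"
  by (simp add: bilin_ext_def)

lemma qlinear_bilin_ext_left: "qlinear (\<lambda>p. bilin_ext f p q)"
  unfolding bilin_ext_def by (rule qlinear_lin_ext)

lemma qlinear_bilin_ext_right: "qlinear (bilin_ext f p)"
  by (rule qlinearI) (simp_all add: bilin_ext_def lin_ext_add lin_ext_scale lin_ext_fun_add lin_ext_fun_scale)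

lemma bilin_ext_bas_left: "bilin_ext f (bas k) q = lin_ext (f k) q"
  by (simp add: bilin_ext_def)

lemma bilin_ext_in_subspace:
  "qvs.subspace V \<Longrightarrow> (\<And>k l. k \<in> keys p \<Longrightarrow> l \<in> keys q \<Longrightarrow> f k l \<in> V) \<Longrightarrow> bilin_ext f p q \<in> V"
  unfolding bilin_ext_def by (intro lin_ext_in_subspace)

lemma tensor_bas [simp]: "tensor (bas k) (bas l) = bas (k, l)"
  by (simp add: tensor_def)

lemma qlinear_tensor_left: "qlinear (\<lambda>p. tensor p q)"
  and qlinear_tensor_right: "qlinear (tensor p)"
  unfolding tensor_def by (rule qlinear_bilin_ext_left, rule qlinear_bilin_ext_right)

lemma tensor_map_bas: "tensor_map f g (bas (k, l)) = tensor (f (bas k)) (g (bas l))"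
  by (simp add: tensor_map_def)

lemma qlinear_tensor_map: "qlinear (tensor_map f g)"
  unfolding tensor_map_def by (rule qlinear_lin_ext)

lemma qlinear2_eqI:
  assumes "\<And>q. qlinear (\<lambda>p. f p q)" "\<And>p. qlinear (f p)" "\<And>q. qlinear (\<lambda>p. g p q)" "\<And>p. qlinear (g p)"
    and "\<And>k l. f (bas k) (bas l) = g (bas k) (bas l)"
  shows "f p q = g p q"
proof -
  have "f (bas k) q = g (bas k) q" for k
    by (rule qlinear_eqI[OF assms(2) assms(4)]) (rule assms(5))
  then show ?thesis by (rule qlinear_eqI[OF assms(1) assms(3)])
qed

lemma tensor_map_tensor:
  assumes "qlinear f" "qlinear g"
  shows "tensor_map f g (tensor p q) = tensor (f p) (g q)"
  by (rule qlinear2_eqI)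
     (auto intro!: qlinear_compose[OF _ qlinear_tensor_map] qlinear_tensor_left qlinear_tensor_right
       qlinear_compose[OF assms(1) qlinear_tensor_left] qlinear_compose[OF assms(2) qlinear_tensor_right]
       simp: tensor_map_bas)

text \<open>This is h \<otimes> id, and \<open>contract_right\<close> is id \<otimes> h. They
  extract single components of coproducts and coactions.\<close>

definition contract_left :: "(('k \<Rightarrow>\<^sub>0 rat) \<Rightarrow> rat) \<Rightarrow> ('k \<times> 'l \<Rightarrow>\<^sub>0 rat) \<Rightarrow> ('l \<Rightarrow>\<^sub>0 rat)" where
  "contract_left h = lin_ext (\<lambda>(k, l). qscale (h (bas k)) (bas l))"

definition contract_right :: "(('l \<Rightarrow>\<^sub>0 rat) \<Rightarrow> rat) \<Rightarrow> ('k \<times> 'l \<Rightarrow>\<^sub>0 rat) \<Rightarrow> ('k \<Rightarrow>\<^sub>0 rat)" where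
  "contract_right h = lin_ext (\<lambda>(k, l). qscale (h (bas l)) (bas k))"

lemma qlinear_contract_left: "qlinear (contract_left h)"
  unfolding contract_left_def by (rule qlinear_lin_ext)

lemma qlinear_contract_right: "qlinear (contract_right h)"
  unfolding contract_right_def by (rule qlinear_lin_ext)

lemma contract_left_bas [simp]: "contract_left h (bas (k, l)) = qscale (h (bas k)) (bas l)"
  by (simp add: contract_left_def)

lemma contract_right_bas [simp]: "contract_right h (bas (k, l)) = qscale (h (bas l)) (bas k)"
  by (simp add: contract_right_def)

lemma qlinear_scale_functional: "qfunctional h \<Longrightarrow> qlinear (\<lambda>p. qscale (h p) q)"
  by (rule qlinearI) (simp_all add: qfunctional_add qfunctional_scale qvs.scale_left_distrib)

lemma contract_left_tensor: "qfunctional h \<Longrightarrow> contract_left h (tensor p q) = qscale (h p) q"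
  by (rule qlinear2_eqI[of "\<lambda>p q. contract_left h (tensor p q)"])
     (auto intro!: qlinear_compose[OF _ qlinear_contract_left] qlinear_tensor_left qlinear_tensor_right
       qlinear_scale_functional)

lemma contract_right_tensor: "qfunctional h \<Longrightarrow> contract_right h (tensor p q) = qscale (h q) p"
  by (rule qlinear2_eqI[of "\<lambda>p q. contract_right h (tensor p q)"])
     (auto intro!: qlinear_compose[OF _ qlinear_contract_right] qlinear_tensor_left qlinear_tensor_right
       qlinear_scale_functional)

lemma lookup_tensor [simp]: "lookup (tensor p q) (k, l) = lookup p k * lookup q l"
proof -
  have "lookup (contract_left (\<lambda>p. lookup p k) t) l = lookup t (k, l)" for t :: "'a \<times> 'b \<Rightarrow>\<^sub>0 rat"
    by (rule qfunctional_eqI[OF qfunctional_compose[OF qlinear_contract_left qfunctional_lookup] qfunctional_lookup])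
       (auto simp: lookup_single when_def split: prod.splits if_splits)
  then show ?thesis
    by (metis contract_left_tensor qfunctional_lookup lookup_qscale)
qed

subsection \<open>Graded subspaces\<close>

lemma homog_eq_span: "homog w N = qvs.span (bas ` {k. w k = N})"
  unfolding span_bas homog_def by auto

lemma subspace_homog: "qvs.subspace (homog w N)"
  unfolding homog_eq_span by simp

lemma bas_in_homog [simp]: "bas k \<in> homog w N \<longleftrightarrow> w k = N"
  by (simp add: homog_def)

lemma qlinear_homog_part: "qlinear (homog_part w N)"
  unfolding homog_part_def by (rule qlinear_lin_ext)

lemma homog_part_add: "homog_part w N (x + y) = homog_part w N x + homog_part w N y"
  and homog_part_diff: "homog_part w N (x - y) = homog_part w N x - homog_part w N y"
  and homog_part_scale: "homog_part w N (qscale c x) = qscale c (homog_part w N x)"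
  and homog_part_sum: "homog_part w N (sum f A) = (\<Sum>a\<in>A. homog_part w N (f a))"
  and homog_part_zero [simp]: "homog_part w N 0 = 0"
  by (simp_all add: qlinear_add[OF qlinear_homog_part] qlinear_diff[OF qlinear_homog_part]
      qlinear_scale[OF qlinear_homog_part] qlinear_sum[OF qlinear_homog_part] qlinear_zero[OF qlinear_homog_part])

lemma lookup_homog_part: "lookup (homog_part w N p) k = (if w k = N then lookup p k else 0)"
  by (rule qfunctional_eqI[OF qfunctional_compose[OF qlinear_homog_part qfunctional_lookup]])
     (auto intro!: qfunctionalI simp: lookup_add homog_part_def lookup_single when_def)

lemma homog_part_in_homog [simp]: "homog_part w N p \<in> homog w N"
  by (auto simp: homog_def in_keys_iff lookup_homog_part split: if_splits)

lemma homog_part_homog: "p \<in> homog w M \<Longrightarrow> homog_part w N p = (if M = N then p else 0)"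
  by (rule poly_mapping_eqI) (auto simp: homog_def in_keys_iff lookup_homog_part)

lemma sum_homog_part: "p = (\<Sum>N\<in>w ` keys p. homog_part w N p)"
  by (rule poly_mapping_eqI) (auto simp: lookup_sum lookup_homog_part in_keys_iff sum.delta' cong: if_cong)

lemma homog_unique: "p \<in> homog w M \<Longrightarrow> p \<in> homog w N \<Longrightarrow> p \<noteq> 0 \<Longrightarrow> M = N"
  by (metis homog_part_homog)

lemma graded_subspaceD:
  "graded_subspace w V \<Longrightarrow> qvs.subspace V" "graded_subspace w V \<Longrightarrow> p \<in> V \<Longrightarrow> homog_part w N p \<in> V"
  by (auto simp: graded_subspace_def)

lemma graded_subspace_span:
  assumes "\<And>s. s \<in> S \<Longrightarrow> \<exists>N. s \<in> homog w N"
  shows "graded_subspace w (qvs.span S)"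
  unfolding graded_subspace_def
proof (intro conjI ballI allI)
  fix p N assume "p \<in> qvs.span S"
  then show "homog_part w N p \<in> qvs.span S"
  proof (induction rule: qvs.span_induct_alt)
    case (step c x y)
    obtain M where "x \<in> homog w M" using assms step by auto
    then show ?case
      using step by (auto simp: homog_part_add homog_part_scale homog_part_homog qvs.span_zero
          intro!: qvs.span_add[OF qvs.span_scale[OF qvs.span_base]])
  qed (simp add: qvs.span_zero)
qed simp

lemma span_homogeneous_basis_Int:
  assumes "qvs.independent B" "\<And>b. b \<in> B \<Longrightarrow> \<exists>N. b \<in> homog w N"
  shows "qvs.span B \<inter> homog w N = qvs.span (B \<inter> homog w N)"
proof (intro equalityI subsetI)
  fix p assume p: "p \<in> qvs.span B \<inter> homog w N"
  have "homog_part w N p \<in> qvs.span (B \<inter> homog w N)" if "p \<in> qvs.span B" for p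
    using that
  proof (induction rule: qvs.span_induct_alt)
    case (step c x y)
    obtain M where "x \<in> homog w M" using assms step by auto
    then show ?case
      using step by (auto simp: homog_part_add homog_part_scale homog_part_homog qvs.span_zero
          intro!: qvs.span_add[OF qvs.span_scale[OF qvs.span_base]])
  qed (simp add: qvs.span_zero)
  then show "p \<in> qvs.span (B \<inter> homog w N)"
    using p by (metis IntD1 IntD2 homog_part_homog)
next
  fix p assume "p \<in> qvs.span (B \<inter> homog w N)"
  then show "p \<in> qvs.span B \<inter> homog w N"
    using qvs.span_mono[of "B \<inter> homog w N" B] qvs.span_minimal[OF _ subspace_homog, of "B \<inter> homog w N" w N] by auto
qed

lemma dim_span_homogeneous_basis:
  assumes "qvs.independent B" "\<And>b. b \<in> B \<Longrightarrow> \<exists>N. b \<in> homog w N"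
  shows "qvs.dim (qvs.span B \<inter> homog w N) = card (B \<inter> homog w N)"
proof -
  have "qvs.independent (B \<inter> homog w N)"
    by (rule qvs.independent_mono[OF assms(1)]) auto
  then show ?thesis
    using span_homogeneous_basis_Int[of B w N, OF assms] qvs.dim_span_eq_card_independent by metis
qed

text \<open>Extend within the homogeneous elements of \<open>V\<close>; these span \<open>V\<close>,
  which contains the homogeneous parts of its elements.\<close>

lemma homogeneous_basis_extension:
  assumes V: "graded_subspace w V" and B0: "qvs.independent B0" "B0 \<subseteq> V" "\<And>b. b \<in> B0 \<Longrightarrow> \<exists>N. b \<in> homog w N"
  obtains B where "B0 \<subseteq> B" "qvs.independent B" "\<And>b. b \<in> B \<Longrightarrow> \<exists>N. b \<in> homog w N" "qvs.span B = V"
proof -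
  let ?H = "{v \<in> V. \<exists>N. v \<in> homog w N}"
  obtain B where B: "B0 \<subseteq> B" "B \<subseteq> ?H" "qvs.independent B" "?H \<subseteq> qvs.span B"
  proof (rule qvs.maximal_independent_subset_extend[of B0 ?H])
    show "B0 \<subseteq> ?H" using B0 by auto
  qed (use B0 in auto)
  have "V \<subseteq> qvs.span B"
  proof
    fix v assume v: "v \<in> V"
    have "homog_part w N v \<in> qvs.span B" for N
      using B(4) graded_subspaceD(2)[OF V v] homog_part_in_homog by blast
    then show "v \<in> qvs.span B"
      by (subst sum_homog_part[of v w]) (rule qvs.span_sum)
  qed
  moreover have "qvs.span B \<subseteq> V"
    by (rule qvs.span_minimal) (use B graded_subspaceD[OF V] in auto)
  ultimately show ?thesis using that[of B] B by auto
qed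

subsection \<open>Dimensions of graded subquotients\<close>

definition graded_subquot :: "'k subquot \<Rightarrow> bool" where
  "graded_subquot X \<longleftrightarrow> graded_subspace (wt X) (num X) \<and> graded_subspace (wt X) (den X) \<and>
     den X \<subseteq> num X \<and> (\<forall>N. finite {k. wt X k = N})"

lemma graded_subquotD:
  assumes "graded_subquot X"
  shows "graded_subspace (wt X) (num X)" "graded_subspace (wt X) (den X)" "den X \<subseteq> num X"
    "finite {k. wt X k = N}" "qvs.subspace (num X)" "qvs.subspace (den X)"
  using assms by (auto simp: graded_subquot_def graded_subspace_def)

text \<open>The elements of \<open>B - B'\<close> represent a homogeneous basis of the quotient, so
  that dimensions of tensor products of quotients become a count.\<close>

definition adapted_basis :: "'k subquot \<Rightarrow> ('k \<Rightarrow>\<^sub>0 rat) set \<Rightarrow> ('k \<Rightarrow>\<^sub>0 rat) set \<Rightarrow> bool" where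
  "adapted_basis X B' B \<longleftrightarrow> B' \<subseteq> B \<and> qvs.independent B \<and> (\<forall>b\<in>B. \<exists>N. b \<in> homog (wt X) N) \<and>
     qvs.span B = num X \<and> qvs.span B' = den X"

lemma adapted_basisD:
  assumes "adapted_basis X B' B"
  shows "B' \<subseteq> B" "qvs.independent B" "b \<in> B \<Longrightarrow> \<exists>N. b \<in> homog (wt X) N"
    "qvs.span B = num X" "qvs.span B' = den X"
  using assms by (auto simp: adapted_basis_def)

lemma adapted_basis_exists:
  assumes "graded_subquot X"
  obtains B' B where "adapted_basis X B' B"
proof -
  note X = graded_subquotD[OF assms]
  obtain B' where B': "qvs.independent B'" "\<And>b. b \<in> B' \<Longrightarrow> \<exists>N. b \<in> homog (wt X) N" "qvs.span B' = den X"
    using homogeneous_basis_extension[OF X(2), of "{}"] by (metis empty_iff empty_subsetI qvs.independent_empty)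
  have "B' \<subseteq> num X"
    using qvs.span_superset[of B'] B'(3) X(3) by auto
  then obtain B where "B' \<subseteq> B" "qvs.independent B" "\<And>b. b \<in> B \<Longrightarrow> \<exists>N. b \<in> homog (wt X) N" "qvs.span B = num X"
    using homogeneous_basis_extension[OF X(1) B'(1) _ B'(2)] by metis
  then show ?thesis using that[of B' B] B'(3) by (simp add: adapted_basis_def)
qed

lemma finite_homog_independent:
  assumes "finite {k. w k = N}" "qvs.independent B"
  shows "finite (B \<inter> homog w N)"
proof (rule qvs.card_le_dim_in_span(1))
  show "qvs.independent (B \<inter> homog w N)" by (rule qvs.independent_mono[OF assms(2)]) auto
  show "B \<inter> homog w N \<subseteq> homog w N" "homog w N \<subseteq> qvs.span (bas ` {k. w k = N})"
    by (auto simp: homog_eq_span)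
  show "finite (bas ` {k. w k = N})" using assms by auto
qed

lemma wt_dim_adapted_basis:
  assumes fin: "finite {k. wt X k = N}" and "adapted_basis X B' B"
  shows "wt_dim X N = card ((B - B') \<inter> homog (wt X) N)"
proof -
  note B = adapted_basisD[OF assms(2)]
  have fB: "finite (B \<inter> homog (wt X) N)" by (rule finite_homog_independent[OF fin B(2)])
  have "qvs.dim (num X \<inter> homog (wt X) N) = card (B \<inter> homog (wt X) N)"
    unfolding B(4)[symmetric] by (rule dim_span_homogeneous_basis) (use B in auto)
  moreover have "qvs.dim (den X \<inter> homog (wt X) N) = card (B' \<inter> homog (wt X) N)"
    unfolding B(5)[symmetric]
    by (rule dim_span_homogeneous_basis[OF qvs.independent_mono[OF B(2,1)]]) (use B(1,3) in auto)
  moreover have "(B - B') \<inter> homog (wt X) N = (B \<inter> homog (wt X) N) - (B' \<inter> homog (wt X) N)" by auto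
  moreover have "card \<dots> = card (B \<inter> homog (wt X) N) - card (B' \<inter> homog (wt X) N)"
    by (rule card_Diff_subset) (use fB B(1) in \<open>auto intro: finite_subset[of "B' \<inter> homog (wt X) N" "B \<inter> homog (wt X) N"]\<close>)
  ultimately show ?thesis unfolding wt_dim_def by simp
qed

lemma tensor_in_homog:
  assumes "p \<in> homog w M" "q \<in> homog w' N"
  shows "tensor p q \<in> homog (\<lambda>(k, l). w k + w' l) (M + N)"
  unfolding homog_def
proof safe
  fix k l assume "(k, l) \<in> keys (tensor p q)"
  then have "k \<in> keys p" "l \<in> keys q" by (auto simp: in_keys_iff)
  then show "w k + w' l = M + N" using assms by (auto simp: homog_def)
qed

text \<open>Contract the left factor with a functional that is 1 at \<open>b\<close> and 0 on the
  rest of \<open>B\<close>: a relation between tensors becomes one in \<open>C\<close>.\<close>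

lemma tensor_notin_span:
  assumes B: "qvs.independent B" and C: "qvs.independent C" and bc: "b \<in> B" "c \<in> C"
  shows "tensor b c \<notin> qvs.span {tensor b' c' |b' c'. b' \<in> B \<and> c' \<in> C \<and> (b', c') \<noteq> (b, c)}"
proof
  assume *: "tensor b c \<in> qvs.span {tensor b' c' |b' c'. b' \<in> B \<and> c' \<in> C \<and> (b', c') \<noteq> (b, c)}"
  obtain h where h: "qfunctional h" "\<And>x. x \<in> qvs.span (B - {b}) \<Longrightarrow> h x = 0" "h b = 1"
  proof (rule qvs.functional_separating)
    show "b \<notin> qvs.span (B - {b})" using B bc by (auto simp: qvs.dependent_def)
  qed auto
  have "contract_left h t \<in> qvs.span (C - {c})"
    if "t \<in> qvs.span {tensor b' c' |b' c'. b' \<in> B \<and> c' \<in> C \<and> (b', c') \<noteq> (b, c)}" for t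
    using that
  proof (induction rule: qvs.span_induct_alt)
    case base
    then show ?case by (simp add: qlinear_zero[OF qlinear_contract_left] qvs.span_zero)
  next
    case (step a x y)
    then obtain b' c' where x: "x = tensor b' c'" "b' \<in> B" "c' \<in> C" "(b', c') \<noteq> (b, c)" by auto
    have "contract_left h x \<in> qvs.span (C - {c})"
    proof (cases "b' = b")
      case True
      then show ?thesis using x by (simp add: contract_left_tensor[OF h(1)] h(3) qvs.span_base)
    next
      case False
      then have "h b' = 0" using x by (intro h(2) qvs.span_base) auto
      then show ?thesis using x by (auto simp: contract_left_tensor[OF h(1)] qvs.span_zero)
    qed
    then show ?case
      using step by (simp add: qlinear_add[OF qlinear_contract_left] qlinear_scale[OF qlinear_contract_left]
          qvs.span_add qvs.span_scale)
  qed
  from this[OF *] have "c \<in> qvs.span (C - {c})"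
    by (simp add: contract_left_tensor[OF h(1)] h(3))
  then show False using C bc by (auto simp: qvs.dependent_def)
qed

lemma inj_on_tensor:
  assumes B: "qvs.independent B" and C: "qvs.independent C"
  shows "inj_on (\<lambda>(b, c). tensor b c) (B \<times> C)"
proof (rule inj_onI, safe)
  fix b c b' c' assume *: "b \<in> B" "c \<in> C" "b' \<in> B" "c' \<in> C" "tensor b c = tensor b' c'"
  have "(b', c') = (b, c)"
  proof (rule ccontr)
    assume "(b', c') \<noteq> (b, c)"
    then have "tensor b c \<in> {tensor b' c' |b' c'. b' \<in> B \<and> c' \<in> C \<and> (b', c') \<noteq> (b, c)}"
      using * by auto
    from qvs.span_base[OF this] tensor_notin_span[OF B C *(1,2)] show False by contradiction
  qed
  then show "b = b'" "c = c'" by auto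
qed

lemma independent_tensor:
  assumes B: "qvs.independent B" and C: "qvs.independent C"
  shows "qvs.independent ((\<lambda>(b, c). tensor b c) ` (B \<times> C))"
  unfolding qvs.dependent_def
proof safe
  fix b c assume bc: "b \<in> B" "c \<in> C"
    "tensor b c \<in> qvs.span ((\<lambda>(b, c). tensor b c) ` (B \<times> C) - {tensor b c})"
  have "(\<lambda>(b, c). tensor b c) ` (B \<times> C) - {tensor b c} \<subseteq>
      {tensor b' c' |b' c'. b' \<in> B \<and> c' \<in> C \<and> (b', c') \<noteq> (b, c)}"
    by auto
  then show False using tensor_notin_span[OF B C bc(1,2)] bc(3) qvs.span_mono by blast
qed

lemma tensor_in_span:
  assumes "v \<in> qvs.span S" "v' \<in> qvs.span T"
  shows "tensor v v' \<in> qvs.span {tensor s t |s t. s \<in> S \<and> t \<in> T}"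
proof -
  have 1: "tensor s v' \<in> qvs.span {tensor s t |s t. s \<in> S \<and> t \<in> T}" if "s \<in> S" for s
    using assms(2)
  proof (induction rule: qvs.span_induct_alt)
    case (step c x y)
    then show ?case
      using that by (auto simp: qlinear_add[OF qlinear_tensor_right] qlinear_scale[OF qlinear_tensor_right]
          intro!: qvs.span_add[OF qvs.span_scale[OF qvs.span_base]])
  qed (simp add: qlinear_zero[OF qlinear_tensor_right] qvs.span_zero)
  show ?thesis
    using assms(1)
  proof (induction rule: qvs.span_induct_alt)
    case (step c x y)
    then show ?case
      by (simp add: qlinear_add[OF qlinear_tensor_left] qlinear_scale[OF qlinear_tensor_left]
          qvs.span_add qvs.span_scale 1)
  qed (simp add: qlinear_zero[OF qlinear_tensor_left] qvs.span_zero)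
qed

lemma span_tensor_span:
  "qvs.span {tensor v v' |v v'. v \<in> qvs.span S \<and> v' \<in> qvs.span T} =
   qvs.span {tensor s t |s t. s \<in> S \<and> t \<in> T}"
proof (intro equalityI)
  show "qvs.span {tensor v v' |v v'. v \<in> qvs.span S \<and> v' \<in> qvs.span T} \<subseteq>
      qvs.span {tensor s t |s t. s \<in> S \<and> t \<in> T}"
    by (rule qvs.span_minimal) (auto intro: tensor_in_span)
  show "qvs.span {tensor s t |s t. s \<in> S \<and> t \<in> T} \<subseteq>
      qvs.span {tensor v v' |v v'. v \<in> qvs.span S \<and> v' \<in> qvs.span T}"
    by (intro qvs.span_mono Collect_mono ex_mono impI) (auto simp: qvs.span_base)
qed

lemma span_Un_cong: "qvs.span A = qvs.span A' \<Longrightarrow> qvs.span B = qvs.span B' \<Longrightarrow> qvs.span (A \<union> B) = qvs.span (A' \<union> B')"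
  by (simp add: qvs.span_Un)

text \<open>The denominator is spanned by the products with at least one factor in a smaller basis.
  These are the pairs outside \<open>(B - B') \<times> (C - C')\<close>.\<close>

lemma adapted_basis_tensor:
  assumes "adapted_basis X B' B" and "adapted_basis Y C' C"
  shows "adapted_basis (X \<otimes>\<^sub>s Y) ((\<lambda>(b, c). tensor b c) ` (B \<times> C - (B - B') \<times> (C - C')))
    ((\<lambda>(b, c). tensor b c) ` (B \<times> C))" (is "adapted_basis _ ?T' ?T")
  unfolding adapted_basis_def
proof (intro conjI ballI)
  note X = adapted_basisD[OF assms(1)] and Y = adapted_basisD[OF assms(2)]
  show "?T' \<subseteq> ?T" by auto
  show "qvs.independent ?T" by (rule independent_tensor[OF X(2) Y(2)])
  show "\<exists>N. t \<in> homog (wt (X \<otimes>\<^sub>s Y)) N" if t: "t \<in> ?T" for t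
  proof -
    obtain b c where bc: "t = tensor b c" "b \<in> B" "c \<in> C" using t by auto
    obtain M N where "b \<in> homog (wt X) M" "c \<in> homog (wt Y) N" using X(3) Y(3) bc by blast
    then have "t \<in> homog (wt (X \<otimes>\<^sub>s Y)) (M + N)"
      unfolding bc(1) by (simp add: tensor_in_homog tensor_sq_def)
    then show ?thesis by blast
  qed
  have T: "?T = {tensor s t |s t. s \<in> B \<and> t \<in> C}" by auto
  show "qvs.span ?T = num (X \<otimes>\<^sub>s Y)"
    unfolding T tensor_sq_def using span_tensor_span[of B C] X(4) Y(4) by simp
  have T': "?T' = {tensor s t |s t. s \<in> B' \<and> t \<in> C} \<union> {tensor s t |s t. s \<in> B \<and> t \<in> C'}"
    using X(1) Y(1) by auto
  show "qvs.span ?T' = den (X \<otimes>\<^sub>s Y)"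
    unfolding T' tensor_sq_def X(4,5)[symmetric] Y(4,5)[symmetric] subquot.simps
    by (rule span_Un_cong) (simp_all add: span_tensor_span)
qed

lemma graded_subspace_adapted_basis:
  assumes "adapted_basis X B' B"
  shows "graded_subspace (wt X) (num X)" "graded_subspace (wt X) (den X)" "den X \<subseteq> num X"
proof -
  note B = adapted_basisD[OF assms]
  have "graded_subspace (wt X) (qvs.span B)" "graded_subspace (wt X) (qvs.span B')"
    by (rule graded_subspace_span, use B(1,3) in blast)+
  then show "graded_subspace (wt X) (num X)" "graded_subspace (wt X) (den X)" by (simp_all add: B(4,5))
  show "den X \<subseteq> num X" using qvs.span_mono[OF B(1)] B(4,5) by simp
qed

lemma finite_tensor_weights:
  assumes "\<And>N. finite {k. w k = N}" "\<And>N. finite {k. w' k = N}"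
  shows "finite {k. (\<lambda>(k, l). w k + w' l) k = (N::nat)}"
proof (rule finite_subset)
  show "{k. (\<lambda>(k, l). w k + w' l) k = N} \<subseteq> (\<Union>i\<le>N. {k. w k = i}) \<times> (\<Union>i\<le>N. {k. w' k = i})" by auto
qed (use assms in auto)

lemma graded_subquot_tensor:
  assumes "graded_subquot X" "graded_subquot Y"
  shows "graded_subquot (X \<otimes>\<^sub>s Y)"
proof -
  obtain B' B where B: "adapted_basis X B' B" by (rule adapted_basis_exists[OF assms(1)])
  obtain C' C where C: "adapted_basis Y C' C" by (rule adapted_basis_exists[OF assms(2)])
  have "finite {k. wt (X \<otimes>\<^sub>s Y) k = N}" for N
    using finite_tensor_weights[of "wt X" "wt Y"] assms unfolding graded_subquot_def tensor_sq_def by simp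
  then show ?thesis
    using graded_subspace_adapted_basis[OF adapted_basis_tensor[OF B C]] by (simp add: graded_subquot_def)
qed

lemma wt_dim_tensor:
  assumes X: "graded_subquot X" and Y: "graded_subquot Y"
  shows "wt_dim (X \<otimes>\<^sub>s Y) N = (\<Sum>i\<le>N. wt_dim X i * wt_dim Y (N - i))"
proof -
  obtain B' B where adB: "adapted_basis X B' B" by (rule adapted_basis_exists[OF X])
  obtain C' C where adC: "adapted_basis Y C' C" by (rule adapted_basis_exists[OF Y])
  note B = adapted_basisD[OF adB] and C = adapted_basisD[OF adC]
  note adT = adapted_basis_tensor[OF adB adC]
  note T = adapted_basisD[OF adT]
  let ?t = "\<lambda>(b, c). tensor b c" and ?B = "\<lambda>i. (B - B') \<inter> homog (wt X) i" and ?C = "\<lambda>i. (C - C') \<inter> homog (wt Y) i"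
  have inj: "inj_on ?t (B \<times> C)" by (rule inj_on_tensor[OF B(2) C(2)])
  have nz: "b \<noteq> 0" if "b \<in> B" for b using B(2) qvs.dependent_zero that by blast
  have nz': "c \<noteq> 0" if "c \<in> C" for c using C(2) qvs.dependent_zero that by blast
  have nzt: "tensor b c \<noteq> 0" if "b \<in> B" "c \<in> C" for b c
  proof -
    have "tensor b c \<in> ?t ` (B \<times> C)" using that by auto
    then show ?thesis using T(2) qvs.dependent_zero by metis
  qed
  have eq: "(?t ` (B \<times> C) - ?t ` (B \<times> C - (B - B') \<times> (C - C'))) \<inter> homog (wt (X \<otimes>\<^sub>s Y)) N =
      ?t ` (\<Union>i\<le>N. ?B i \<times> ?C (N - i))"
  proof -
    have "?t ` (B \<times> C) - ?t ` (B \<times> C - (B - B') \<times> (C - C')) = ?t ` ((B - B') \<times> (C - C'))"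
    proof -
      have "B \<times> C - (B \<times> C - (B - B') \<times> (C - C')) = (B - B') \<times> (C - C')" by auto
      moreover have "?t ` (B \<times> C - (B \<times> C - (B - B') \<times> (C - C'))) =
          ?t ` (B \<times> C) - ?t ` (B \<times> C - (B - B') \<times> (C - C'))"
        by (rule inj_on_image_set_diff[OF inj]) blast+
      ultimately show ?thesis by (simp only:)
    qed
    moreover have "?t ` ((B - B') \<times> (C - C')) \<inter> homog (wt (X \<otimes>\<^sub>s Y)) N = ?t ` (\<Union>i\<le>N. ?B i \<times> ?C (N - i))"
    proof (intro equalityI subsetI)
      fix t assume "t \<in> ?t ` ((B - B') \<times> (C - C')) \<inter> homog (wt (X \<otimes>\<^sub>s Y)) N"
      then obtain b c where bc: "t = tensor b c" "b \<in> B - B'" "c \<in> C - C'" "t \<in> homog (wt (X \<otimes>\<^sub>s Y)) N" by auto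
      obtain i j where ij: "b \<in> homog (wt X) i" "c \<in> homog (wt Y) j" using B(3) C(3) bc by blast
      have "t \<in> homog (wt (X \<otimes>\<^sub>s Y)) (i + j)"
        using tensor_in_homog[OF ij] bc by (simp add: tensor_sq_def)
      then have "i + j = N" using homog_unique bc nzt by (metis DiffD1)
      then have "i \<le> N" "j = N - i" by auto
      then show "t \<in> ?t ` (\<Union>i\<le>N. ?B i \<times> ?C (N - i))" using bc ij by auto
    next
      fix t assume "t \<in> ?t ` (\<Union>i\<le>N. ?B i \<times> ?C (N - i))"
      then obtain i b c where bc: "i \<le> N" "t = tensor b c" "b \<in> ?B i" "c \<in> ?C (N - i)" by auto
      then have "t \<in> homog (wt (X \<otimes>\<^sub>s Y)) (i + (N - i))"
        using tensor_in_homog[of b "wt X" i c "wt Y" "N - i"] by (simp add: tensor_sq_def)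
      then show "t \<in> ?t ` ((B - B') \<times> (C - C')) \<inter> homog (wt (X \<otimes>\<^sub>s Y)) N" using bc by auto
    qed
    ultimately show ?thesis by simp
  qed
  have finB: "finite (?B i)" for i
    using finite_homog_independent[OF graded_subquotD(4)[OF X, of i] B(2)] by (rule finite_subset[rotated]) auto
  have finC: "finite (?C i)" for i
    using finite_homog_independent[OF graded_subquotD(4)[OF Y, of i] C(2)] by (rule finite_subset[rotated]) auto
  have "wt_dim (X \<otimes>\<^sub>s Y) N = card (?t ` (\<Union>i\<le>N. ?B i \<times> ?C (N - i)))"
    unfolding eq[symmetric]
    by (rule wt_dim_adapted_basis[OF graded_subquotD(4)[OF graded_subquot_tensor[OF X Y]] adT])
  also have "\<dots> = card (\<Union>i\<le>N. ?B i \<times> ?C (N - i))"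
    by (rule card_image, rule inj_on_subset[OF inj]) auto
  also have "\<dots> = (\<Sum>i\<le>N. card (?B i \<times> ?C (N - i)))"
  proof (rule card_UN_disjoint)
    show "\<forall>i\<in>{..N}. \<forall>j\<in>{..N}. i \<noteq> j \<longrightarrow> (?B i \<times> ?C (N - i)) \<inter> (?B j \<times> ?C (N - j)) = {}"
      using homog_unique nz by blast
  qed (use finB finC in auto)
  also have "\<dots> = (\<Sum>i\<le>N. wt_dim X i * wt_dim Y (N - i))"
    using wt_dim_adapted_basis[OF graded_subquotD(4)[OF X] adB] wt_dim_adapted_basis[OF graded_subquotD(4)[OF Y] adC]
    by (simp add: card_cartesian_product)
  finally show ?thesis .
qed

subsection \<open>Exact sequences\<close>

text \<open>The linear map \<open>f\<close> representing a map of quotients preserves weights only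
  modulo \<open>den Y\<close>; there it may be replaced by its component of the right
  weight.\<close>

lemma homog_part_sq_map:
  assumes f: "sq_map X Y f" and X: "graded_subquot X" and Y: "graded_subquot Y" and v: "v \<in> num X \<inter> homog (wt X) N"
  shows "f v - homog_part (wt Y) N (f v) \<in> den Y"
    and "M \<noteq> N \<Longrightarrow> homog_part (wt Y) M (f v) \<in> den Y"
proof -
  obtain v' where v': "v' \<in> num Y \<inter> homog (wt Y) N" "f v - v' \<in> den Y"
    using f v unfolding sq_map_def by blast
  note Yg = graded_subquotD[OF Y]
  have part: "homog_part (wt Y) M (f v) - homog_part (wt Y) M v' \<in> den Y" for M
    using graded_subspaceD(2)[OF Yg(2) v'(2)] by (simp add: homog_part_diff)
  have v'N: "homog_part (wt Y) M v' = (if M = N then v' else 0)" for M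
    using v'(1) homog_part_homog by fastforce
  have "(f v - v') - (homog_part (wt Y) N (f v) - v') \<in> den Y"
    using qvs.subspace_diff[OF Yg(6) v'(2) part[of N]] v'N by simp
  then show "f v - homog_part (wt Y) N (f v) \<in> den Y" by simp
  show "homog_part (wt Y) M (f v) \<in> den Y" if "M \<noteq> N" using part[of M] v'N that by simp
qed

text \<open>The components of \<open>u\<close> of other weights contribute only elements of
  \<open>den Y\<close> in weight \<open>N\<close>. Hence a preimage of a homogeneous element can be
  chosen homogeneous.\<close>

lemma homog_part_sq_map_total:
  assumes f: "sq_map X Y f" and X: "graded_subquot X" and Y: "graded_subquot Y" and u: "u \<in> num X"
  shows "homog_part (wt Y) N (f u) - homog_part (wt Y) N (f (homog_part (wt X) N u)) \<in> den Y"
proof -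
  have lin: "qlinear f" using f by (simp add: sq_map_def)
  let ?I = "wt X ` keys u - {N}"
  have "u = homog_part (wt X) N u + (\<Sum>M\<in>?I. homog_part (wt X) M u)"
  proof (cases "N \<in> wt X ` keys u")
    case True
    then show ?thesis using sum_homog_part[of u "wt X"] by (simp add: sum.remove)
  next
    case False
    then have "homog_part (wt X) N u = 0"
      by (intro poly_mapping_eqI) (auto simp: lookup_homog_part in_keys_iff)
    then show ?thesis using sum_homog_part[of u "wt X"] False by simp
  qed
  then have "f u = f (homog_part (wt X) N u) + (\<Sum>M\<in>?I. f (homog_part (wt X) M u))"
    by (metis qlinear_add[OF lin] qlinear_sum[OF lin])
  then have "homog_part (wt Y) N (f u) - homog_part (wt Y) N (f (homog_part (wt X) N u)) =
      (\<Sum>M\<in>?I. homog_part (wt Y) N (f (homog_part (wt X) M u)))"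
    by (simp add: homog_part_add homog_part_sum)
  also have "\<dots> \<in> den Y"
  proof (rule qvs.subspace_sum)
    show "qvs.subspace (den Y)" by (rule graded_subquotD(6)[OF Y])
    fix M assume "M \<in> ?I"
    then have "N \<noteq> M" by auto
    then show "homog_part (wt Y) N (f (homog_part (wt X) M u)) \<in> den Y"
      using homog_part_sq_map(2)[OF f X Y _ \<open>N \<noteq> M\<close>] graded_subspaceD(2)[OF graded_subquotD(1)[OF X] u] by auto
  qed
  finally show ?thesis .
qed

text \<open>Rank-nullity in weight \<open>N\<close> for the induced map of quotients, expressed by
  preimages in the numerators: \<open>dim_preimage\<close> for the weight \<open>N\<close> part of
  \<open>f\<close>.\<close>

lemma dim_sq_map:
  assumes f: "sq_map X Y f" and X: "graded_subquot X" and Y: "graded_subquot Y"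
  shows "qvs.dim (num X \<inter> homog (wt X) N) + qvs.dim (den Y \<inter> homog (wt Y) N) =
    qvs.dim {v \<in> num X \<inter> homog (wt X) N. f v \<in> den Y} +
    qvs.dim {v \<in> num Y \<inter> homog (wt Y) N. \<exists>u\<in>num X. v - f u \<in> den Y}"
proof -
  note Xg = graded_subquotD[OF X] and Yg = graded_subquotD[OF Y]
  have lin: "qlinear f" and fnum: "\<And>v. v \<in> num X \<Longrightarrow> f v \<in> num Y" using f by (auto simp: sq_map_def)
  define g where "g v = homog_part (wt Y) N (f v)" for v
  have glin: "qlinear g" unfolding g_def by (rule qlinear_compose[OF lin qlinear_homog_part])
  let ?V = "num X \<inter> homog (wt X) N" and ?W = "den Y \<inter> homog (wt Y) N"
  have "qvs.dim ?V + qvs.dim ?W = qvs.dim {v \<in> ?V. g v \<in> ?W} + qvs.dim {g v + w |v w. v \<in> ?V \<and> w \<in> ?W}"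
  proof (rule qvp.dim_preimage[OF glin])
    show "qvs.subspace ?V" "qvs.subspace ?W"
      using Xg(5) Yg(6) subspace_homog qvs.subspace_inter by blast+
    show "?V \<subseteq> qvs.span (bas ` {k. wt X k = N})" "?W \<subseteq> qvs.span (bas ` {k. wt Y k = N})"
      by (auto simp: homog_eq_span)
  qed (use Xg(4) Yg(4) in auto)
  also have "{v \<in> ?V. g v \<in> ?W} = {v \<in> ?V. f v \<in> den Y}"
  proof -
    have "g v \<in> den Y \<longleftrightarrow> f v \<in> den Y" if "v \<in> ?V" for v
      using qvs.subspace_add[OF Yg(6) homog_part_sq_map(1)[OF f X Y that], of "g v"]
        qvs.subspace_diff[OF Yg(6) _ homog_part_sq_map(1)[OF f X Y that], of "f v"]
      by (auto simp: g_def)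
    then show ?thesis by (auto simp: g_def)
  qed
  also have "{g v + w |v w. v \<in> ?V \<and> w \<in> ?W} = {v \<in> num Y \<inter> homog (wt Y) N. \<exists>u\<in>num X. v - f u \<in> den Y}"
  proof (intro equalityI subsetI)
    fix y assume "y \<in> {g v + w |v w. v \<in> ?V \<and> w \<in> ?W}"
    then obtain v w where vw: "y = g v + w" "v \<in> ?V" "w \<in> ?W" by auto
    have "g v \<in> num Y" unfolding g_def using graded_subspaceD(2)[OF Yg(1) fnum] vw by auto
    then have "y \<in> num Y" using vw Yg(3,5) qvs.subspace_add by blast
    moreover have "y \<in> homog (wt Y) N"
      using vw by (auto simp: g_def intro!: qvs.subspace_add[OF subspace_homog])
    moreover have "y - f v \<in> den Y"
    proof -
      have "y - f v = w - (f v - g v)" using vw by simp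
      also have "w - (f v - g v) \<in> den Y"
        using homog_part_sq_map(1)[OF f X Y vw(2)] vw(3) qvs.subspace_diff[OF Yg(6)] by (simp add: g_def)
      finally show ?thesis .
    qed
    ultimately show "y \<in> {v \<in> num Y \<inter> homog (wt Y) N. \<exists>u\<in>num X. v - f u \<in> den Y}" using vw by auto
  next
    fix y assume "y \<in> {v \<in> num Y \<inter> homog (wt Y) N. \<exists>u\<in>num X. v - f u \<in> den Y}"
    then obtain u where y: "y \<in> num Y" "y \<in> homog (wt Y) N" "u \<in> num X" "y - f u \<in> den Y" by auto
    let ?u = "homog_part (wt X) N u"
    have 1: "?u \<in> ?V" using graded_subspaceD(2)[OF Xg(1) y(3)] by simp
    have "y - homog_part (wt Y) N (f u) \<in> den Y"
      using graded_subspaceD(2)[OF Yg(2) y(4), of N] homog_part_homog[OF y(2)] by (simp add: homog_part_diff)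
    moreover have "homog_part (wt Y) N (f u) - g ?u \<in> den Y"
      unfolding g_def by (rule homog_part_sq_map_total[OF f X Y y(3)])
    ultimately have "y - g ?u \<in> den Y"
      using qvs.subspace_add[OF Yg(6)] by fastforce
    moreover have "y - g ?u \<in> homog (wt Y) N"
      using y(2) by (auto simp: g_def intro!: qvs.subspace_diff[OF subspace_homog])
    ultimately have "y = g ?u + (y - g ?u)" "y - g ?u \<in> ?W" by auto
    then show "y \<in> {g v + w |v w. v \<in> ?V \<and> w \<in> ?W}" using 1 by blast
  qed
  finally show ?thesis .
qed

lemma dim_den_le_num:
  assumes "graded_subquot X"
  shows "qvs.dim (den X \<inter> homog (wt X) N) \<le> qvs.dim (num X \<inter> homog (wt X) N)"
  by (rule qvs.dim_mono_in_span[of _ _ "bas ` {k. wt X k = N}"])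
     (use graded_subquotD[OF assms] in \<open>auto simp: homog_eq_span\<close>)

text \<open>Exactness identifies the preimage of each kernel with that of the preceding image, so
  the three instances of \<open>dim_sq_map\<close> telescope.\<close>

lemma wt_dim_exact_seq:
  assumes "exists_exact_seq A B C D" "graded_subquot A" "graded_subquot B" "graded_subquot C" "graded_subquot D"
  shows "wt_dim A N + wt_dim C N = wt_dim B N + wt_dim D N"
proof -
  obtain f g h where fgh: "sq_map A B f" "sq_map B C g" "sq_map C D h"
      "sq_inj A B f" "sq_exact_at A B C f g" "sq_exact_at B C D g h" "sq_surj C D h"
    using assms(1) unfolding exists_exact_seq_def by blast
  have 1: "{v \<in> num A \<inter> homog (wt A) N. f v \<in> den B} = den A \<inter> homog (wt A) N"
    using fgh(1,4) graded_subquotD(3)[OF assms(2)] by (auto simp: sq_inj_def sq_map_def)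
  have 2: "{v \<in> num B \<inter> homog (wt B) N. g v \<in> den C} =
      {v \<in> num B \<inter> homog (wt B) N. \<exists>u\<in>num A. v - f u \<in> den B}"
    using fgh(5) by (auto simp: sq_exact_at_def)
  have 3: "{v \<in> num C \<inter> homog (wt C) N. h v \<in> den D} =
      {v \<in> num C \<inter> homog (wt C) N. \<exists>u\<in>num B. v - g u \<in> den C}"
    using fgh(6) by (auto simp: sq_exact_at_def)
  have 4: "{v \<in> num D \<inter> homog (wt D) N. \<exists>u\<in>num C. v - h u \<in> den D} = num D \<inter> homog (wt D) N"
    using fgh(7) by (auto simp: sq_surj_def)
  show ?thesis
    using dim_sq_map[OF fgh(1) assms(2,3), of N] dim_sq_map[OF fgh(2) assms(3,4), of N]
      dim_sq_map[OF fgh(3) assms(4,5), of N]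
      dim_den_le_num[OF assms(2), of N] dim_den_le_num[OF assms(3), of N]
      dim_den_le_num[OF assms(4), of N] dim_den_le_num[OF assms(5), of N]
    unfolding 1 2 3 4 wt_dim_def by linarith
qed

subsection \<open>Single zeta values are nonzero\<close>

lemma iter_int_replicate_E0:
  assumes "0 < t" "t \<le> y"
  shows "iter_int (replicate k E0) t y = (ln y - ln t) ^ k / fact k"
  using assms
proof (induction k arbitrary: t)
  case (Suc k)
  let ?G = "\<lambda>s. - ((ln y - ln s) ^ Suc k / fact (Suc k))"
  have "((\<lambda>s. 1 / s * ((ln y - ln s) ^ k / fact k)) has_integral (?G y - ?G t)) {t..y}"
  proof (rule fundamental_theorem_of_calculus)
    fix s assume s: "s \<in> {t..y}"
    have "(?G has_real_derivative (1 / s * ((ln y - ln s) ^ k / fact k))) (at s within {t..y})"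
      using s Suc.prems
      by (auto intro!: derivative_eq_intros simp: field_simps simp del: power_Suc fact_Suc) 
         (simp add: field_simps)
    then show "(?G has_vector_derivative (1 / s * ((ln y - ln s) ^ k / fact k))) (at s within {t..y})"
      by (simp add: has_real_derivative_iff_has_vector_derivative)
  qed (use Suc in auto)
  then have "integral {t..y} (\<lambda>s. 1 / s * ((ln y - ln s) ^ k / fact k)) = (ln y - ln t) ^ Suc k / fact (Suc k)"
    by (simp add: integral_unique)
  moreover have "integral {t..y} (\<lambda>s. 1 / s * iter_int (replicate k E0) s y) =
      integral {t..y} (\<lambda>s. 1 / s * ((ln y - ln s) ^ k / fact k))"
    by (rule integral_cong) (use Suc in auto)
  ultimately show ?case by simp
qed simp

lemma poly_limit_at_bot_const:
  fixes p :: "real poly"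
  assumes "((\<lambda>x. poly p x) \<longlongrightarrow> L) at_bot"
  shows "p = [:L:]"
proof (cases "degree p = 0")
  case True
  then obtain c where "p = [:c:]" by (rule degree_eq_zeroE)
  then show ?thesis using assms by (simp add: tendsto_const_iff)
next
  case False
  then have "filterlim (poly p) at_infinity at_infinity" by (intro filterlim_poly_at_infinity) auto
  then have "filterlim (poly p) at_infinity at_bot"
    by (rule filterlim_mono) (auto simp: at_infinity_eq_at_top_bot)
  then show ?thesis using assms not_tendsto_and_filterlim_at_infinity[of at_bot "poly p" L] by (simp add: trivial_limit_at_bot_linorder)
qed

text \<open>For a convergent integral the regularising polynomial is constant:
  \<open>ln \<epsilon>\<close> tends to minus infinity, and a polynomial with a finite limit there
  is constant. This makes the definite description unique.\<close>

lemma per_word_eqI: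
  assumes "((\<lambda>\<epsilon>. iter_int w \<epsilon> (1 - \<epsilon>)) \<longlongrightarrow> L) (at_right 0)"
  shows "per_word w = L"
  unfolding per_word_def
proof (rule the_equality)
  show "\<exists>p. poly p 0 = L \<and> ((\<lambda>\<epsilon>. iter_int w \<epsilon> (1 - \<epsilon>) - poly p (ln \<epsilon>)) \<longlongrightarrow> 0) (at_right 0)"
    using tendsto_diff[OF assms tendsto_const[of L]] by (intro exI[of _ "[:L:]"]) simp
next
  fix c assume "\<exists>p. poly p 0 = c \<and> ((\<lambda>\<epsilon>. iter_int w \<epsilon> (1 - \<epsilon>) - poly p (ln \<epsilon>)) \<longlongrightarrow> 0) (at_right 0)"
  then obtain p where p: "poly p 0 = c" "((\<lambda>\<epsilon>. iter_int w \<epsilon> (1 - \<epsilon>) - poly p (ln \<epsilon>)) \<longlongrightarrow> 0) (at_right 0)"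
    by auto
  have lim: "((\<lambda>\<epsilon>. poly p (ln \<epsilon>)) \<longlongrightarrow> L) (at_right 0)"
    using tendsto_diff[OF assms p(2)] by simp
  have "filterlim (exp :: real \<Rightarrow> real) (at_right 0) at_bot"
    unfolding filterlim_at using exp_at_bot by auto
  from filterlim_compose[OF lim this] have "((\<lambda>x. poly p x) \<longlongrightarrow> L) at_bot" by simp
  then show "c = L" using poly_limit_at_bot_const p(1) by fastforce
qed

text \<open>One factor \<open>- ln t\<close> absorbs the pole at \<open>t = 1\<close>, hence
  \<open>0 < k\<close>; the others are bounded by small negative powers of \<open>t\<close>. The
  exponent -1/2 keeps the bound integrable at 0.\<close>

lemma bounded_log_kernel:
  assumes "0 < k"
  obtains C :: real where "\<And>t::real. 0 < t \<Longrightarrow> t < 1 \<Longrightarrow> (- ln t) ^ k / (1 - t) \<le> C * t powr (-1/2)" "0 \<le> C"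
proof -
  obtain j where k: "k = Suc j" using assms by (cases k) auto
  have root_bound: "- ln t \<le> m * t powr (- 1 / m)" if "0 < t" "t < 1" "0 < m" for t m :: real
  proof -
    have "ln (1 / t) \<le> ((1 / t) powr (1 / m)) / (1 / m)" by (rule ln_powr_bound) (use that in auto)
    then show ?thesis using that by (simp add: ln_div powr_divide powr_minus_divide field_simps)
  qed
  \<comment> \<open>The 8 is 2 from \<open>1 / (1 - t)\<close> on \<open>t \<le> 1/2\<close> times 4
    from the root bound with exponent -1/4. Each of the other \<open>j\<close> logarithms costs a
    factor \<open>4 * k\<close> with exponent \<open>- 1 / (4 * k)\<close>, and
    \<open>j / (4 * k)\<close> is below 1/4.\<close>
  show ?thesis
  proof (rule that[of "8 * (4 * k) ^ j"])
    fix t :: real assume t: "0 < t" "t < 1"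
    have 1: "- ln t / (1 - t) \<le> 8 * t powr (-1/4)"
    proof (cases "t \<le> 1/2")
      case True
      have "- ln t / (1 - t) \<le> - ln t / (1/2)"
        by (rule divide_left_mono) (use t True in auto)
      also have "\<dots> \<le> 8 * t powr (-1/4)" using root_bound[of t 4] t by simp
      finally show ?thesis .
    next
      case False
      have "- ln t = ln (1 / t)" using t by (simp add: ln_div)
      also have "\<dots> \<le> 1 / t - 1" using t by (intro ln_le_minus_one) auto
      also have "\<dots> = (1 - t) / t" using t by (simp add: field_simps)
      also have "\<dots> \<le> (1 - t) / (1/2)" by (rule divide_left_mono) (use t False in auto)
      finally have "- ln t / (1 - t) \<le> 2" using t by (simp add: field_simps)
      also have "2 \<le> 8 * t powr (-1/4)"
        using powr_mono'[of "-1/4" 0 t] t by simp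
      finally show ?thesis .
    qed
    have "(- ln t) ^ j \<le> (4 * k * t powr (- 1 / (4 * k))) ^ j"
      by (rule power_mono) (use root_bound[of t "4 * k"] t k in auto)
    also have "\<dots> = (4 * k) ^ j * t powr (- real j / (4 * k))"
      using t by (simp add: power_mult_distrib powr_power)
    also have "\<dots> \<le> (4 * k) ^ j * t powr (-1/4)"
      by (intro mult_left_mono powr_mono') (use t k in \<open>auto simp: field_simps\<close>)
    finally have 2: "(- ln t) ^ j \<le> (4 * k) ^ j * t powr (-1/4)" by simp
    have "(- ln t) ^ k / (1 - t) = (- ln t / (1 - t)) * (- ln t) ^ j" by (simp add: k)
    also have "\<dots> \<le> (8 * t powr (-1/4)) * ((4 * k) ^ j * t powr (-1/4))"
      by (intro mult_mono 1 2) (use t in auto)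
    also have "\<dots> = 8 * (4 * k) ^ j * t powr (-1/2)"
      by (simp add: powr_add[symmetric])
    finally show "(- ln t) ^ k / (1 - t) \<le> 8 * (4 * k) ^ j * t powr (-1/2)" .
  qed simp
qed

text \<open>This is \<zeta>(k + 1) > 0. The truncated integrals grow as \<open>\<epsilon>\<close>
  decreases and stay below the integral of \<open>C * t powr (-1/2)\<close>, so they converge to
  their supremum, which is at least the positive value at 1/4.\<close>

lemma per_word_zeta_pos:
  assumes "0 < k"
  shows "per_word (E1 # replicate k E0) > 0"
proof -
  define g where "g y t = 1 / (1 - t) * ((ln y - ln t) ^ k / fact k)" for y t :: real
  define F where "F \<epsilon> = integral {\<epsilon>..1 - \<epsilon>} (g (1 - \<epsilon>))" for \<epsilon> :: real
  have F: "iter_int (E1 # replicate k E0) \<epsilon> (1 - \<epsilon>) = F \<epsilon>" if "0 < \<epsilon>" for \<epsilon>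
    unfolding F_def g_def iter_int.simps form.simps
    by (rule integral_cong) (use that in \<open>auto simp: iter_int_replicate_E0\<close>)
  have cont: "g y integrable_on {a..b}" if "0 < a" "b < 1" "0 < y" for a b y
    unfolding g_def by (rule integrable_continuous_interval) (use that in \<open>auto intro!: continuous_intros\<close>)
  have nonneg: "0 \<le> g y t" if "0 < t" "t \<le> y" "t < 1" for y t
    unfolding g_def using that by auto
  have mono: "F \<epsilon> \<le> F \<epsilon>'" if e: "0 < \<epsilon>'" "\<epsilon>' \<le> \<epsilon>" "\<epsilon> < 1/2" for \<epsilon> \<epsilon>'
  proof -
    have "F \<epsilon> \<le> integral {\<epsilon>..1 - \<epsilon>} (g (1 - \<epsilon>'))"
      unfolding F_def
    proof (rule integral_le)
      fix t assume t: "t \<in> {\<epsilon>..1 - \<epsilon>}"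
      have "(ln (1 - \<epsilon>) - ln t) ^ k \<le> (ln (1 - \<epsilon>') - ln t) ^ k"
        by (rule power_mono) (use t e in auto)
      then show "g (1 - \<epsilon>) t \<le> g (1 - \<epsilon>') t"
        unfolding g_def using t e by (intro mult_left_mono divide_right_mono) auto
    qed (use e in \<open>auto intro!: cont\<close>)
    also have "\<dots> \<le> F \<epsilon>'"
      unfolding F_def by (rule integral_subset_le) (use e in \<open>auto intro!: cont nonneg\<close>)
    finally show ?thesis .
  qed
  obtain C :: real where C: "\<And>t::real. 0 < t \<Longrightarrow> t < 1 \<Longrightarrow> (- ln t) ^ k / (1 - t) \<le> C * t powr (-1/2)" "0 \<le> C"
    using bounded_log_kernel[OF assms] by blast
  have bound: "F \<epsilon> \<le> 2 * C" if e: "0 < \<epsilon>" "\<epsilon> < 1/2" for \<epsilon>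
  proof -
    have int: "((\<lambda>t. C * t powr (-1/2)) has_integral (2 * C * sqrt (1 - \<epsilon>) - 2 * C * sqrt \<epsilon>)) {\<epsilon>..1 - \<epsilon>}"
    proof (rule fundamental_theorem_of_calculus)
      fix t assume "t \<in> {\<epsilon>..1 - \<epsilon>}"
      then have "((\<lambda>t. 2 * C * sqrt t) has_real_derivative C * t powr (-1/2)) (at t within {\<epsilon>..1 - \<epsilon>})"
        using e by (auto intro!: derivative_eq_intros simp: powr_minus powr_half_sqrt field_simps)
      then show "((\<lambda>t. 2 * C * sqrt t) has_vector_derivative C * t powr (-1/2)) (at t within {\<epsilon>..1 - \<epsilon>})"
        by (simp add: has_real_derivative_iff_has_vector_derivative)
    qed (use e in auto)
    have "F \<epsilon> \<le> integral {\<epsilon>..1 - \<epsilon>} (\<lambda>t. C * t powr (-1/2))"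
      unfolding F_def
    proof (rule integral_le)
      fix t assume t: "t \<in> {\<epsilon>..1 - \<epsilon>}"
      have "(ln (1 - \<epsilon>) - ln t) ^ k \<le> (- ln t) ^ k"
        by (rule power_mono) (use t e in auto)
      also have "\<dots> / fact k \<le> (- ln t) ^ k"
        using divide_left_mono[of 1 "fact k" "(- ln t) ^ k"] t e by auto
      finally have "(ln (1 - \<epsilon>) - ln t) ^ k / fact k \<le> (- ln t) ^ k"
        by (simp add: divide_right_mono)
      then have "g (1 - \<epsilon>) t \<le> 1 / (1 - t) * (- ln t) ^ k"
        unfolding g_def using t e by (intro mult_left_mono) auto
      also have "\<dots> \<le> C * t powr (-1/2)" using C(1)[of t] t e by auto
      finally show "g (1 - \<epsilon>) t \<le> C * t powr (-1/2)" .
    qed (use e int in \<open>auto intro!: cont\<close>)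
    also have "\<dots> = 2 * C * sqrt (1 - \<epsilon>) - 2 * C * sqrt \<epsilon>" using int by (rule integral_unique)
    also have "\<dots> \<le> 2 * C * 1 - 0"
      by (intro diff_mono mult_left_mono) (use e C(2) in auto)
    finally show ?thesis by simp
  qed
  define S where "S = F ` {0<..<1/2}"
  have bdd: "bdd_above S" unfolding S_def by (rule bdd_aboveI[of _ "2 * C"]) (use bound in auto)
  have le: "F \<epsilon> \<le> Sup S" if "0 < \<epsilon>" "\<epsilon> < 1/2" for \<epsilon>
    by (rule cSup_upper[OF _ bdd]) (use that in \<open>auto simp: S_def\<close>)
  have ev: "eventually (\<lambda>\<epsilon>. \<epsilon> \<in> {0<..<\<epsilon>'}) (at_right 0)" if "0 < \<epsilon>'" for \<epsilon>' :: real
    using that eventually_at_right_real by blast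
  have lim: "(F \<longlongrightarrow> Sup S) (at_right 0)"
  proof (rule order_tendstoI)
    fix a assume "a < Sup S"
    then obtain \<epsilon>' where e': "0 < \<epsilon>'" "\<epsilon>' < 1/2" "a < F \<epsilon>'"
      using less_cSup_iff[OF _ bdd] by (auto simp: S_def)
    show "eventually (\<lambda>\<epsilon>. a < F \<epsilon>) (at_right 0)"
      using ev[OF e'(1)]
    proof eventually_elim
      case (elim \<epsilon>)
      then show ?case using mono[of \<epsilon> \<epsilon>'] e' by auto
    qed
  next
    fix a assume "Sup S < a"
    have "0 < (1/2 :: real)" by simp
    from ev[OF this] show "eventually (\<lambda>\<epsilon>. F \<epsilon> < a) (at_right 0)"
      by eventually_elim (use le \<open>Sup S < a\<close> in force)
  qed
  have "eventually (\<lambda>\<epsilon>. F \<epsilon> = iter_int (E1 # replicate k E0) \<epsilon> (1 - \<epsilon>)) (at_right 0)"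
    using ev[OF zero_less_one] by eventually_elim (use F in auto)
  then have "per_word (E1 # replicate k E0) = Sup S"
    using lim by (intro per_word_eqI) (rule Lim_transform_eventually)
  moreover have "0 < F (1/4)"
  proof -
    \<comment> \<open>On [1/4, 1/2] the ratio (3/4) / t is at least 3/2, so \<open>?c\<close> bounds
      the inner iterated integral from below.\<close>
    let ?c = "ln (3/2) ^ k / fact k :: real"
    have "0 < ?c" by simp
    have "?c * (1/4) = integral {1/4..1/2} (\<lambda>t::real. ?c)" by simp
    also have "\<dots> \<le> integral {1/4..1/2} (g (3/4))"
    proof (rule integral_le)
      fix t :: real assume t: "t \<in> {1/4..1/2}"
      have "ln (3/2) \<le> ln (3/4 / t)" using t by (subst ln_le_cancel_iff) (auto simp: field_simps)
      also have "\<dots> = ln (3/4) - ln t" using t by (subst ln_div) auto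
      finally have "?c \<le> (ln (3/4) - ln t) ^ k / fact k"
        by (intro divide_right_mono power_mono) auto
      also have "\<dots> = 1 * ((ln (3/4) - ln t) ^ k / fact k)" by simp
      also have "\<dots> \<le> g (3/4) t"
        unfolding g_def by (rule mult_right_mono) (use t \<open>0 < ?c\<close> calculation in \<open>auto simp: field_simps\<close>)
      finally show "?c \<le> g (3/4) t" .
    qed (auto intro!: cont)
    also have "\<dots> \<le> integral {1/4..3/4} (g (3/4))"
      by (rule integral_subset_le) (auto intro!: cont nonneg)
    finally have "?c * (1/4) \<le> F (1/4)" by (simp add: F_def)
    moreover have "0 < ?c * (1/4)" using \<open>0 < ?c\<close> by simp
    ultimately show ?thesis by (rule order_less_le_trans[rotated])
  qed
  ultimately show ?thesis using le[of "1/4"] by simp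
qed

subsection \<open>Shuffles and the number of letters \<open>e\<^sup>1\<close>\<close>

lemma shuffle_bas [simp]: "bas u \<diamondop> bas v = shuffle_words u v"
  by (simp add: shuffle_def)

lemma qlinear_shuffle_left: "qlinear (\<lambda>p. p \<diamondop> q)"
  and qlinear_shuffle_right: "qlinear ((\<diamondop>) p)"
  unfolding shuffle_def by (rule qlinear_bilin_ext_left, rule qlinear_bilin_ext_right)

lemma shuffle_words_Nil_right [simp]: "shuffle_words u [] = bas u"
  by (cases u) auto

lemma shuffle_unit_left [simp]: "bas [] \<diamondop> q = q"
  by (rule qlinear_eqI[OF qlinear_shuffle_right qlinear_id]) simp

lemma shuffle_unit_right [simp]: "p \<diamondop> bas [] = p"
  by (rule qlinear_eqI[OF qlinear_shuffle_left qlinear_id]) simp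

lemma shuffle_zero [simp]: "0 \<diamondop> q = 0" "p \<diamondop> 0 = 0"
  using qlinear_zero[OF qlinear_shuffle_left] qlinear_zero[OF qlinear_shuffle_right] by auto

lemma keys_lin_ext_bas: "keys (lin_ext (\<lambda>k. bas (f k)) p) \<subseteq> f ` keys p"
proof -
  have "lin_ext (\<lambda>k. bas (f k)) p \<in> {q. keys q \<subseteq> f ` keys p}"
    by (rule lin_ext_in_subspace[OF subspace_keys]) auto
  then show ?thesis by simp
qed

lemma mset_shuffle_words: "w \<in> keys (shuffle_words u v) \<Longrightarrow> mset w = mset u + mset v"
proof (induction u v arbitrary: w rule: shuffle_words.induct)
  case (3 a u b v)
  have "w \<in> (#) a ` keys (shuffle_words u (b # v)) \<union> (#) b ` keys (shuffle_words (a # u) v)"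
    using 3(3) keys_add[of "lin_ext (\<lambda>w. bas (a # w)) (shuffle_words u (b # v))"
        "lin_ext (\<lambda>w. bas (b # w)) (shuffle_words (a # u) v)"]
      keys_lin_ext_bas[of "(#) a" "shuffle_words u (b # v)"] keys_lin_ext_bas[of "(#) b" "shuffle_words (a # u) v"]
    by auto
  then show ?case using 3(1,2) by auto
qed auto

text \<open>Unlike zeta words, these words may begin with e^0, as the factors in Goncharov's formula
  do. The spaces are multiplicative for the shuffle product.\<close>

definition depth_words :: "nat \<Rightarrow> pialg set" where
  "depth_words r = {p. keys p \<subseteq> {w. count_list w E1 \<le> r}}"

lemma subspace_depth_words: "qvs.subspace (depth_words r)"
  unfolding depth_words_def by (rule subspace_keys)

lemma bas_in_depth_words [simp]: "bas w \<in> depth_words r \<longleftrightarrow> count_list w E1 \<le> r"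
  by (simp add: depth_words_def)

lemma depth_words_mono: "r \<le> s \<Longrightarrow> depth_words r \<subseteq> depth_words s"
  by (auto simp: depth_words_def)

lemma depth_words_eq_span: "depth_words r = qvs.span (bas ` {w. count_list w E1 \<le> r})"
  by (simp add: span_bas depth_words_def)

lemma count_list_mset: "mset u = mset v \<Longrightarrow> count_list u x = count_list v x"
  by (metis count_mset)

lemma shuffle_in_depth_words:
  assumes "p \<in> depth_words r" "q \<in> depth_words s"
  shows "p \<diamondop> q \<in> depth_words (r + s)"
  unfolding shuffle_def
proof (rule bilin_ext_in_subspace[OF subspace_depth_words])
  fix u v assume uv: "u \<in> keys p" "v \<in> keys q"
  have "count_list w E1 \<le> r + s" if w: "w \<in> keys (shuffle_words u v)" for w
  proof -
    have "count_list w E1 = count_list (u @ v) E1"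
      using mset_shuffle_words[OF w] by (intro count_list_mset) simp
    then show ?thesis using uv assms by (force simp: depth_words_def)
  qed
  then show "shuffle_words u v \<in> depth_words (r + s)" by (auto simp: depth_words_def)
qed

lemma shuffle_in_homog_length:
  assumes "p \<in> homog length M" "q \<in> homog length N"
  shows "p \<diamondop> q \<in> homog length (M + N)"
  unfolding shuffle_def
proof (rule bilin_ext_in_subspace[OF subspace_homog])
  fix u v assume uv: "u \<in> keys p" "v \<in> keys q"
  have "length w = M + N" if "w \<in> keys (shuffle_words u v)" for w
    using arg_cong[OF mset_shuffle_words[OF that], of size] uv assms by (auto simp: homog_def)
  then show "shuffle_words u v \<in> homog length (M + N)" by (auto simp: homog_def)
qed

subsection \<open>Segments of a word\<close>

definition segment :: "'a list \<Rightarrow> nat \<Rightarrow> nat \<Rightarrow> 'a list" where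
  "segment a p q = drop (Suc p) (take q a)"

text \<open>\<open>segment_prod\<close> with the list of cut positions, both ends included, as an
  argument, so that inductions can strip the first cut.\<close>

fun segments_prod :: "letter list \<Rightarrow> nat list \<Rightarrow> pialg" where
  "segments_prod a (p # q # ps) = path_fun (a ! p) (segment a p q) (a ! q) \<diamondop> segments_prod a (q # ps)"
| "segments_prod a _ = bas []"

lemma segments_prod_eq_foldr:
  "segments_prod a ps = foldr (\<diamondop>) (map (\<lambda>(p, q). path_fun (a ! p) (drop (Suc p) (take q a)) (a ! q)) (zip ps (tl ps))) (bas [])"
  by (induction a ps rule: segments_prod.induct) (auto simp: segment_def)

lemma segment_prod_eq:
  "segment_prod w S = segments_prod (E0 # w @ [E1]) (0 # sorted_list_of_set S @ [length w + 1])"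
  unfolding segment_prod_def segments_prod_eq_foldr Let_def by simp

lemma nths_eq_map_nth: "nths xs A = map ((!) xs) (filter (\<lambda>i. i \<in> A) [0..<length xs])"
proof (induction xs rule: rev_induct)
  case (snoc x xs)
  have "map ((!) (xs @ [x])) (filter (\<lambda>i. i \<in> A) [0..<length xs]) = map ((!) xs) (filter (\<lambda>i. i \<in> A) [0..<length xs])"
    by (rule map_cong) (auto simp: nth_append)
  then show ?case by (simp add: nths_append snoc.IH)
qed simp

lemma nths_eq_map_sorted:
  assumes "S \<subseteq> {..<length xs}"
  shows "nths xs S = map ((!) xs) (sorted_list_of_set S)"
proof -
  have "finite S" using assms finite_subset by blast
  then have "sorted_list_of_set S = filter (\<lambda>i. i \<in> S) [0..<length xs]"
    by (intro sorted_distinct_set_unique) (use assms in \<open>auto simp: sorted_wrt_filter\<close>)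
  then show ?thesis by (simp add: nths_eq_map_nth)
qed

lemma path_fun_in:
  assumes "count_list w E1 \<le> r"
  shows "path_fun a w b \<in> depth_words r" "path_fun a w b \<in> homog length (length w)"
proof -
  have "path_fun a w b \<in> {0, bas w, qscale ((-1) ^ length w) (bas (rev w))}"
    by (cases "(a, w, b)" rule: path_fun.cases) auto
  moreover have "count_list (rev w) E1 \<le> r" using assms by simp
  ultimately show "path_fun a w b \<in> depth_words r" "path_fun a w b \<in> homog length (length w)"
    using assms by (auto intro!: qvs.subspace_scale subspace_depth_words subspace_homog
        simp: qvs.subspace_0[OF subspace_depth_words] qvs.subspace_0[OF subspace_homog])
qed

lemma segment_split:
  assumes "p < q" "q < r" "r \<le> length a"
  shows "segment a p r = segment a p q @ a ! q # segment a q r"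
proof -
  have "take r a = take q a @ a ! q # drop (Suc q) (take r a)"
    using assms id_take_nth_drop[of q "take r a"] by (simp add: min_absorb1)
  then have "drop (Suc p) (take r a) = drop (Suc p) (take q a @ a ! q # drop (Suc q) (take r a))" by simp
  also have "\<dots> = drop (Suc p) (take q a) @ a ! q # drop (Suc q) (take r a)"
    using assms by simp
  finally show ?thesis by (simp add: segment_def)
qed

lemma sorted_wrt_last: "sorted_wrt (<) (p # ps) \<Longrightarrow> ps \<noteq> [] \<Longrightarrow> (p::nat) < last ps"
  by (induction ps) auto

text \<open>The letters strictly between the first and the last cut are distributed over the
  segments and the interior cuts \<open>butlast ps\<close>, so the numbers of letters e^1 and the
  lengths add up. Vanishing path functions are harmless, since 0 lies in all these spaces.\<close>

lemma segments_prod_in: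
  assumes "sorted_wrt (<) (p # ps)" "last (p # ps) < length a" "ps \<noteq> []"
  shows "\<exists>j. segments_prod a (p # ps) \<in> depth_words j \<and>
       j + count_list (map ((!) a) (butlast ps)) E1 = count_list (segment a p (last ps)) E1"
    and "\<exists>l. segments_prod a (p # ps) \<in> homog length l \<and>
       l + length (butlast ps) = length (segment a p (last ps))"
  using assms
proof (induction ps arbitrary: p)
  case (Cons q ps)
  note IH = Cons.IH
  have c: "path_fun (a ! p) (segment a p q) (a ! q) \<in> depth_words (count_list (segment a p q) E1)"
      "path_fun (a ! p) (segment a p q) (a ! q) \<in> homog length (length (segment a p q))" for p
    by (rule path_fun_in[OF order_refl])+
  {
    case 1
    show ?case
    proof (cases "ps = []")
      case True
      then show ?thesis using c(1) by (intro exI[of _ "count_list (segment a p q) E1"]) simp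
    next
      case False
      then obtain j where j: "segments_prod a (q # ps) \<in> depth_words j"
         "j + count_list (map ((!) a) (butlast ps)) E1 = count_list (segment a q (last ps)) E1"
        using IH(1)[of q] 1 by auto
      have "segment a p (last ps) = segment a p q @ a ! q # segment a q (last ps)"
        by (rule segment_split) (use 1 False sorted_wrt_last[of q ps] in auto)
      then show ?thesis
        using shuffle_in_depth_words[OF c(1) j(1)] j(2) False
        by (intro exI[of _ "count_list (segment a p q) E1 + j"]) auto
    qed
  next
    case 2
    show ?case
    proof (cases "ps = []")
      case True
      then show ?thesis using c(2) by (intro exI[of _ "length (segment a p q)"]) simp
    next
      case False
      then obtain j where j: "segments_prod a (q # ps) \<in> homog length j"
         "j + length (butlast ps) = length (segment a q (last ps))"
        using IH(2)[of q] 2 by auto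
      have "segment a p (last ps) = segment a p q @ a ! q # segment a q (last ps)"
        by (rule segment_split) (use 2 False sorted_wrt_last[of q ps] in auto)
      then show ?thesis
        using shuffle_in_homog_length[OF c(2) j(1)] j(2) False
        by (intro exI[of _ "length (segment a p q) + j"]) (cases ps, auto)
    qed
  }
qed auto

abbreviation subword :: "letter list \<Rightarrow> nat set \<Rightarrow> letter list" where
  "subword w S \<equiv> nths (E0 # w @ [E1]) S"

lemma subword_eq:
  "S \<subseteq> {1..length w} \<Longrightarrow> subword w S = map ((!) (E0 # w @ [E1])) (sorted_list_of_set S)"
  by (rule nths_eq_map_sorted) auto

lemma sorted_wrt_marks:
  assumes "S \<subseteq> {1..n::nat}"
  shows "sorted_wrt (<) (0 # sorted_list_of_set S @ [n + 1])"
proof -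
  have "finite S" using assms finite_subset by blast
  moreover have "\<forall>x\<in>S. 0 < x \<and> x < n + 1" using assms by auto
  ultimately show ?thesis by (simp add: sorted_wrt_append)
qed

text \<open>The Ihara coaction respects depth: the depths of the two factors add up to that of the
  word.\<close>

lemma segment_prod_depth:
  assumes "S \<subseteq> {1..length w}"
  obtains j where "segment_prod w S \<in> depth_words j" "j + count_list (subword w S) E1 = count_list w E1"
  using segments_prod_in(1)[OF sorted_wrt_marks[OF assms], of "E0 # w @ [E1]"]
  by (auto simp: segment_prod_eq subword_eq[OF assms] segment_def)

lemma segment_prod_empty: "segment_prod w {} = bas w"
proof -
  have "path_fun E0 w E1 = bas w" by (cases w) auto
  then show ?thesis by (simp add: segment_prod_eq segment_def nth_append)
qed

lemma subword_eq_Nil_iff: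
  assumes "S \<subseteq> {1..length w}"
  shows "subword w S = [] \<longleftrightarrow> S = {}"
proof -
  have "finite S" using assms finite_subset by blast
  then show ?thesis by (simp add: subword_eq[OF assms])
qed

subsection \<open>Words up to shuffles with \<open>e\<^sup>0\<close>\<close>

lemma shuffle_E0_replicate: "shuffle_words [E0] (replicate k E0) = qscale (of_nat (Suc k)) (bas (replicate (Suc k) E0))"
proof (induction k)
  case (Suc k)
  have "shuffle_words [E0] (replicate (Suc k) E0) =
      bas (replicate (Suc (Suc k)) E0) + lin_ext (\<lambda>w. bas (E0 # w)) (shuffle_words [E0] (replicate k E0))"
    by simp
  also have "\<dots> = qscale (of_nat (Suc (Suc k))) (bas (replicate (Suc (Suc k)) E0))"
    unfolding Suc.IH by (auto simp: lin_ext_scale lookup_add intro!: poly_mapping_eqI) (simp add: algebra_simps)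
  finally show ?case .
qed simp

text \<open>The new letter lands in one of \<open>k + 1\<close> equivalent places before the first
  e^1, or after it.\<close>

lemma shuffle_E0_replicate_E1:
  "shuffle_words [E0] (replicate k E0 @ E1 # u) =
     qscale (of_nat (Suc k)) (bas (replicate (Suc k) E0 @ E1 # u)) +
     lin_ext (\<lambda>w. bas (replicate k E0 @ E1 # w)) (shuffle_words [E0] u)"
proof (induction k)
  case (Suc k)
  have "shuffle_words [E0] (replicate (Suc k) E0 @ E1 # u) =
      bas (replicate (Suc (Suc k)) E0 @ E1 # u) +
      lin_ext (\<lambda>w. bas (E0 # w)) (shuffle_words [E0] (replicate k E0 @ E1 # u))"
    by simp
  also have "\<dots> = qscale (of_nat (Suc (Suc k))) (bas (replicate (Suc (Suc k)) E0 @ E1 # u)) +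
     lin_ext (\<lambda>w. bas (replicate (Suc k) E0 @ E1 # w)) (shuffle_words [E0] u)"
    unfolding Suc.IH
    by (auto simp: lin_ext_scale lin_ext_add qlinear_lin_ext_lin_ext[OF qlinear_lin_ext] lookup_add intro!: poly_mapping_eqI)
       (simp add: algebra_simps)
  finally show ?case .
qed simp

lemma zeta_elt_of_word:
  assumes "w = [] \<or> hd w = E1"
  shows "\<exists>ns. bas w = zeta_elt ns \<and> length ns = count_list w E1 \<and> (\<forall>n\<in>set ns. 1 \<le> n)"
proof -
  let ?c = "\<lambda>ns. concat (map (\<lambda>n. E1 # replicate (n - 1) E0) ns)"
  have "\<exists>ns. w = ?c ns \<and> length ns = count_list w E1 \<and> (\<forall>n\<in>set ns. 1 \<le> n)"
    using assms
  proof (induction w rule: rev_induct)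
    case (snoc x w)
    have "w = [] \<or> hd w = E1" using snoc.prems by (cases w) auto
    then obtain ns where ns: "w = ?c ns" "length ns = count_list w E1" "\<forall>n\<in>set ns. 1 \<le> n"
      using snoc.IH by blast
    show ?case
    proof (cases x)
      case E1
      then show ?thesis using ns by (intro exI[of _ "ns @ [1]"]) auto
    next
      case E0
      then have "ns \<noteq> []" using snoc.prems ns by auto
      then obtain ms m where ms: "ns = ms @ [m]" by (metis append_butlast_last_id)
      have "replicate (Suc m - 1) E0 = replicate (m - 1) E0 @ [E0]"
        using ns(3) ms by (cases m) (auto simp: replicate_append_same)
      then show ?thesis using E0 ns ms by (intro exI[of _ "ms @ [Suc m]"]) auto
    qed
  qed auto
  then show ?thesis by (auto simp: zeta_elt_def)
qed

lemma count_zeta_elt: "count_list (concat (map (\<lambda>n. E1 # replicate (n - 1) E0) ns)) E1 = length ns"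
proof -
  have "count_list (replicate k E0) E1 = 0" for k by (induction k) auto
  then show ?thesis by (induction ns) auto
qed

lemma word_leading_E0: "\<exists>k u. w = replicate k E0 \<or> w = replicate k E0 @ E1 # u"
proof (induction w)
  case (Cons x w)
  then obtain k u where ku: "w = replicate k E0 \<or> w = replicate k E0 @ E1 # u" by blast
  show ?case
  proof (cases x)
    case E0
    then have "x # w = replicate (Suc k) E0 \<or> x # w = replicate (Suc k) E0 @ E1 # u" using ku by auto
    then show ?thesis by blast
  next
    case E1
    then have "x # w = replicate 0 E0 @ E1 # w" by simp
    then show ?thesis by blast
  qed
qed (auto intro: exI[of _ 0])

text \<open>Modulo the ideal generated by \<open>e\<^sup>0\<close>, leading letters \<open>e\<^sup>0\<close> can be moved to the right.\<close>

lemma word_mod_E0: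
  "bas w \<in> qvs.span ({zeta_elt ns |ns. length ns \<le> count_list w E1 \<and> (\<forall>n\<in>set ns. 1 \<le> n)} \<union> {bas [E0] \<diamondop> x |x. True})"
proof -
  obtain k u where "w = replicate k E0 \<or> w = replicate k E0 @ E1 # u" using word_leading_E0 by blast
  then show ?thesis
  proof
    assume w: "w = replicate k E0"
    show ?thesis
    proof (cases k)
      case 0
      then have "bas w = zeta_elt []" using w by (simp add: zeta_elt_def)
      then show ?thesis by (intro qvs.span_base UnI1 CollectI exI[of _ "[]"]) auto
    next
      case (Suc j)
      have "bas w = qscale (1 / of_nat (Suc j)) (bas [E0] \<diamondop> bas (replicate j E0))"
        unfolding shuffle_bas shuffle_E0_replicate w Suc by simp
      then show ?thesis by (simp only:) (rule qvs.span_scale, rule qvs.span_base, blast)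
    qed
  next
    assume w: "w = replicate k E0 @ E1 # u"
    then show ?thesis
    proof (induction k arbitrary: u w)
      case 0
      then show ?case using zeta_elt_of_word[of w] by (auto intro!: qvs.span_base)
    next
      case (Suc k)
      let ?G = "\<lambda>w. {zeta_elt ns |ns. length ns \<le> count_list w E1 \<and> (\<forall>n\<in>set ns. 1 \<le> n)} \<union> {bas [E0] \<diamondop> x |x. True}"
      let ?y = "lin_ext (\<lambda>w. bas (replicate k E0 @ E1 # w)) (shuffle_words [E0] u)"
      have y: "?y \<in> qvs.span (?G w)"
      proof (rule lin_ext_in_subspace)
        fix v assume v: "v \<in> keys (shuffle_words [E0] u)"
        have "count_list v E1 = count_list (E0 # u) E1"
          using mset_shuffle_words[OF v] by (intro count_list_mset) auto
        then have "count_list (replicate k E0 @ E1 # v) E1 = count_list w E1"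
          using Suc.prems by simp
        then show "bas (replicate k E0 @ E1 # v) \<in> qvs.span (?G w)"
          using Suc.IH[OF refl, of v] by simp
      qed simp
      have "bas w = qscale (1 / of_nat (Suc k)) (bas [E0] \<diamondop> bas (replicate k E0 @ E1 # u) - ?y)"
        unfolding shuffle_bas shuffle_E0_replicate_E1 Suc.prems by simp
      also have "\<dots> \<in> qvs.span (?G w)"
        by (intro qvs.span_scale qvs.span_diff y qvs.span_base) blast
      finally show ?case .
    qed
  qed
qed

subsection \<open>Coefficients of the coaction\<close>

lemma take_drop_eq_iff: "i \<le> length w \<Longrightarrow> take i w = u \<and> drop i w = v \<longleftrightarrow> i = length u \<and> w = u @ v"
  by (metis append_eq_conv_conj append_take_drop_id length_take min.absorb2)

lemma lookup_deconc:
  "lookup (contract_left (\<lambda>p. lookup p u) (deconc y)) v = lookup y (u @ v)"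
proof (rule qfunctional_eqI[where p = y])
  show "qfunctional (\<lambda>y. lookup (contract_left (\<lambda>p. lookup p u) (deconc y)) v)"
    unfolding deconc_def
    by (intro qfunctional_compose[OF _ qfunctional_lookup] qlinear_compose[OF qlinear_lin_ext qlinear_contract_left])
next
  fix w :: "nat list"
  have "lookup (contract_left (\<lambda>p. lookup p u) (deconc (bas w))) v =
      (\<Sum>i\<le>length w. if take i w = u \<and> drop i w = v then 1 else 0)"
    by (auto simp: deconc_def qlinear_sum[OF qlinear_contract_left] lookup_sum lookup_single when_def intro!: sum.cong)
  also have "\<dots> = (\<Sum>i\<le>length w. if i = length u then (if w = u @ v then 1 else 0) else 0)"
    by (rule sum.cong[OF refl]) (simp add: take_drop_eq_iff)
  also have "\<dots> = lookup (bas w) (u @ v)"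
    by (auto simp: lookup_single when_def)
  finally show "lookup (contract_left (\<lambda>p. lookup p u) (deconc (bas w))) v = lookup (bas w) (u @ v)" .
qed (rule qfunctional_lookup)

lemma lookup_PM_coact_left:
  "lookup (contract_left (\<lambda>p. lookup p u) (PM_coact z)) (v, k) = lookup z (u @ v, k)"
proof (rule qfunctional_eqI[where p = z])
  show "qfunctional (\<lambda>y. lookup (contract_left (\<lambda>p. lookup p u) (PM_coact y)) (v, k))"
    unfolding PM_coact_def
    by (intro qfunctional_compose[OF _ qfunctional_lookup] qlinear_compose[OF qlinear_lin_ext qlinear_contract_left])
next
  fix wj :: "nat list \<times> nat"
  obtain w j where wj: "wj = (w, j)" by (cases wj)
  have "lookup (contract_left (\<lambda>p. lookup p u) (PM_coact (bas wj))) (v, k) =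
      (\<Sum>i\<le>length w. if take i w = u \<and> drop i w = v \<and> j = k then 1 else 0)"
    by (auto simp: wj PM_coact_def qlinear_sum[OF qlinear_contract_left] lookup_sum lookup_single when_def intro!: sum.cong)
  also have "\<dots> = (\<Sum>i\<le>length w. if i = length u then (if w = u @ v \<and> j = k then 1 else 0) else 0)"
  proof (rule sum.cong[OF refl])
    fix i assume "i \<in> {..length w}"
    then have "take i w = u \<and> drop i w = v \<longleftrightarrow> i = length u \<and> w = u @ v"
      by (intro take_drop_eq_iff) simp
    then have *: "take i w = u \<and> drop i w = v \<and> j = k \<longleftrightarrow> i = length u \<and> w = u @ v \<and> j = k" by blast
    show "(if take i w = u \<and> drop i w = v \<and> j = k then 1 else 0) =
        (if i = length u then (if w = u @ v \<and> j = k then 1 else 0) else (0::rat))"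
      unfolding * by simp
  qed
  also have "\<dots> = lookup (bas wj) (u @ v, k)"
    by (auto simp: wj lookup_single when_def)
  finally show "lookup (contract_left (\<lambda>p. lookup p u) (PM_coact (bas wj))) (v, k) = lookup (bas wj) (u @ v, k)" .
qed (rule qfunctional_lookup)

lemma lookup_PM_coact_right:
  "lookup (contract_right (\<lambda>z. lookup z ([], k)) (PM_coact z)) u = lookup z (u, k)"
proof (rule qfunctional_eqI[where p = z])
  show "qfunctional (\<lambda>z. lookup (contract_right (\<lambda>z. lookup z ([], k)) (PM_coact z)) u)"
    unfolding PM_coact_def
    by (intro qfunctional_compose[OF _ qfunctional_lookup] qlinear_compose[OF qlinear_lin_ext qlinear_contract_right])
next
  fix wj :: "nat list \<times> nat"
  obtain w j where wj: "wj = (w, j)" by (cases wj)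
  have "lookup (contract_right (\<lambda>z. lookup z ([], k)) (PM_coact (bas wj))) u =
      (\<Sum>i\<le>length w. if take i w = u \<and> drop i w = [] \<and> j = k then 1 else 0)"
    by (auto simp: wj PM_coact_def qlinear_sum[OF qlinear_contract_right] lookup_sum lookup_single when_def intro!: sum.cong)
  also have "\<dots> = (\<Sum>i\<le>length w. if i = length w then (if w = u \<and> j = k then 1 else 0) else 0)"
    by (rule sum.cong) auto
  also have "\<dots> = lookup (bas wj) (u, k)"
    by (auto simp: wj lookup_single when_def)
  finally show "lookup (contract_right (\<lambda>z. lookup z ([], k)) (PM_coact (bas wj))) u = lookup (bas wj) (u, k)" .
qed (rule qfunctional_lookup)

text \<open>The coefficient of \<open>f\<^sub>2\<^sup>k\<close> in \<open>z\<close>. Written through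
  the coaction, it can be computed on \<open>\<phi> x\<close> by Goncharov's formula.\<close>

definition coeff_f2 :: "nat \<Rightarrow> (nat list \<times> nat \<Rightarrow>\<^sub>0 rat) \<Rightarrow> (nat list \<Rightarrow>\<^sub>0 rat)" where
  "coeff_f2 k z = contract_right (\<lambda>z. lookup z ([], k)) (PM_coact z)"

lemma lookup_coeff_f2 [simp]: "lookup (coeff_f2 k z) w = lookup z (w, k)"
  unfolding coeff_f2_def by (rule lookup_PM_coact_right)

lemma qlinear_coeff_f2: "qlinear (coeff_f2 k)"
  by (rule qlinearI) (auto intro!: poly_mapping_eqI simp: lookup_add)

definition times_f2 :: "nat \<Rightarrow> (nat list \<Rightarrow>\<^sub>0 rat) \<Rightarrow> (nat list \<times> nat \<Rightarrow>\<^sub>0 rat)" where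
  "times_f2 k = lin_ext (\<lambda>w. bas (w, k))"

lemma qlinear_times_f2: "qlinear (times_f2 k)"
  unfolding times_f2_def by (rule qlinear_lin_ext)

lemma times_f2_bas [simp]: "times_f2 k (bas w) = bas (w, k)"
  by (simp add: times_f2_def)

lemma lookup_times_f2: "lookup (times_f2 k y) (w, j) = (if j = k then lookup y w else 0)"
  by (rule qfunctional_eqI[OF qfunctional_compose[OF qlinear_times_f2 qfunctional_lookup]])
     (auto intro!: qfunctionalI simp: lookup_add lookup_single when_def)

lemma coeff_f2_times_f2: "coeff_f2 j (times_f2 k y) = (if j = k then y else 0)"
  by (rule poly_mapping_eqI) (auto simp: lookup_times_f2)

lemma sum_times_f2: "finite K \<Longrightarrow> snd ` keys z \<subseteq> K \<Longrightarrow> z = (\<Sum>k\<in>K. times_f2 k (coeff_f2 k z))"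
proof (rule poly_mapping_eqI)
  fix wj :: "nat list \<times> nat" assume K: "finite K" "snd ` keys z \<subseteq> K"
  obtain w j where wj: "wj = (w, j)" by (cases wj)
  have "j \<notin> K \<Longrightarrow> lookup z (w, j) = 0" using K(2) by (force simp: in_keys_iff)
  then show "lookup z wj = lookup (\<Sum>k\<in>K. times_f2 k (coeff_f2 k z)) wj"
    using K(1) by (auto simp: wj lookup_sum lookup_times_f2)
qed

lemma qlinear_PM_mult_left: "qlinear (\<lambda>p. PM_mult p q)"
  and qlinear_PM_mult_right: "qlinear (PM_mult p)"
  unfolding PM_mult_def by (rule qlinear_bilin_ext_left, rule qlinear_bilin_ext_right)

lemma PM_mult_f2_power: "PM_mult (bas ([], k)) (times_f2 j y) = times_f2 (k + j) y"
  by (rule qlinear_eqI[OF qlinear_compose[OF qlinear_times_f2 qlinear_PM_mult_right] qlinear_times_f2])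
     (simp add: PM_mult_def)

lemma lin_ext_homog_part:
  assumes "qlinear f" "\<And>N x. x \<in> homog w N \<Longrightarrow> f x \<in> homog w' N"
  shows "f (homog_part w N x) = homog_part w' N (f x)"
proof (rule qlinear_eqI[OF qlinear_compose[OF qlinear_homog_part assms(1)] qlinear_compose[OF assms(1) qlinear_homog_part]])
  fix k
  have "f (bas k) \<in> homog w' (w k)" by (rule assms(2)) simp
  then show "f (homog_part w N (bas k)) = homog_part w' N (f (bas k))"
    using homog_part_homog[of "bas k" w "w k"] by (auto simp: homog_part_homog qlinear_zero[OF assms(1)])
qed

lemma PM_iff: "z \<in> PM \<longleftrightarrow> keys z \<subseteq> lists {n. odd n \<and> 3 \<le> n} \<times> UNIV"
  unfolding PM_def by auto

lemma subspace_PM: "qvs.subspace PM"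
proof -
  have "PM = {z. keys z \<subseteq> lists {n. odd n \<and> 3 \<le> n} \<times> UNIV}" using PM_iff by blast
  show ?thesis unfolding \<open>PM = _\<close> by (rule subspace_keys)
qed

lemma OU_word_weight: "w \<in> lists {n::nat. odd n \<and> 3 \<le> n} \<Longrightarrow> 3 * length w \<le> sum_list w"
  by (induction w) auto

section \<open>The coaction on words and its effect on depth\<close>

context mixed_tate_Z
begin

lemma phi_sum: "\<phi> (sum f A) = (\<Sum>a\<in>A. \<phi> (f a))"
  and phi_add: "\<phi> (x + y) = \<phi> x + \<phi> y"
  and phi_scale: "\<phi> (qscale c x) = qscale c (\<phi> x)"
  and phi_zero: "\<phi> 0 = 0"
  using phi_linear by (simp_all add: qlinear_sum qlinear_add qlinear_scale qlinear_zero)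

lemma psi_add: "\<psi> (x + y) = \<psi> x + \<psi> y"
  and psi_scale: "\<psi> (qscale c x) = qscale c (\<psi> x)"
  and psi_zero: "\<psi> 0 = 0"
  using psi_linear by (simp_all add: qlinear_add qlinear_scale qlinear_zero)

lemma ihara_bas: "ihara (bas w) = (\<Sum>S\<in>Pow {1..length w}. tensor (segment_prod w S) (bas (subword w S)))"
  by (simp add: ihara_def)

lemma contract_left_deconc_psi:
  assumes "qfunctional h"
  shows "contract_left h (deconc (\<psi> (bas w))) =
    (\<Sum>S\<in>Pow {1..length w}. qscale (h (\<psi> (segment_prod w S))) (\<psi> (bas (subword w S))))"
  by (simp add: psi_comult ihara_bas qlinear_sum[OF qlinear_tensor_map] qlinear_sum[OF qlinear_contract_left]
      tensor_map_tensor[OF psi_linear psi_linear] contract_left_tensor[OF assms])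

lemma coeff_f2_phi_bas:
  "coeff_f2 k (\<phi> (bas w)) =
    (\<Sum>S\<in>Pow {1..length w}. qscale (lookup (\<phi> (bas (subword w S))) ([], k)) (\<psi> (segment_prod w S)))"
  unfolding coeff_f2_def
  by (simp add: phi_coact ihara_bas qlinear_sum[OF qlinear_tensor_map] qlinear_sum[OF qlinear_contract_right]
      tensor_map_tensor[OF psi_linear phi_linear] contract_right_tensor[OF qfunctional_lookup])

lemma contract_left_coaction:
  assumes "qfunctional h"
  shows "\<phi> (contract_left h (coaction \<psi> x)) = contract_left h (PM_coact (\<phi> x))"
proof -
  have "\<phi> (contract_left h (tensor_map \<psi> (\<lambda>y. y) t)) = contract_left h (tensor_map \<psi> \<phi> t)" for t
    by (rule qlinear_eqI[OF qlinear_compose[OF qlinear_tensor_map qlinear_compose[OF qlinear_contract_left phi_linear]]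
          qlinear_compose[OF qlinear_tensor_map qlinear_contract_left]])
       (auto simp: tensor_map_def contract_left_tensor[OF assms] phi_scale)
  then show ?thesis by (simp add: coaction_def phi_coact)
qed

text \<open>The letters f_n have weight at least 3 and f_2 has weight 2, so nothing has weight 1;
  \<phi> kills e^0 for the same reason.\<close>

lemma psi_E0: "\<psi> (bas [E0]) = 0"
proof (rule ccontr)
  assume "\<psi> (bas [E0]) \<noteq> 0"
  then obtain w where w: "w \<in> keys (\<psi> (bas [E0]))" by (metis keys_zero lookup_zero not_in_keys_iff_lookup_eq_zero poly_mapping_eqI)
  then have "w \<in> lists {n. odd n \<and> 3 \<le> n}" "sum_list w = 1"
    using psi_OU[of "bas [E0]"] psi_weight[of "bas [E0]" 1] by (auto simp: OU_def homog_def)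
  then show False using OU_word_weight[of w] by (cases w) auto
qed

lemma phi_E0: "\<phi> (bas [E0]) = 0"
proof (rule ccontr)
  assume "\<phi> (bas [E0]) \<noteq> 0"
  then obtain wk where wk: "wk \<in> keys (\<phi> (bas [E0]))" by (metis keys_zero lookup_zero not_in_keys_iff_lookup_eq_zero poly_mapping_eqI)
  obtain w k where wk': "wk = (w, k)" by (cases wk)
  have "w \<in> lists {n. odd n \<and> 3 \<le> n}" "sum_list w + 2 * k = 1"
    using wk phi_PM[of "bas [E0]"] phi_weight[of "bas [E0]" 1] by (auto simp: wk' PM_iff homog_def PM_wt_def)
  then show False using OU_word_weight[of w] by (cases w) auto
qed

lemma psi_shuffle_E0: "\<psi> (bas [E0] \<diamondop> x) = 0"
  by (simp only: psi_mult psi_E0 shuffle_zero)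

lemma phi_shuffle_E0: "\<phi> (bas [E0] \<diamondop> x) = 0"
  by (simp only: phi_mult phi_E0 qlinear_zero[OF qlinear_PM_mult_left])

lemma phi_replicate_E0: "0 < k \<Longrightarrow> \<phi> (bas (replicate k E0)) = 0"
proof -
  assume "0 < k"
  then obtain j where k: "k = Suc j" by (cases k) auto
  have "0 = \<phi> (bas [E0] \<diamondop> bas (replicate j E0))" by (rule phi_shuffle_E0[symmetric])
  also have "\<dots> = qscale (of_nat (Suc j)) (\<phi> (bas (replicate k E0)))"
    by (simp only: shuffle_bas shuffle_E0_replicate phi_scale k)
  finally show ?thesis by (simp add: qvs.scale_eq_0_iff)
qed

lemma no_E1_replicate: "count_list w E1 = 0 \<Longrightarrow> w = replicate (length w) E0"
proof (induction w)
  case (Cons x w)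
  then show ?case by (cases x) (auto split: if_splits)
qed simp

lemma lookup_phi_Nil:
  assumes "w \<noteq> []"
  shows "lookup (\<phi> (bas w)) ([], 0) = 0"
proof (rule ccontr)
  assume "lookup (\<phi> (bas w)) ([], 0) \<noteq> 0"
  then have "([], 0) \<in> keys (\<phi> (bas w))" by (simp add: in_keys_iff)
  then show False using phi_weight[of "bas w" "length w"] assms by (auto simp: homog_def PM_wt_def)
qed

text \<open>By weight, the right factor has a constant term only for the empty subword, and then the
  left factor is the whole word. Thus \<psi> is \<phi> modulo f_2.\<close>

lemma coeff_f2_0_phi: "coeff_f2 0 (\<phi> x) = \<psi> x"
proof (rule qlinear_eqI[OF qlinear_compose[OF phi_linear qlinear_coeff_f2] psi_linear])
  fix w
  have "coeff_f2 0 (\<phi> (bas w)) = (\<Sum>S\<in>Pow {1..length w}. if S = {} then \<psi> (bas w) else 0)"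
    unfolding coeff_f2_phi_bas
  proof (rule sum.cong)
    fix S assume S: "S \<in> Pow {1..length w}"
    show "qscale (lookup (\<phi> (bas (subword w S))) ([], 0)) (\<psi> (segment_prod w S)) = (if S = {} then \<psi> (bas w) else 0)"
      using S subword_eq_Nil_iff[of S w] lookup_phi_Nil[of "subword w S"]
      by (auto simp: segment_prod_empty phi_one)
  qed simp
  then show "coeff_f2 0 (\<phi> (bas w)) = \<psi> (bas w)" by simp
qed

lemma psi_eq_0_if_phi: "\<phi> x = 0 \<Longrightarrow> \<psi> x = 0"
  using coeff_f2_0_phi[of x] qlinear_zero[OF qlinear_coeff_f2] by simp

text \<open>The right factor that produces \<open>f\<^sub>2\<^sup>k\<close> contains an e^1, since
  \<phi> kills nonempty powers of e^0; this leaves at most \<open>r - 1\<close> of them for the left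
  factor.\<close>

lemma coeff_f2_phi_depth:
  assumes "x \<in> depth_words r" "0 < k" "r \<noteq> 0"
  shows "coeff_f2 k (\<phi> x) \<in> \<psi> ` depth_words (r - 1)"
proof -
  have sub: "qvs.subspace (\<psi> ` depth_words (r - 1))"
    by (rule subspace_image_qlinear[OF psi_linear subspace_depth_words])
  have bas: "coeff_f2 k (\<phi> (bas w)) \<in> \<psi> ` depth_words (r - 1)" if w: "count_list w E1 \<le> r" for w
    unfolding coeff_f2_phi_bas
  proof (rule qvs.subspace_sum[OF sub])
    fix S assume S: "S \<in> Pow {1..length w}"
    obtain j where j: "segment_prod w S \<in> depth_words j" "j + count_list (subword w S) E1 = count_list w E1"
      using segment_prod_depth[of S w] S by auto
    show "qscale (lookup (\<phi> (bas (subword w S))) ([], k)) (\<psi> (segment_prod w S)) \<in> \<psi> ` depth_words (r - 1)"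
    proof (cases "count_list (subword w S) E1 = 0")
      case True
      then obtain i where i: "subword w S = replicate i E0" using no_E1_replicate by blast
      have "lookup (\<phi> (bas (subword w S))) ([], k) = 0"
        using assms(2) phi_replicate_E0[of i] phi_one unfolding i by (cases "i = 0") (auto simp: lookup_single)
      then show ?thesis using qvs.subspace_0[OF sub] by simp
    next
      case False
      then have "j \<le> r - 1" using j w by linarith
      then have "segment_prod w S \<in> depth_words (r - 1)" using j depth_words_mono by blast
      then show ?thesis by (intro qvs.subspace_scale[OF sub]) auto
    qed
  qed
  have "x \<in> qvs.span (bas ` {w. count_list w E1 \<le> r})" using assms(1) by (simp add: depth_words_eq_span)
  then show ?thesis
  proof (induction rule: qvs.span_induct_alt)
    case base
    show ?case by (simp only: phi_zero qlinear_zero[OF qlinear_coeff_f2] qvs.subspace_0[OF sub])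
  next
    case (step c x y)
    have "coeff_f2 k (\<phi> x) \<in> \<psi> ` depth_words (r - 1)" using bas step.hyps by auto
    then show ?case using step.IH
      by (simp only: phi_add phi_scale qlinear_add[OF qlinear_coeff_f2] qlinear_scale[OF qlinear_coeff_f2])
         (intro qvs.subspace_add[OF sub] qvs.subspace_scale[OF sub])
  qed
qed

lemma phi_depth_0: "\<phi> ` depth_words 0 = range (\<lambda>c. qscale c (bas ([], 0)))"
proof -
  have "\<phi> x \<in> qvs.span {bas ([], 0)}" if "x \<in> depth_words 0" for x
  proof -
    have "x \<in> qvs.span (bas ` {w. count_list w E1 \<le> 0})" using that by (simp add: depth_words_eq_span)
    then show ?thesis
    proof (induction rule: qvs.span_induct_alt)
      case (step c x y)
      then obtain w where "x = bas w" "count_list w E1 = 0" by auto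
      then obtain i where "x = bas (replicate i E0)" using no_E1_replicate by metis
      then have "\<phi> x \<in> qvs.span {bas ([], 0)}"
        using phi_replicate_E0[of i] phi_one by (cases "i = 0") (auto simp: qvs.span_zero intro: qvs.span_base)
      then show ?case using step by (simp add: phi_add phi_scale qvs.span_add qvs.span_scale)
    qed (simp add: phi_zero qvs.span_zero)
  qed
  moreover have "qscale c (bas ([], 0)) \<in> \<phi> ` depth_words 0" for c
    using phi_scale[of c "bas []"] phi_one
    by (intro image_eqI[of _ _ "qscale c (bas [])"]) (auto intro!: qvs.subspace_scale[OF subspace_depth_words])
  ultimately show ?thesis by (auto simp: qvs.span_singleton)
qed

lemma psi_depth_0: "\<psi> ` depth_words 0 = range (\<lambda>c. qscale c (bas []))"
proof -
  have "\<psi> ` depth_words 0 = coeff_f2 0 ` \<phi> ` depth_words 0"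
    by (simp add: image_image coeff_f2_0_phi)
  also have "\<dots> = range (\<lambda>c. qscale c (bas []))"
  proof -
    have "coeff_f2 0 (qscale c (bas ([], 0))) = qscale c (bas [])" for c
      by (rule poly_mapping_eqI) (simp add: lookup_single when_def)
    then show ?thesis unfolding phi_depth_0 by (simp add: image_image)
  qed
  finally show ?thesis .
qed

text \<open>Depth bounds the coradical degree. A first letter can be split off only by a left factor
  with some e^1, because depth 0 maps to constants; the rest then comes from a subword of smaller
  depth.\<close>

lemma psi_depth_length:
  assumes "x \<in> depth_words r" "u \<in> keys (\<psi> x)"
  shows "length u \<le> r"
proof -
  have bas: "length u \<le> r" if "count_list w E1 \<le> r" "u \<in> keys (\<psi> (bas w))" for u w r
    using that
  proof (induction r arbitrary: u w)
    case 0
    then have "\<psi> (bas w) \<in> \<psi> ` depth_words 0" by auto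
    then show ?case using 0 unfolding psi_depth_0 by (auto simp: in_keys_iff lookup_single when_def split: if_splits)
  next
    case (Suc r)
    show ?case
    proof (cases u)
      case (Cons m v)
      have "lookup (contract_left (\<lambda>p. lookup p [m]) (deconc (\<psi> (bas w)))) v \<noteq> 0"
        using Suc.prems(2) Cons by (simp add: lookup_deconc in_keys_iff)
      then have "(\<Sum>S\<in>Pow {1..length w}. lookup (\<psi> (segment_prod w S)) [m] * lookup (\<psi> (bas (subword w S))) v) \<noteq> 0"
        by (simp add: contract_left_deconc_psi[OF qfunctional_lookup] lookup_sum)
      then obtain S where S: "S \<in> Pow {1..length w}" "lookup (\<psi> (segment_prod w S)) [m] \<noteq> 0"
          "lookup (\<psi> (bas (subword w S))) v \<noteq> 0"
        by (metis (no_types, lifting) mult_eq_0_iff sum.neutral)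
      obtain j where j: "segment_prod w S \<in> depth_words j" "j + count_list (subword w S) E1 = count_list w E1"
        using segment_prod_depth[of S w] S by auto
      have "j \<noteq> 0"
      proof
        assume "j = 0"
        then have "\<psi> (segment_prod w S) \<in> \<psi> ` depth_words 0" using j by auto
        then show False using S(2) unfolding psi_depth_0 by (auto simp: lookup_single when_def)
      qed
      then have "length v \<le> r"
        using S(3) j(2) Suc.prems(1) by (intro Suc.IH[of "subword w S"]) (auto simp: in_keys_iff)
      then show ?thesis using Cons by simp
    qed simp
  qed
  have "x \<in> qvs.span (bas ` {w. count_list w E1 \<le> r})" using assms(1) by (simp add: depth_words_eq_span)
  then have "\<psi> x \<in> {p. keys p \<subseteq> {u. length u \<le> r}}"
  proof (induction rule: qvs.span_induct_alt)
    case base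
    then show ?case by (simp add: psi_zero)
  next
    case (step c x y)
    then have "\<psi> x \<in> {p. keys p \<subseteq> {u. length u \<le> r}}" using bas by auto
    then show ?case using step
      by (simp only: psi_add psi_scale)
         (intro qvs.subspace_add[OF subspace_keys] qvs.subspace_scale[OF subspace_keys])
  qed
  then show ?thesis using assms(2) by auto
qed

end

subsection \<open>Depth one and the motivic ideal\<close>

lemma zeta_elt_single: "zeta_elt [n] = bas (E1 # replicate (n - 1) E0)"
  by (simp add: zeta_elt_def)

lemma count_list_replicate_E0 [simp]: "count_list (replicate k E0) E1 = 0"
  by (induction k) auto

lemma zeta_single_in_depth: "zeta_elt [n] \<in> depth_words 1"
  by (simp add: zeta_elt_single)

lemma zeta_single_in_homog: "1 \<le> n \<Longrightarrow> zeta_elt [n] \<in> homog length n"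
  by (simp add: zeta_elt_single)

lemma per_bas: "per (bas w) = per_word w"
  by (simp add: per_def)

lemma per_zeta_single_nonzero: "2 \<le> n \<Longrightarrow> per (zeta_elt [n]) \<noteq> 0"
  using per_word_zeta_pos[of "n - 1"] by (simp add: zeta_elt_single per_bas)

lemma keys_subset_singleton: "keys p \<subseteq> {k} \<Longrightarrow> p = qscale (lookup p k) (bas k)"
  by (rule poly_mapping_eqI) (auto simp: lookup_single when_def in_keys_iff)

context mixed_tate_Z
begin

text \<open>The scalar by which \<psi> takes this zeta value to the letter f_n. It depends on the
  choice of generators, but its vanishing does not.\<close>

definition zeta_coeff :: "nat \<Rightarrow> rat" where
  "zeta_coeff n = lookup (\<psi> (zeta_elt [n])) [n]"

lemma keys_psi:
  assumes "x \<in> depth_words r" "x \<in> homog length N" "u \<in> keys (\<psi> x)"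
  shows "length u \<le> r" "sum_list u = N" "u \<in> lists {n. odd n \<and> 3 \<le> n}"
  using psi_depth_length[OF assms(1,3)] psi_weight[OF assms(2)] psi_OU[of x] assms(3)
  by (auto simp: homog_def OU_def)

lemma psi_zeta_single:
  assumes "1 \<le> n"
  shows "\<psi> (zeta_elt [n]) = qscale (zeta_coeff n) (bas [n])"
  unfolding zeta_coeff_def
proof (rule keys_subset_singleton, rule subsetI)
  fix u assume "u \<in> keys (\<psi> (zeta_elt [n]))"
  note u = keys_psi[OF zeta_single_in_depth zeta_single_in_homog[OF assms] this]
  then show "u \<in> {[n]}" using assms by (cases u) auto
qed

lemma zeta_coeff_eq_0: "1 \<le> n \<Longrightarrow> \<not> (odd n \<and> 3 \<le> n) \<Longrightarrow> zeta_coeff n = 0"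
  using keys_psi(3)[OF zeta_single_in_depth zeta_single_in_homog, of n "[n]"]
  by (auto simp: zeta_coeff_def in_keys_iff)

lemma lookup_phi: "lookup (\<phi> x) (u, 0) = lookup (\<psi> x) u"
  by (metis coeff_f2_0_phi lookup_coeff_f2)

text \<open>In depth one the coefficients of positive powers of f_2 have depth 0, so they are
  constants; the weight decides which power can occur.\<close>

lemma lookup_phi_zeta_single:
  assumes "1 \<le> n" "0 < k"
  shows "lookup (\<phi> (zeta_elt [n])) (u, k) = (if u = [] \<and> n = 2 * k then lookup (\<phi> (zeta_elt [n])) ([], k) else 0)"
proof (cases "lookup (\<phi> (zeta_elt [n])) (u, k) = 0")
  case False
  have "coeff_f2 k (\<phi> (zeta_elt [n])) \<in> \<psi> ` depth_words (1 - 1)"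
    by (rule coeff_f2_phi_depth[OF zeta_single_in_depth assms(2)]) simp
  then obtain c where "coeff_f2 k (\<phi> (zeta_elt [n])) = qscale c (bas [])"
    by (auto simp: psi_depth_0)
  then have "lookup (\<phi> (zeta_elt [n])) (u, k) = c * lookup (bas []) u"
    by (metis lookup_coeff_f2 lookup_qscale)
  then have u: "u = []" using False by (auto simp: lookup_single when_def split: if_splits)
  have "(u, k) \<in> keys (\<phi> (zeta_elt [n]))" using False by (simp add: in_keys_iff)
  then have "n = 2 * k"
    using phi_weight[OF zeta_single_in_homog[OF assms(1)]] u by (auto simp: homog_def PM_wt_def)
  then show ?thesis using u by simp
qed auto

lemma phi_zeta_odd:
  assumes "odd n"
  shows "\<phi> (zeta_elt [n]) = qscale (zeta_coeff n) (bas ([n], 0))"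
proof (rule poly_mapping_eqI)
  fix uk :: "nat list \<times> nat"
  obtain u k where uk: "uk = (u, k)" by (cases uk)
  have n: "1 \<le> n" using assms by (cases n) auto
  show "lookup (\<phi> (zeta_elt [n])) uk = lookup (qscale (zeta_coeff n) (bas ([n], 0))) uk"
  proof (cases "k = 0")
    case True
    then show ?thesis by (simp add: uk lookup_phi psi_zeta_single[OF n] lookup_single when_def)
  next
    case False
    then show ?thesis using lookup_phi_zeta_single[of n k u] n assms
      by (auto simp: uk lookup_single when_def)
  qed
qed

text \<open>The motivic form of Euler's theorem that \<zeta>(2k) is a rational multiple of a power
  of \<pi>^2.\<close>

lemma phi_zeta_even:
  assumes "0 < k"
  shows "\<phi> (zeta_elt [2 * k]) = qscale (lookup (\<phi> (zeta_elt [2 * k])) ([], k)) (bas ([], k))"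
proof (rule poly_mapping_eqI)
  fix uj :: "nat list \<times> nat"
  obtain u j where uj: "uj = (u, j)" by (cases uj)
  show "lookup (\<phi> (zeta_elt [2 * k])) uj = lookup (qscale (lookup (\<phi> (zeta_elt [2 * k])) ([], k)) (bas ([], k))) uj"
  proof (cases "j = 0")
    case True
    then show ?thesis using assms zeta_coeff_eq_0[of "2 * k"]
      by (simp add: uj lookup_phi psi_zeta_single lookup_single when_def)
  next
    case False
    then show ?thesis using lookup_phi_zeta_single[of "2 * k" j u] assms
      by (auto simp: uj lookup_single when_def)
  qed
qed

lemma phi_nonzero_if_per: "per x \<noteq> 0 \<Longrightarrow> \<phi> x \<noteq> 0"
proof
  assume "per x \<noteq> 0" "\<phi> x = 0"
  moreover have "\<rho> (qscale 0 0) = of_rat 0 * \<rho> 0" by (rule rho_scale) (simp add: qvs.subspace_0[OF subspace_PM])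
  ultimately show False by (simp add: per_rho_phi)
qed

text \<open>If the coefficient vanished, so would the motivic period of this zeta value, and with it
  the positive real number \<zeta>(n).\<close>

lemma zeta_coeff_nonzero: "odd n \<Longrightarrow> 3 \<le> n \<Longrightarrow> zeta_coeff n \<noteq> 0"
  using phi_nonzero_if_per[OF per_zeta_single_nonzero[of n]] phi_zeta_odd[of n] by auto

lemma phi_zeta_even_nonzero: "0 < k \<Longrightarrow> lookup (\<phi> (zeta_elt [2 * k])) ([], k) \<noteq> 0"
  using phi_nonzero_if_per[OF per_zeta_single_nonzero[of "2 * k"]] phi_zeta_even[of k] by auto

section \<open>The motivic ideal as the kernel of \<phi>\<close>

lemma bas_f2_in_PM [simp]: "bas ([], k) \<in> PM"
  by (simp add: PM_iff)

lemma rho_f2_power: "\<rho> (bas ([], k)) = (pi\<^sup>2 / 6) ^ k"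
proof (induction k)
  case (Suc k)
  have "bas ([], Suc k) = PM_mult (bas ([], 1)) (bas ([], k))" by (simp add: PM_mult_def)
  then show ?case using rho_mult[of "bas ([], 1)" "bas ([], k)"] rho_f2 Suc by simp
qed (simp add: rho_one)

lemma kernel_phi_graded_ideal: "graded_ideal {x. \<phi> x = 0}"
  unfolding graded_ideal_def graded_subspace_def
proof (intro conjI ballI allI)
  show "qvs.subspace {x. \<phi> x = 0}" by (rule qvp.linear_subspace_kernel[OF phi_linear])
  show "homog_part length N x \<in> {x. \<phi> x = 0}" if "x \<in> {x. \<phi> x = 0}" for x N
    using that lin_ext_homog_part[OF phi_linear phi_weight] by simp
  show "y \<diamondop> x \<in> {x. \<phi> x = 0}" if "x \<in> {x. \<phi> x = 0}" for x y
    using that by (simp add: phi_mult qlinear_zero[OF qlinear_PM_mult_right])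
qed

text \<open>Write the coaction of \<open>x\<close> as a sum of basis words tensored with components.
  By equivariance \<phi> maps these components to those of the coaction of
  \<open>\<phi> x = 0\<close>.\<close>

lemma kernel_phi_coaction_stable: "coaction_stable \<psi> {x. \<phi> x = 0}"
  unfolding coaction_stable_def
proof safe
  fix x assume x: "\<phi> x = 0"
  let ?t = "coaction \<psi> x"
  let ?c = "\<lambda>l. contract_left (\<lambda>p. lookup p l) ?t"
  have "\<phi> (?c l) = 0" for l
    by (simp add: contract_left_coaction[OF qfunctional_lookup] x PM_coact_def qlinear_zero[OF qlinear_contract_left])
  moreover have "bas l \<in> OU" if "l \<in> fst ` keys ?t" for l
  proof -
    have "?t \<in> {t. keys t \<subseteq> lists {n. odd n \<and> 3 \<le> n} \<times> UNIV}"
      unfolding coaction_def tensor_map_def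
    proof (rule lin_ext_in_subspace[OF subspace_keys])
      fix kl :: "letter list \<times> letter list"
      show "(case kl of (k, l) \<Rightarrow> tensor (\<psi> (bas k)) (bas l)) \<in> {t. keys t \<subseteq> lists {n. odd n \<and> 3 \<le> n} \<times> UNIV}"
      proof (cases kl)
        case (Pair a b)
        have "keys (tensor (\<psi> (bas a)) (bas b)) \<subseteq> keys (\<psi> (bas a)) \<times> UNIV" by (auto simp: in_keys_iff)
        also have "\<dots> \<subseteq> lists {n. odd n \<and> 3 \<le> n} \<times> UNIV"
          by (rule Sigma_mono) (use psi_OU[of "bas a"] in \<open>simp_all add: OU_def\<close>)
        finally show ?thesis using Pair by simp
      qed
    qed
    then show ?thesis using that by (auto simp: OU_def)
  qed
  moreover have "?t = (\<Sum>l\<in>fst ` keys ?t. tensor (bas l) (?c l))"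
  proof (rule poly_mapping_eqI)
    fix lw :: "nat list \<times> letter list"
    obtain l w where lw: "lw = (l, w)" by (cases lw)
    have lk: "lookup (contract_left (\<lambda>p. lookup p l) t) w = lookup t (l, w)" for t :: "nat list \<times> letter list \<Rightarrow>\<^sub>0 rat"
      by (rule qfunctional_eqI[OF qfunctional_compose[OF qlinear_contract_left qfunctional_lookup] qfunctional_lookup])
         (auto simp: lookup_single when_def split: prod.splits if_splits)
    have "l \<notin> fst ` keys ?t \<Longrightarrow> lookup ?t (l, w) = 0" by (force simp: in_keys_iff)
    then show "lookup ?t lw = lookup (\<Sum>l\<in>fst ` keys ?t. tensor (bas l) (?c l)) lw"
      by (auto simp: lw lookup_sum lookup_single when_def lk if_distrib[of "\<lambda>x. x * _"] cong: if_cong)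
  qed
  ultimately show "?t \<in> qvs.span {tensor u x |u x. u \<in> OU \<and> x \<in> {x. \<phi> x = 0}}"
    by (subst \<open>?t = _\<close>) (intro qvs.span_sum qvs.span_base, blast)
qed

text \<open>If some homogeneous part had a nonzero image, contract its coaction with a longest word
  \<open>u\<close> of that image. Stability keeps the result in \<open>J\<close>, while its image
  shrinks to a nonzero multiple of a power of f_2, whose period is not zero.\<close>

lemma kernel_phi_maximal:
  assumes J: "graded_ideal J" "J \<subseteq> {x. per x = 0}" "coaction_stable \<psi> J" and x: "x \<in> J"
  shows "\<phi> x = 0"
proof -
  have sub: "qvs.subspace J" and hp: "\<And>N. homog_part length N x \<in> J"
    using J(1) x by (auto simp: graded_ideal_def graded_subspace_def)
  have "\<phi> (homog_part length N x) = 0" for N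
  proof (rule ccontr)
    let ?z = "\<phi> (homog_part length N x)"
    assume "?z \<noteq> 0"
    then have ne: "keys ?z \<noteq> {}" by simp
    let ?L = "(\<lambda>p. length (fst p)) ` keys ?z"
    have "Max ?L \<in> ?L" by (rule Max_in) (use ne in auto)
    then obtain p where p: "p \<in> keys ?z" "length (fst p) = Max ?L" by auto
    obtain u k where puk: "p = (u, k)" by (cases p)
    have uk: "(u, k) \<in> keys ?z" using p puk by simp
    have uk_max: "length v \<le> length u" if "(v, j) \<in> keys ?z" for v j
    proof -
      have "length v \<in> ?L" using that by (auto intro!: image_eqI[of _ _ "(v, j)"])
      then have "length v \<le> Max ?L" by (intro Max_ge) auto
      then show ?thesis using p(2) puk by simp
    qed
    let ?h = "\<lambda>p. lookup p u"
    let ?x = "contract_left ?h (coaction \<psi> (homog_part length N x))"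
    have "?x \<in> J"
    proof -
      have "coaction \<psi> (homog_part length N x) \<in> qvs.span {tensor u x |u x. u \<in> OU \<and> x \<in> J}"
        using J(3) hp unfolding coaction_stable_def by blast
      then show ?thesis
      proof (induction rule: qvs.span_induct_alt)
        case (step c a b)
        then obtain v y where "a = tensor v y" "y \<in> J" by auto
        then show ?case using step
          by (auto simp: qlinear_add[OF qlinear_contract_left] qlinear_scale[OF qlinear_contract_left]
              contract_left_tensor[OF qfunctional_lookup] intro!: qvs.subspace_add[OF sub] qvs.subspace_scale[OF sub])
      qed (simp add: qlinear_zero[OF qlinear_contract_left] qvs.subspace_0[OF sub])
    qed
    have look: "lookup (\<phi> ?x) (v, j) = lookup ?z (u @ v, j)" for v j
      by (simp add: contract_left_coaction[OF qfunctional_lookup] lookup_PM_coact_left)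
    have wt: "sum_list w + 2 * j = N" if "(w, j) \<in> keys ?z" for w j
      using phi_weight[OF homog_part_in_homog[of length N x]] that by (auto simp: homog_def PM_wt_def)
    \<comment> \<open>Maximality of \<open>u\<close> removes all longer words, and homogeneity fixes
      the power of f_2.\<close>
    have "\<phi> ?x = qscale (lookup ?z (u, k)) (bas ([], k))"
    proof (rule poly_mapping_eqI)
      fix vj :: "nat list \<times> nat"
      obtain v j where vj: "vj = (v, j)" by (cases vj)
      show "lookup (\<phi> ?x) vj = lookup (qscale (lookup ?z (u, k)) (bas ([], k))) vj"
      proof (cases "(u @ v, j) \<in> keys ?z")
        case True
        then have "v = []" using uk_max[of "u @ v"] by fastforce
        moreover have "j = k" using wt[OF True] wt[OF uk] \<open>v = []\<close> by simp
        ultimately show ?thesis by (simp add: vj look)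
      next
        case False
        then have "lookup ?z (u @ v, j) = 0" by (simp add: in_keys_iff)
        moreover have "\<not> (v = [] \<and> j = k)" using False uk by auto
        ultimately show ?thesis by (auto simp: vj look lookup_single when_def)
      qed
    qed
    then have "per ?x = of_rat (lookup ?z (u, k)) * (pi\<^sup>2 / 6) ^ k"
      by (simp add: per_rho_phi rho_scale rho_f2_power)
    moreover have "per ?x = 0" using \<open>?x \<in> J\<close> J(2) by auto
    ultimately show False using uk by (simp add: in_keys_iff)
  qed
  then show ?thesis by (subst sum_homog_part[of x length]) (simp add: phi_sum)
qed

lemma motivic_ideal_eq: "motivic_ideal \<psi> = {x. \<phi> x = 0}"
  unfolding motivic_ideal_def
proof (rule Greatest_equality)
  show "graded_ideal {x. \<phi> x = 0} \<and> {x. \<phi> x = 0} \<subseteq> {x. per x = 0} \<and> coaction_stable \<psi> {x. \<phi> x = 0}"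
    using kernel_phi_graded_ideal kernel_phi_coaction_stable phi_nonzero_if_per by blast
qed (use kernel_phi_maximal in blast)

subsection \<open>The depth filtrations\<close>

lemma subspace_phi_depth: "qvs.subspace (\<phi> ` depth_words r)"
  and subspace_psi_depth: "qvs.subspace (\<psi> ` depth_words r)"
  by (rule subspace_image_qlinear[OF phi_linear subspace_depth_words],
      rule subspace_image_qlinear[OF psi_linear subspace_depth_words])

text \<open>A word with leading e^0 is a combination of zeta words of no greater depth and of
  multiples of e^0, which \<phi> kills. So all words may replace the zeta words, and the filtration
  of \<H> is seen in the range of \<phi>.\<close>

lemma depth_H_eq: "depth_H \<psi> r = {x. \<phi> x \<in> \<phi> ` depth_words r}"
proof (intro equalityI)
  have "qvs.subspace {x. \<phi> x \<in> \<phi> ` depth_words r}"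
    by (rule qvp.linear_subspace_linear_preimage[OF phi_linear subspace_phi_depth])
  then show "depth_H \<psi> r \<subseteq> {x. \<phi> x \<in> \<phi> ` depth_words r}"
    unfolding depth_H_def motivic_ideal_eq
    by (intro qvs.span_minimal) (auto simp: zeta_elt_def count_zeta_elt[simplified] qvs.subspace_0[OF subspace_phi_depth])
  show "{x. \<phi> x \<in> \<phi> ` depth_words r} \<subseteq> depth_H \<psi> r"
  proof safe
    fix x y assume y: "\<phi> x = \<phi> y" "y \<in> depth_words r"
    have "x - y \<in> depth_H \<psi> r"
      unfolding depth_H_def motivic_ideal_eq
      by (rule qvs.span_base) (use y qlinear_diff[OF phi_linear] in auto)
    moreover have "y \<in> depth_H \<psi> r"
    proof -
      have "bas w \<in> depth_H \<psi> r" if "count_list w E1 \<le> r" for w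
      proof -
        have "{zeta_elt ns |ns. length ns \<le> count_list w E1 \<and> (\<forall>n\<in>set ns. 1 \<le> n)} \<union> {bas [E0] \<diamondop> x |x. True}
          \<subseteq> {zeta_elt ns |ns. length ns \<le> r \<and> (\<forall>n\<in>set ns. 1 \<le> n)} \<union> {x. \<phi> x = 0}"
          using that phi_shuffle_E0 by fastforce
        from subsetD[OF qvs.span_mono[OF this] word_mod_E0] show ?thesis
          unfolding depth_H_def motivic_ideal_eq .
      qed
      then have "qvs.span (bas ` {w. count_list w E1 \<le> r}) \<subseteq> depth_H \<psi> r"
        unfolding depth_H_def by (intro qvs.span_minimal) auto
      then show ?thesis using y(2) by (auto simp: depth_words_eq_span)
    qed
    ultimately have "(x - y) + y \<in> depth_H \<psi> r"
      unfolding depth_H_def by (rule qvs.span_add)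
    then show "x \<in> depth_H \<psi> r" by simp
  qed
qed

lemma coeff_f2_phi_depth':
  assumes "x \<in> depth_words r" "0 < k"
  shows "coeff_f2 k (\<phi> x) \<in> (if r = 0 then {0} else \<psi> ` depth_words (r - 1))"
proof (cases "r = 0")
  case True
  then have "\<phi> x \<in> \<phi> ` depth_words 0" using assms by auto
  then obtain c where c: "\<phi> x = qscale c (bas ([], 0))" unfolding phi_depth_0 by auto
  have "coeff_f2 k (\<phi> x) = 0"
    unfolding c by (rule poly_mapping_eqI) (use assms(2) in \<open>simp add: lookup_single when_def\<close>)
  then show ?thesis using True by simp
qed (use coeff_f2_phi_depth assms in auto)

lemma times_f2_zero [simp]: "times_f2 k 0 = 0"
  by (rule qlinear_zero[OF qlinear_times_f2])

lemma phi_expand: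
  assumes "finite K" "0 \<in> K" "snd ` keys (\<phi> x) \<subseteq> K"
  shows "\<phi> x = times_f2 0 (\<psi> x) + (\<Sum>k\<in>K - {0}. times_f2 k (coeff_f2 k (\<phi> x)))"
  using sum_times_f2[OF assms(1,3)] assms(1,2) by (simp add: sum.remove coeff_f2_0_phi)

text \<open>Multiplying \<open>x\<close> by \<zeta>(2k), of depth one, gives a multiple of
  \<open>f\<^sub>2\<^sup>k \<psi> x\<close> plus terms with further powers of f_2. \<open>H\<close>
  disposes of the latter; their coefficients have smaller depth, so \<open>H\<close> will come from
  an induction hypothesis.\<close>

lemma phi_depth_times_f2_step:
  assumes x: "x \<in> depth_words r" and H: "\<And>i j. 0 < j \<Longrightarrow> times_f2 (i + j) (coeff_f2 j (\<phi> x)) \<in> \<phi> ` depth_words r"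
  shows "times_f2 0 (\<psi> x) \<in> \<phi> ` depth_words r" and "0 < k \<Longrightarrow> times_f2 k (\<psi> x) \<in> \<phi> ` depth_words (Suc r)"
proof -
  let ?K = "insert 0 (snd ` keys (\<phi> x))"
  have phi: "\<phi> x = times_f2 0 (\<psi> x) + (\<Sum>j\<in>?K - {0}. times_f2 j (coeff_f2 j (\<phi> x)))"
    by (rule phi_expand) auto
  have "(\<Sum>j\<in>?K - {0}. times_f2 j (coeff_f2 j (\<phi> x))) \<in> \<phi> ` depth_words r"
    by (rule qvs.subspace_sum[OF subspace_phi_depth]) (use H[of _ 0] in auto)
  moreover have "times_f2 0 (\<psi> x) = \<phi> x - (\<Sum>j\<in>?K - {0}. times_f2 j (coeff_f2 j (\<phi> x)))"
    by (rule eq_diff_eq[THEN iffD2], rule phi[symmetric])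
  moreover have "\<phi> x \<in> \<phi> ` depth_words r" using x by (rule imageI)
  ultimately show "times_f2 0 (\<psi> x) \<in> \<phi> ` depth_words r"
    by (simp only: qvs.subspace_diff[OF subspace_phi_depth])
  assume k: "0 < k"
  define d where "d = lookup (\<phi> (zeta_elt [2 * k])) ([], k)"
  have d: "d \<noteq> 0" unfolding d_def by (rule phi_zeta_even_nonzero[OF k])
  have "\<phi> (zeta_elt [2 * k] \<diamondop> x) = qscale d (PM_mult (bas ([], k)) (\<phi> x))"
    unfolding phi_mult by (subst phi_zeta_even[OF k]) (simp add: d_def qlinear_scale[OF qlinear_PM_mult_left])
  also have "PM_mult (bas ([], k)) (\<phi> x) = times_f2 k (\<psi> x) + (\<Sum>j\<in>?K - {0}. times_f2 (k + j) (coeff_f2 j (\<phi> x)))"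
    by (subst phi) (simp add: qlinear_add[OF qlinear_PM_mult_right] qlinear_sum[OF qlinear_PM_mult_right] PM_mult_f2_power)
  finally have eq: "times_f2 k (\<psi> x) = qscale (1 / d) (\<phi> (zeta_elt [2 * k] \<diamondop> x)) -
      (\<Sum>j\<in>?K - {0}. times_f2 (k + j) (coeff_f2 j (\<phi> x)))"
    using d by simp
  have "zeta_elt [2 * k] \<diamondop> x \<in> depth_words (Suc r)"
    using shuffle_in_depth_words[OF zeta_single_in_depth x] by simp
  moreover have "(\<Sum>j\<in>?K - {0}. times_f2 (k + j) (coeff_f2 j (\<phi> x))) \<in> \<phi> ` depth_words (Suc r)"
  proof (rule qvs.subspace_sum[OF subspace_phi_depth])
    fix j assume "j \<in> ?K - {0}"
    then have "times_f2 (k + j) (coeff_f2 j (\<phi> x)) \<in> \<phi> ` depth_words r" by (intro H) auto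
    then show "times_f2 (k + j) (coeff_f2 j (\<phi> x)) \<in> \<phi> ` depth_words (Suc r)"
      using depth_words_mono[of r "Suc r"] by auto
  qed
  ultimately show "times_f2 k (\<psi> x) \<in> \<phi> ` depth_words (Suc r)"
    unfolding eq by (intro qvs.subspace_diff[OF subspace_phi_depth] qvs.subspace_scale[OF subspace_phi_depth]) auto
qed

lemma phi_depth_times_f2:
  assumes "y \<in> \<psi> ` depth_words r"
  shows "times_f2 0 y \<in> \<phi> ` depth_words r" and "0 < k \<Longrightarrow> times_f2 k y \<in> \<phi> ` depth_words (Suc r)"
proof -
  have "times_f2 0 y \<in> \<phi> ` depth_words r \<and> (\<forall>k>0. times_f2 k y \<in> \<phi> ` depth_words (Suc r))"
    using assms
  proof (induction r arbitrary: y)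
    case (0 y)
    then obtain x where x: "x \<in> depth_words 0" "y = \<psi> x" by auto
    have "times_f2 (i + j) (coeff_f2 j (\<phi> x)) \<in> \<phi> ` depth_words 0" if "0 < j" for i j
      using coeff_f2_phi_depth'[OF x(1) that] by (simp add: qvs.subspace_0[OF subspace_phi_depth])
    then show ?case using phi_depth_times_f2_step[OF x(1)] x(2) by blast
  next
    case (Suc r y)
    then obtain x where x: "x \<in> depth_words (Suc r)" "y = \<psi> x" by auto
    have "times_f2 (i + j) (coeff_f2 j (\<phi> x)) \<in> \<phi> ` depth_words (Suc r)" if "0 < j" for i j
    proof -
      have "coeff_f2 j (\<phi> x) \<in> \<psi> ` depth_words r" using coeff_f2_phi_depth'[OF x(1) that] by simp
      then show ?thesis using Suc.IH that by auto
    qed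
    then show ?case using phi_depth_times_f2_step[OF x(1)] x(2) by blast
  qed
  then show "times_f2 0 y \<in> \<phi> ` depth_words r" "0 < k \<Longrightarrow> times_f2 k y \<in> \<phi> ` depth_words (Suc r)" by auto
qed

text \<open>This is \<H> = \<A> \<otimes> \<rat>[f_2] as a filtered space: a positive power of f_2
  has depth one, whatever its exponent. The case \<open>r = 0\<close> is separate because
  \<open>r - 1\<close> truncates.\<close>

lemma phi_depth_iff:
  "z \<in> \<phi> ` depth_words r \<longleftrightarrow> coeff_f2 0 z \<in> \<psi> ` depth_words r \<and>
     (\<forall>k>0. coeff_f2 k z \<in> (if r = 0 then {0} else \<psi> ` depth_words (r - 1)))"
proof
  assume "z \<in> \<phi> ` depth_words r"
  then show "coeff_f2 0 z \<in> \<psi> ` depth_words r \<and>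
     (\<forall>k>0. coeff_f2 k z \<in> (if r = 0 then {0} else \<psi> ` depth_words (r - 1)))"
    using coeff_f2_phi_depth' coeff_f2_0_phi by (metis image_iff)
next
  assume z: "coeff_f2 0 z \<in> \<psi> ` depth_words r \<and>
     (\<forall>k>0. coeff_f2 k z \<in> (if r = 0 then {0} else \<psi> ` depth_words (r - 1)))"
  have "times_f2 k (coeff_f2 k z) \<in> \<phi> ` depth_words r" for k
  proof (cases "k = 0")
    case True
    then show ?thesis using phi_depth_times_f2(1) z by simp
  next
    case False
    then show ?thesis
      using phi_depth_times_f2(2)[of "coeff_f2 k z" "r - 1" k] z qvs.subspace_0[OF subspace_phi_depth]
      by (cases "r = 0") auto
  qed
  then show "z \<in> \<phi> ` depth_words r"
    by (subst sum_times_f2[of "snd ` keys z" z]) (auto intro!: qvs.subspace_sum[OF subspace_phi_depth])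
qed

lemma in_depth_words: "\<exists>r. x \<in> depth_words r"
proof
  show "x \<in> depth_words (Max ((\<lambda>w. count_list w E1) ` keys x))"
    by (auto simp: depth_words_def)
qed

text \<open>If \<open>\<psi> x = 0\<close>, every term of \<open>\<phi> x\<close> has a factor f_2.
  Lowering its exponent by one stays in the range of \<phi>, and \<zeta>(2) restores the factor up
  to a scalar.\<close>

lemma ideal_A_eq: "ideal_A \<psi> = {x. \<psi> x = 0}"
proof (intro equalityI)
  have 0: "\<psi> (zeta_elt [2]) = 0"
    using psi_zeta_single[of 2] zeta_coeff_eq_0[of 2] by simp
  show "ideal_A \<psi> \<subseteq> {x. \<psi> x = 0}"
    unfolding ideal_A_def motivic_ideal_eq
  proof (rule qvs.span_minimal)
    show "{x. \<phi> x = 0} \<union> {zeta_elt [2] \<diamondop> x |x. True} \<subseteq> {x. \<psi> x = 0}"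
      using psi_eq_0_if_phi 0 by (auto simp: psi_mult)
    show "qvs.subspace {x. \<psi> x = 0}" by (rule qvp.linear_subspace_kernel[OF psi_linear])
  qed
  show "{x. \<psi> x = 0} \<subseteq> ideal_A \<psi>"
  proof safe
    fix x assume x: "\<psi> x = 0"
    define d where "d = lookup (\<phi> (zeta_elt [2 * 1])) ([], 1)"
    have d: "d \<noteq> 0" unfolding d_def by (rule phi_zeta_even_nonzero) simp
    obtain r where r: "x \<in> depth_words r" using in_depth_words by blast
    let ?K = "insert 0 (snd ` keys (\<phi> x))"
    have phi: "\<phi> x = (\<Sum>j\<in>?K - {0}. times_f2 j (coeff_f2 j (\<phi> x)))"
      using phi_expand[of ?K x] x by (simp add: subset_insertI)
    have "\<exists>y. times_f2 j (coeff_f2 j (\<phi> x)) = \<phi> (zeta_elt [2] \<diamondop> y)" if j: "0 < j" for j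
    proof -
      have "coeff_f2 j (\<phi> x) \<in> \<psi> ` depth_words r"
        using coeff_f2_phi_depth'[OF r j] qvs.subspace_0[OF subspace_psi_depth] depth_words_mono[of "r - 1" r]
        by (auto split: if_splits)
      then have "times_f2 (j - 1) (coeff_f2 j (\<phi> x)) \<in> range \<phi>"
        using phi_depth_times_f2(1)[of "coeff_f2 j (\<phi> x)" r] phi_depth_times_f2(2)[of "coeff_f2 j (\<phi> x)" r "j - 1"]
        by (cases "j - 1 = 0") (simp_all, blast+)
      then obtain y where y: "times_f2 (j - 1) (coeff_f2 j (\<phi> x)) = \<phi> y" by auto
      have "\<phi> (zeta_elt [2 * 1] \<diamondop> y) = qscale d (times_f2 j (coeff_f2 j (\<phi> x)))"
        unfolding phi_mult y[symmetric] using j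
        by (subst phi_zeta_even) (simp_all add: d_def qlinear_scale[OF qlinear_PM_mult_left] PM_mult_f2_power)
      then have "times_f2 j (coeff_f2 j (\<phi> x)) = \<phi> (zeta_elt [2] \<diamondop> qscale (1 / d) y)"
        using d by (simp add: qlinear_scale[OF qlinear_shuffle_right] phi_scale)
      then show ?thesis by blast
    qed
    then obtain y where y: "\<And>j. 0 < j \<Longrightarrow> times_f2 j (coeff_f2 j (\<phi> x)) = \<phi> (zeta_elt [2] \<diamondop> y j)" by metis
    let ?s = "\<Sum>j\<in>?K - {0}. zeta_elt [2] \<diamondop> y j"
    have "\<phi> x = \<phi> ?s" by (subst phi) (simp add: phi_sum y)
    then have "x - ?s \<in> ideal_A \<psi>"
      unfolding ideal_A_def motivic_ideal_eq by (intro qvs.span_base) (simp add: qlinear_diff[OF phi_linear])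
    moreover have "?s \<in> ideal_A \<psi>"
      unfolding ideal_A_def by (intro qvs.span_sum qvs.span_base) auto
    ultimately have "(x - ?s) + ?s \<in> ideal_A \<psi>" unfolding ideal_A_def by (rule qvs.span_add)
    then show "x \<in> ideal_A \<psi>" by simp
  qed
qed

lemma depth_A_eq: "depth_A \<psi> r = {x. \<psi> x \<in> \<psi> ` depth_words r}"
proof (intro equalityI)
  have H: "depth_words r \<subseteq> depth_H \<psi> r" by (auto simp: depth_H_eq)
  show "depth_A \<psi> r \<subseteq> {x. \<psi> x \<in> \<psi> ` depth_words r}"
    unfolding depth_A_def
  proof (rule qvs.span_minimal)
    show "qvs.subspace {x. \<psi> x \<in> \<psi> ` depth_words r}"
      by (rule qvp.linear_subspace_linear_preimage[OF psi_linear subspace_psi_depth])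
    show "depth_H \<psi> r \<union> ideal_A \<psi> \<subseteq> {x. \<psi> x \<in> \<psi> ` depth_words r}"
      using coeff_f2_0_phi qvs.subspace_0[OF subspace_psi_depth] unfolding depth_H_eq ideal_A_eq
      by (auto simp: image_iff) metis
  qed
  show "{x. \<psi> x \<in> \<psi> ` depth_words r} \<subseteq> depth_A \<psi> r"
  proof safe
    fix x y assume xy: "\<psi> x = \<psi> y" "y \<in> depth_words r"
    have "x - y \<in> depth_A \<psi> r" unfolding depth_A_def
      by (rule qvs.span_base) (use xy in \<open>simp add: ideal_A_eq qlinear_diff[OF psi_linear]\<close>)
    moreover have "y \<in> depth_A \<psi> r" unfolding depth_A_def
      by (rule qvs.span_base) (use xy H in auto)
    ultimately have "(x - y) + y \<in> depth_A \<psi> r" unfolding depth_A_def by (rule qvs.span_add)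
    then show "x \<in> depth_A \<psi> r" by simp
  qed
qed

end

subsection \<open>Dimensions of the graded pieces\<close>

lemma graded_subspace_preimage:
  assumes "qlinear f" "\<And>N x. x \<in> homog w N \<Longrightarrow> f x \<in> homog w' N" "graded_subspace w' V"
  shows "graded_subspace w {x. f x \<in> V}"
  unfolding graded_subspace_def
proof (intro conjI ballI allI)
  show "qvs.subspace {x. f x \<in> V}"
    by (rule qvp.linear_subspace_linear_preimage[OF assms(1) graded_subspaceD(1)[OF assms(3)]])
  show "homog_part w N x \<in> {x. f x \<in> V}" if "x \<in> {x. f x \<in> V}" for x N
    using that lin_ext_homog_part[OF assms(1,2)] graded_subspaceD(2)[OF assms(3)] by simp
qed

lemma graded_subspace_image:
  assumes "qlinear f" "\<And>N x. x \<in> homog w N \<Longrightarrow> f x \<in> homog w' N" "graded_subspace w V"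
  shows "graded_subspace w' (f ` V)"
  unfolding graded_subspace_def
proof (intro conjI ballI allI)
  show "qvs.subspace (f ` V)" by (rule subspace_image_qlinear[OF assms(1) graded_subspaceD(1)[OF assms(3)]])
  show "homog_part w' N y \<in> f ` V" if "y \<in> f ` V" for y N
    using that lin_ext_homog_part[OF assms(1,2)] graded_subspaceD(2)[OF assms(3)] by (metis image_iff)
qed

lemma dim_graded_preimage:
  assumes f: "qlinear f" "\<And>N x. x \<in> homog w N \<Longrightarrow> f x \<in> homog w' N"
    and V: "qvs.subspace V" "V \<subseteq> range f" and fin: "finite {k. w k = N}"
  shows "qvs.dim ({x. f x \<in> V} \<inter> homog w N) = qvs.dim (V \<inter> homog w' N) + qvs.dim ({x. f x = 0} \<inter> homog w N)"
proof -
  let ?U = "{x. f x \<in> V} \<inter> homog w N"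
  have "qvs.dim ?U = qvs.dim (f ` ?U) + qvs.dim {x \<in> ?U. f x = 0}"
  proof (rule qvp.rank_nullity[OF f(1)])
    show "qvs.subspace ?U"
      by (rule qvs.subspace_inter[OF qvp.linear_subspace_linear_preimage[OF f(1) V(1)] subspace_homog])
    show "?U \<subseteq> qvs.span (bas ` {k. w k = N})" by (auto simp: homog_eq_span)
  qed (use fin in auto)
  also have "f ` ?U = V \<inter> homog w' N"
  proof (intro equalityI subsetI)
    fix y assume y: "y \<in> V \<inter> homog w' N"
    then obtain x where x: "y = f x" using V(2) by auto
    have "y = f (homog_part w N x)"
      using lin_ext_homog_part[OF f] y homog_part_homog[of y w' N N] x by simp
    then show "y \<in> f ` ?U" using y by (intro image_eqI[of _ _ "homog_part w N x"]) auto
  qed (use f in auto)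
  also have "{x \<in> ?U. f x = 0} = {x. f x = 0} \<inter> homog w N"
    using qvs.subspace_0[OF V(1)] by auto
  finally show ?thesis .
qed

lemma finite_letter_words: "finite {w :: letter list. length w = N}"
proof -
  have "finite (UNIV :: letter set)"
    by (rule finite_subset[of _ "{E0, E1}"]) (use letter.exhaust in auto)
  from finite_lists_length_eq[OF this, of N] show ?thesis by simp
qed

definition odd_words :: "nat \<Rightarrow> nat list set" where
  "odd_words N = {w \<in> lists {n. odd n \<and> 3 \<le> n}. sum_list w = N}"

lemma finite_odd_words: "finite (odd_words N)"
proof (rule finite_subset)
  have "length w \<le> N \<and> set w \<subseteq> {..N}" if "w \<in> odd_words N" for w
  proof
    show "length w \<le> N" using that OU_word_weight[of w] by (auto simp: odd_words_def)
    show "set w \<subseteq> {..N}" using that member_le_sum_list[of _ w] by (auto simp: odd_words_def)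
  qed
  then show "odd_words N \<subseteq> {w. set w \<subseteq> {..N} \<and> length w \<le> N}" by auto
qed (rule finite_lists_length_le, simp)

lemma OU_Int_homog: "OU \<inter> homog sum_list N = {p. keys p \<subseteq> odd_words N}"
  by (auto simp: OU_def homog_def odd_words_def)

lemma keys_Int_homog: "{p. keys p \<subseteq> K} \<inter> homog w N = {p. keys p \<subseteq> {k \<in> K. w k = N}}"
  by (auto simp: homog_def)

lemma graded_depth_words: "graded_subspace length (depth_words r)"
  unfolding depth_words_eq_span by (rule graded_subspace_span) auto

lemma depth_words_Int_homog: "N \<le> r \<Longrightarrow> homog length N \<subseteq> depth_words r"
  using count_le_length by (fastforce simp: homog_def depth_words_def intro: order_trans)

context mixed_tate_Z
begin

text \<open>The filtered piece of \<A>, not the graded one, realised in the range of \<psi>, where a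
  weight space is spanned by finitely many words.\<close>

definition dim_A :: "nat \<Rightarrow> nat \<Rightarrow> nat" where
  "dim_A r N = qvs.dim (\<psi> ` depth_words r \<inter> homog sum_list N)"

lemma graded_psi_depth: "graded_subspace sum_list (\<psi> ` depth_words r)"
  by (rule graded_subspace_image[OF psi_linear psi_weight graded_depth_words])

lemma psi_depth_subset: "\<psi> ` depth_words r \<inter> homog sum_list N \<subseteq> {p. keys p \<subseteq> odd_words N}"
  using psi_OU OU_Int_homog by blast

lemma psi_depth_span: "\<psi> ` depth_words r \<inter> homog sum_list N \<subseteq> qvs.span (bas ` odd_words N)"
  using psi_depth_subset by (simp add: span_bas)

lemma dim_A_mono: "r \<le> s \<Longrightarrow> dim_A r N \<le> dim_A s N"
  unfolding dim_A_def
  by (rule qvs.dim_mono_in_span[OF _ psi_depth_span])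
     (use depth_words_mono[of r s] finite_odd_words in auto)

lemma graded_subquot_gr_A: "graded_subquot (gr_A \<psi> r)"
proof -
  have 0: "graded_subspace length {x. \<psi> x = 0}"
    using graded_subspace_preimage[OF psi_linear psi_weight, where V = "{0}"] by (simp add: graded_subspace_def)
  have 1: "graded_subspace length (depth_A \<psi> r)" for r
    unfolding depth_A_eq by (rule graded_subspace_preimage[OF psi_linear psi_weight graded_psi_depth])
  have "{x. \<psi> x = 0} \<subseteq> depth_A \<psi> 0" "depth_A \<psi> (r - 1) \<subseteq> depth_A \<psi> r" for r
    using qvs.subspace_0[OF subspace_psi_depth, of 0] image_mono[OF depth_words_mono[of "r - 1" r], of \<psi>]
    by (auto simp: depth_A_eq)
  then show ?thesis
    unfolding graded_subquot_def gr_A_def using 0 1 finite_letter_words by (simp add: ideal_A_eq)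
qed

lemma dim_depth_A:
  "qvs.dim (depth_A \<psi> r \<inter> homog length N) = dim_A r N + qvs.dim ({x. \<psi> x = 0} \<inter> homog length N)"
  unfolding depth_A_eq dim_A_def
  by (rule dim_graded_preimage[OF psi_linear psi_weight subspace_psi_depth _ finite_letter_words]) auto

text \<open>The kernel of \<psi> lies in numerator and denominator, and its dimension
  cancels.\<close>

lemma wt_dim_gr_A: "wt_dim (gr_A \<psi> r) N = dim_A r N - (if r = 0 then 0 else dim_A (r - 1) N)"
  by (simp add: wt_dim_def gr_A_def dim_depth_A ideal_A_eq)

lemma dim_A_eq_sum: "dim_A R N = (\<Sum>r\<le>R. wt_dim (gr_A \<psi> r) N)"
proof (induction R)
  case (Suc R)
  then show ?case using dim_A_mono[of R "Suc R" N] by (simp add: wt_dim_gr_A)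
qed (simp add: wt_dim_gr_A)

text \<open>A word of length \<open>N\<close> has at most \<open>N\<close> letters e^1, so the depth
  filtration is exhausted there.\<close>

lemma psi_depth_total: "N \<le> r \<Longrightarrow> \<psi> ` depth_words r \<inter> homog sum_list N = range \<psi> \<inter> homog sum_list N"
proof (intro equalityI subsetI)
  fix y assume r: "N \<le> r" and y: "y \<in> range \<psi> \<inter> homog sum_list N"
  then obtain x where "y = \<psi> x" by auto
  then have "y = \<psi> (homog_part length N x)"
    using lin_ext_homog_part[OF psi_linear psi_weight] homog_part_homog[of y sum_list N N] y by simp
  then show "y \<in> \<psi> ` depth_words r \<inter> homog sum_list N"
    using depth_words_Int_homog[OF r] homog_part_in_homog y by blast
qed auto

lemma gr_A_eq_0: "N < r \<Longrightarrow> wt_dim (gr_A \<psi> r) N = 0"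
  using psi_depth_total[of N r] psi_depth_total[of N "r - 1"] by (simp add: wt_dim_gr_A dim_A_def)

lemma psi_depth_1: "\<psi> ` depth_words 1 = {p. keys p \<subseteq> {u \<in> lists {n. odd n \<and> 3 \<le> n}. length u \<le> 1}}"
proof (intro equalityI subsetI)
  fix p assume "p \<in> \<psi> ` depth_words 1"
  then show "p \<in> {p. keys p \<subseteq> {u \<in> lists {n. odd n \<and> 3 \<le> n}. length u \<le> 1}}"
    using psi_OU psi_depth_length by (fastforce simp: OU_def)
next
  fix p :: "nat list \<Rightarrow>\<^sub>0 rat"
  assume p: "p \<in> {p. keys p \<subseteq> {u \<in> lists {n. odd n \<and> 3 \<le> n}. length u \<le> 1}}"
  have "bas u \<in> \<psi> ` depth_words 1" if "u \<in> keys p" for u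
  proof -
    have u: "u \<in> lists {n. odd n \<and> 3 \<le> n}" "length u \<le> 1" using p that by auto
    show ?thesis
    proof (cases u)
      case Nil
      then show ?thesis using psi_one by (intro image_eqI[of _ _ "bas []"]) auto
    next
      case (Cons n v)
      then have un: "u = [n]" "odd n" "3 \<le> n" using u by auto
      then have "bas u = \<psi> (qscale (1 / zeta_coeff n) (zeta_elt [n]))"
        using psi_zeta_single[of n] zeta_coeff_nonzero[of n] by (simp add: psi_scale)
      then show ?thesis
        by (rule image_eqI) (rule qvs.subspace_scale[OF subspace_depth_words zeta_single_in_depth])
    qed
  qed
  then have "lin_ext bas p \<in> \<psi> ` depth_words 1" by (rule lin_ext_in_subspace[OF subspace_psi_depth])
  then show "p \<in> \<psi> ` depth_words 1" by (simp add: lin_ext_bas_self)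
qed

lemma dim_A_0: "dim_A 0 N = (if N = 0 then 1 else 0)"
proof -
  have "\<psi> ` depth_words 0 = {p. keys p \<subseteq> {[]}}"
    unfolding psi_depth_0 span_bas[of "{[]}", symmetric] by (simp add: qvs.span_singleton)
  then have "\<psi> ` depth_words 0 \<inter> homog sum_list N = {p. keys p \<subseteq> {k \<in> {[]}. sum_list k = N}}"
    by (simp only: keys_Int_homog)
  moreover have "{k \<in> {[]}. sum_list k = N} = (if N = 0 then {[]} else {})" by auto
  ultimately show ?thesis unfolding dim_A_def by (simp add: dim_keys del: subset_empty subset_singleton_iff)
qed

lemma dim_A_1: "dim_A 1 N = (if N = 0 then 1 else 0) + (if odd N \<and> 3 \<le> N then 1 else 0)"
proof -
  have "\<psi> ` depth_words 1 \<inter> homog sum_list N =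
      {p. keys p \<subseteq> {u \<in> {u \<in> lists {n. odd n \<and> 3 \<le> n}. length u \<le> 1}. sum_list u = N}}"
    unfolding psi_depth_1 keys_Int_homog ..
  also have "{u \<in> {u \<in> lists {n. odd n \<and> 3 \<le> n}. length u \<le> 1}. sum_list u = N} =
      (if N = 0 then {[]} else {}) \<union> (if odd N \<and> 3 \<le> N then {[N]} else {})"
    by (auto simp: le_Suc_eq length_Suc_conv)
  finally show ?thesis unfolding dim_A_def by (simp add: dim_keys del: subset_empty subset_singleton_iff subset_insert_iff)
qed

lemma wt_dim_gr_A_0: "wt_dim (gr_A \<psi> 0) N = (if N = 0 then 1 else 0)"
  by (simp add: wt_dim_gr_A dim_A_0)

lemma wt_dim_gr_A_1: "wt_dim (gr_A \<psi> 1) N = (if odd N \<and> 3 \<le> N then 1 else 0)"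
  unfolding wt_dim_gr_A dim_A_1 by (simp add: dim_A_0)

text \<open>The single zeta values of even weight and of weight one vanish in \<A>, so the remaining
  ones already span depth one modulo depth zero.\<close>

lemma gr1_A_odd_eq: "gr1_A_odd \<psi> = gr_A \<psi> 1"
proof -
  have "qvs.span ({zeta_elt [n] |n. 3 \<le> n \<and> odd n} \<union> depth_A \<psi> 0) = depth_A \<psi> 1"
  proof (intro equalityI)
    have "depth_A \<psi> 0 \<subseteq> depth_A \<psi> 1"
      using image_mono[OF depth_words_mono[of 0 1], of \<psi>] by (auto simp: depth_A_eq)
    then show "qvs.span ({zeta_elt [n] |n. 3 \<le> n \<and> odd n} \<union> depth_A \<psi> 0) \<subseteq> depth_A \<psi> 1"
      by (intro qvs.span_minimal) (auto simp: depth_A_eq zeta_single_in_depth[simplified]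
          intro: qvp.linear_subspace_linear_preimage[OF psi_linear subspace_psi_depth])
    show "depth_A \<psi> 1 \<subseteq> qvs.span ({zeta_elt [n] |n. 3 \<le> n \<and> odd n} \<union> depth_A \<psi> 0)"
    proof
      let ?V = "qvs.span ({zeta_elt [n] |n. 3 \<le> n \<and> odd n} \<union> depth_A \<psi> 0)"
      fix x assume "x \<in> depth_A \<psi> 1"
      then have x: "keys (\<psi> x) \<subseteq> {u \<in> lists {n. odd n \<and> 3 \<le> n}. length u \<le> 1}"
        unfolding depth_A_eq psi_depth_1 by auto
      have "\<psi> x \<in> \<psi> ` ?V"
      proof -
        have sub: "qvs.subspace (\<psi> ` ?V)" by (rule subspace_image_qlinear[OF psi_linear]) simp
        have "bas u \<in> \<psi> ` ?V" if "u \<in> keys (\<psi> x)" for u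
        proof (cases u)
          case Nil
          have "bas [] \<in> depth_A \<psi> 0" by (simp add: depth_A_eq)
          then show ?thesis using Nil psi_one by (intro image_eqI[of _ _ "bas []"]) (auto intro: qvs.span_base)
        next
          case (Cons n v)
          then have un: "u = [n]" "odd n" "3 \<le> n" using x that by auto
          then have "bas u = \<psi> (qscale (1 / zeta_coeff n) (zeta_elt [n]))"
            using psi_zeta_single[of n] zeta_coeff_nonzero[of n] by (simp add: psi_scale)
          then show ?thesis
            by (rule image_eqI) (use un in \<open>blast intro: qvs.span_scale qvs.span_base\<close>)
        qed
        then have "lin_ext bas (\<psi> x) \<in> \<psi> ` ?V" by (rule lin_ext_in_subspace[OF sub])
        then show ?thesis by (simp add: lin_ext_bas_self)
      qed
      then obtain v where v: "v \<in> ?V" "\<psi> x = \<psi> v" by auto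
      have "x - v \<in> depth_A \<psi> 0"
        using v(2) qvs.subspace_0[OF subspace_psi_depth] by (simp add: depth_A_eq qlinear_diff[OF psi_linear])
      then have "(x - v) + v \<in> ?V" by (intro qvs.span_add v(1) qvs.span_base) auto
      then show "x \<in> ?V" by simp
    qed
  qed
  then show ?thesis by (simp add: gr1_A_odd_def gr_A_def)
qed

subsection \<open>From \<open>\<A>\<close> to \<open>\<H>\<close>\<close>

definition dim_H :: "nat \<Rightarrow> nat \<Rightarrow> nat" where
  "dim_H r N = qvs.dim (\<phi> ` depth_words r \<inter> homog PM_wt N)"

lemma dim_depth_H:
  "qvs.dim (depth_H \<psi> r \<inter> homog length N) = dim_H r N + qvs.dim ({x. \<phi> x = 0} \<inter> homog length N)"
  unfolding depth_H_eq dim_H_def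
  by (rule dim_graded_preimage[OF phi_linear phi_weight subspace_phi_depth _ finite_letter_words]) auto

lemma wt_dim_gr_H: "r \<noteq> 0 \<Longrightarrow> wt_dim (gr_H \<psi> r) N = dim_H r N - dim_H (r - 1) N"
  by (simp add: wt_dim_def gr_H_def dim_depth_H)

end

text \<open>These are polynomials in f_2 with prescribed spaces of coefficients; rank-nullity splits
  off the top coefficient.\<close>

lemma dim_f2_components:
  assumes C: "\<And>k. qvs.subspace (C k)" "\<And>k. C k \<subseteq> {p. keys p \<subseteq> F k}" "\<And>k. finite (F k)" "\<And>k. M < k \<Longrightarrow> C k = {0}"
  shows "qvs.dim {z. \<forall>k. coeff_f2 k z \<in> C k} = (\<Sum>k\<le>M. qvs.dim (C k))"
  using C
proof (induction M arbitrary: C)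
  case (0 C)
  have "{z. \<forall>k. coeff_f2 k z \<in> C k} = times_f2 0 ` C 0"
  proof (intro equalityI subsetI)
    fix z assume z: "z \<in> {z. \<forall>k. coeff_f2 k z \<in> C k}"
    have "z = times_f2 0 (coeff_f2 0 z)"
    proof (rule poly_mapping_eqI)
      fix wj :: "nat list \<times> nat"
      obtain w j where wj: "wj = (w, j)" by (cases wj)
      have "j \<noteq> 0 \<Longrightarrow> coeff_f2 j z = 0" using z 0(4)[of j] by blast
      then have "j \<noteq> 0 \<Longrightarrow> lookup z (w, j) = 0" by (metis lookup_coeff_f2 lookup_zero)
      then show "lookup z wj = lookup (times_f2 0 (coeff_f2 0 z)) wj"
        by (simp add: wj lookup_times_f2)
    qed
    then show "z \<in> times_f2 0 ` C 0" using z by blast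
  next
    fix z assume "z \<in> times_f2 0 ` C 0"
    then show "z \<in> {z. \<forall>k. coeff_f2 k z \<in> C k}"
      using 0(1) by (auto simp: coeff_f2_times_f2 qvs.subspace_0)
  qed
  moreover have "qvs.dim (times_f2 0 ` C 0) = qvs.dim (C 0)"
  proof (rule qvp.dim_image_injective[OF qlinear_times_f2 0(1)])
    show "C 0 \<subseteq> qvs.span (bas ` F 0)" using 0(2) by (simp add: span_bas)
    show "v = 0" if "times_f2 0 v = 0" for v
      using that coeff_f2_times_f2[of 0 0 v] qlinear_zero[OF qlinear_coeff_f2] by simp
  qed (use 0(3) in auto)
  ultimately show ?case by simp
next
  case (Suc M C)
  let ?K = "{z. \<forall>k. coeff_f2 k z \<in> C k}" and ?C = "C(Suc M := {0})"
  have keysK: "?K \<subseteq> {p. keys p \<subseteq> (\<Union>k\<le>Suc M. F k \<times> {k})}"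
  proof safe
    fix z w j assume z: "\<forall>k. coeff_f2 k z \<in> C k" and wj: "(w, j) \<in> keys z"
    have "lookup (coeff_f2 j z) w \<noteq> 0" using wj by (simp add: in_keys_iff)
    then have "w \<in> keys (coeff_f2 j z)" unfolding in_keys_iff .
    moreover from this have "coeff_f2 j z \<noteq> 0" by (metis keys_zero empty_iff)
    moreover have "coeff_f2 j z \<in> C j" using z by blast
    ultimately have "w \<in> F j" "j \<le> Suc M" using Suc.prems(2)[of j] Suc.prems(4)[of j] by (auto simp: not_less[symmetric])
    then show "(w, j) \<in> (\<Union>k\<le>Suc M. F k \<times> {k})" by auto
  qed
  have subK: "qvs.subspace ?K"
    using Suc.prems(1)
    by (auto simp: qvs.subspace_def qlinear_zero[OF qlinear_coeff_f2] qlinear_add[OF qlinear_coeff_f2] qlinear_scale[OF qlinear_coeff_f2])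
  have "qvs.dim ?K = qvs.dim (coeff_f2 (Suc M) ` ?K) + qvs.dim {z \<in> ?K. coeff_f2 (Suc M) z = 0}"
    by (rule qvp.rank_nullity[OF qlinear_coeff_f2 subK, of "bas ` (\<Union>k\<le>Suc M. F k \<times> {k})"])
       (use keysK Suc.prems(3) in \<open>auto simp: span_bas\<close>)
  also have "coeff_f2 (Suc M) ` ?K = C (Suc M)"
  proof (intro equalityI subsetI)
    fix y assume "y \<in> C (Suc M)"
    then show "y \<in> coeff_f2 (Suc M) ` ?K"
      using Suc.prems(1) by (intro image_eqI[of _ _ "times_f2 (Suc M) y"]) (auto simp: coeff_f2_times_f2 qvs.subspace_0)
  qed auto
  also have "{z \<in> ?K. coeff_f2 (Suc M) z = 0} = {z. \<forall>k. coeff_f2 k z \<in> ?C k}"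
    using qvs.subspace_0[OF Suc.prems(1)] by auto
  also have "qvs.dim \<dots> = (\<Sum>k\<le>M. qvs.dim (?C k))"
  proof (rule Suc.IH)
    show "?C k = {0}" if "M < k" for k using Suc.prems(4)[of k] that by (cases "k = Suc M") auto
  qed (use Suc.prems in \<open>auto simp: qvs.subspace_single_0\<close>)
  also have "\<dots> = (\<Sum>k\<le>M. qvs.dim (C k))" by (rule sum.cong) auto
  finally show ?case by simp
qed

context mixed_tate_Z
begin

lemma coeff_f2_in_homog:
  "z \<in> homog PM_wt N \<longleftrightarrow> (\<forall>k. coeff_f2 k z \<in> (if 2 * k \<le> N then homog sum_list (N - 2 * k) else {0}))"
proof
  assume z: "z \<in> homog PM_wt N"
  show "\<forall>k. coeff_f2 k z \<in> (if 2 * k \<le> N then homog sum_list (N - 2 * k) else {0})"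
  proof
    fix k
    have *: "sum_list w + 2 * k = N" if "w \<in> keys (coeff_f2 k z)" for w
    proof -
      have "(w, k) \<in> keys z" using that by (simp add: in_keys_iff)
      then show ?thesis using z by (auto simp: homog_def PM_wt_def)
    qed
    then have "coeff_f2 k z \<in> homog sum_list (N - 2 * k)" by (fastforce simp: homog_def)
    moreover have "coeff_f2 k z = 0" if "\<not> 2 * k \<le> N"
    proof -
      have "keys (coeff_f2 k z) = {}" using * that by fastforce
      then show ?thesis by simp
    qed
    ultimately show "coeff_f2 k z \<in> (if 2 * k \<le> N then homog sum_list (N - 2 * k) else {0})" by simp
  qed
next
  assume *: "\<forall>k. coeff_f2 k z \<in> (if 2 * k \<le> N then homog sum_list (N - 2 * k) else {0})"
  show "z \<in> homog PM_wt N"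
    unfolding homog_def
  proof safe
    fix w k assume "(w, k) \<in> keys z"
    then have "w \<in> keys (coeff_f2 k z)" by (simp add: in_keys_iff)
    then have "2 * k \<le> N" "sum_list w = N - 2 * k"
      using *[rule_format, of k] by (auto simp: homog_def split: if_splits)
    then show "PM_wt (w, k) = N" by (simp add: PM_wt_def)
  qed
qed

lemma dim_H_eq:
  assumes "r \<noteq> 0"
  shows "dim_H r N = dim_A r N + (\<Sum>k\<in>{1..N div 2}. dim_A (r - 1) (N - 2 * k))"
proof -
  define C where "C k = (if k = 0 then \<psi> ` depth_words r else \<psi> ` depth_words (r - 1)) \<inter>
      (if 2 * k \<le> N then homog sum_list (N - 2 * k) else {0})" for k
  have "\<phi> ` depth_words r \<inter> homog PM_wt N = {z. \<forall>k. coeff_f2 k z \<in> C k}"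
  proof (intro equalityI subsetI)
    fix z assume z: "z \<in> \<phi> ` depth_words r \<inter> homog PM_wt N"
    then have z1: "z \<in> \<phi> ` depth_words r" and z2: "z \<in> homog PM_wt N" by auto
    show "z \<in> {z. \<forall>k. coeff_f2 k z \<in> C k}"
      using z1[unfolded phi_depth_iff] z2[unfolded coeff_f2_in_homog] assms
      by (auto simp only: C_def mem_Collect_eq Int_iff if_False split: if_splits)
  next
    fix z assume "z \<in> {z. \<forall>k. coeff_f2 k z \<in> C k}"
    then have z: "\<And>k. coeff_f2 k z \<in> C k" by auto
    have "z \<in> \<phi> ` depth_words r"
    proof -
      have "coeff_f2 0 z \<in> \<psi> ` depth_words r" using z[of 0] by (simp add: C_def)
      moreover have "coeff_f2 k z \<in> \<psi> ` depth_words (r - 1)" if "0 < k" for k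
        using z[of k] that by (simp add: C_def)
      ultimately show ?thesis unfolding phi_depth_iff using assms by simp
    qed
    moreover have "z \<in> homog PM_wt N"
      unfolding coeff_f2_in_homog using z[unfolded C_def] by (simp only: Int_iff) blast
    ultimately show "z \<in> \<phi> ` depth_words r \<inter> homog PM_wt N" by blast
  qed
  moreover have "qvs.dim {z. \<forall>k. coeff_f2 k z \<in> C k} = (\<Sum>k\<le>N div 2. qvs.dim (C k))"
  proof (rule dim_f2_components)
    show "qvs.subspace (C k)" for k
      unfolding C_def by (intro qvs.subspace_inter) (simp_all add: subspace_psi_depth subspace_homog)
    show "C k \<subseteq> {p. keys p \<subseteq> odd_words (N - 2 * k)}" for k
    proof
      fix p assume p: "p \<in> C k"
      obtain s where "p \<in> \<psi> ` depth_words s"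
        using IntD1[OF p[unfolded C_def]] by (simp only: split: if_splits)
      moreover have "p = 0 \<or> p \<in> homog sum_list (N - 2 * k)"
        using p by (auto simp only: C_def Int_iff split: if_splits)
      ultimately have "p = 0 \<or> p \<in> {p. keys p \<subseteq> odd_words (N - 2 * k)}"
        using psi_depth_subset[of s "N - 2 * k"] by blast
      then show "p \<in> {p. keys p \<subseteq> odd_words (N - 2 * k)}" by auto
    qed
    show "C k = {0}" if "N div 2 < k" for k
      using that qvs.subspace_0[OF subspace_psi_depth] unfolding C_def by auto
  qed (rule finite_odd_words)
  moreover have "(\<Sum>k\<le>N div 2. qvs.dim (C k)) = qvs.dim (C 0) + (\<Sum>k\<in>{1..N div 2}. qvs.dim (C k))"
  proof -
    have "{..N div 2} = insert 0 {1..N div 2}" by auto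
    then show ?thesis by simp
  qed
  moreover have "qvs.dim (C 0) = dim_A r N" by (simp add: C_def dim_A_def)
  moreover have "(\<Sum>k\<in>{1..N div 2}. qvs.dim (C k)) = (\<Sum>k\<in>{1..N div 2}. dim_A (r - 1) (N - 2 * k))"
  proof (rule sum.cong[OF refl])
    fix k assume "k \<in> {1..N div 2}"
    then have "k \<noteq> 0" "2 * k \<le> N" by auto
    then show "qvs.dim (C k) = dim_A (r - 1) (N - 2 * k)" by (simp add: C_def dim_A_def)
  qed
  ultimately show ?thesis unfolding dim_H_def by simp
qed

lemma dim_H_0: "dim_H 0 N = (if N = 0 then 1 else 0)"
proof -
  have "\<phi> ` depth_words 0 = {p. keys p \<subseteq> {([], 0)}}"
    unfolding phi_depth_0 span_bas[of "{([], 0)}", symmetric] by (simp add: qvs.span_singleton)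
  then have "\<phi> ` depth_words 0 \<inter> homog PM_wt N = {p. keys p \<subseteq> {k \<in> {([], 0)}. PM_wt k = N}}"
    by (simp only: keys_Int_homog)
  moreover have "{k \<in> {([], 0)}. PM_wt k = N} = (if N = 0 then {([], 0)} else {})" by (auto simp: PM_wt_def)
  ultimately show ?thesis unfolding dim_H_def by (simp add: dim_keys del: subset_empty subset_singleton_iff)
qed

text \<open>The factor 1 + \<E>(x) y in terms of coefficients: each
  \<open>f\<^sub>2\<^sup>k\<close>, of weight \<open>2 * k\<close>, contributes a copy of the graded
  piece of depth \<open>r - 1\<close>.\<close>

lemma wt_dim_gr_H_eq:
  assumes "r \<noteq> 0"
  shows "wt_dim (gr_H \<psi> r) N = wt_dim (gr_A \<psi> r) N + (\<Sum>k\<in>{1..N div 2}. wt_dim (gr_A \<psi> (r - 1)) (N - 2 * k))"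
proof (cases "r = 1")
  case True
  then show ?thesis by (simp add: wt_dim_gr_H dim_H_eq dim_H_0 wt_dim_gr_A dim_A_0)
next
  case False
  then have r: "r - 1 \<noteq> 0" "r - 1 - 1 = r - 2" using assms by auto
  have "(\<Sum>k\<in>{1..N div 2}. dim_A (r - 1) (N - 2 * k) - dim_A (r - 2) (N - 2 * k)) =
      (\<Sum>k\<in>{1..N div 2}. dim_A (r - 1) (N - 2 * k)) - (\<Sum>k\<in>{1..N div 2}. dim_A (r - 2) (N - 2 * k))"
    by (rule sum_subtractf_nat) (rule dim_A_mono, simp)
  moreover have "(\<Sum>k\<in>{1..N div 2}. dim_A (r - 2) (N - 2 * k)) \<le> (\<Sum>k\<in>{1..N div 2}. dim_A (r - 1) (N - 2 * k))"
    by (rule sum_mono) (rule dim_A_mono, simp)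
  ultimately show ?thesis
    using assms r dim_A_mono[of "r - 1" r N]
    by (simp add: wt_dim_gr_H dim_H_eq wt_dim_gr_A)
qed

end

subsection \<open>A growth criterion for \<open>\<A> = \<O>(U\<^sup>d\<^sup>R)\<close>\<close>

definition cons_letter :: "nat \<Rightarrow> (nat list \<Rightarrow>\<^sub>0 rat) \<Rightarrow> (nat list \<Rightarrow>\<^sub>0 rat)" where
  "cons_letter n = lin_ext (\<lambda>v. bas (n # v))"

lemma qlinear_cons_letter: "qlinear (cons_letter n)"
  unfolding cons_letter_def by (rule qlinear_lin_ext)

lemma lookup_cons_letter:
  "lookup (cons_letter n y) v = (case v of [] \<Rightarrow> 0 | k # u \<Rightarrow> if k = n then lookup y u else 0)"
proof (rule qfunctional_eqI[OF qfunctional_compose[OF qlinear_cons_letter qfunctional_lookup], where p = y])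
  show "qfunctional (\<lambda>y. case v of [] \<Rightarrow> 0 | k # u \<Rightarrow> if k = n then lookup y u else 0)"
    by (cases v) (auto intro!: qfunctionalI simp: lookup_add)
qed (auto simp: cons_letter_def lookup_single when_def split: list.splits)

lemma qlinear_deconc: "qlinear deconc"
  unfolding deconc_def by (rule qlinear_lin_ext)

text \<open>The prefixes of weight \<open>N\<close> of a shuffle of \<open>a\<close> with a word in letters larger than \<open>N\<close> contain
  none of the large letters.\<close>

lemma prefix_of_shuffle:
  assumes "\<And>v. sum_list v \<noteq> N \<Longrightarrow> h v = (0::rat)" "\<forall>x\<in>set a. 0 < x" "\<forall>x\<in>set u. N < x"
    "sum_list pre + sum_list a = (N::nat)"
  shows "lin_ext (\<lambda>v. \<Sum>i\<le>length v. qscale (h (pre @ take i v)) (bas (drop i v))) (shuffle_words a u) =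
    qscale (h (pre @ a)) (bas u)"
  using assms(2-)
proof (induction a u arbitrary: pre rule: shuffle_words.induct)
  case (1 u)
  have "(\<Sum>i\<le>length u. qscale (h (pre @ take i u)) (bas (drop i u))) =
      (\<Sum>i\<le>length u. if i = 0 then qscale (h pre) (bas u) else 0)"
  proof (rule sum.cong[OF refl])
    fix i assume i: "i \<in> {..length u}"
    show "qscale (h (pre @ take i u)) (bas (drop i u)) = (if i = 0 then qscale (h pre) (bas u) else 0)"
    proof (cases "i = 0")
      case False
      then have "u \<noteq> []" using i by auto
      then have hd: "hd u \<in> set (take i u)" "hd u \<in> set u" using False by (cases u; cases i; auto)+
      have "N < hd u" using 1(2) hd(2) by blast
      also have "hd u \<le> sum_list (take i u)" by (rule member_le_sum_list[OF hd(1)]) simp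
      finally have "N < sum_list (take i u)" .
      then have "h (pre @ take i u) = 0" by (intro assms(1)) auto
      then show ?thesis using False by simp
    qed simp
  qed
  then show ?case by simp
next
  case (2 c a)
  have "(\<Sum>i\<le>length (c # a). qscale (h (pre @ take i (c # a))) (bas (drop i (c # a)))) =
      (\<Sum>i\<le>length (c # a). if i = length (c # a) then qscale (h (pre @ c # a)) (bas []) else 0)"
  proof (rule sum.cong[OF refl])
    fix i assume i: "i \<in> {..length (c # a)}"
    show "qscale (h (pre @ take i (c # a))) (bas (drop i (c # a))) =
       (if i = length (c # a) then qscale (h (pre @ c # a)) (bas []) else 0)"
    proof (cases "i = length (c # a)")
      case False
      then have "drop i (c # a) \<noteq> []" using i by auto
      then have hd: "hd (drop i (c # a)) \<in> set (drop i (c # a))" by (rule hd_in_set)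
      have "0 < hd (drop i (c # a))" using 2(1) in_set_dropD[OF hd] by blast
      also have "\<dots> \<le> sum_list (drop i (c # a))" by (rule member_le_sum_list[OF hd]) simp
      finally have "0 < sum_list (drop i (c # a))" .
      moreover have "sum_list (c # a) = sum_list (take i (c # a)) + sum_list (drop i (c # a))"
        by (metis append_take_drop_id sum_list_append)
      ultimately have "h (pre @ take i (c # a)) = 0" using 2(3) by (intro assms(1)) auto
      then show ?thesis using False by simp
    qed simp
  qed
  then show ?case by simp
next
  case (3 c a d u)
  let ?f = "\<lambda>pre v. \<Sum>i\<le>length v. qscale (h (pre @ take i v)) (bas (drop i v))"
  have step: "?f pre (x # v) = ?f (pre @ [x]) v" for x v
  proof -
    have "h pre = 0" using 3(3,5) by (intro assms(1)) auto
    then show ?thesis by (simp add: sum.atMost_Suc_shift del: sum.atMost_Suc)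
  qed
  have shift: "lin_ext (?f pre) (lin_ext (\<lambda>w. bas (x # w)) q) = lin_ext (?f (pre @ [x])) q" for x q
    by (simp only: qlinear_lin_ext_lin_ext[OF qlinear_lin_ext] lin_ext_bas step)
  have "lin_ext (?f pre) (lin_ext (\<lambda>w. bas (d # w)) (shuffle_words (c # a) u)) = 0"
  proof -
    have "?f (pre @ [d]) v = 0" for v
    proof (rule sum.neutral, rule ballI)
      fix i
      have "h ((pre @ [d]) @ take i v) = 0" using 3(4) by (intro assms(1)) auto
      then show "qscale (h ((pre @ [d]) @ take i v)) (bas (drop i v)) = 0" by simp
    qed
    then show ?thesis unfolding shift by (simp only: lin_ext_def qvs.scale_zero_right sum.neutral_const)
  qed
  moreover have "lin_ext (?f pre) (lin_ext (\<lambda>w. bas (c # w)) (shuffle_words a (d # u))) = qscale (h (pre @ c # a)) (bas (d # u))"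
    unfolding shift using 3(1)[of "pre @ [c]"] 3(3-5) by simp
  ultimately show ?case by (simp add: lin_ext_add)
qed

text \<open>A prefix of weight \<open>N\<close> contains no large letter, hence is
  \<open>n # a\<close>. As \<open>h\<close> sees only prefixes of this weight, what remains is the
  word in the large letters.\<close>

lemma contract_cons_shuffle:
  assumes h: "qfunctional h" "\<And>v. sum_list v \<noteq> N \<Longrightarrow> h (bas v) = 0" "h (bas (n # a)) = 1"
    and a: "\<forall>x\<in>set a. 0 < x" "n + sum_list a = N" "0 < n"
    and y: "keys y \<subseteq> {u. \<forall>x\<in>set u. N < x}"
  shows "contract_left h (deconc (cons_letter n (bas a \<diamondop> y))) = y"
proof -
  let ?f = "\<lambda>y. contract_left h (deconc (cons_letter n (bas a \<diamondop> y)))"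
  have lin: "qlinear ?f"
    by (intro qlinear_compose[OF qlinear_shuffle_right] qlinear_compose[OF qlinear_cons_letter]
        qlinear_compose[OF qlinear_deconc] qlinear_contract_left)
  have "?f (bas u) = bas u" if u: "\<forall>x\<in>set u. N < x" for u
  proof -
    have h0: "h (bas []) = 0" using a by (intro h(2)) auto
    have "contract_left h (deconc (bas (n # v))) = (\<Sum>i\<le>length v. qscale (h (bas ([n] @ take i v))) (bas (drop i v)))" for v
      by (simp add: deconc_def qlinear_add[OF qlinear_contract_left] qlinear_sum[OF qlinear_contract_left] sum.atMost_Suc_shift h0 del: sum.atMost_Suc)
    then have "?f (bas u) = lin_ext (\<lambda>v. \<Sum>i\<le>length v. qscale (h (bas ([n] @ take i v))) (bas (drop i v))) (shuffle_words a u)"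
      unfolding cons_letter_def shuffle_bas
      by (simp add: qlinear_lin_ext_lin_ext[OF qlinear_compose[OF qlinear_deconc qlinear_contract_left]])
    also have "\<dots> = bas u"
      using prefix_of_shuffle[of N "\<lambda>v. h (bas v)" a u "[n]"] h(2,3) a u by simp
    finally show ?thesis .
  qed
  then have "lin_ext (\<lambda>u. ?f (bas u)) y = lin_ext bas y"
    unfolding lin_ext_def using y by (intro sum.cong) auto
  with qlinear_eq_lin_ext[OF lin, of y] show ?thesis unfolding lin_ext_bas_self by (rule trans)
qed

text \<open>Words in the letters f_n are not yet known to lie in \<A>, but products of letters do,
  since \<A> is a subalgebra that contains each letter.\<close>

definition letter_prod :: "nat list \<Rightarrow> (nat list \<Rightarrow>\<^sub>0 rat)" where
  "letter_prod ns = foldr (\<lambda>m p. bas [m] \<diamondop> p) ns (bas [])"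

text \<open>Shuffles have nonnegative coefficients, so nothing cancels; this will show that
  \<open>ns\<close> itself occurs in \<open>letter_prod ns\<close>.\<close>

lemma lookup_shuffle_letter:
  fixes p :: "nat list \<Rightarrow>\<^sub>0 rat"
  assumes "\<And>v. 0 \<le> lookup p v"
  shows "0 \<le> lookup (bas [m] \<diamondop> p) v" and "lookup p v \<le> lookup (bas [m] \<diamondop> p) (m # v)"
proof -
  have eq: "lookup (bas [m] \<diamondop> p) v = (\<Sum>u\<in>keys p. lookup p u * lookup (shuffle_words [m] u) v)" for v
    unfolding shuffle_def bilin_ext_bas_left by (simp add: qfunctional_lin_ext[OF qfunctional_lookup])
  have nonneg: "0 \<le> lookup (shuffle_words [m] u) v" for u v
  proof (induction u arbitrary: v)
    case (Cons c u)
    have "lookup (lin_ext (\<lambda>w. bas (c # w)) (shuffle_words [m] u)) v \<ge> 0"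
      unfolding cons_letter_def[symmetric] lookup_cons_letter using Cons by (auto split: list.splits)
    then show ?case by (simp add: lookup_add lookup_single when_def)
  qed (simp add: lookup_single when_def)
  show "0 \<le> lookup (bas [m] \<diamondop> p) v"
    unfolding eq by (intro sum_nonneg mult_nonneg_nonneg assms nonneg)
  have one: "1 \<le> lookup (shuffle_words [m] v) (m # v)"
  proof (cases v)
    case (Cons c u)
    have "lookup (lin_ext (\<lambda>w. bas (c # w)) (shuffle_words [m] u)) (m # v) \<ge> 0"
      unfolding cons_letter_def[symmetric] lookup_cons_letter using nonneg by auto
    then show ?thesis using Cons by (simp add: lookup_add)
  qed simp
  show "lookup p v \<le> lookup (bas [m] \<diamondop> p) (m # v)"
  proof (cases "v \<in> keys p")
    case True
    have "lookup p v * 1 \<le> lookup p v * lookup (shuffle_words [m] v) (m # v)"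
      by (rule mult_left_mono[OF one assms])
    also have "\<dots> \<le> lookup (bas [m] \<diamondop> p) (m # v)"
      unfolding eq by (rule member_le_sum[OF True]) (auto intro!: mult_nonneg_nonneg assms nonneg)
    finally show ?thesis by simp
  next
    case False
    then have "lookup p v = 0" by (simp add: in_keys_iff)
    then show ?thesis unfolding eq by (auto intro!: sum_nonneg mult_nonneg_nonneg assms nonneg)
  qed
qed

lemma lookup_letter_prod: "0 \<le> lookup (letter_prod ns) v" "0 < lookup (letter_prod ns) ns"
proof -
  have "(\<forall>v. 0 \<le> lookup (letter_prod ns) v) \<and> 0 < lookup (letter_prod ns) ns"
  proof (induction ns)
    case (Cons m ns)
    have eq: "letter_prod (m # ns) = bas [m] \<diamondop> letter_prod ns" by (simp add: letter_prod_def)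
    show ?case unfolding eq
      using lookup_shuffle_letter[where p = "letter_prod ns" and m = m] Cons by (metis order_less_le_trans)
  qed (auto simp: letter_prod_def lookup_single when_def)
  then show "0 \<le> lookup (letter_prod ns) v" "0 < lookup (letter_prod ns) ns" by auto
qed

lemma mset_letter_prod: "v \<in> keys (letter_prod ns) \<Longrightarrow> mset v = mset ns"
proof (induction ns arbitrary: v)
  case (Cons m ns)
  have "letter_prod (m # ns) = lin_ext (shuffle_words [m]) (letter_prod ns)"
    by (simp add: letter_prod_def shuffle_def bilin_ext_bas_left)
  moreover have "lin_ext (shuffle_words [m]) (letter_prod ns) \<in> {p. keys p \<subseteq> {v. mset v = mset (m # ns)}}"
    by (rule lin_ext_in_subspace[OF subspace_keys]) (auto dest!: mset_shuffle_words simp: Cons.IH)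
  ultimately show ?case using Cons.prems by auto
qed (auto simp: letter_prod_def)

lemma independent_if_separated:
  assumes "\<And>p. p \<in> S \<Longrightarrow> \<exists>k. lookup p k \<noteq> 0 \<and> (\<forall>q\<in>S - {p}. lookup q k = 0)"
  shows "qvs.independent S"
  unfolding qvs.dependent_def
proof safe
  fix p assume p: "p \<in> S" "p \<in> qvs.span (S - {p})"
  obtain k where k: "lookup p k \<noteq> 0" "\<forall>q\<in>S - {p}. lookup q k = 0" using assms p(1) by blast
  have "qvs.span (S - {p}) \<subseteq> {q. lookup q k = 0}"
    by (rule qvs.span_minimal) (use k(2) in \<open>auto simp: qvs.subspace_def lookup_add\<close>)
  then show False using p(2) k(1) by auto
qed

lemma dim_span_UN_le:
  assumes "finite K" "\<And>k. k \<in> K \<Longrightarrow> qlinear (f k)"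
    "\<And>k. k \<in> K \<Longrightarrow> V k \<subseteq> qvs.span (S k)" "\<And>k. k \<in> K \<Longrightarrow> finite (S k)"
  shows "qvs.dim (\<Union>k\<in>K. f k ` V k) \<le> (\<Sum>k\<in>K. qvs.dim (V k))"
proof -
  have "\<exists>D. finite D \<and> V k \<subseteq> qvs.span D \<and> card D = qvs.dim (V k)" if "k \<in> K" for k
    using qvs.finite_basis_in_span[OF assms(3,4)[OF that]] by metis
  then obtain D where D: "\<And>k. k \<in> K \<Longrightarrow> finite (D k) \<and> V k \<subseteq> qvs.span (D k) \<and> card (D k) = qvs.dim (V k)"
    by metis
  have "(\<Union>k\<in>K. f k ` V k) \<subseteq> qvs.span (\<Union>k\<in>K. f k ` D k)"
  proof safe
    fix k v assume k: "k \<in> K" "v \<in> V k"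
    then have "f k v \<in> qvs.span (f k ` D k)"
      using D[OF k(1)] span_image_qlinear[OF assms(2)[OF k(1)], of "D k"] by auto
    then show "f k v \<in> qvs.span (\<Union>k\<in>K. f k ` D k)"
      using qvs.span_mono[of "f k ` D k" "\<Union>k\<in>K. f k ` D k"] k(1) by blast
  qed
  then have "qvs.dim (\<Union>k\<in>K. f k ` V k) \<le> card (\<Union>k\<in>K. f k ` D k)"
    by (rule qvs.dim_le_card) (use assms(1) D in auto)
  also have "\<dots> \<le> (\<Sum>k\<in>K. card (f k ` D k))" by (rule card_UN_le[OF assms(1)])
  also have "\<dots> \<le> (\<Sum>k\<in>K. qvs.dim (V k))"
  proof (rule sum_mono)
    fix k assume "k \<in> K"
    then show "card (f k ` D k) \<le> qvs.dim (V k)" using card_image_le[of "D k" "f k"] D by fastforce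
  qed
  finally show ?thesis .
qed

definition odd_letters :: "nat \<Rightarrow> nat set" where
  "odd_letters M = {k. odd k \<and> 3 \<le> k \<and> k \<le> M}"

lemma finite_odd_letters: "finite (odd_letters M)"
  by (rule finite_subset[of _ "{..M}"]) (auto simp: odd_letters_def)

context mixed_tate_Z
begin

definition dim_A_total :: "nat \<Rightarrow> nat" where
  "dim_A_total N = qvs.dim (range \<psi> \<inter> homog sum_list N)"

lemma range_psi_span: "range \<psi> \<inter> homog sum_list N \<subseteq> qvs.span (bas ` odd_words N)"
  using psi_OU OU_Int_homog[of N] by (auto simp: span_bas)

lemma subspace_range_psi: "qvs.subspace (range \<psi>)"
  by (rule subspace_image_qlinear[OF psi_linear qvs.subspace_UNIV])

lemma contract_deconc_range_psi:
  assumes "qfunctional h"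
  shows "contract_left h (deconc (\<psi> x)) \<in> range \<psi>"
proof -
  have "contract_left h (deconc (\<psi> x)) = lin_ext (\<lambda>w. contract_left h (deconc (\<psi> (bas w)))) x"
    by (rule qlinear_eq_lin_ext[OF qlinear_compose[OF psi_linear qlinear_compose[OF qlinear_deconc qlinear_contract_left]]])
  also have "\<dots> \<in> range \<psi>"
    unfolding contract_left_deconc_psi[OF assms]
    by (intro lin_ext_in_subspace qvs.subspace_sum qvs.subspace_scale subspace_range_psi) auto
  finally show ?thesis .
qed

lemma contract_deconc_eq_0:
  assumes "qfunctional h" "\<And>y. h (\<psi> y) = 0"
  shows "contract_left h (deconc (\<psi> x)) = 0"
proof -
  have "contract_left h (deconc (\<psi> x)) = lin_ext (\<lambda>w. contract_left h (deconc (\<psi> (bas w)))) x"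
    by (rule qlinear_eq_lin_ext[OF qlinear_compose[OF psi_linear qlinear_compose[OF qlinear_deconc qlinear_contract_left]]])
  then show ?thesis by (simp add: contract_left_deconc_psi[OF assms(1)] assms(2) lin_ext_def)
qed

text \<open>The sum of the spaces f_k \<A> in weight \<open>M\<close>. It contains the weight
  \<open>M\<close> part of \<A>, and its dimension is at most the coefficient of x^M in \<O>(x)
  times the series of \<A>.\<close>

definition cons_A :: "nat \<Rightarrow> (nat list \<Rightarrow>\<^sub>0 rat) set" where
  "cons_A M = qvs.span (\<Union>k\<in>odd_letters M. cons_letter k ` (range \<psi> \<inter> homog sum_list (M - k)))"

lemma dim_cons_A: "qvs.dim (cons_A M) \<le> (\<Sum>k\<in>odd_letters M. dim_A_total (M - k))"
  unfolding cons_A_def qvs.dim_span dim_A_total_def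
  by (rule dim_span_UN_le[OF finite_odd_letters qlinear_cons_letter range_psi_span])
     (use finite_odd_words in auto)

lemma cons_A_span: "cons_A M \<subseteq> qvs.span (bas ` odd_words M)"
  unfolding cons_A_def
proof (rule qvs.span_minimal)
  show "(\<Union>k\<in>odd_letters M. cons_letter k ` (range \<psi> \<inter> homog sum_list (M - k))) \<subseteq> qvs.span (bas ` odd_words M)"
  proof safe
    fix k x assume k: "k \<in> odd_letters M" and x: "\<psi> x \<in> homog sum_list (M - k)"
    have "\<psi> x \<in> {p. keys p \<subseteq> odd_words (M - k)}"
      using range_psi_span[of "M - k"] x by (auto simp: span_bas)
    then have "u \<in> odd_words M" if "u \<in> keys (cons_letter k (\<psi> x))" for u
      using that k by (auto simp: in_keys_iff lookup_cons_letter odd_words_def odd_letters_def split: list.splits if_splits)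
    then show "cons_letter k (\<psi> x) \<in> qvs.span (bas ` odd_words M)" by (auto simp: span_bas)
  qed
qed simp

text \<open>Stripping the first letter is a contraction of the coproduct, and such contractions
  preserve \<A>.\<close>

lemma range_psi_subset_cons_A:
  assumes "0 < M"
  shows "range \<psi> \<inter> homog sum_list M \<subseteq> cons_A M"
proof
  fix y assume y: "y \<in> range \<psi> \<inter> homog sum_list M"
  let ?q = "\<lambda>k. contract_left (\<lambda>p. lookup p [k]) (deconc y)"
  have look: "lookup (?q k) v = lookup y (k # v)" for k v by (simp add: lookup_deconc)
  have ky: "keys y \<subseteq> odd_words M" using range_psi_span[of M] y by (auto simp: span_bas)
  have "y = (\<Sum>k\<in>odd_letters M. cons_letter k (?q k))"
  proof (rule poly_mapping_eqI)
    fix v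
    show "lookup y v = lookup (\<Sum>k\<in>odd_letters M. cons_letter k (?q k)) v"
    proof (cases v)
      case Nil
      then have "v \<notin> keys y" using ky assms by (auto simp: odd_words_def)
      then show ?thesis using Nil by (simp add: lookup_sum lookup_cons_letter in_keys_iff)
    next
      case (Cons j u)
      have "j \<notin> odd_letters M \<Longrightarrow> lookup y v = 0"
        using ky Cons by (fastforce simp: odd_words_def odd_letters_def in_keys_iff)
      then show ?thesis
        using Cons by (auto simp: lookup_sum lookup_cons_letter look finite_odd_letters)
    qed
  qed
  also have "\<dots> \<in> cons_A M"
    unfolding cons_A_def
  proof (rule qvs.span_sum)
    fix k assume k: "k \<in> odd_letters M"
    have "?q k \<in> range \<psi>" using y contract_deconc_range_psi[OF qfunctional_lookup] by auto
    moreover have "?q k \<in> homog sum_list (M - k)"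
      unfolding homog_def
    proof safe
      fix v assume "v \<in> keys (?q k)"
      then have "k # v \<in> keys y" by (simp add: in_keys_iff look)
      then show "sum_list v = M - k" using ky by (auto simp: odd_words_def)
    qed
    ultimately have "cons_letter k (?q k) \<in> cons_letter k ` (range \<psi> \<inter> homog sum_list (M - k))" by blast
    then show "cons_letter k (?q k) \<in> qvs.span (\<Union>k\<in>odd_letters M. cons_letter k ` (range \<psi> \<inter> homog sum_list (M - k)))"
      using k by (intro qvs.span_base) blast
  qed
  finally show "y \<in> cons_A M" .
qed

lemma letter_prod_in_range_psi: "set ns \<subseteq> {n. odd n \<and> 3 \<le> n} \<Longrightarrow> letter_prod ns \<in> range \<psi>"
proof (induction ns)
  case Nil
  have "letter_prod [] = \<psi> (bas [])" by (simp add: letter_prod_def psi_one)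
  then show ?case by (simp only: rangeI)
next
  case (Cons m ns)
  then obtain x where x: "letter_prod ns = \<psi> x" by auto
  have "bas [m] = \<psi> (qscale (1 / zeta_coeff m) (zeta_elt [m]))"
    using psi_zeta_single[of m] zeta_coeff_nonzero[of m] Cons.prems by (simp add: psi_scale)
  then have "letter_prod (m # ns) = \<psi> (qscale (1 / zeta_coeff m) (zeta_elt [m]) \<diamondop> x)"
    by (simp add: letter_prod_def psi_mult x[symmetric])
  then show ?case by blast
qed

lemma shuffle_in_range_psi: "p \<in> range \<psi> \<Longrightarrow> q \<in> range \<psi> \<Longrightarrow> p \<diamondop> q \<in> range \<psi>"
  by (auto simp flip: psi_mult)

text \<open>If a word \<open>n # a\<close> does not lie in \<open>\<A>\<close> although \<open>a\<close> does, then \<open>n (a \<diamondop> b)\<close>, for products \<open>b\<close> of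
  large letters, are independent modulo \<open>\<A>\<close>: a functional that vanishes on \<open>\<A>\<close> but not
  on \<open>n # a\<close> recovers \<open>b\<close> from the coproduct.\<close>

lemma dim_cons_A_lower:
  assumes na: "n # a \<in> lists {n. odd n \<and> 3 \<le> n}" "bas a \<in> range \<psi>" "bas (n # a) \<notin> range \<psi>"
    and N: "N = n + sum_list a"
    and E: "finite E" "\<And>e. e \<in> E \<Longrightarrow> set e \<subseteq> {x. odd x \<and> 3 \<le> x \<and> N < x} \<and> sum_list e = m" "inj_on mset E"
  shows "dim_A_total (N + m) + card E \<le> qvs.dim (cons_A (N + m))"
proof -
  obtain h0 where h0: "qfunctional h0" "\<And>y. y \<in> range \<psi> \<Longrightarrow> h0 y = 0" "h0 (bas (n # a)) = 1"
    using qvs.functional_separating[OF subspace_range_psi na(3)] by metis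
  \<comment> \<open>Cutting \<open>h0\<close> down to weight \<open>N\<close> leaves it zero on
    \<A>, which is graded, and makes it blind to prefixes of any other weight.\<close>
  define h where "h p = h0 (homog_part sum_list N p)" for p
  have h: "qfunctional h" unfolding h_def by (rule qfunctional_compose[OF qlinear_homog_part h0(1)])
  have h1: "h (\<psi> y) = 0" for y
  proof -
    have "homog_part sum_list N (\<psi> y) = \<psi> (homog_part length N y)"
      by (rule lin_ext_homog_part[symmetric, OF psi_linear]) (rule psi_weight)
    then show ?thesis by (simp add: h_def h0(2))
  qed
  have h2: "h (bas v) = 0" if "sum_list v \<noteq> N" for v
    unfolding h_def using that homog_part_homog[of "bas v" sum_list "sum_list v" N]
    by (simp add: qfunctional_zero[OF h0(1)])
  have h3: "h (bas (n # a)) = 1"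
    unfolding h_def using homog_part_homog[of "bas (n # a)" sum_list N N] N h0(3) by simp
  let ?f = "\<lambda>y. contract_left h (deconc y)" and ?X = "cons_A (N + m)"
  have lin: "qlinear ?f" by (rule qlinear_compose[OF qlinear_deconc qlinear_contract_left])
  have n: "0 < n" "\<forall>x\<in>set a. 0 < x" "odd n" "3 \<le> n" using na(1) by auto
  have fX: "qvs.subspace ?X" unfolding cons_A_def by simp
  have "letter_prod ` E \<subseteq> ?f ` ?X"
  proof safe
    fix e assume e: "e \<in> E"
    note ee = E(2)[OF e]
    have keys: "mset v = mset e" if "v \<in> keys (letter_prod e)" for v using mset_letter_prod[OF that] .
    have "?f (cons_letter n (bas a \<diamondop> letter_prod e)) = letter_prod e"
    proof (rule contract_cons_shuffle[OF h h2 h3 n(2) N[symmetric] n(1)])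
      show "keys (letter_prod e) \<subseteq> {u. \<forall>x\<in>set u. N < x}"
        using keys ee by (auto dest!: mset_eq_setD)
    qed
    moreover have "cons_letter n (bas a \<diamondop> letter_prod e) \<in> ?X"
    proof -
      have "n \<in> odd_letters (N + m)" using n N by (auto simp: odd_letters_def)
      moreover have "bas a \<diamondop> letter_prod e \<in> range \<psi>"
        using ee by (intro shuffle_in_range_psi na(2) letter_prod_in_range_psi) auto
      moreover have "bas a \<diamondop> letter_prod e \<in> homog sum_list (N + m - n)"
        unfolding shuffle_def
      proof (rule bilin_ext_in_subspace[OF subspace_homog])
        fix k l assume kl: "k \<in> keys (bas a :: nat list \<Rightarrow>\<^sub>0 rat)" "l \<in> keys (letter_prod e)"
        have "sum_list w = N + m - n" if "w \<in> keys (shuffle_words k l)" for w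
          using mset_shuffle_words[OF that] kl keys[OF kl(2)] ee N
          by (simp flip: sum_mset_sum_list)
        then show "shuffle_words k l \<in> homog sum_list (N + m - n)" by (auto simp: homog_def)
      qed
      ultimately show ?thesis unfolding cons_A_def by (intro qvs.span_base) blast
    qed
    ultimately show "letter_prod e \<in> ?f ` ?X" by (metis imageI)
  qed
  have spanX: "?X \<subseteq> qvs.span (bas ` odd_words (N + m))" "finite (bas ` odd_words (N + m))"
    using cons_A_span finite_odd_words by auto
  have sep: "lookup (letter_prod e') e = 0" if "e \<in> E" "e' \<in> E" "e \<noteq> e'" for e e'
  proof -
    have "mset e \<noteq> mset e'" using E(3) that by (auto dest: inj_onD)
    then have "e \<notin> keys (letter_prod e')" using mset_letter_prod by blast
    then show ?thesis by (simp add: in_keys_iff)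
  qed
  have inj: "inj_on letter_prod E"
    using sep lookup_letter_prod(2) by (intro inj_onI) (metis less_irrefl)
  have ind: "qvs.independent (letter_prod ` E)"
  proof (rule independent_if_separated)
    fix p assume "p \<in> letter_prod ` E"
    then obtain e where e: "p = letter_prod e" "e \<in> E" by auto
    show "\<exists>k. lookup p k \<noteq> 0 \<and> (\<forall>q\<in>letter_prod ` E - {p}. lookup q k = 0)"
      using lookup_letter_prod(2)[of e] sep e by (intro exI[of _ e]) auto
  qed
  have "card E = card (letter_prod ` E)" using inj by (simp add: card_image)
  also have "\<dots> \<le> qvs.dim (?f ` ?X)"
  proof (rule qvs.card_le_dim_in_span(2)[OF ind \<open>letter_prod ` E \<subseteq> ?f ` ?X\<close>])
    show "?f ` ?X \<subseteq> qvs.span (?f ` bas ` odd_words (N + m))"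
      using spanX(1) span_image_qlinear[OF lin] by auto
  qed (use finite_odd_words in auto)
  finally have 1: "card E \<le> qvs.dim (?f ` ?X)" .
  have 2: "dim_A_total (N + m) \<le> qvs.dim {v \<in> ?X. ?f v = 0}"
    unfolding dim_A_total_def
  proof (rule qvs.dim_mono_in_span)
    show "range \<psi> \<inter> homog sum_list (N + m) \<subseteq> {v \<in> ?X. ?f v = 0}"
      using range_psi_subset_cons_A[of "N + m"] contract_deconc_eq_0[OF h h1] n N by auto
    show "{v \<in> ?X. ?f v = 0} \<subseteq> qvs.span (bas ` odd_words (N + m))" using spanX by auto
  qed (rule spanX(2))
  show ?thesis using qvp.rank_nullity[OF lin fX spanX] 1 2 by simp
qed


text \<open>For a shortest missing word \<open>n # a\<close>, the remainder \<open>a\<close> lies in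
  \<A>. The products of four fixed large letters with exponents below \<open>L\<close> number
  \<open>L ^ 4\<close>, and their weights are O(L). The growth bound admits O(L^2) of each weight,
  hence O(L^3) altogether, which fails for large \<open>L\<close>.\<close>

lemma OU_subset_range_psi:
  assumes growth: "\<And>M. 0 < M \<Longrightarrow> (\<Sum>k\<in>odd_letters M. dim_A_total (M - k)) \<le> dim_A_total M + 2 * M\<^sup>2"
  shows "OU \<subseteq> range \<psi>"
proof -
  have "bas w \<in> range \<psi>" if "w \<in> lists {n. odd n \<and> 3 \<le> n}" for w :: "nat list"
    using that
  proof (induction w rule: length_induct)
    case (1 w)
    show ?case
    proof (rule ccontr)
      assume notin: "bas w \<notin> range \<psi>"
      then have "w \<noteq> []" using psi_one by (metis rangeI)
      then obtain n a where w: "w = n # a" by (cases w) auto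
      have a: "bas a \<in> range \<psi>" using 1 w by auto
      define N where "N = n + sum_list a"
      \<comment> \<open>Makes the four letters \<open>p\<close>, \<open>p + 2\<close>,
        \<open>p + 4\<close>, \<open>p + 6\<close> odd and larger than \<open>N\<close>.\<close>
      define p where "p = 2 * N + 3"
      define E where "E = (\<lambda>L. {..<L} \<times> {..<L} \<times> {..<L} \<times> {..<L::nat})"
      define ns where "ns = (\<lambda>(i, j, k, l). replicate i p @ replicate j (p + 2) @ replicate k (p + 4) @ replicate l (p + 6))"
      have ns_letters: "set (ns e) \<subseteq> {x. odd x \<and> 3 \<le> x \<and> N < x}" for e
        by (cases e) (auto simp: ns_def p_def)
      have inj: "inj_on mset (ns ` X)" "inj ns" for X
      proof -
        have c: "count (mset (ns (i, j, k, l))) p = i" "count (mset (ns (i, j, k, l))) (p + 2) = j"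
          "count (mset (ns (i, j, k, l))) (p + 4) = k" "count (mset (ns (i, j, k, l))) (p + 6) = l" for i j k l
          by (simp_all add: ns_def)
        have eq: "e = e'" if "mset (ns e) = mset (ns e')" for e e'
          using that c by (metis prod_cases4)
        show "inj_on mset (ns ` X)" by (rule inj_onI) (auto dest: eq)
        show "inj ns" by (rule injI, rule eq) simp
      qed
      have bound: "card {e \<in> E L. sum_list (ns e) = m} \<le> 2 * (N + m)\<^sup>2" for L m
      proof -
        have "dim_A_total (N + m) + card (ns ` {e \<in> E L. sum_list (ns e) = m}) \<le> qvs.dim (cons_A (N + m))"
        proof (rule dim_cons_A_lower[OF _ a _ N_def])
          show "n # a \<in> lists {n. odd n \<and> 3 \<le> n}" "bas (n # a) \<notin> range \<psi>" using 1(2) notin w by auto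
          show "set e \<subseteq> {x. odd x \<and> 3 \<le> x \<and> N < x} \<and> sum_list e = m"
            if "e \<in> ns ` {e \<in> E L. sum_list (ns e) = m}" for e
            using that ns_letters by blast
        qed (auto simp: E_def intro: inj(1))
        also have "\<dots> \<le> dim_A_total (N + m) + 2 * (N + m)\<^sup>2"
          using dim_cons_A[of "N + m"] growth[of "N + m"] 1(2) by (simp add: w N_def)
        finally show ?thesis
          using card_image[OF inj_on_subset[OF inj(2)], of "{e \<in> E L. sum_list (ns e) = m}"] by simp
      qed
      \<comment> \<open>Chosen so that \<open>C * L\<close> bounds both the weights
        \<open>N + m\<close> and the number of values of \<open>m\<close>.\<close>
      define C where "C = 4 * (p + 6) + N + 1"
      have L: "L ^ 4 \<le> 2 * C ^ 3 * L ^ 3" if "0 < L" for L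
      proof -
        let ?W = "4 * (p + 6) * L"
        have le: "sum_list (ns e) \<le> ?W" if "e \<in> E L" for e
        proof -
          obtain i j k l where e: "e = (i, j, k, l)" by (rule prod_cases4)
          have *: "i * p \<le> L * (p + 6)" "j * (p + 2) \<le> L * (p + 6)" "k * (p + 4) \<le> L * (p + 6)" "l * (p + 6) \<le> L * (p + 6)"
            using that mult_le_mono[of i L p "p + 6"] mult_le_mono[of j L "p + 2" "p + 6"]
              mult_le_mono[of k L "p + 4" "p + 6"] mult_le_mono[of l L "p + 6" "p + 6"]
            by (auto simp: e E_def)
          have "sum_list (ns e) = i * p + j * (p + 2) + k * (p + 4) + l * (p + 6)"
            by (simp add: e ns_def sum_list_replicate)
          also have "\<dots> \<le> L * (p + 6) + L * (p + 6) + L * (p + 6) + L * (p + 6)"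
            by (intro add_mono *)
          also have "\<dots> = ?W" by (simp add: algebra_simps)
          finally show ?thesis .
        qed
        have "L ^ 4 = card (E L)" by (simp add: E_def card_cartesian_product power4_eq_xxxx)
        also have "E L = (\<Union>m\<le>?W. {e \<in> E L. sum_list (ns e) = m})" using le by auto
        also have "card \<dots> \<le> (\<Sum>m\<le>?W. card {e \<in> E L. sum_list (ns e) = m})" by (rule card_UN_le) simp
        also have "\<dots> \<le> (\<Sum>m\<le>?W. 2 * (C * L)\<^sup>2)"
        proof (rule sum_mono)
          fix m assume m: "m \<in> {..?W}"
          have "N \<le> N * L" using that by simp
          then have "N + m \<le> N * L + ?W" by (rule add_mono) (use m in simp)
          also have "\<dots> \<le> C * L" by (simp add: C_def algebra_simps)
          finally have "2 * (N + m)\<^sup>2 \<le> 2 * (C * L)\<^sup>2" by (simp add: power_mono)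
          then show "card {e \<in> E L. sum_list (ns e) = m} \<le> 2 * (C * L)\<^sup>2" using bound order_trans by blast
        qed
        also have "\<dots> = (?W + 1) * (2 * (C * L)\<^sup>2)" by simp
        also have "\<dots> \<le> (C * L) * (2 * (C * L)\<^sup>2)"
          by (rule mult_right_mono) (use that in \<open>auto simp: C_def algebra_simps\<close>)
        also have "\<dots> = 2 * C ^ 3 * L ^ 3" by (simp add: power2_eq_square power3_eq_cube)
        finally show ?thesis .
      qed
      \<comment> \<open>The estimate fails as soon as \<open>L\<close> exceeds its constant
        \<open>2 * C ^ 3\<close>.\<close>
      have "(2 * C ^ 3 + 1) * (2 * C ^ 3 + 1) ^ 3 \<le> 2 * C ^ 3 * (2 * C ^ 3 + 1) ^ 3"
        using L[of "2 * C ^ 3 + 1"] by (simp add: power_numeral_reduce)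
      then show False by (subst (asm) mult_le_cancel2) simp
    qed
  qed
  then show ?thesis
  proof (intro subsetI)
    fix x :: "nat list \<Rightarrow>\<^sub>0 rat" assume "\<And>w. w \<in> lists {n. odd n \<and> 3 \<le> n} \<Longrightarrow> bas w \<in> range \<psi>" "x \<in> OU"
    then have "lin_ext bas x \<in> range \<psi>"
      by (intro lin_ext_in_subspace subspace_range_psi) (auto simp: OU_def)
    then show "x \<in> range \<psi>" by (simp add: lin_ext_bas_self)
  qed
qed

lemma dim_A_total_eq_card:
  assumes "OU \<subseteq> range \<psi>"
  shows "dim_A_total N = card (odd_words N)"
proof -
  have "range \<psi> = OU" using assms psi_OU by auto
  then show ?thesis by (simp add: dim_A_total_def OU_Int_homog dim_keys[OF finite_odd_words])
qed

end

lemma card_odd_words: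
  assumes "0 < M"
  shows "card (odd_words M) = (\<Sum>k\<in>odd_letters M. card (odd_words (M - k)))"
proof -
  have "odd_words M = (\<Union>k\<in>odd_letters M. (#) k ` odd_words (M - k))"
  proof (intro equalityI subsetI)
    fix w assume w: "w \<in> odd_words M"
    then obtain k u where "w = k # u" using assms by (cases w) (auto simp: odd_words_def)
    moreover from this have "k \<in> odd_letters M" "u \<in> odd_words (M - k)"
      using w by (auto simp: odd_words_def odd_letters_def)
    ultimately show "w \<in> (\<Union>k\<in>odd_letters M. (#) k ` odd_words (M - k))" by blast
  qed (auto simp: odd_words_def odd_letters_def)
  moreover have "card \<dots> = (\<Sum>k\<in>odd_letters M. card ((#) k ` odd_words (M - k)))"
    by (rule card_UN_disjoint) (auto simp: finite_odd_letters finite_odd_words)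
  moreover have "card ((#) k ` odd_words (M - k)) = card (odd_words (M - k))" for k
    by (rule card_image) simp
  ultimately show ?thesis by simp
qed

subsection \<open>Depth two\<close>

text \<open>The coefficient of a one-letter word is a derivation relative to the counit, so it kills
  products of two elements without constant term.\<close>

lemma lookup_shuffle_single:
  "lookup (p \<diamondop> q) [m] = lookup p [m] * lookup q [] + lookup p [] * lookup q [m]"
proof -
  have w: "lookup (shuffle_words u v) [m] = lookup (bas u) [m] * lookup (bas v) [] + lookup (bas u) [] * lookup (bas v) [m]"
    for u v :: "'a list"
  proof (cases u)
    case (Cons c u')
    show ?thesis
    proof (cases v)
      case (Cons d v')
      have "[m] \<notin> keys (shuffle_words u v)"
        using mset_shuffle_words[of "[m]" u v] \<open>u = c # u'\<close> Cons by (auto dest: arg_cong[of _ _ size])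
      then show ?thesis using \<open>u = c # u'\<close> Cons by (auto simp: in_keys_iff lookup_single when_def)
    qed (auto simp: Cons lookup_single when_def)
  qed (auto simp: lookup_single when_def)
  have 1: "lookup (bas u \<diamondop> q) [m] = lookup (bas u) [m] * lookup q [] + lookup (bas u) [] * lookup q [m]" for u
    by (rule qfunctional_eqI[OF qfunctional_compose[OF qlinear_shuffle_right qfunctional_lookup], where p = q])
       (auto intro!: qfunctionalI simp: lookup_add w algebra_simps)
  show ?thesis
    by (rule qfunctional_eqI[OF qfunctional_compose[OF qlinear_shuffle_left qfunctional_lookup], where p = p])
       (auto intro!: qfunctionalI simp: lookup_add 1 algebra_simps simp del: shuffle_bas)
qed

lemma lookup_shuffle_Nil: "lookup (p \<diamondop> q) [] = lookup p [] * lookup q []"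
proof -
  have w: "lookup (shuffle_words u v) [] = lookup (bas u) [] * lookup (bas v) []" for u v :: "'a list"
  proof (cases "u = [] \<or> v = []")
    case False
    then have "[] \<notin> keys (shuffle_words u v)" using mset_shuffle_words[of "[]" u v] by auto
    then show ?thesis using False by (auto simp: in_keys_iff lookup_single when_def)
  qed (auto simp: lookup_single when_def)
  have 1: "lookup (bas u \<diamondop> q) [] = lookup (bas u) [] * lookup q []" for u
    by (rule qfunctional_eqI[OF qfunctional_compose[OF qlinear_shuffle_right qfunctional_lookup], where p = q])
       (auto intro!: qfunctionalI simp: lookup_add w algebra_simps)
  show ?thesis
    by (rule qfunctional_eqI[OF qfunctional_compose[OF qlinear_shuffle_left qfunctional_lookup], where p = p])
       (auto intro!: qfunctionalI simp: lookup_add 1 algebra_simps simp del: shuffle_bas)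
qed

section \<open>Components of the coaction with a one-letter left factor\<close>

lemma segment_Suc [simp]: "segment a p (Suc p) = []"
  by (simp add: segment_def)

lemma segments_prod_consecutive: "segments_prod a [p..<q] = bas []"
proof (induction "q - p" arbitrary: p)
  case (Suc d)
  show ?case
  proof (cases "Suc p < q")
    case True
    then have "[p..<q] = p # Suc p # [Suc (Suc p)..<q]" by (simp add: upt_conv_Cons del: upt_Suc)
    moreover have "segments_prod a (Suc p # [Suc (Suc p)..<q]) = bas []"
      using Suc(1)[of "Suc p"] Suc(2) True by (simp add: upt_conv_Cons del: upt_Suc)
    ultimately show ?thesis by simp
  next
    case False
    then have "[p..<q] = [p]" using Suc(2) by (simp add: upt_conv_Cons del: upt_Suc)
    then show ?thesis by simp
  qed
qed simp

lemma segments_prod_one_gap: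
  assumes "p \<le> k" "q < L"
  shows "segments_prod a ([p..<Suc k] @ [q..<L]) = path_fun (a ! k) (segment a k q) (a ! q)"
  using assms(1)
proof (induction "k - p" arbitrary: p)
  case 0
  then have "[p..<Suc k] @ [q..<L] = k # q # [Suc q..<L]" using assms(2) by (simp add: upt_conv_Cons del: upt_Suc)
  moreover have "segments_prod a (q # [Suc q..<L]) = bas []"
    using segments_prod_consecutive[of a q L] assms(2) by (simp add: upt_conv_Cons del: upt_Suc)
  ultimately show ?case by simp
next
  case (Suc d)
  then have "[p..<Suc k] @ [q..<L] = p # Suc p # ([Suc (Suc p)..<Suc k] @ [q..<L])"
    by (simp add: upt_conv_Cons del: upt_Suc)
  moreover have "segments_prod a (Suc p # ([Suc (Suc p)..<Suc k] @ [q..<L])) = path_fun (a ! k) (segment a k q) (a ! q)"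
    using Suc(1)[of "Suc p"] Suc(2,3) by (simp add: upt_conv_Cons del: upt_Suc)
  ultimately show ?case by simp
qed

lemma length_segment: "q \<le> length a \<Longrightarrow> length (segment a p q) = q - Suc p"
  by (simp add: segment_def)

context mixed_tate_Z
begin

lemma lookup_psi_homog:
  assumes "x \<in> homog length l" "sum_list u \<noteq> l"
  shows "lookup (\<psi> x) u = 0"
proof (rule ccontr)
  assume "lookup (\<psi> x) u \<noteq> 0"
  then have "u \<in> keys (\<psi> x)" by (simp add: in_keys_iff)
  then show False using psi_weight[OF assms(1)] assms(2) by (simp add: homog_def)
qed

lemma path_fun_homog: "path_fun x w y \<in> homog length (length w)"
  by (rule path_fun_in(2)[OF order_refl])

text \<open>A nonempty segment has positive weight, hence no constant term; a nonzero counit forces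
  all cuts to be adjacent.\<close>

lemma segments_prod_counit:
  assumes "sorted_wrt (<) (p # ps)" "last (p # ps) < length a" "lookup (\<psi> (segments_prod a (p # ps))) [] \<noteq> 0"
  shows "p # ps = [p..<Suc (last (p # ps))]"
  using assms
proof (induction ps arbitrary: p)
  case (Cons q ps)
  have e: "lookup (\<psi> (path_fun (a ! p) (segment a p q) (a ! q))) [] \<noteq> 0" "lookup (\<psi> (segments_prod a (q # ps))) [] \<noteq> 0"
    using Cons.prems(3) by (auto simp: psi_mult lookup_shuffle_Nil)
  have "q \<le> last (q # ps)"
    using Cons.prems(1) last_in_set[of ps] by (cases "ps = []") (auto simp: less_imp_le)
  then have "q < length a" using Cons.prems(2) by simp
  then have "q = Suc p"
    using e(1) lookup_psi_homog[OF path_fun_homog[of "a ! p" "segment a p q" "a ! q"], of "[]"] length_segment[of q a p] Cons.prems(1) by fastforce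
  moreover have "q # ps = [q..<Suc (last (q # ps))]" using Cons.IH[of q] Cons.prems e(2) by auto
  moreover have "p < Suc (last (q # ps))"
    using sorted_wrt_last[OF Cons.prems(1)] by simp
  ultimately show ?case by (metis last_ConsR list.distinct(1) upt_conv_Cons)
qed simp

text \<open>By the derivation property only one segment can be nonempty, and by weight it has length
  \<open>m\<close>. The cuts are then all positions outside one interval.\<close>

lemma segments_prod_primitive:
  assumes "sorted_wrt (<) (p # ps)" "last (p # ps) < length a" "lookup (\<psi> (segments_prod a (p # ps))) [m] \<noteq> 0"
  shows "\<exists>k. p \<le> k \<and> k + m + 1 \<le> last (p # ps) \<and> p # ps = [p..<Suc k] @ [k + m + 1..<Suc (last (p # ps))]"
  using assms
proof (induction ps arbitrary: p)
  case Nil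
  then show ?case using psi_one by (simp add: lookup_single)
next
  case (Cons q ps)
  let ?x = "path_fun (a ! p) (segment a p q) (a ! q)" and ?y = "segments_prod a (q # ps)"
  have qp: "p < q" "sorted_wrt (<) (q # ps)" "last (q # ps) < length a" using Cons.prems by auto
  have ql: "q \<le> last (q # ps)" using qp(2) last_in_set[of ps] by (cases "ps = []") (auto simp: less_imp_le)
  show ?case
  proof (cases "q = Suc p")
    case True
    then have "lookup (\<psi> ?y) [m] \<noteq> 0" using Cons.prems(3) by simp
    then obtain k where k: "q \<le> k" "k + m + 1 \<le> last (q # ps)" "q # ps = [q..<Suc k] @ [k + m + 1..<Suc (last (q # ps))]"
      using Cons.IH[OF qp(2,3)] by blast
    have "p # q # ps = [p..<Suc k] @ [k + m + 1..<Suc (last (p # q # ps))]"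
      using k(1,3) True by (simp add: upt_conv_Cons del: upt_Suc)
    then show ?thesis using k True by (intro exI[of _ k]) auto
  next
    case False
    have len: "length (segment a p q) = q - Suc p" using ql qp(3) by (intro length_segment) simp
    then have "lookup (\<psi> ?x) [] = 0" using False qp(1) by (intro lookup_psi_homog[OF path_fun_homog]) simp
    then have *: "lookup (\<psi> ?x) [m] \<noteq> 0" "lookup (\<psi> ?y) [] \<noteq> 0"
      using Cons.prems(3) by (auto simp: psi_mult lookup_shuffle_single)
    have "q - Suc p = m" using lookup_psi_homog[OF path_fun_homog[of "a ! p" "segment a p q" "a ! q"], of "[m]"] *(1) len by auto
    then have q: "q = p + m + 1" using qp(1) by simp
    have "[p..<Suc p] @ [q..<Suc (last (p # q # ps))] = p # [q..<Suc (last (q # ps))]" by simp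
    also have "\<dots> = p # q # ps"
      by (rule arg_cong[OF segments_prod_counit[OF qp(2,3) *(2), symmetric]])
    finally have "p # q # ps = [p..<Suc p] @ [p + m + 1..<Suc (last (p # q # ps))]" unfolding q by (rule sym)
    moreover have "p + m + 1 \<le> last (p # q # ps)" using ql q by simp
    ultimately show ?thesis by blast
  qed
qed

lemma sorted_list_of_two_intervals:
  assumes "k + m \<le> N"
  shows "sorted_list_of_set ({1..k} \<union> {k + m + 1..N}) = [1..<Suc k] @ [k + m + 1..<Suc N]"
  by (rule sorted_distinct_set_unique) (use assms in \<open>auto simp: sorted_append\<close>)

lemma upt_marks:
  assumes "k + m \<le> N"
  shows "0 # ([1..<Suc k] @ [k + m + 1..<Suc N]) @ [N + 1] = [0..<Suc k] @ [k + m + 1..<Suc (Suc N)]"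
proof -
  have "[0..<Suc k] = 0 # [1..<Suc k]" by (simp add: upt_conv_Cons del: upt_Suc)
  moreover have "[k + m + 1..<Suc (Suc N)] = [k + m + 1..<Suc N] @ [Suc N]"
    by (rule upt_Suc_append) (use assms in simp)
  ultimately show ?thesis by (simp del: upt_Suc)
qed

lemma marks_eq_two_intervals:
  assumes S: "S \<subseteq> {1..N}" and k: "k + m + 1 \<le> N + 1"
    "0 # sorted_list_of_set S @ [N + 1] = [0..<Suc k] @ [k + m + 1..<Suc (N + 1)]"
  shows "S = {1..k} \<union> {k + m + 1..N}"
proof -
  have fin: "finite S" using S finite_subset by blast
  have "insert 0 (insert (N + 1) S) = {0..<Suc k} \<union> {k + m + 1..<Suc (N + 1)}"
    using arg_cong[OF k(2), of set]
    by (simp only: list.set set_append set_upt set_sorted_list_of_set[OF fin] Un_insert_right Un_empty_right)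
  then have "insert 0 (insert (N + 1) S) - {0, N + 1} = ({0..<Suc k} \<union> {k + m + 1..<Suc (N + 1)}) - {0, N + 1}"
    by simp
  moreover have "insert 0 (insert (N + 1) S) - {0, N + 1} = S" using S by auto
  moreover have "({0..<Suc k} \<union> {k + m + 1..<Suc (N + 1)}) - {0, N + 1} = {1..k} \<union> {k + m + 1..N}"
    using k(1) by auto
  ultimately show ?thesis by simp
qed

lemma subword_two_intervals:
  assumes "k + m \<le> length w"
  shows "subword w ({1..k} \<union> {k + m + 1..length w}) = take k w @ drop (k + m) w"
proof -
  let ?A = "E0 # w @ [E1]"
  have "subword w ({1..k} \<union> {k + m + 1..length w}) = map ((!) ?A) ([1..<Suc k] @ [k + m + 1..<Suc (length w)])"
    using sorted_list_of_two_intervals[OF assms] assms by (subst subword_eq) auto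
  also have "map ((!) ?A) [1..<Suc k] = take k w"
    by (rule nth_equalityI) (use assms in \<open>auto simp: nth_append simp del: upt_Suc\<close>)
  moreover have "map ((!) ?A) [k + m + 1..<Suc (length w)] = drop (k + m) w"
    by (rule nth_equalityI) (use assms in \<open>auto simp: nth_append simp del: upt_Suc\<close>)
  ultimately show ?thesis by simp
qed

lemma segment_prod_two_intervals:
  assumes "k + m \<le> length w"
  shows "segment_prod w ({1..k} \<union> {k + m + 1..length w}) =
    path_fun ((E0 # w @ [E1]) ! k) (take m (drop k w)) ((E0 # w @ [E1]) ! (k + m + 1))"
proof -
  let ?A = "E0 # w @ [E1]"
  have "segment_prod w ({1..k} \<union> {k + m + 1..length w}) = segments_prod ?A ([0..<Suc k] @ [k + m + 1..<Suc (Suc (length w))])"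
    unfolding segment_prod_eq sorted_list_of_two_intervals[OF assms]
    by (simp only: upt_marks[OF assms])
  also have "\<dots> = path_fun (?A ! k) (segment ?A k (k + m + 1)) (?A ! (k + m + 1))"
    by (rule segments_prod_one_gap) (use assms in auto)
  also have "segment ?A k (k + m + 1) = take m (drop k w)"
    using assms by (simp add: segment_def drop_take)
  finally show ?thesis .
qed

text \<open>Only complements of an interval contribute to the part of the coaction with left factor of depth one.\<close>

lemma lookup_psi_pair:
  assumes m: "0 < m" "m \<le> length w"
  shows "lookup (\<psi> (bas w)) (m # v) = (\<Sum>k\<le>length w - m.
    lookup (\<psi> (path_fun ((E0 # w @ [E1]) ! k) (take m (drop k w)) ((E0 # w @ [E1]) ! (k + m + 1)))) [m] *
    lookup (\<psi> (bas (take k w @ drop (k + m) w))) v)"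
proof -
  let ?N = "length w" and ?S = "\<lambda>k. {1..k} \<union> {k + m + 1..length w}"
  let ?t = "\<lambda>S. lookup (\<psi> (segment_prod w S)) [m] * lookup (\<psi> (bas (subword w S))) v"
  have "lookup (\<psi> (bas w)) (m # v) = lookup (contract_left (\<lambda>p. lookup p [m]) (deconc (\<psi> (bas w)))) v"
    by (simp add: lookup_deconc)
  also have "\<dots> = (\<Sum>S\<in>Pow {1..?N}. ?t S)"
    by (simp add: contract_left_deconc_psi[OF qfunctional_lookup] lookup_sum)
  also have "\<dots> = (\<Sum>S\<in>?S ` {..?N - m}. ?t S)"
  proof (rule sum.mono_neutral_right)
    show "?S ` {..?N - m} \<subseteq> Pow {1..?N}" using m by auto
    show "\<forall>S\<in>Pow {1..?N} - ?S ` {..?N - m}. ?t S = 0"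
    proof safe
      fix S assume S: "S \<subseteq> {1..?N}" "S \<notin> ?S ` {..?N - m}"
      have "lookup (\<psi> (segment_prod w S)) [m] = 0"
      proof (rule ccontr)
        assume "lookup (\<psi> (segment_prod w S)) [m] \<noteq> 0"
        then obtain k where k: "k + m + 1 \<le> ?N + 1"
            "0 # sorted_list_of_set S @ [?N + 1] = [0..<Suc k] @ [k + m + 1..<Suc (?N + 1)]"
          using segments_prod_primitive[OF sorted_wrt_marks[OF S(1)], of "E0 # w @ [E1]" m]
          unfolding segment_prod_eq by auto
        have "S = ?S k" by (rule marks_eq_two_intervals[OF S(1) k])
        then show False using S(2) k(1) by auto
      qed
      then show "?t S = 0" by simp
    qed
  qed simp
  also have "\<dots> = (\<Sum>k\<le>?N - m. ?t (?S k))"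
  proof (rule sum.reindex_cong[of ?S])
    show "inj_on ?S {..?N - m}"
    proof (rule linorder_inj_onI)
      fix k l assume kl: "k < l" "k \<in> {..?N - m}" "l \<in> {..?N - m}"
      have "Suc k \<in> ?S l" "Suc k \<notin> ?S k" using kl m by auto
      then show "?S k \<noteq> ?S l" by blast
    qed auto
  qed auto
  also have "\<dots> = (\<Sum>k\<le>?N - m.
    lookup (\<psi> (path_fun ((E0 # w @ [E1]) ! k) (take m (drop k w)) ((E0 # w @ [E1]) ! (k + m + 1)))) [m] *
    lookup (\<psi> (bas (take k w @ drop (k + m) w))) v)"
  proof (rule sum.cong[OF refl])
    fix k assume "k \<in> {..?N - m}"
    then have "k + m \<le> ?N" using m by auto
    then show "?t (?S k) = lookup (\<psi> (path_fun ((E0 # w @ [E1]) ! k) (take m (drop k w)) ((E0 # w @ [E1]) ! (k + m + 1)))) [m] *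
        lookup (\<psi> (bas (take k w @ drop (k + m) w))) v"
      by (simp only: segment_prod_two_intervals subword_two_intervals)
  qed
  finally show ?thesis .
qed

text \<open>Since \<psi> kills multiples of e^0, a shuffle with e^0 yields a recursion: moving one
  e^0 from the right of e^1 to the left costs the factor \<open>- (j + 1) / (i + 1)\<close>.\<close>

lemma psi_single_E1:
  "lookup (\<psi> (bas (replicate i E0 @ E1 # replicate j E0))) [Suc (i + j)] =
     (-1) ^ i * of_nat ((i + j) choose i) * zeta_coeff (Suc (i + j))"
proof (induction i arbitrary: j)
  case 0
  then show ?case by (simp add: zeta_coeff_def zeta_elt_single)
next
  case (Suc i)
  let ?x = "\<lambda>i j. lookup (\<psi> (bas (replicate i E0 @ E1 # replicate j E0))) [Suc (Suc i + j)]"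
  have "0 = \<psi> (bas [E0] \<diamondop> bas (replicate i E0 @ E1 # replicate j E0))" by (rule psi_shuffle_E0[symmetric])
  also have "bas [E0] \<diamondop> bas (replicate i E0 @ E1 # replicate j E0) =
      qscale (of_nat (Suc i)) (bas (replicate (Suc i) E0 @ E1 # replicate j E0)) +
      qscale (of_nat (Suc j)) (bas (replicate i E0 @ E1 # replicate (Suc j) E0))"
    unfolding shuffle_bas shuffle_E0_replicate_E1 shuffle_E0_replicate by (simp only: lin_ext_scale lin_ext_bas)
  finally have sum0: "0 = qscale (of_nat (Suc i)) (\<psi> (bas (replicate (Suc i) E0 @ E1 # replicate j E0))) +
      qscale (of_nat (Suc j)) (\<psi> (bas (replicate i E0 @ E1 # replicate (Suc j) E0)))"
    by (simp only: psi_add psi_scale)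
  have W: "Suc (i + Suc j) = Suc (Suc i + j)" by simp
  from arg_cong[OF sum0, of "\<lambda>p. lookup p [Suc (Suc i + j)]"]
  have "of_nat (Suc i) * lookup (\<psi> (bas (replicate (Suc i) E0 @ E1 # replicate j E0))) [Suc (Suc i + j)] =
      - (of_nat (Suc j) * lookup (\<psi> (bas (replicate i E0 @ E1 # replicate (Suc j) E0))) [Suc (i + Suc j)])"
    unfolding W by (simp only: lookup_add lookup_qscale lookup_zero eq_neg_iff_add_eq_0)
  also have "lookup (\<psi> (bas (replicate i E0 @ E1 # replicate (Suc j) E0))) [Suc (i + Suc j)] =
      (-1) ^ i * of_nat ((i + Suc j) choose i) * zeta_coeff (Suc (i + Suc j))" by (rule Suc.IH)
  finally have eq: "of_nat (Suc i) * lookup (\<psi> (bas (replicate (Suc i) E0 @ E1 # replicate j E0))) [Suc (Suc i + j)] =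
      (-1) ^ Suc i * of_nat (Suc j * ((i + Suc j) choose i)) * zeta_coeff (Suc (i + Suc j))" by (simp add: algebra_simps)
  have "Suc j * ((i + Suc j) choose i) = Suc i * ((Suc i + j) choose Suc i)"
    using Suc_times_binomial_add[of i j] by (simp add: mult.commute)
  then have "of_nat (Suc i) * lookup (\<psi> (bas (replicate (Suc i) E0 @ E1 # replicate j E0))) [Suc (Suc i + j)] =
      of_nat (Suc i) * ((-1) ^ Suc i * of_nat ((Suc i + j) choose Suc i) * zeta_coeff (Suc (Suc i + j)))"
    unfolding eq by (simp only: of_nat_mult add_Suc_right add_Suc mult.assoc mult.left_commute)
  then show ?case by (simp only: mult_cancel_left of_nat_eq_0_iff) simp
qed

end

section \<open>Annihilators with respect to the pairing, and double zeta values\<close>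

lemma pairing_superset:
  assumes "finite K" "keys l \<subseteq> K"
  shows "pairing l p = (\<Sum>k\<in>K. lookup l k * lookup p k)"
  unfolding pairing_def by (rule sum.mono_neutral_left) (use assms in \<open>auto simp: in_keys_iff\<close>)

lemma qfunctional_pairing: "qfunctional (pairing l)"
  by (rule qfunctionalI) (simp_all add: pairing_def lookup_add distrib_left sum.distrib sum_distrib_left mult.left_commute)

lemma pairing_commute: "pairing l p = pairing p l"
  using pairing_superset[of "keys l \<union> keys p" l p] pairing_superset[of "keys l \<union> keys p" p l]
  by (simp add: mult.commute)

lemma qfunctional_pairing_left: "qfunctional (\<lambda>l. pairing l p)"
  unfolding pairing_commute[of _ p] by (rule qfunctional_pairing)

lemma pairing_self_eq_0: "pairing p p = 0 \<Longrightarrow> p = 0"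
  unfolding pairing_def
  by (subst (asm) sum_nonneg_eq_0_iff) (auto intro!: poly_mapping_eqI simp: in_keys_iff)

text \<open>\<open>T\<close> pairs with a basis of \<open>W\<close> and sums up, so its kernel is
  the annihilator. It is injective on \<open>W\<close>, because the pairing is positive definite
  over \<rat>; hence its image is all of \<open>W\<close>.\<close>

lemma dim_annihilator:
  assumes K: "finite K" and W: "qvs.subspace W" "W \<subseteq> {p. keys p \<subseteq> K}"
  shows "qvs.dim {l. keys l \<subseteq> K \<and> (\<forall>p\<in>W. pairing l p = 0)} + qvs.dim W = card K"
proof -
  let ?V = "{p. keys p \<subseteq> K}"
  have spanV: "?V \<subseteq> qvs.span (bas ` K)" and finK: "finite (bas ` K)" using K by (auto simp: span_bas)
  obtain B where B: "B \<subseteq> W" "qvs.independent B" "finite B" "W \<subseteq> qvs.span B" "card B = qvs.dim W"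
    by (rule qvs.finite_basis_in_span[of W "bas ` K"]) (use W(2) spanV finK in auto)
  define T where "T l = (\<Sum>b\<in>B. qscale (pairing l b) b)" for l
  have lin: "qlinear T"
    by (rule qlinearI)
       (simp_all add: T_def qfunctional_add[OF qfunctional_pairing_left] qfunctional_scale[OF qfunctional_pairing_left]
          qvs.scale_left_distrib sum.distrib qvs.scale_sum_right)
  have T0: "T l = 0 \<longleftrightarrow> (\<forall>p\<in>W. pairing l p = 0)" for l
  proof
    assume "T l = 0"
    then have b: "pairing l b = 0" if "b \<in> B" for b
      using qvs.independentD[OF B(2,3), of "pairing l"] that by (auto simp: T_def)
    show "\<forall>p\<in>W. pairing l p = 0"
    proof
      fix p assume "p \<in> W"
      then have "p \<in> qvs.span B" using B by auto
      then show "pairing l p = 0"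
        by (induction rule: qvs.span_induct_alt)
           (simp_all add: qfunctional_zero[OF qfunctional_pairing] qfunctional_add[OF qfunctional_pairing]
             qfunctional_scale[OF qfunctional_pairing] b)
    qed
  qed (use B(1) in \<open>auto simp: T_def intro!: sum.neutral\<close>)
  have TW: "T l \<in> W" for l
    unfolding T_def by (intro qvs.subspace_sum qvs.subspace_scale W(1)) (use B(1) in auto)
  have "qvs.dim (T ` W) = qvs.dim W"
  proof (rule qvp.dim_image_injective[OF lin W(1)])
    show "W \<subseteq> qvs.span (bas ` K)" using W(2) spanV by auto
    show "v = 0" if "v \<in> W" "T v = 0" for v using that T0 pairing_self_eq_0 by blast
  qed (rule finK)
  moreover have "qvs.dim (T ` W) \<le> qvs.dim (T ` ?V)" "qvs.dim (T ` ?V) \<le> qvs.dim W"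
  proof -
    have "W \<subseteq> qvs.span (bas ` K)" using W(2) spanV by auto
    moreover have "T ` ?V \<subseteq> W" using TW by auto
    moreover have "T ` W \<subseteq> T ` ?V" using W(2) by auto
    ultimately show "qvs.dim (T ` W) \<le> qvs.dim (T ` ?V)" "qvs.dim (T ` ?V) \<le> qvs.dim W"
      using qvs.dim_mono_in_span[OF _ _ finK] by (meson subset_trans)+
  qed
  ultimately have "qvs.dim (T ` ?V) = qvs.dim W" by simp
  moreover have "qvs.dim ?V = qvs.dim (T ` ?V) + qvs.dim {l \<in> ?V. T l = 0}"
    by (rule qvp.rank_nullity[OF lin subspace_keys spanV finK])
  ultimately show ?thesis using dim_keys[OF K] by (simp add: T0)
qed

lemma nth_double_zeta_word:
  assumes "1 \<le> a" "1 \<le> b" "i < a + b"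
  shows "(E1 # replicate (a - 1) E0 @ E1 # replicate (b - 1) E0) ! i = (if i = 0 \<or> i = a then E1 else E0)"
  using assms by (auto simp: nth_Cons nth_append split: nat.splits)

lemma zeta_elt_double: "zeta_elt [a, b] = bas (E1 # replicate (a - 1) E0 @ E1 # replicate (b - 1) E0)"
  by (simp add: zeta_elt_def)

context mixed_tate_Z
begin

lemma lookup_psi_no_E1:
  assumes "E1 \<notin> set w"
  shows "lookup (\<psi> (path_fun x w y)) [m] = 0"
  using psi_depth_length[OF path_fun_in(1)[of w 0 x y], of "[m]"] assms
  by (auto simp: count_list_0_iff in_keys_iff)

lemma path_fun_same: "w \<noteq> [] \<Longrightarrow> path_fun x w x = 0"
  by (cases x; cases w) auto

lemma lookup_psi_zero [simp]: "lookup (\<psi> 0) u = 0"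
  by (simp add: psi_zero)

text \<open>An interval of length \<open>m\<close> counts only if its bounding letters differ and it
  contains an e^1. This leaves \<open>k = 0\<close> (left bound the initial e^0),
  \<open>k = 1\<close> (left bound the first e^1 of the word) and \<open>k = n\<close> (right bound
  the final e^1), one for each summand.\<close>

lemma lookup_psi_double_zeta:
  assumes ab: "1 \<le> a" "1 \<le> b" "a + b = m + n" and mn: "odd m" "3 \<le> m" "odd n" "3 \<le> n"
  shows "lookup (\<psi> (zeta_elt [a, b])) [m, n] = zeta_coeff m * zeta_coeff n *
    ((if m = a then 1 else 0) + (-1) ^ a * of_nat ((m - 1) choose (a - 1)) - (-1) ^ b * of_nat ((m - 1) choose (b - 1)))"
proof -
  define w where "w = E1 # replicate (a - 1) E0 @ E1 # replicate (b - 1) E0"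
  define A where "A = E0 # w @ [E1]"
  have len: "length w = a + b" using ab by (simp add: w_def)
  have nthw: "w ! i = (if i = 0 \<or> i = a then E1 else E0)" if "i < a + b" for i
    unfolding w_def by (rule nth_double_zeta_word[OF ab(1,2) that])
  have A0: "A ! 0 = E0" and AN: "A ! (a + b + 1) = E1" by (simp_all add: A_def nth_append len)
  have AS: "A ! (Suc i) = (if i = 0 \<or> i = a then E1 else E0)" if "i < a + b" for i
    using nthw[OF that] that by (simp add: A_def nth_append len)
  define T where "T k = lookup (\<psi> (path_fun (A ! k) (take m (drop k w)) (A ! (k + m + 1)))) [m] *
    lookup (\<psi> (bas (take k w @ drop (k + m) w))) [n]" for k
  have seg_ne: "take m (drop k w) \<noteq> []" if "k \<le> n" for k using that mn ab len by auto
  have noE1: "E1 \<notin> set (take m (drop k w))" if "k \<le> n" "0 < k" "\<not> (k \<le> a \<and> a < k + m)" for k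
  proof
    assume "E1 \<in> set (take m (drop k w))"
    then obtain i where i: "i < m" "k + i < a + b" "w ! (k + i) = E1"
      using that ab len by (auto simp: in_set_conv_nth)
    then have "k + i = a" using nthw[of "k + i"] that(2) by (auto split: if_splits)
    then show False using that(3) i(1) by auto
  qed
  have T0: "T 0 = (if m = a then zeta_coeff m * zeta_coeff n else 0)"
  proof (cases "m = a")
    case True
    then have "b = n" using ab by simp
    have "A ! (0 + m + 1) = E1" using AS[of m] True ab by simp
    moreover have "take m (drop 0 w) = E1 # replicate (m - 1) E0" "drop (0 + m) w = E1 # replicate (n - 1) E0"
      using True ab by (simp_all add: w_def \<open>b = n\<close> take_Cons' drop_Cons')
    ultimately show ?thesis
      unfolding T_def A0 using True by (simp add: zeta_coeff_def zeta_elt_single)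
  next
    case False
    then have "A ! (0 + m + 1) = E0" using AS[of m] ab mn by simp
    then show ?thesis
      unfolding T_def A0 using False path_fun_same[OF seg_ne[of 0], of E0] by simp
  qed
  \<comment> \<open>The path runs from 1 to 0, so the segment is reversed with sign
    \<open>(-1) ^ m\<close>; with \<open>(-1) ^ (m - a)\<close> from \<open>psi_single_E1\<close>
    this leaves \<open>(-1) ^ a\<close>. For \<open>m < a\<close> the binomial coefficient is
    0.\<close>
  have T1: "T 1 = zeta_coeff m * zeta_coeff n * ((-1) ^ a * of_nat ((m - 1) choose (a - 1)))"
  proof (cases "m < a")
    case True
    have "lookup (\<psi> (path_fun (A ! 1) (take m (drop 1 w)) (A ! (1 + m + 1)))) [m] = 0"
    proof (cases "m = a - 1")
      case True
      have "A ! 1 = A ! (1 + m + 1)" using AS[of 0] AS[of a] True ab mn by simp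
      then show ?thesis using path_fun_same[OF seg_ne[of 1]] mn by simp
    next
      case False
      then show ?thesis using noE1[of 1] True mn by (intro lookup_psi_no_E1) auto
    qed
    moreover have "(m - 1) choose (a - 1) = 0" using True mn by simp
    ultimately show ?thesis unfolding T_def by simp
  next
    case False
    have "A ! 1 = E1" using AS[of 0] ab mn by simp
    moreover have "A ! (1 + m + 1) = E0" using AS[of "m + 1"] False ab mn by simp
    moreover have seg: "take m (drop 1 w) = replicate (a - 1) E0 @ E1 # replicate (m - a) E0"
      using False ab mn by (simp add: w_def take_Cons')
    moreover have "drop (1 + m) w = replicate (n - 1) E0"
      using False ab mn by (simp add: w_def drop_Cons')
    moreover have "take 1 w = [E1]" by (simp add: w_def)
    moreover have "length (replicate (a - 1) E0 @ E1 # replicate (m - a) E0) = m" using False ab by simp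
    ultimately have "T 1 = (-1) ^ m * lookup (\<psi> (bas (replicate (m - a) E0 @ E1 # replicate (a - 1) E0))) [m] *
        lookup (\<psi> (bas (E1 # replicate (n - 1) E0))) [n]"
    proof -
      assume A1: "A ! 1 = E1" "A ! (1 + m + 1) = E0"
        and seg: "take m (drop 1 w) = replicate (a - 1) E0 @ E1 # replicate (m - a) E0"
        and rest: "drop (1 + m) w = replicate (n - 1) E0" "take 1 w = [E1]"
        and len: "length (replicate (a - 1) E0 @ E1 # replicate (m - a) E0) = m"
      have "path_fun E1 (replicate (a - 1) E0 @ E1 # replicate (m - a) E0) E0 =
          qscale ((-1) ^ m) (bas (replicate (m - a) E0 @ E1 # replicate (a - 1) E0))"
      proof -
        have "path_fun E1 v E0 = qscale ((-1) ^ length v) (bas (rev v))" if "v \<noteq> []" for v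
          using that by (cases v) auto
        from this[of "replicate (a - 1) E0 @ E1 # replicate (m - a) E0"] show ?thesis
          unfolding len by simp
      qed
      then show ?thesis unfolding T_def A1 seg rest by (simp add: psi_scale)
    qed
    moreover have "lookup (\<psi> (bas (replicate (m - a) E0 @ E1 # replicate (a - 1) E0))) [m] =
        (-1) ^ (m - a) * of_nat ((m - 1) choose (a - 1)) * zeta_coeff m"
      using psi_single_E1[of "m - a" "a - 1"] False ab mn binomial_symmetric[of "a - 1" "m - 1"]
      by (simp add: Suc_diff_le)
    moreover have "(-1) ^ m * (-1) ^ (m - a) = ((-1) ^ a :: rat)"
      using False by (simp add: power_add[symmetric] minus_one_power_iff)
    ultimately show ?thesis by (simp add: zeta_coeff_def zeta_elt_single mult_ac)
  qed
  \<comment> \<open>As \<open>m\<close> is odd, \<open>(-1) ^ (m - b)\<close> equals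
    \<open>- ((-1) ^ b)\<close>; this is the origin of the minus sign.\<close>
  have Tn: "T n = - (zeta_coeff m * zeta_coeff n * ((-1) ^ b * of_nat ((m - 1) choose (b - 1))))"
  proof (cases "a < n")
    case True
    have "lookup (\<psi> (path_fun (A ! n) (take m (drop n w)) (A ! (n + m + 1)))) [m] = 0"
    proof (cases "n = a + 1")
      case t: True
      have "A ! n = A ! (n + m + 1)" using AS[of a] AN t ab mn by (simp add: add.commute)
      then show ?thesis using path_fun_same[OF seg_ne[of n]] mn by simp
    next
      case False
      then show ?thesis using noE1[of n] True mn by (intro lookup_psi_no_E1) auto
    qed
    moreover have "(m - 1) choose (b - 1) = 0" using True ab mn by simp
    ultimately show ?thesis unfolding T_def by simp
  next
    case False
    have An: "A ! n = E0" using AS[of "n - 1"] False ab mn by (auto split: if_splits)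
    have AN': "A ! (n + m + 1) = E1" using AN ab by (simp add: add.commute)
    have seg: "take m (drop n w) = replicate (m - b) E0 @ E1 # replicate (b - 1) E0"
    proof -
      have "a - 1 - (n - 1) = m - b" using ab False mn by simp
      then show ?thesis using False ab mn by (simp add: w_def drop_Cons')
    qed
    have rest: "take n w = E1 # replicate (n - 1) E0" "drop (n + m) w = []"
      using False ab mn len by (simp_all add: w_def take_Cons')
    have "path_fun E0 (replicate (m - b) E0 @ E1 # replicate (b - 1) E0) E1 = bas (replicate (m - b) E0 @ E1 # replicate (b - 1) E0)"
      by (cases "m - b") auto
    then have "T n = lookup (\<psi> (bas (replicate (m - b) E0 @ E1 # replicate (b - 1) E0))) [m] *
        lookup (\<psi> (bas (E1 # replicate (n - 1) E0))) [n]"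
      unfolding T_def An AN' seg rest by simp
    moreover have "lookup (\<psi> (bas (replicate (m - b) E0 @ E1 # replicate (b - 1) E0))) [m] =
        (-1) ^ (m - b) * of_nat ((m - 1) choose (b - 1)) * zeta_coeff m"
      using psi_single_E1[of "m - b" "b - 1"] False ab mn binomial_symmetric[of "b - 1" "m - 1"]
      by (simp add: Suc_diff_le)
    moreover have "(-1) ^ (m - b) = (- ((-1) ^ b) :: rat)"
    proof -
      have "b \<le> m" using False ab by simp
      then have "even (m - b) \<longleftrightarrow> odd b" using mn by auto
      then show ?thesis by (simp add: minus_one_power_iff)
    qed
    ultimately show ?thesis by (simp add: zeta_coeff_def zeta_elt_single mult_ac)
  qed
  \<comment> \<open>For other \<open>k\<close> the bounding letters differ only if one of them is
    the second e^1 of the word, and then no e^1 is left inside.\<close>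
  have Tk: "T k = 0" if k: "k \<in> {..n} - {0, 1, n}" for k
  proof -
    have k2: "2 \<le> k" "k < n" using k by auto
    have "lookup (\<psi> (path_fun (A ! k) (take m (drop k w)) (A ! (k + m + 1)))) [m] = 0"
    proof (cases "A ! k = A ! (k + m + 1)")
      case True
      then show ?thesis using path_fun_same[OF seg_ne[of k]] k2 by simp
    next
      case False
      have "A ! k = (if k - 1 = a then E1 else E0)" using AS[of "k - 1"] k2 ab by auto
      moreover have "A ! (k + m + 1) = (if k + m = a then E1 else E0)" using AS[of "k + m"] k2 ab by auto
      ultimately have "k - 1 = a \<or> k + m = a" using False by (auto split: if_splits)
      then have "\<not> (k \<le> a \<and> a < k + m)" using k2 by auto
      then show ?thesis using noE1[of k] k2 by (intro lookup_psi_no_E1) auto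
    qed
    then show ?thesis unfolding T_def by simp
  qed
  have "lookup (\<psi> (zeta_elt [a, b])) [m, n] = (\<Sum>k\<le>length w - m. T k)"
    unfolding zeta_elt_double w_def[symmetric] T_def A_def
    by (rule lookup_psi_pair) (use mn ab len in auto)
  also have "length w - m = n" using ab len by simp
  also have "(\<Sum>k\<le>n. T k) = (\<Sum>k\<in>{0, 1, n}. T k)"
    by (rule sum.mono_neutral_right) (use Tk mn in auto)
  also have "\<dots> = T 0 + T 1 + T n" using mn by simp
  finally show ?thesis unfolding T0 T1 Tn by (simp add: algebra_simps)
qed

definition pair_words :: "nat \<Rightarrow> nat list set" where
  "pair_words N = {u \<in> odd_words N. length u = 2}"

lemma pair_words_iff: "u \<in> pair_words N \<longleftrightarrow> (\<exists>m n. u = [m, n] \<and> odd m \<and> 3 \<le> m \<and> odd n \<and> 3 \<le> n \<and> m + n = N)"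
  by (auto simp: pair_words_def odd_words_def length_Suc_conv numeral_2_eq_2)

lemma finite_pair_words: "finite (pair_words N)"
  unfolding pair_words_def using finite_odd_words by auto

text \<open>The annihilator of the depth-two part of \<A> in the dual of the two-letter words. It
  measures which combinations of these words \<A> misses.\<close>

definition double_relations :: "nat \<Rightarrow> (nat list \<Rightarrow>\<^sub>0 rat) set" where
  "double_relations N = {l. keys l \<subseteq> pair_words N \<and>
     (\<forall>a b. 1 \<le> a \<longrightarrow> 1 \<le> b \<longrightarrow> a + b = N \<longrightarrow> pairing l (\<psi> (zeta_elt [a, b])) = 0)}"

lemma double_relations_annihilate:
  assumes l: "l \<in> double_relations N" and x: "x \<in> depth_words 2"
  shows "pairing l (\<psi> x) = 0"
proof -
  have kl: "keys l \<subseteq> pair_words N" using l by (simp add: double_relations_def)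
  have zero: "pairing l y = 0" if "keys y \<inter> pair_words N = {}" for y
    unfolding pairing_def using that kl by (intro sum.neutral) (auto simp: in_keys_iff)
  have gen: "pairing l (\<psi> (zeta_elt ns)) = 0" if ns: "length ns \<le> 2" "\<forall>n\<in>set ns. 1 \<le> n" for ns
  proof (cases "length ns = 2")
    case True
    then obtain a b where ab: "ns = [a, b]" "1 \<le> a" "1 \<le> b" using ns(2) by (auto simp: length_Suc_conv numeral_2_eq_2)
    show ?thesis
    proof (cases "a + b = N")
      case True
      then show ?thesis using l ab by (simp add: double_relations_def)
    next
      case False
      have "zeta_elt [a, b] \<in> homog length (a + b)" using ab by (simp add: zeta_elt_double)
      then have "keys (\<psi> (zeta_elt [a, b])) \<subseteq> {u. sum_list u = a + b}" using psi_weight by (auto simp: homog_def)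
      then have "keys (\<psi> (zeta_elt [a, b])) \<inter> pair_words N = {}" using False by (auto simp: pair_words_def odd_words_def)
      then show ?thesis unfolding ab(1) by (rule zero)
    qed
  next
    case False
    have "zeta_elt ns \<in> depth_words 1"
      using False ns(1) count_zeta_elt[of ns] by (simp add: zeta_elt_def)
    then have "keys (\<psi> (zeta_elt ns)) \<inter> pair_words N = {}" using psi_depth_length by (fastforce simp: pair_words_def)
    then show ?thesis by (rule zero)
  qed
  have bas: "pairing l (\<psi> (bas w)) = 0" if "count_list w E1 \<le> 2" for w
    using word_mod_E0[of w]
  proof (induction rule: qvs.span_induct_alt)
    case (step c x y)
    have "pairing l (\<psi> x) = 0"
      using step.hyps gen that psi_shuffle_E0 qfunctional_zero[OF qfunctional_pairing] by auto
    then show ?case using step.IH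
      by (simp add: psi_add psi_scale qfunctional_add[OF qfunctional_pairing] qfunctional_scale[OF qfunctional_pairing])
  qed (simp add: psi_zero qfunctional_zero[OF qfunctional_pairing])
  have "x \<in> qvs.span (bas ` {w. count_list w E1 \<le> 2})" using x by (simp add: depth_words_eq_span)
  then show ?thesis
    by (induction rule: qvs.span_induct_alt)
       (auto simp: psi_zero psi_add psi_scale qfunctional_zero[OF qfunctional_pairing] bas
         qfunctional_add[OF qfunctional_pairing] qfunctional_scale[OF qfunctional_pairing])
qed

text \<open>Project to two-letter words. On depth two the kernel is exactly depth one, which already
  contains all words of length at most one; the image is measured by its annihilator.\<close>

lemma wt_dim_gr_A_2: "wt_dim (gr_A \<psi> 2) N + qvs.dim (double_relations N) = card (pair_words N)"
proof -
  define f where "f = lin_ext (\<lambda>u::nat list. if length u = 2 then bas u else 0)"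
  have lin: "qlinear f" unfolding f_def by (rule qlinear_lin_ext)
  have look: "lookup (f p) u = (if length u = 2 then lookup p u else 0)" for p u
    by (rule qfunctional_eqI[OF qfunctional_compose[OF lin qfunctional_lookup], where p = p])
       (auto intro!: qfunctionalI simp: lookup_add f_def lookup_single when_def)
  let ?V = "\<psi> ` depth_words 2 \<inter> homog sum_list N"
  have subV: "qvs.subspace ?V" by (rule qvs.subspace_inter[OF subspace_psi_depth subspace_homog])
  have kV: "keys p \<subseteq> odd_words N" if "p \<in> ?V" for p using psi_depth_subset[of 2 N] that by auto
  have "qvs.dim ?V = qvs.dim (f ` ?V) + qvs.dim {p \<in> ?V. f p = 0}"
    by (rule qvp.rank_nullity[OF lin subV psi_depth_span]) (simp add: finite_odd_words)
  moreover have "{p \<in> ?V. f p = 0} = \<psi> ` depth_words 1 \<inter> homog sum_list N"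
  proof (intro equalityI subsetI)
    fix p assume p: "p \<in> {p \<in> ?V. f p = 0}"
    have "length u \<le> 1" if u: "u \<in> keys p" for u
    proof -
      have "length u \<le> 2" using psi_depth_length p u by auto
      moreover have "length u \<noteq> 2" using look[of p u] p u by (auto simp: in_keys_iff)
      ultimately show ?thesis by simp
    qed
    then have "p \<in> \<psi> ` depth_words 1" unfolding psi_depth_1 using p kV[of p] by (auto simp: odd_words_def)
    then show "p \<in> \<psi> ` depth_words 1 \<inter> homog sum_list N" using p by auto
  next
    fix p assume p: "p \<in> \<psi> ` depth_words 1 \<inter> homog sum_list N"
    have "f p = 0"
    proof (rule poly_mapping_eqI)
      fix u
      show "lookup (f p) u = lookup 0 u"
        using psi_depth_length[of _ 1 u] p by (force simp: look in_keys_iff)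
    qed
    then show "p \<in> {p \<in> ?V. f p = 0}" using p depth_words_mono[of 1 2] by auto
  qed
  moreover have "qvs.dim (f ` ?V) + qvs.dim (double_relations N) = card (pair_words N)"
  proof -
    have sub: "f ` ?V \<subseteq> {p. keys p \<subseteq> pair_words N}"
    proof safe
      fix x u assume x: "x \<in> depth_words 2" "\<psi> x \<in> homog sum_list N" and u: "u \<in> keys (f (\<psi> x))"
      have "u \<in> keys (\<psi> x)" "length u = 2" using u by (auto simp: in_keys_iff look split: if_splits)
      then show "u \<in> pair_words N" using kV[of "\<psi> x"] x by (auto simp: pair_words_def)
    qed
    have pair: "pairing l (f p) = pairing l p" if "keys l \<subseteq> pair_words N" for l p
      unfolding pairing_def using that by (intro sum.cong) (auto simp: look pair_words_def)
    have "double_relations N = {l. keys l \<subseteq> pair_words N \<and> (\<forall>p\<in>f ` ?V. pairing l p = 0)}"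
    proof (intro equalityI subsetI)
      fix l assume l: "l \<in> double_relations N"
      then have kl: "keys l \<subseteq> pair_words N" by (simp add: double_relations_def)
      then show "l \<in> {l. keys l \<subseteq> pair_words N \<and> (\<forall>p\<in>f ` ?V. pairing l p = 0)}"
        using double_relations_annihilate[OF l] pair[OF kl] by auto
    next
      fix l assume l: "l \<in> {l. keys l \<subseteq> pair_words N \<and> (\<forall>p\<in>f ` ?V. pairing l p = 0)}"
      have "pairing l (\<psi> (zeta_elt [a, b])) = 0" if ab: "1 \<le> a" "1 \<le> b" "a + b = N" for a b
      proof -
        have "zeta_elt [a, b] \<in> depth_words 2" by (simp add: zeta_elt_double)
        moreover have "\<psi> (zeta_elt [a, b]) \<in> homog sum_list N"
          using ab by (intro psi_weight) (simp add: zeta_elt_double)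
        ultimately have "f (\<psi> (zeta_elt [a, b])) \<in> f ` ?V" by blast
        then have "pairing l (f (\<psi> (zeta_elt [a, b]))) = 0" using l by blast
        then show ?thesis using l pair[of l] by simp
      qed
      then show "l \<in> double_relations N" using l by (simp add: double_relations_def)
    qed
    then show ?thesis
      using dim_annihilator[OF finite_pair_words subspace_image_qlinear[OF lin subV] sub] by simp
  qed
  ultimately show ?thesis by (simp add: wt_dim_gr_A dim_A_def)
qed

end

subsection \<open>Homogeneous polynomial functions of two variables\<close>

definition fscale :: "rat \<Rightarrow> (rat \<Rightarrow> rat \<Rightarrow> rat) \<Rightarrow> (rat \<Rightarrow> rat \<Rightarrow> rat)" where
  "fscale c f = (\<lambda>x y. c * f x y)"

interpretation fvs: vector_space fscale
  by unfold_locales (auto simp: fscale_def fun_eq_iff algebra_simps)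

interpretation ffp: vector_space_pair fscale fscale ..

interpretation qfp: vector_space_pair "qscale :: rat \<Rightarrow> ('k \<Rightarrow>\<^sub>0 rat) \<Rightarrow> ('k \<Rightarrow>\<^sub>0 rat)" fscale ..

lemma flinearI:
  assumes "\<And>f g. T (f + g) = T f + T g" "\<And>c f. T (fscale c f) = fscale c (T f)"
  shows "Vector_Spaces.linear fscale fscale T"
  using assms by (simp add: Vector_Spaces.linear_iff fvs.vector_space_axioms)

text \<open>Homogeneous polynomials as functions: linear substitutions become compositions, and
  divisibility an equation of functions. The form x g + y h is not unique, but it provides an
  induction on the degree.\<close>

primrec hpoly :: "nat \<Rightarrow> (rat \<Rightarrow> rat \<Rightarrow> rat) set" where
  "hpoly 0 = {f. \<exists>c. f = (\<lambda>x y. c)}"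
| "hpoly (Suc n) = {f. \<exists>g\<in>hpoly n. \<exists>h\<in>hpoly n. f = (\<lambda>x y. x * g x y + y * h x y)}"

declare hpoly.simps(2) [simp del]

lemma hpoly_SucI: "g \<in> hpoly n \<Longrightarrow> h \<in> hpoly n \<Longrightarrow> (\<lambda>x y. x * g x y + y * h x y) \<in> hpoly (Suc n)"
  by (auto simp: hpoly.simps(2))

lemma hpoly_zero: "(\<lambda>x y. 0) \<in> hpoly n"
proof (induction n)
  case (Suc n)
  then show ?case using hpoly_SucI[OF Suc Suc] by simp
qed auto

lemma hpoly_lincomb: "f \<in> hpoly n \<Longrightarrow> g \<in> hpoly n \<Longrightarrow> (\<lambda>x y. c * f x y + d * g x y) \<in> hpoly n"
proof (induction n arbitrary: f g)
  case (Suc n)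
  obtain f1 f2 where f: "f1 \<in> hpoly n" "f2 \<in> hpoly n" "f = (\<lambda>x y. x * f1 x y + y * f2 x y)" using Suc.prems by (auto simp: hpoly.simps(2))
  obtain g1 g2 where g: "g1 \<in> hpoly n" "g2 \<in> hpoly n" "g = (\<lambda>x y. x * g1 x y + y * g2 x y)" using Suc.prems by (auto simp: hpoly.simps(2))
  have "(\<lambda>x y. c * f x y + d * g x y) =
      (\<lambda>x y. x * (c * f1 x y + d * g1 x y) + y * (c * f2 x y + d * g2 x y))"
    by (auto simp: f g fun_eq_iff algebra_simps)
  also have "\<dots> \<in> hpoly (Suc n)" by (intro hpoly_SucI Suc.IH f g)
  finally show ?case .
qed auto

lemma hpoly_add: "f \<in> hpoly n \<Longrightarrow> g \<in> hpoly n \<Longrightarrow> (\<lambda>x y. f x y + g x y) \<in> hpoly n"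
  using hpoly_lincomb[of f n g 1 1] by simp

lemma hpoly_diff: "f \<in> hpoly n \<Longrightarrow> g \<in> hpoly n \<Longrightarrow> (\<lambda>x y. f x y - g x y) \<in> hpoly n"
  using hpoly_lincomb[of f n g 1 "-1"] by simp

lemma hpoly_scale: "f \<in> hpoly n \<Longrightarrow> (\<lambda>x y. c * f x y) \<in> hpoly n"
  using hpoly_lincomb[of f n f c 0] by simp

lemma subspace_hpoly: "fvs.subspace (hpoly n)"
  unfolding fvs.subspace_def
  using hpoly_zero[of n] hpoly_add[of _ n] hpoly_scale[of _ n]
  by (auto simp: fscale_def zero_fun_def plus_fun_def)

lemma hpoly_mult: "f \<in> hpoly m \<Longrightarrow> g \<in> hpoly n \<Longrightarrow> (\<lambda>x y. f x y * g x y) \<in> hpoly (m + n)"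
proof (induction m arbitrary: f)
  case 0
  then show ?case using hpoly_scale by auto
next
  case (Suc m)
  obtain f1 f2 where f: "f1 \<in> hpoly m" "f2 \<in> hpoly m" "f = (\<lambda>x y. x * f1 x y + y * f2 x y)" using Suc.prems by (auto simp: hpoly.simps(2))
  have "(\<lambda>x y. f x y * g x y) = (\<lambda>x y. x * (f1 x y * g x y) + y * (f2 x y * g x y))"
    by (auto simp: f fun_eq_iff algebra_simps)
  also have "\<dots> \<in> hpoly (Suc (m + n))" by (intro hpoly_SucI Suc.IH f Suc.prems)
  finally show ?case by simp
qed

lemma hpoly_linear: "(\<lambda>x y. a * x + b * y) \<in> hpoly 1"
proof -
  have "(\<lambda>x y. x * (\<lambda>x y. a) x y + y * (\<lambda>x y. b) x y) \<in> hpoly (Suc 0)" by (rule hpoly_SucI) auto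
  then show ?thesis by (simp add: mult.commute)
qed

lemma hpoly_subst: "f \<in> hpoly n \<Longrightarrow> (\<lambda>x y. f (a * x + b * y) (c * x + d * y)) \<in> hpoly n"
proof (induction n arbitrary: f)
  case (Suc n)
  obtain f1 f2 where f: "f1 \<in> hpoly n" "f2 \<in> hpoly n" "f = (\<lambda>x y. x * f1 x y + y * f2 x y)" using Suc.prems by (auto simp: hpoly.simps(2))
  let ?s = "\<lambda>f x y. f (a * x + b * y) (c * x + d * y)"
  have "?s f = (\<lambda>x y. x * (a * ?s f1 x y + c * ?s f2 x y) + y * (b * ?s f1 x y + d * ?s f2 x y))"
    by (auto simp: f fun_eq_iff algebra_simps)
  also have "\<dots> \<in> hpoly (Suc n)" by (intro hpoly_SucI hpoly_lincomb Suc.IH f)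
  finally show ?case .
qed auto

lemma hpoly_homogeneous: "f \<in> hpoly n \<Longrightarrow> f (t * x) (t * y) = t ^ n * f x y"
proof (induction n arbitrary: f)
  case (Suc n)
  obtain f1 f2 where f: "f1 \<in> hpoly n" "f2 \<in> hpoly n" "f = (\<lambda>x y. x * f1 x y + y * f2 x y)" using Suc.prems by (auto simp: hpoly.simps(2))
  show ?case using Suc.IH[OF f(1)] Suc.IH[OF f(2)] by (simp add: f algebra_simps)
qed auto

lemma hpoly_even: "f \<in> hpoly n \<Longrightarrow> even n \<Longrightarrow> f (- x) (- y) = f x y"
  and hpoly_odd: "f \<in> hpoly n \<Longrightarrow> odd n \<Longrightarrow> f (- x) (- y) = - f x y"
  using hpoly_homogeneous[of f n "-1" x y] by auto

lemma hpoly_on_line: "f \<in> hpoly n \<Longrightarrow> \<exists>P. \<forall>t. f (x + t * u) (y + t * v) = poly P t"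
proof (induction n arbitrary: f)
  case 0
  then obtain c where "f = (\<lambda>x y. c)" by auto
  then show ?case by (intro exI[of _ "[:c:]"]) simp
next
  case (Suc n)
  obtain f1 f2 where f: "f1 \<in> hpoly n" "f2 \<in> hpoly n" "f = (\<lambda>x y. x * f1 x y + y * f2 x y)" using Suc.prems by (auto simp: hpoly.simps(2))
  obtain P1 P2 where P: "\<forall>t. f1 (x + t * u) (y + t * v) = poly P1 t" "\<forall>t. f2 (x + t * u) (y + t * v) = poly P2 t"
    using Suc.IH f by meson
  then show ?case by (intro exI[of _ "[:x, u:] * P1 + [:y, v:] * P2"]) (simp add: f algebra_simps)
qed

text \<open>Restrict to the line from \<open>(x, y)\<close> to \<open>(a, b)\<close>: there both
  factors are polynomials in one variable, and \<open>L\<close> is not the zero polynomial.\<close>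

lemma hpoly_no_zero_divisors:
  assumes L: "L \<in> hpoly m" "L a b \<noteq> 0" and f: "f \<in> hpoly n" and 0: "\<And>x y. L x y * f x y = 0"
  shows "f x y = 0"
proof -
  obtain PL Pf where P: "\<And>t. L (x + t * (a - x)) (y + t * (b - y)) = poly PL t"
      "\<And>t. f (x + t * (a - x)) (y + t * (b - y)) = poly Pf t"
    using hpoly_on_line[OF L(1)] hpoly_on_line[OF f] by meson
  have "poly (PL * Pf) t = 0" for t using 0 by (simp flip: P)
  then have "PL * Pf = 0" using poly_all_0_iff_0 by blast
  moreover have "PL \<noteq> 0" using P(1)[of 1] L(2) by auto
  ultimately have "Pf = 0" by simp
  then show ?thesis using P(2)[of 0] by simp
qed

lemma hpoly_factor_y: "f \<in> hpoly (Suc n) \<Longrightarrow> f 1 0 = 0 \<Longrightarrow> \<exists>g\<in>hpoly n. f = (\<lambda>x y. y * g x y)"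
proof (induction n arbitrary: f)
  case 0
  then show ?case by (auto simp: hpoly.simps(2))
next
  case (Suc n)
  obtain f1 f2 where f: "f1 \<in> hpoly (Suc n)" "f2 \<in> hpoly (Suc n)" "f = (\<lambda>x y. x * f1 x y + y * f2 x y)"
    using Suc.prems(1) by (auto simp only: hpoly.simps(2)[of "Suc n"])
  then have "f1 1 0 = 0" using Suc.prems(2) by simp
  then obtain g where g: "g \<in> hpoly n" "f1 = (\<lambda>x y. y * g x y)" using Suc.IH f(1) by blast
  have "f = (\<lambda>x y. y * (x * g x y + 1 * f2 x y))" by (auto simp: f g fun_eq_iff algebra_simps)
  moreover have "(\<lambda>x y. x * g x y + 1 * f2 x y) \<in> hpoly (Suc n)"
    using hpoly_add[OF hpoly_SucI[OF g(1) hpoly_zero] f(2)] by simp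
  ultimately show ?case by (intro bexI[of _ "\<lambda>x y. x * g x y + 1 * f2 x y"])
qed

lemma hpoly_ifI: "(if b then h = (\<lambda>x y. 0) else h \<in> hpoly n) \<Longrightarrow> h \<in> hpoly n"
  by (cases b) (auto simp: hpoly_zero)

text \<open>A linear change of variables moves the zero \<open>(a, b)\<close> to
  \<open>(1, 0)\<close>, where a factor y splits off.\<close>

lemma hpoly_factor:
  assumes f: "f \<in> hpoly n" "f a b = 0" and ab: "a \<noteq> 0 \<or> b \<noteq> 0"
  shows "\<exists>g. f = (\<lambda>x y. (b * x - a * y) * g x y) \<and> (if n = 0 then g = (\<lambda>x y. 0) else g \<in> hpoly (n - 1))"
proof (cases n)
  case 0
  then show ?thesis using f by auto
next
  case (Suc k)
  have det: "a * a + b * b \<noteq> 0" using ab by (metis sum_squares_eq_zero_iff)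
  \<comment> \<open>The matrix with rows (a, b) and (b, -a) sends (1, 0) to (a, b), and its square
    is a^2 + b^2 times the identity; so it is its own inverse up to the factor \<open>e\<close>
    below.\<close>
  define f' where "f' = (\<lambda>x y. f (a * x + b * y) (b * x + (- a) * y))"
  have "f' \<in> hpoly (Suc k)" unfolding f'_def using hpoly_subst f(1) Suc by blast
  moreover have "f' 1 0 = 0" using f(2) by (simp add: f'_def)
  ultimately obtain g where g: "g \<in> hpoly k" "f' = (\<lambda>x y. y * g x y)" using hpoly_factor_y by blast
  define e where "e = 1 / (a * a + b * b)"
  have e: "(a * a + b * b) * e = 1" using det by (simp add: e_def)
  have eq: "f x y = f' ((a * e) * x + (b * e) * y) ((b * e) * x + (- a * e) * y)" for x y
  proof -
    have "a * ((a * e) * x + (b * e) * y) + b * ((b * e) * x + (- a * e) * y) = ((a * a + b * b) * e) * x" by algebra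
    moreover have "b * ((a * e) * x + (b * e) * y) + (- a) * ((b * e) * x + (- a * e) * y) = ((a * a + b * b) * e) * y" by algebra
    ultimately show ?thesis unfolding f'_def e by simp
  qed
  let ?g = "\<lambda>x y. e * g ((a * e) * x + (b * e) * y) ((b * e) * x + (- a * e) * y)"
  have "?g \<in> hpoly k" by (intro hpoly_scale hpoly_subst g)
  moreover have "f = (\<lambda>x y. (b * x - a * y) * ?g x y)"
    unfolding fun_eq_iff eq g(2) by (simp add: algebra_simps)
  ultimately show ?thesis using Suc by (intro exI[of _ ?g]) simp
qed

lemma hpoly_factor3:
  assumes f: "f \<in> hpoly n" "f a1 b1 = 0" "f a2 b2 = 0" "f a3 b3 = 0"
    and d: "b1 * a2 \<noteq> a1 * b2" "b1 * a3 \<noteq> a1 * b3" "b2 * a3 \<noteq> a2 * b3"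
  shows "\<exists>g. f = (\<lambda>x y. (b1 * x - a1 * y) * (b2 * x - a2 * y) * (b3 * x - a3 * y) * g x y) \<and>
    (if n < 3 then g = (\<lambda>x y. 0) else g \<in> hpoly (n - 3))"
proof -
  have ne: "a1 \<noteq> 0 \<or> b1 \<noteq> 0" "a2 \<noteq> 0 \<or> b2 \<noteq> 0" "a3 \<noteq> 0 \<or> b3 \<noteq> 0" using d by auto
  obtain g1 where g1: "f = (\<lambda>x y. (b1 * x - a1 * y) * g1 x y)" "if n = 0 then g1 = (\<lambda>x y. 0) else g1 \<in> hpoly (n - 1)"
    using hpoly_factor[OF f(1,2) ne(1)] by blast
  have g1': "g1 \<in> hpoly (n - 1)" by (rule hpoly_ifI[OF g1(2)])
  have z1: "g1 a2 b2 = 0" "g1 a3 b3 = 0" using f(3,4) d by (auto simp: g1(1))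
  obtain g2 where g2: "g1 = (\<lambda>x y. (b2 * x - a2 * y) * g2 x y)" "if n - 1 = 0 then g2 = (\<lambda>x y. 0) else g2 \<in> hpoly (n - 1 - 1)"
    using hpoly_factor[OF g1' z1(1) ne(2)] by blast
  have g2': "g2 \<in> hpoly (n - 1 - 1)" by (rule hpoly_ifI[OF g2(2)])
  have z2: "g2 a3 b3 = 0" using z1(2) d by (auto simp: g2(1))
  obtain g3 where g3: "g2 = (\<lambda>x y. (b3 * x - a3 * y) * g3 x y)" "if n - 1 - 1 = 0 then g3 = (\<lambda>x y. 0) else g3 \<in> hpoly (n - 1 - 1 - 1)"
    using hpoly_factor[OF g2' z2 ne(3)] by blast
  have "f = (\<lambda>x y. (b1 * x - a1 * y) * (b2 * x - a2 * y) * (b3 * x - a3 * y) * g3 x y)"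
    by (simp add: g1(1) g2(1) g3(1) mult.assoc)
  moreover have "if n < 3 then g3 = (\<lambda>x y. 0) else g3 \<in> hpoly (n - 3)"
    using g3(2) by (auto simp: numeral_3_eq_3 split: if_splits)
  ultimately show ?thesis by blast
qed

subsection \<open>Invariants of the symmetric group on three letters\<close>

text \<open>The group is generated by the exchange of the variables and by \<open>(x, y) \<mapsto> (x - y, x)\<close>. Both change the
  sign of \<open>x y (x - y)\<close>; the first fixes and the second changes the sign of \<open>(x + y) (x - 2 y) (2 x - y)\<close>.\<close>

definition invariants :: "nat \<Rightarrow> (rat \<Rightarrow> rat \<Rightarrow> rat) set" where
  "invariants n = {f \<in> hpoly n. \<forall>x y. f y x = f x y \<and> f (x - y) x = f x y}"

definition sign_invariants :: "nat \<Rightarrow> (rat \<Rightarrow> rat \<Rightarrow> rat) set" where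
  "sign_invariants n = {f \<in> hpoly n. \<forall>x y. f y x = - f x y \<and> f (x - y) x = f x y}"

definition tri :: "rat \<Rightarrow> rat \<Rightarrow> rat" where
  "tri x y = x * y * (x - y)"

definition tri' :: "rat \<Rightarrow> rat \<Rightarrow> rat" where
  "tri' x y = (x + y) * (x - 2 * y) * (2 * x - y)"

lemma hpoly_triple:
  "(\<lambda>x y. (a1 * x + b1 * y) * (a2 * x + b2 * y) * (a3 * x + b3 * y)) \<in> hpoly 3"
  using hpoly_mult[OF hpoly_mult[OF hpoly_linear[of a1 b1] hpoly_linear[of a2 b2]] hpoly_linear[of a3 b3]]
  by (simp add: numeral_3_eq_3)

lemma tri_hpoly: "tri \<in> hpoly 3" "tri' \<in> hpoly 3"
  using hpoly_triple[of 1 0 0 1 1 "-1"] hpoly_triple[of 1 1 1 "-2" 2 "-1"]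
  by (simp_all add: tri_def[abs_def] tri'_def[abs_def])

lemma hpoly_cancel:
  assumes "L = tri \<or> L = tri'" "f \<in> hpoly n" "\<And>x y. L x y * f x y = 0"
  shows "f x y = 0"
proof -
  have "L \<in> hpoly 3" "L 3 1 \<noteq> 0" using assms(1) tri_hpoly by (auto simp: tri_def tri'_def)
  then show ?thesis using hpoly_no_zero_divisors[of L 3 3 1 f n] assms(2,3) by blast
qed

lemma tri_swap: "tri y x = - tri x y" "tri (x - y) x = - tri x y"
  and tri'_swap: "tri' y x = tri' x y" "tri' (x - y) x = - tri' x y"
  by (simp_all add: tri_def tri'_def) algebra+

lemma factor_tri:
  assumes "f \<in> hpoly n" "f 1 0 = 0" "f 0 1 = 0" "f 1 1 = 0"
  shows "\<exists>g. f = (\<lambda>x y. tri x y * g x y) \<and> (if n < 3 then g = (\<lambda>x y. 0) else g \<in> hpoly (n - 3))"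
proof -
  obtain g where g: "f = (\<lambda>x y. (0 * x - 1 * y) * (1 * x - 0 * y) * (1 * x - 1 * y) * g x y)"
      "if n < 3 then g = (\<lambda>x y. 0) else g \<in> hpoly (n - 3)"
    using hpoly_factor3[of f n 1 0 0 1 1 1] assms by force
  have "f = (\<lambda>x y. tri x y * (- 1 * g x y))" by (simp add: g(1) tri_def fun_eq_iff)
  moreover have "if n < 3 then (\<lambda>x y. - 1 * g x y) = (\<lambda>x y. 0) else (\<lambda>x y. - 1 * g x y) \<in> hpoly (n - 3)"
    using g(2) hpoly_scale[of g "n - 3" "-1"] by (simp split: if_splits)
  ultimately show ?thesis by (intro exI[of _ "\<lambda>x y. - 1 * g x y"]) blast
qed

lemma factor_tri':
  assumes "f \<in> hpoly n" "f 1 (- 1) = 0" "f 2 1 = 0" "f 1 2 = 0"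
  shows "\<exists>g. f = (\<lambda>x y. tri' x y * g x y) \<and> (if n < 3 then g = (\<lambda>x y. 0) else g \<in> hpoly (n - 3))"
proof -
  obtain g where g: "f = (\<lambda>x y. (- 1 * x - 1 * y) * (1 * x - 2 * y) * (2 * x - 1 * y) * g x y)"
      "if n < 3 then g = (\<lambda>x y. 0) else g \<in> hpoly (n - 3)"
    using hpoly_factor3[of f n 1 "-1" 2 1 1 2] assms by force
  have "f = (\<lambda>x y. tri' x y * (- 1 * g x y))" by (simp add: g(1) tri'_def fun_eq_iff algebra_simps)
  moreover have "if n < 3 then (\<lambda>x y. - 1 * g x y) = (\<lambda>x y. 0) else (\<lambda>x y. - 1 * g x y) \<in> hpoly (n - 3)"
    using g(2) hpoly_scale[of g "n - 3" "-1"] by (simp split: if_splits)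
  ultimately show ?thesis by (intro exI[of _ "\<lambda>x y. - 1 * g x y"]) blast
qed

lemma cofactor_symmetry:
  assumes L: "L = tri \<or> L = tri'" and g: "g \<in> hpoly n"
    and sym: "\<And>x y. L y x * g y x = c * (L x y * g x y)" "\<And>x y. L y x = a * L x y" and a: "a * a = 1"
  shows "g y x = a * c * g x y"
proof -
  have "(\<lambda>x y. 1 * g y x + (- a * c) * g x y) \<in> hpoly n"
    using hpoly_lincomb[OF hpoly_subst[OF g, of 0 1 1 0] g, of 1 "- a * c"] by simp
  moreover have "L x y * (1 * g y x + (- a * c) * g x y) = 0" for x y
  proof -
    have "a * (a * L x y * g y x) = a * (c * (L x y * g x y))" using sym(1)[of y x] sym(2)[of y x] by simp
    then have "(a * a) * (L x y * g y x) = a * c * (L x y * g x y)" by (simp only: mult_ac)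
    then show ?thesis unfolding a by (simp add: algebra_simps)
  qed
  ultimately have "1 * g y x + (- a * c) * g x y = 0" by (rule hpoly_cancel[OF L])
  then show ?thesis by simp
qed

lemma cofactor_rotation:
  assumes L: "L = tri \<or> L = tri'" and g: "g \<in> hpoly n"
    and sym: "\<And>x y. L (x - y) x * g (x - y) x = c * (L x y * g x y)"
  shows "g (x - y) x = - c * g x y"
proof -
  have "(\<lambda>x y. 1 * g (x - y) x + c * g x y) \<in> hpoly n"
    using hpoly_lincomb[OF hpoly_subst[OF g, of 1 "-1" 1 0] g, of 1 c] by simp
  moreover have "L x y * (1 * g (x - y) x + c * g x y) = 0" for x y
  proof -
    have "L (x - y) x = - L x y" using L tri_swap(2) tri'_swap(2) by auto
    then show ?thesis using sym[of x y] by (simp add: algebra_simps)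
  qed
  ultimately have "1 * g (x - y) x + c * g x y = 0" by (rule hpoly_cancel[OF L])
  then show ?thesis by simp
qed

text \<open>The orbit of (1, 0) contains (1, 1) and (0, 1), so \<open>f\<close> is divisible by
  \<open>tri\<close>. The cofactor changes sign under both generators and vanishes at the same
  points, which gives a second factor \<open>tri\<close>.\<close>

lemma invariants_factor:
  assumes f: "f \<in> invariants n" "f 1 0 = 0"
  shows "\<exists>g. f = (\<lambda>x y. tri x y * tri x y * g x y) \<and> (if n < 6 then g = (\<lambda>x y. 0) else g \<in> invariants (n - 6))"
proof -
  have fi: "f \<in> hpoly n" "f y x = f x y" "f (x - y) x = f x y" for x y using f(1) unfolding invariants_def by blast+
  have "f 1 1 = 0" using fi(3)[of 1 0] f(2) by simp
  moreover have "f 0 1 = 0" using fi(2)[of 1 0] f(2) by simp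
  ultimately obtain h where h: "f = (\<lambda>x y. tri x y * h x y)" "if n < 3 then h = (\<lambda>x y. 0) else h \<in> hpoly (n - 3)"
    using factor_tri[OF fi(1) f(2)] by blast
  have h1: "h \<in> hpoly (n - 3)" by (rule hpoly_ifI[OF h(2)])
  have h2': "tri y x * h y x = 1 * (tri x y * h x y)" "tri y x = -1 * tri x y" for x y
    using fi(2)[unfolded h(1), of y x] tri_swap(1)[of y x] by simp_all
  have h2: "h y x = - h x y" for x y
    using cofactor_symmetry[of tri, OF _ h1 h2', of y x] by simp
  have h3': "tri (x - y) x * h (x - y) x = 1 * (tri x y * h x y)" for x y
    using fi(3)[unfolded h(1), of x y] by simp
  have h3: "h (x - y) x = - h x y" for x y
    using cofactor_rotation[of tri, OF _ h1 h3', of x y] by simp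
  have "h 1 1 = 0" using h2[of 1 1] by simp
  moreover from this have "h 1 0 = 0" using h3[of 1 0] by simp
  moreover from this have "h 0 1 = 0" using h2[of 1 0] by simp
  ultimately obtain g where g: "h = (\<lambda>x y. tri x y * g x y)" "if n - 3 < 3 then g = (\<lambda>x y. 0) else g \<in> hpoly (n - 3 - 3)"
    using factor_tri[OF h1] by blast
  have g1: "g \<in> hpoly (n - 6)" using hpoly_ifI[OF g(2)] by simp
  have g2': "tri y x * g y x = -1 * (tri x y * g x y)" "tri y x = -1 * tri x y" for x y
    using h2[unfolded g(1), of y x] tri_swap(1)[of y x] by simp_all
  have g2: "g y x = g x y" for x y
    using cofactor_symmetry[of tri, OF _ g1 g2', of y x] by simp
  have g3': "tri (x - y) x * g (x - y) x = -1 * (tri x y * g x y)" for x y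
    using h3[unfolded g(1), of x y] by simp
  have g3: "g (x - y) x = g x y" for x y
    using cofactor_rotation[of tri, OF _ g1 g3', of x y] by simp
  have "f = (\<lambda>x y. tri x y * tri x y * g x y)" by (simp add: h(1) g(1) mult.assoc)
  moreover have "if n < 6 then g = (\<lambda>x y. 0) else g \<in> invariants (n - 6)"
    using g(2) g1 g2 g3 by (auto simp: invariants_def)
  ultimately show ?thesis by blast
qed

text \<open>Antisymmetry gives a zero at (1, 1) and along its orbit, thus a factor
  \<open>tri\<close>. The cofactor is symmetric of odd degree, so it vanishes at (1, -1); the
  generators carry this zero to (2, 1) and (1, 2), whence the factor \<open>tri'\<close>.\<close>

lemma sign_invariants_factor:
  assumes f: "f \<in> sign_invariants n" and n: "even n"
  shows "\<exists>g. f = (\<lambda>x y. tri x y * tri' x y * g x y) \<and> (if n < 6 then g = (\<lambda>x y. 0) else g \<in> invariants (n - 6))"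
proof -
  have fi: "f \<in> hpoly n" "f y x = - f x y" "f (x - y) x = f x y" for x y using f(1) unfolding sign_invariants_def by blast+
  have "f 1 1 = 0" using fi(2)[of 1 1] by simp
  moreover from this have "f 1 0 = 0" using fi(3)[of 1 0] by simp
  moreover from this have "f 0 1 = 0" using fi(2)[of 1 0] by simp
  ultimately obtain h where h: "f = (\<lambda>x y. tri x y * h x y)" "if n < 3 then h = (\<lambda>x y. 0) else h \<in> hpoly (n - 3)"
    using factor_tri[OF fi(1)] by blast
  have h1: "h \<in> hpoly (n - 3)" by (rule hpoly_ifI[OF h(2)])
  have h2': "tri y x * h y x = -1 * (tri x y * h x y)" "tri y x = -1 * tri x y" for x y
    using fi(2)[unfolded h(1), of y x] tri_swap(1)[of y x] by simp_all
  have h2: "h y x = h x y" for x y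
    using cofactor_symmetry[of tri, OF _ h1 h2', of y x] by simp
  have h3': "tri (x - y) x * h (x - y) x = 1 * (tri x y * h x y)" for x y
    using fi(3)[unfolded h(1), of x y] by simp
  have h3: "h (x - y) x = - h x y" for x y
    using cofactor_rotation[of tri, OF _ h1 h3', of x y] by simp
  have "h 1 (- 1) = 0"
  proof (cases "n < 3")
    case False
    then have "odd (n - 3)" using n by simp
    then show ?thesis using hpoly_odd[OF h1, of 1 "-1"] h2[of 1 "-1"] by simp
  qed (use h(2) in auto)
  moreover from this have "h 2 1 = 0" using h3[of 1 "-1"] by simp
  moreover from this have "h 1 2 = 0" using h2[of 2 1] by simp
  ultimately obtain g where g: "h = (\<lambda>x y. tri' x y * g x y)" "if n - 3 < 3 then g = (\<lambda>x y. 0) else g \<in> hpoly (n - 3 - 3)"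
    using factor_tri'[OF h1] by blast
  have g1: "g \<in> hpoly (n - 6)" using hpoly_ifI[OF g(2)] by simp
  have g2': "tri' y x * g y x = 1 * (tri' x y * g x y)" "tri' y x = 1 * tri' x y" for x y
    using h2[unfolded g(1), of y x] tri'_swap(1)[of y x] by simp_all
  have g2: "g y x = g x y" for x y
    using cofactor_symmetry[of tri', OF _ g1 g2', of y x] by simp
  have g3': "tri' (x - y) x * g (x - y) x = -1 * (tri' x y * g x y)" for x y
    using h3[unfolded g(1), of x y] by simp
  have g3: "g (x - y) x = g x y" for x y
    using cofactor_rotation[of tri', OF _ g1 g3', of x y] by simp
  have "f = (\<lambda>x y. tri x y * tri' x y * g x y)" by (simp add: h(1) g(1) mult.assoc)
  moreover have "if n < 6 then g = (\<lambda>x y. 0) else g \<in> invariants (n - 6)"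
    using g(2) g1 g2 g3 by (auto simp: invariants_def)
  ultimately show ?thesis by blast
qed

section \<open>Polynomial functions and their coefficients\<close>

lemma eval2_superset:
  assumes "finite K" "keys p \<subseteq> K"
  shows "eval2 p x y = (\<Sum>(i, j)\<in>K. lookup p (i, j) * x ^ i * y ^ j)"
  unfolding eval2_def by (rule sum.mono_neutral_left) (use assms in \<open>auto simp: in_keys_iff\<close>)

lemma qfunctional_eval2: "qfunctional (\<lambda>p. eval2 p x y)"
proof (rule qfunctionalI)
  fix p q :: "nat \<times> nat \<Rightarrow>\<^sub>0 rat" and c
  let ?K = "keys p \<union> keys q"
  have "eval2 r x y = (\<Sum>(i, j)\<in>?K. lookup r (i, j) * x ^ i * y ^ j)" if "keys r \<subseteq> ?K" for r
    by (rule eval2_superset) (use that in auto)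
  from this[of p] this[of q] this[of "p + q"] show "eval2 (p + q) x y = eval2 p x y + eval2 q x y"
    using keys_add[of p q] by (simp add: lookup_add algebra_simps sum.distrib case_prod_unfold)
  have "keys (qscale c p) \<subseteq> keys p" by (auto simp: in_keys_iff)
  then show "eval2 (qscale c p) x y = c * eval2 p x y"
    using eval2_superset[of "keys p" "qscale c p" x y] eval2_superset[of "keys p" p x y]
    by (simp add: sum_distrib_left mult.assoc case_prod_unfold)
qed

lemma eval2_bas [simp]: "eval2 (bas (i, j)) x y = x ^ i * y ^ j"
  by (simp add: eval2_def)

definition monomials :: "nat \<Rightarrow> (nat \<times> nat) set" where
  "monomials n = {(i, j). i + j = n}"

lemma monomials_eq: "monomials n = (\<lambda>i. (i, n - i)) ` {..n}"
  by (auto simp: monomials_def image_iff)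

lemma finite_monomials: "finite (monomials n)"
  by (simp add: monomials_eq)

lemma eval2_monomials:
  assumes "keys p \<subseteq> monomials n"
  shows "eval2 p x y = (\<Sum>i\<le>n. lookup p (i, n - i) * x ^ i * y ^ (n - i))"
  unfolding eval2_superset[OF finite_monomials assms] monomials_eq
  by (subst sum.reindex) (auto simp: inj_on_def)

text \<open>Dehomogenise at \<open>y = 1\<close>: a polynomial in one variable with infinitely many
  zeros is zero.\<close>

lemma eval2_eq_0:
  assumes "keys p \<subseteq> monomials n" "\<And>x y. eval2 p x y = 0"
  shows "p = 0"
proof -
  let ?P = "\<Sum>i\<le>n. monom (lookup p (i, n - i)) i"
  have "poly ?P x = 0" for x
    using assms(2)[of x 1] by (simp add: eval2_monomials[OF assms(1)] poly_sum poly_monom)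
  then have "?P = 0" using poly_all_0_iff_0 by blast
  then have P: "coeff ?P i = 0" for i by (simp only: coeff_0)
  have "lookup p (i, n - i) = 0" if "i \<le> n" for i
    using that P[of i] by (simp add: coeff_sum)
  then have "lookup p k = 0" if "k \<in> monomials n" for k
    using that unfolding monomials_eq by blast
  then have "keys p = {}" using assms(1) by (meson in_keys_iff subset_iff equals0I)
  then show ?thesis by simp
qed

lemma mono_in_hpoly: "(\<lambda>x y. x ^ i * y ^ j) \<in> hpoly (i + j)"
proof (induction i)
  case 0
  show ?case
  proof (induction j)
    case (Suc j)
    then show ?case using hpoly_SucI[OF hpoly_zero Suc] by simp
  qed auto
next
  case (Suc i)
  then show ?case using hpoly_SucI[OF Suc hpoly_zero] by (simp add: mult.assoc)
qed

lemma eval2_in_hpoly: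
  assumes "keys p \<subseteq> monomials n"
  shows "eval2 p \<in> hpoly n"
proof -
  have "p \<in> qvs.span (bas ` monomials n)" using assms by (simp add: span_bas)
  then show ?thesis
  proof (induction rule: qvs.span_induct_alt)
    case base
    have "eval2 0 = (\<lambda>x y. 0)" by (simp add: eval2_def fun_eq_iff)
    then show ?case using hpoly_zero by simp
  next
    case (step c a b)
    then obtain i j where ij: "a = bas (i, j)" "i + j = n" by (auto simp: monomials_def)
    have "eval2 (qscale c a + b) = (\<lambda>x y. c * (x ^ i * y ^ j) + 1 * eval2 b x y)"
      by (simp add: fun_eq_iff qfunctional_add[OF qfunctional_eval2] qfunctional_scale[OF qfunctional_eval2] ij(1))
    then show ?case by (simp only: hpoly_lincomb[OF mono_in_hpoly[of i j, unfolded ij(2)] step.IH])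
  qed
qed

lemma hpoly_eq_eval2: "f \<in> hpoly n \<Longrightarrow> \<exists>p. keys p \<subseteq> monomials n \<and> f = eval2 p"
proof (induction n arbitrary: f)
  case 0
  then obtain c where "f = (\<lambda>x y. c)" by auto
  then have "f = eval2 (qscale c (bas (0, 0)))"
    by (simp add: fun_eq_iff qfunctional_scale[OF qfunctional_eval2])
  then show ?case by (intro exI[of _ "qscale c (bas (0, 0))"]) (auto simp: monomials_def in_keys_iff lookup_single when_def split: if_splits)
next
  case (Suc n)
  obtain f1 f2 where f: "f1 \<in> hpoly n" "f2 \<in> hpoly n" "f = (\<lambda>x y. x * f1 x y + y * f2 x y)" using Suc.prems by (auto simp: hpoly.simps(2))
  obtain p q where pq: "keys p \<subseteq> monomials n" "f1 = eval2 p" "keys q \<subseteq> monomials n" "f2 = eval2 q"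
    using Suc.IH[OF f(1)] Suc.IH[OF f(2)] by blast
  let ?X = "lin_ext (\<lambda>(i, j). bas (Suc i, j))" and ?Y = "lin_ext (\<lambda>(i, j). bas (i, Suc j))"
  have X: "eval2 (?X r) x y = x * eval2 r x y" for r x y
    by (rule qfunctional_eqI[OF qfunctional_compose[OF qlinear_lin_ext qfunctional_eval2], where p = r])
       (auto intro!: qfunctionalI simp: qfunctional_add[OF qfunctional_eval2] qfunctional_scale[OF qfunctional_eval2] algebra_simps)
  have Y: "eval2 (?Y r) x y = y * eval2 r x y" for r x y
    by (rule qfunctional_eqI[OF qfunctional_compose[OF qlinear_lin_ext qfunctional_eval2], where p = r])
       (auto intro!: qfunctionalI simp: qfunctional_add[OF qfunctional_eval2] qfunctional_scale[OF qfunctional_eval2] algebra_simps)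
  have "?X p \<in> {r. keys r \<subseteq> monomials (Suc n)}" "?Y q \<in> {r. keys r \<subseteq> monomials (Suc n)}"
    using pq(1,3) by (intro lin_ext_in_subspace[OF subspace_keys]; force simp: monomials_def)+
  then have "?X p + ?Y q \<in> {r. keys r \<subseteq> monomials (Suc n)}" by (rule qvs.subspace_add[OF subspace_keys])
  moreover have "f = eval2 (?X p + ?Y q)"
    by (simp add: fun_eq_iff f(3) pq X Y qfunctional_add[OF qfunctional_eval2])
  ultimately show ?case by blast
qed

lemma linear_eval2: "Vector_Spaces.linear qscale fscale eval2"
  unfolding Vector_Spaces.linear_iff
  by (simp add: qvs.vector_space_axioms fvs.vector_space_axioms fun_eq_iff plus_fun_def fscale_def
      qfunctional_add[OF qfunctional_eval2] qfunctional_scale[OF qfunctional_eval2])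

lemma hpoly_finite_span: "hpoly n \<subseteq> fvs.span (eval2 ` bas ` monomials n)"
proof
  fix f assume "f \<in> hpoly n"
  then obtain p where "keys p \<subseteq> monomials n" "f = eval2 p" using hpoly_eq_eval2 by blast
  then show "f \<in> fvs.span (eval2 ` bas ` monomials n)"
    unfolding qfp.linear_span_image[OF linear_eval2] by (simp add: span_bas)
qed

section \<open>Dimensions of the spaces of invariants\<close>

lemma subspace_invariants: "fvs.subspace (invariants n)" "fvs.subspace (sign_invariants n)"
proof -
  have "fvs.subspace {f. \<forall>x y. f y x = s * f x y \<and> f (x - y) x = f x y}" for s
  proof (rule fvs.subspaceI; (unfold mem_Collect_eq)?)
    fix f g :: "rat \<Rightarrow> rat \<Rightarrow> rat"
    assume "\<forall>x y. f y x = s * f x y \<and> f (x - y) x = f x y" "\<forall>x y. g y x = s * g x y \<and> g (x - y) x = g x y"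
    then have *: "f y x = s * f x y" "f (x - y) x = f x y" "g y x = s * g x y" "g (x - y) x = g x y" for x y by blast+
    show "\<forall>x y. (f + g) y x = s * (f + g) x y \<and> (f + g) (x - y) x = (f + g) x y"
      unfolding plus_fun_def ring_distribs by (intro allI conjI arg_cong2[where f = "(+)"] *)
  next
    fix c and f :: "rat \<Rightarrow> rat \<Rightarrow> rat"
    assume "\<forall>x y. f y x = s * f x y \<and> f (x - y) x = f x y"
    then have *: "f y x = s * f x y" "f (x - y) x = f x y" for x y by blast+
    show "\<forall>x y. fscale c f y x = s * fscale c f x y \<and> fscale c f (x - y) x = fscale c f x y"
      unfolding fscale_def mult.left_commute[of s c] by (intro allI conjI arg_cong2[where f = "(*)"] * refl)
  qed simp
  from fvs.subspace_inter[OF subspace_hpoly[of n] this[of 1]] fvs.subspace_inter[OF subspace_hpoly[of n] this[of "-1"]]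
  show "fvs.subspace (invariants n)" "fvs.subspace (sign_invariants n)"
    by (simp_all only: invariants_def sign_invariants_def Int_def mem_Collect_eq mult_1 mult_minus1)
qed

lemma invariants_span: "invariants n \<subseteq> fvs.span (eval2 ` bas ` monomials n)"
  "sign_invariants n \<subseteq> fvs.span (eval2 ` bas ` monomials n)"
  using hpoly_finite_span[of n] by (auto simp: invariants_def sign_invariants_def)

lemma dim_mult_image:
  assumes "L \<in> hpoly m" "L a b \<noteq> 0"
  shows "fvs.dim ((\<lambda>g x y. L x y * g x y) ` invariants n) = fvs.dim (invariants n)"
proof (rule ffp.dim_image_injective)
  show "Vector_Spaces.linear fscale fscale (\<lambda>g x y. L x y * g x y)"
    by (rule flinearI) (auto simp: fun_eq_iff fscale_def algebra_simps)
  show "g = 0" if "g \<in> invariants n" "(\<lambda>x y. L x y * g x y) = 0" for g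
    using hpoly_no_zero_divisors[OF assms, of g n] that by (auto simp: invariants_def fun_eq_iff zero_fun_def)
qed (use subspace_invariants invariants_span finite_monomials in auto)

lemma mult_invariant:
  assumes L: "L \<in> hpoly m" "\<And>x y. L y x = s * L x y" "\<And>x y. L (x - y) x = L x y" and g: "g \<in> invariants n"
  shows "(\<lambda>x y. L x y * g x y) \<in> {f \<in> hpoly (m + n). \<forall>x y. f y x = s * f x y \<and> f (x - y) x = f x y}"
proof -
  have g': "g \<in> hpoly n" "g y x = g x y" "g (x - y) x = g x y" for x y using g unfolding invariants_def by blast+
  have "L y x * g y x = s * (L x y * g x y) \<and> L (x - y) x * g (x - y) x = L x y * g x y" for x y
    using L(2)[of y x] L(3)[of x y] g'(2)[of y x] g'(3)[of x y] by simp
  then show ?thesis using hpoly_mult[OF L(1) g'(1)] by blast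
qed

lemma dim_zero_set: "fvs.dim {0} = 0"
  using fvs.dim_le_card[of "{0}" "{}"] by simp

lemma dim_const_functions: "fvs.dim (range (\<lambda>c (x::rat) (y::rat). c)) = 1"
proof -
  have "range (\<lambda>c (x::rat) (y::rat). c) = fvs.span {\<lambda>x y. 1}"
    by (auto simp: fvs.span_singleton fscale_def)
  moreover have "fvs.independent {\<lambda>x y. 1}" by (simp add: zero_fun_def fun_eq_iff)
  ultimately show ?thesis using fvs.dim_span_eq_card_independent by fastforce
qed

text \<open>Evaluate at (1, 0). Powers of the invariant quadratic form x^2 - x y + y^2 show that
  every value occurs, and the kernel is the square of \<open>tri\<close> times the invariants of
  degree \<open>n - 6\<close>. The value is kept as a constant function to stay in the same
  space.\<close>

lemma dim_invariants_step:
  assumes "even n"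
  shows "fvs.dim (invariants n) = Suc (if n < 6 then 0 else fvs.dim (invariants (n - 6)))"
proof -
  let ?T = "\<lambda>f (x::rat) (y::rat). f 1 0 :: rat"
  have lin: "Vector_Spaces.linear fscale fscale ?T"
    by (rule flinearI) (auto simp: fun_eq_iff fscale_def)
  let ?q = "\<lambda>x y. 1 * (x * x) + 1 * (y * y - x * y)" and ?e = "\<lambda>x y. (x * x - x * y + y * y) ^ (n div 2) :: rat"
  have q: "(\<lambda>x y. x * x - x * y + y * y) \<in> hpoly 2"
  proof -
    have "(\<lambda>x y. x * (1 * x + (- 1) * y) + y * (0 * x + 1 * y)) \<in> hpoly (Suc 1)" by (intro hpoly_SucI hpoly_linear)
    then show ?thesis by (simp add: numeral_2_eq_2 algebra_simps)
  qed
  have "(\<lambda>x y. (x * x - x * y + y * y) ^ k) \<in> hpoly (2 * k)" for k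
  proof (induction k)
    case (Suc k)
    then show ?case using hpoly_mult[OF q Suc] by simp
  qed auto
  from this[of "n div 2"] have "?e \<in> hpoly n" using assms by simp
  moreover have "(x - y) * (x - y) - (x - y) * x + x * x = x * x - x * y + y * (y::rat)" for x y by algebra
  ultimately have e: "?e \<in> invariants n" by (simp add: invariants_def algebra_simps)
  have "?T ` invariants n = range (\<lambda>c x y. c)"
  proof (intro equalityI subsetI)
    fix g assume "g \<in> range (\<lambda>c (x::rat) (y::rat). c :: rat)"
    then obtain c where c: "g = (\<lambda>x y. c)" by auto
    have "fscale c ?e \<in> invariants n" by (rule fvs.subspace_scale[OF subspace_invariants(1) e])
    moreover have "g = ?T (fscale c ?e)" by (simp add: c fscale_def)
    ultimately show "g \<in> ?T ` invariants n" by blast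
  qed auto
  moreover have "fvs.dim (invariants n) = fvs.dim (?T ` invariants n) + fvs.dim {f \<in> invariants n. ?T f = 0}"
    by (rule ffp.rank_nullity[OF lin subspace_invariants(1) invariants_span(1)]) (simp add: finite_monomials)
  moreover have "fvs.dim {f \<in> invariants n. ?T f = 0} = (if n < 6 then 0 else fvs.dim (invariants (n - 6)))"
  proof (cases "n < 6")
    case True
    have "f = 0" if f: "f \<in> invariants n" "?T f = 0" for f
    proof -
      have "f 1 0 = 0" using f(2) by (simp add: fun_eq_iff)
      then show ?thesis using invariants_factor[OF f(1)] True by (auto simp: fun_eq_iff)
    qed
    then have "{f \<in> invariants n. ?T f = 0} = {0}"
      using fvs.subspace_0[OF subspace_invariants(1)[of n]] by (auto simp: zero_fun_def)
    then show ?thesis using True dim_zero_set by simp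
  next
    case False
    let ?L = "\<lambda>x y. tri x y * tri x y"
    have L: "?L \<in> hpoly 6" "?L 3 1 \<noteq> 0" using hpoly_mult[OF tri_hpoly(1) tri_hpoly(1)] by (auto simp: tri_def)
    have "{f \<in> invariants n. ?T f = 0} = (\<lambda>g x y. ?L x y * g x y) ` invariants (n - 6)"
    proof (intro equalityI subsetI)
      fix f assume f: "f \<in> {f \<in> invariants n. ?T f = 0}"
      then have "f 1 0 = 0" by (auto simp: fun_eq_iff)
      then show "f \<in> (\<lambda>g x y. ?L x y * g x y) ` invariants (n - 6)"
        using invariants_factor[of f n] f False by auto
    next
      fix f assume "f \<in> (\<lambda>g x y. ?L x y * g x y) ` invariants (n - 6)"
      then obtain g where g: "g \<in> invariants (n - 6)" "f = (\<lambda>x y. ?L x y * g x y)" by auto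
      have "tri y x * tri y x = 1 * (tri x y * tri x y)" "tri (x - y) x * tri (x - y) x = tri x y * tri x y" for x y
        using tri_swap(1)[of y x] tri_swap(2)[of x y] by simp_all
      from mult_invariant[of ?L, OF L(1) this g(1)] have "f \<in> invariants n"
        using False by (simp only: g(2) invariants_def mult_1 le_add_diff_inverse not_less)
      moreover have "f 1 0 = 0" by (simp add: g(2) tri_def)
      ultimately show "f \<in> {f \<in> invariants n. ?T f = 0}" by (simp add: zero_fun_def)
    qed
    then show ?thesis using False dim_mult_image[OF L] by simp
  qed
  ultimately show ?thesis using dim_const_functions by simp
qed

lemma dim_invariants: "even n \<Longrightarrow> fvs.dim (invariants n) = Suc (n div 6)"
proof (induction n rule: less_induct)
  case (less n)
  show ?case
  proof (cases "n < 6")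
    case False
    then have "n div 6 = Suc ((n - 6) div 6)" by presburger
    then show ?thesis using False less dim_invariants_step[of n] by simp
  qed (use less dim_invariants_step[of n] in auto)
qed

lemma dim_sign_invariants:
  assumes "even n"
  shows "fvs.dim (sign_invariants n) = n div 6"
proof (cases "n < 6")
  case True
  have "f = 0" if "f \<in> sign_invariants n" for f
    using sign_invariants_factor[OF that assms] True by (auto simp: fun_eq_iff)
  then have "sign_invariants n = {0}"
    using fvs.subspace_0[OF subspace_invariants(2)[of n]] by auto
  then show ?thesis using True dim_zero_set by simp
next
  case False
  let ?L = "\<lambda>x y. tri x y * tri' x y"
  have L: "?L \<in> hpoly 6" "?L 3 1 \<noteq> 0" using hpoly_mult[OF tri_hpoly] by (auto simp: tri_def tri'_def)
  have "sign_invariants n = (\<lambda>g x y. ?L x y * g x y) ` invariants (n - 6)"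
  proof (intro equalityI subsetI)
    fix f assume f: "f \<in> sign_invariants n"
    then show "f \<in> (\<lambda>g x y. ?L x y * g x y) ` invariants (n - 6)"
      using sign_invariants_factor[OF f assms] False by auto
  next
    fix f assume "f \<in> (\<lambda>g x y. ?L x y * g x y) ` invariants (n - 6)"
    then obtain g where g: "g \<in> invariants (n - 6)" "f = (\<lambda>x y. ?L x y * g x y)" by auto
    have "tri y x * tri' y x = - 1 * (tri x y * tri' x y)" "tri (x - y) x * tri' (x - y) x = tri x y * tri' x y" for x y
      using tri_swap(1)[of y x] tri_swap(2)[of x y] tri'_swap(1)[of y x] tri'_swap(2)[of x y] by simp_all
    from mult_invariant[of ?L, OF L(1) this g(1)] show "f \<in> sign_invariants n"
      using False by (simp only: g(2) sign_invariants_def mult_minus1 le_add_diff_inverse not_less)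
  qed
  moreover have "n div 6 = Suc ((n - 6) div 6)" using False by presburger
  ultimately show ?thesis using dim_mult_image[OF L] dim_invariants[of "n - 6"] assms False by simp
qed

subsection \<open>Even period polynomials\<close>

lemma eval2_unique:
  assumes "keys p \<subseteq> monomials n" "keys q \<subseteq> monomials n" "\<And>x y. eval2 p x y = eval2 q x y"
  shows "p = q"
proof -
  have "p - q \<in> {r. keys r \<subseteq> monomials n}" by (rule qvs.subspace_diff[OF subspace_keys]) (use assms in auto)
  moreover have "eval2 (p - q) x y = 0" for x y
    using qfunctional_add[OF qfunctional_eval2, of "p - q" q] assms(3)[of x y] by simp
  ultimately have "p - q = 0" using eval2_eq_0[of "p - q" n] by blast
  then show ?thesis by simp
qed

definition swap_poly :: "(nat \<times> nat \<Rightarrow>\<^sub>0 rat) \<Rightarrow> (nat \<times> nat \<Rightarrow>\<^sub>0 rat)" where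
  "swap_poly = lin_ext (\<lambda>(i, j). bas (j, i))"

definition flip_poly :: "(nat \<times> nat \<Rightarrow>\<^sub>0 rat) \<Rightarrow> (nat \<times> nat \<Rightarrow>\<^sub>0 rat)" where
  "flip_poly = lin_ext (\<lambda>(i, j). qscale ((- 1) ^ i) (bas (i, j)))"

lemma qlinear_swap_poly: "qlinear swap_poly" and qlinear_flip_poly: "qlinear flip_poly"
  unfolding swap_poly_def flip_poly_def by (rule qlinear_lin_ext)+

lemma lookup_swap_poly: "lookup (swap_poly p) (i, j) = lookup p (j, i)"
  by (rule qfunctional_eqI[OF qfunctional_compose[OF qlinear_swap_poly qfunctional_lookup] qfunctional_lookup, where p = p])
     (auto simp: swap_poly_def lookup_single when_def split: if_splits)

lemma lookup_flip_poly: "lookup (flip_poly p) (i, j) = (- 1) ^ i * lookup p (i, j)"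
  by (rule qfunctional_eqI[OF qfunctional_compose[OF qlinear_flip_poly qfunctional_lookup], where p = p])
     (auto intro!: qfunctionalI simp: lookup_add algebra_simps flip_poly_def lookup_single when_def split: if_splits)

lemma eval2_swap_poly: "eval2 (swap_poly p) x y = eval2 p y x"
  by (rule qfunctional_eqI[OF qfunctional_compose[OF qlinear_swap_poly qfunctional_eval2] qfunctional_eval2, where p = p])
     (auto simp: swap_poly_def mult.commute)

lemma eval2_flip_poly: "eval2 (flip_poly p) x y = eval2 p (- x) y"
  by (rule qfunctional_eqI[OF qfunctional_compose[OF qlinear_flip_poly qfunctional_eval2] qfunctional_eval2, where p = p])
     (auto simp: flip_poly_def qfunctional_scale[OF qfunctional_eval2] power_minus[of x])

definition even_alternating :: "nat \<Rightarrow> (nat \<times> nat \<Rightarrow>\<^sub>0 rat) set" where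
  "even_alternating n = {p. keys p \<subseteq> monomials n \<and> flip_poly p = p \<and> swap_poly p = qscale (- 1) p}"

lemma even_alternating_iff:
  assumes "keys p \<subseteq> monomials n"
  shows "p \<in> even_alternating n \<longleftrightarrow> (\<forall>x y. eval2 p (- x) y = eval2 p x y) \<and> (\<forall>x y. eval2 p y x = - eval2 p x y)"
proof -
  have k: "keys (flip_poly p) \<subseteq> monomials n" "keys (swap_poly p) \<subseteq> monomials n" "keys (qscale (- 1) p) \<subseteq> monomials n"
    using assms by (auto simp: in_keys_iff lookup_flip_poly lookup_swap_poly monomials_def add.commute)
  have "flip_poly p = p \<longleftrightarrow> (\<forall>x y. eval2 p (- x) y = eval2 p x y)"
    using eval2_unique[OF k(1) assms] by (auto simp flip: eval2_flip_poly)
  moreover have "swap_poly p = qscale (- 1) p \<longleftrightarrow> (\<forall>x y. eval2 p y x = - eval2 p x y)"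
  proof -
    have "(\<forall>x y. eval2 p y x = - eval2 p x y) \<longleftrightarrow> (\<forall>x y. eval2 (swap_poly p) x y = eval2 (qscale (- 1) p) x y)"
      by (simp only: eval2_swap_poly qfunctional_scale[OF qfunctional_eval2] mult_minus1)
    then show ?thesis using eval2_unique[OF k(2,3)] by metis
  qed
  ultimately show ?thesis using assms unfolding even_alternating_def by blast
qed

lemma even_alternating_lookup:
  assumes "p \<in> even_alternating n"
  shows "odd i \<Longrightarrow> lookup p (i, j) = 0" "lookup p (j, i) = - lookup p (i, j)"
  using assms lookup_flip_poly[of p i j] lookup_swap_poly[of p i j] by (simp_all add: even_alternating_def)

lemma even_alternatingI:
  assumes "keys p \<subseteq> monomials n" "\<And>i j. odd i \<Longrightarrow> lookup p (i, j) = 0" "\<And>i j. lookup p (j, i) = - lookup p (i, j)"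
  shows "p \<in> even_alternating n"
proof -
  have "lookup (flip_poly p) (i, j) = lookup p (i, j)" for i j
    using assms(2)[of i j] by (cases "even i") (simp_all add: lookup_flip_poly)
  moreover have "lookup (swap_poly p) (i, j) = lookup (qscale (- 1) p) (i, j)" for i j
    using assms(3)[of j i] by (simp add: lookup_swap_poly)
  ultimately have "flip_poly p = p" "swap_poly p = qscale (- 1) p"
    by (simp_all only: poly_mapping_eq_iff fun_eq_iff split_paired_All simp_thms)
  then show ?thesis using assms(1) unfolding even_alternating_def by blast
qed

lemma subspace_even_alternating: "qvs.subspace (even_alternating n)"
proof -
  have "qvs.subspace {p. flip_poly p = p \<and> swap_poly p = qscale (- 1) p}"
    unfolding qvs.subspace_def
    by (simp add: qlinear_add[OF qlinear_flip_poly] qlinear_add[OF qlinear_swap_poly] qlinear_zero[OF qlinear_flip_poly]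
      qlinear_zero[OF qlinear_swap_poly] qlinear_scale[OF qlinear_flip_poly] qlinear_scale[OF qlinear_swap_poly]
      qvs.scale_right_distrib qvs.scale_left_commute[of "- 1"])
  from qvs.subspace_inter[OF subspace_keys[of "monomials n"] this] show ?thesis
    by (simp add: even_alternating_def Int_def)
qed

text \<open>Antisymmetrised monomials with even exponents and \<open>i < j\<close> form a basis;
  with \<open>i = 2 * a\<close> the condition is \<open>2 * a < d\<close>, which has
  \<open>(d + 1) div 2\<close> solutions.\<close>

lemma dim_even_alternating: "qvs.dim (even_alternating (2 * d)) = (d + 1) div 2"
proof -
  define K where "K = {(i, j). i + j = 2 * d \<and> even i \<and> i < j}"
  have fK: "finite K" by (rule finite_subset[OF _ finite_monomials[of "2 * d"]]) (auto simp: K_def monomials_def)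
  have K: "(i, j) \<in> K \<longleftrightarrow> i + j = 2 * d \<and> even i \<and> i < j" for i j by (simp add: K_def)
  define R where "R q = q - swap_poly q" for q
  have lin: "qlinear R"
    unfolding R_def using qlinear_swap_poly
    by (intro qlinearI) (simp_all add: qlinear_add qlinear_scale qvs.scale_right_diff_distrib)
  have look: "lookup (R q) (i, j) = lookup q (i, j) - lookup q (j, i)" for q i j
    by (simp add: R_def lookup_minus lookup_swap_poly)
  have z: "lookup q (i, j) = 0" if "keys q \<subseteq> K" "\<not> (i + j = 2 * d \<and> even i \<and> i < j)" for q i j
    using that by (auto simp: K_def in_keys_iff)
  have "even_alternating (2 * d) = R ` {q. keys q \<subseteq> K}"
  proof (intro equalityI subsetI)
    fix p assume p: "p \<in> even_alternating (2 * d)"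
    define q where "q = homog_part (\<lambda>k. if k \<in> K then 1 else 0) 1 p"
    have q: "lookup q k = (if k \<in> K then lookup p k else 0)" for k by (simp add: q_def lookup_homog_part)
    have "lookup p (i, j) = lookup (R q) (i, j)" for i j
    proof -
      have alt: "lookup p (j, i) = - lookup p (i, j)" by (rule even_alternating_lookup(2)[OF p])
      have "lookup p (i, j) \<noteq> 0 \<Longrightarrow> i + j = 2 * d" using p by (auto simp: even_alternating_def monomials_def in_keys_iff)
      then consider "lookup p (i, j) = 0" | "i + j = 2 * d" "even i" "i < j" | "i + j = 2 * d" "even i" "j < i" | "i = j" "lookup p (i, j) \<noteq> 0"
        using even_alternating_lookup(1)[OF p, of i j] by (metis linorder_cases)
      then show ?thesis
      proof cases
        case 3
        then have "even (i + j)" by simp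
        then have "even j" using 3(2) even_add by blast
        then show ?thesis using 3 alt by (simp add: look q K add.commute)
      qed (use alt in \<open>auto simp: look q K\<close>)
    qed
    then have "p = R q" by (intro poly_mapping_eqI) auto
    moreover have "keys q \<subseteq> K" by (auto simp: in_keys_iff q split: if_splits)
    ultimately show "p \<in> R ` {q. keys q \<subseteq> K}" by blast
  next
    fix p assume "p \<in> R ` {q. keys q \<subseteq> K}"
    then obtain q where q: "keys q \<subseteq> K" "p = R q" by auto
    have "lookup p (i, j) = 0" if "i + j \<noteq> 2 * d" for i j
      using that z[OF q(1), of i j] z[OF q(1), of j i] by (simp add: q(2) look)
    then have "keys p \<subseteq> monomials (2 * d)" unfolding monomials_def in_keys_iff[symmetric] by (auto simp: in_keys_iff)
    moreover have "lookup p (i, j) = 0" if "odd i" for i j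
    proof -
      have "\<not> (j + i = 2 * d \<and> even j \<and> j < i)" using that by presburger
      then show ?thesis using that z[OF q(1), of i j] z[OF q(1), of j i] by (simp only: q(2) look) simp
    qed
    ultimately show "p \<in> even_alternating (2 * d)"
      by (intro even_alternatingI) (simp_all add: q(2) look)
  qed
  moreover have "qvs.dim (R ` {q. keys q \<subseteq> K}) = qvs.dim {q. keys q \<subseteq> K}"
  proof (rule qvp.dim_image_injective[OF lin subspace_keys])
    show "{q. keys q \<subseteq> K} \<subseteq> qvs.span (bas ` K)" by (simp add: span_bas)
    show "q = 0" if q: "q \<in> {q. keys q \<subseteq> K}" "R q = 0" for q
    proof -
      have "lookup q (i, j) = 0" for i j
      proof (cases "i < j")
        case True
        then show ?thesis using look[of q i j] q z[of q j i] by simp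
      qed (use q z[of q i j] in simp)
      then show ?thesis by (intro poly_mapping_eqI) auto
    qed
  qed (use fK in simp)
  moreover have "card K = (d + 1) div 2"
  proof -
    have "K = (\<lambda>a. (2 * a, 2 * d - 2 * a)) ` {..<(d + 1) div 2}"
    proof (intro equalityI subsetI)
      fix k assume "k \<in> K"
      then obtain i j where k: "k = (i, j)" "i + j = 2 * d" "even i" "i < j" by (auto simp: K_def)
      then show "k \<in> (\<lambda>a. (2 * a, 2 * d - 2 * a)) ` {..<(d + 1) div 2}"
        by (intro image_eqI[of _ _ "i div 2"]) auto
    qed (auto simp: K_def)
    moreover have "inj_on (\<lambda>a. (2 * a, 2 * d - 2 * a)) {..<(d + 1) div 2}" by (auto simp: inj_on_def)
    ultimately show ?thesis by (simp add: card_image)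
  qed
  ultimately show ?thesis by (simp add: dim_keys[OF fK])
qed

text \<open>The substitution of (x - y, x) for (x, y) has cube -1, so it acts with order three on
  functions of even degree. This is the sum over its powers.\<close>

definition period_map :: "(rat \<Rightarrow> rat \<Rightarrow> rat) \<Rightarrow> (rat \<Rightarrow> rat \<Rightarrow> rat)" where
  "period_map f = (\<lambda>x y. f x y + f (x - y) x + f (- y) (x - y))"

lemma linear_period_map: "Vector_Spaces.linear fscale fscale period_map"
  by (rule flinearI) (simp_all add: period_map_def fscale_def fun_eq_iff algebra_simps)

lemma linear_period_map_eval2: "Vector_Spaces.linear qscale fscale (\<lambda>p. period_map (eval2 p))"
  using Vector_Spaces.linear_compose[OF linear_eval2 linear_period_map] by (simp add: comp_def)

lemma subspace_period_map_kernel: "qvs.subspace {p. period_map (eval2 p) = 0}"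
  using linear_period_map_eval2 unfolding qvs.subspace_def
  by (simp add: Vector_Spaces.linear_iff) (simp add: period_map_def eval2_def zero_fun_def)

lemma eval2_x_axis:
  assumes "keys p \<subseteq> monomials n"
  shows "eval2 p x 0 = lookup p (n, 0) * x ^ n"
proof -
  have "eval2 p x 0 = (\<Sum>i\<le>n. if i = n then lookup p (n, 0) * x ^ n else 0)"
    unfolding eval2_monomials[OF assms] by (intro sum.cong) auto
  then show ?thesis by simp
qed

text \<open>Adding the relations at (x, y) and (y, x) and using evenness shows that period
  polynomials are antisymmetric. Then \<open>- eval2 p (x - y) y\<close> is
  \<open>eval2 p (- y) (x - y)\<close>, and the relation becomes the vanishing of
  \<open>period_map\<close>.\<close>

lemma period_polys_even:
  assumes n: "even n"
  shows "period_polys (n + 2) = {p \<in> even_alternating n. period_map (eval2 p) = 0 \<and> lookup p (n, 0) = 0}"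
proof (intro equalityI subsetI)
  fix p assume p: "p \<in> period_polys (n + 2)"
  then have k: "keys p \<subseteq> monomials n" by (auto simp: period_polys_def monomials_def)
  have "\<forall>x y. eval2 p (- x) y = eval2 p x y" "\<forall>x y. eval2 p x (- y) = eval2 p x y"
    and "\<forall>x y. eval2 p x y + eval2 p (x - y) x - eval2 p (x - y) y = 0" and p0: "eval2 p 1 0 = 0"
    using p by (auto simp: period_polys_def)
  then have ev: "eval2 p (- x) y = eval2 p x y" "eval2 p x (- y) = eval2 p x y"
    and rel: "eval2 p x y + eval2 p (x - y) x - eval2 p (x - y) y = 0" for x y by blast+
  have alt: "eval2 p y x = - eval2 p x y" for x y
    using rel[of x y] rel[of y x] ev(1)[of "x - y" x] ev(1)[of "x - y" y] by simp
  have "eval2 p x y + eval2 p (x - y) x + eval2 p (- y) (x - y) = 0" for x y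
    using rel[of x y] alt[of "x - y" y] ev(1)[of y "x - y"] by simp
  moreover have "p \<in> even_alternating n" using even_alternating_iff[OF k] ev(1) alt by blast
  moreover have "lookup p (n, 0) = 0" using p0 eval2_x_axis[OF k, of 1] by simp
  ultimately show "p \<in> {p \<in> even_alternating n. period_map (eval2 p) = 0 \<and> lookup p (n, 0) = 0}"
    by (simp add: period_map_def zero_fun_def)
next
  fix p assume p: "p \<in> {p \<in> even_alternating n. period_map (eval2 p) = 0 \<and> lookup p (n, 0) = 0}"
  then have k: "keys p \<subseteq> monomials n" by (simp add: even_alternating_def)
  have "\<forall>x y. eval2 p (- x) y = eval2 p x y" "\<forall>x y. eval2 p y x = - eval2 p x y"
    using even_alternating_iff[OF k] p by blast+
  then have ev: "eval2 p (- x) y = eval2 p x y" and alt: "eval2 p y x = - eval2 p x y" for x y by blast+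
  have ev': "eval2 p x (- y) = eval2 p x y" for x y
    using alt[of x "- y"] alt[of x y] ev[of y x] by simp
  have rel: "eval2 p x y + eval2 p (x - y) x + eval2 p (- y) (x - y) = 0" for x y
    using p by (simp add: period_map_def fun_eq_iff)
  have "eval2 p x y + eval2 p (x - y) x - eval2 p (x - y) y = 0" for x y
    using rel[of x y] alt[of "x - y" y] ev[of y "x - y"] by simp
  moreover have "eval2 p x 0 = 0" for x using eval2_x_axis[OF k] p by simp
  ultimately show "p \<in> period_polys (n + 2)"
    using k ev ev' by (auto simp: period_polys_def monomials_def)
qed

lemma period_polys_odd:
  assumes n: "odd n"
  shows "period_polys (n + 2) = {0}"
proof (intro equalityI subsetI)
  fix p assume p: "p \<in> period_polys (n + 2)"
  then have k: "keys p \<subseteq> monomials n" by (auto simp: period_polys_def monomials_def)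
  have "eval2 p x y = 0" for x y
  proof -
    have "eval2 p (- x) (- y) = eval2 p x y" using p by (simp add: period_polys_def)
    then show ?thesis using hpoly_odd[OF eval2_in_hpoly[OF k] n, of x y] by simp
  qed
  then show "p \<in> {0}" using eval2_eq_0[OF k] by blast
qed (auto simp: period_polys_def eval2_def)

lemma subspace_period_polys: "qvs.subspace (period_polys (n + 2))"
proof (cases "even n")
  case True
  have "qvs.subspace {p :: nat \<times> nat \<Rightarrow>\<^sub>0 rat. lookup p (n, 0) = 0}"
    unfolding qvs.subspace_def by (simp add: lookup_add)
  then have "qvs.subspace (even_alternating n \<inter> ({p. period_map (eval2 p) = 0} \<inter> {p. lookup p (n, 0) = 0}))"
    by (intro qvs.subspace_inter subspace_even_alternating subspace_period_map_kernel)
  then show ?thesis unfolding period_polys_even[OF True] by (simp add: Int_def)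
next
  case False
  show ?thesis unfolding period_polys_odd[OF False] by (rule qvs.subspace_single_0)
qed

lemma sum_fun_apply2: "(\<Sum>i\<in>A. g i) x y = (\<Sum>i\<in>A. g i x y :: rat)"
  by (induction A rule: infinite_finite_induct) simp_all

text \<open>Modulo the sums on the right-hand side, \<open>x^(n-j-1) (x + y)^(j+1)\<close> and \<open>x^(n-j-1) y^(j+1)\<close> agree, so
  that \<open>x^(n-j) y^j\<close> is a combination of the monomials with a smaller power of \<open>y\<close>.\<close>

lemma hpoly_decomposition:
  assumes f: "f \<in> hpoly n" and n: "even n" "0 < n"
  shows "\<exists>a\<in>hpoly n. \<exists>b\<in>hpoly n. \<exists>c\<in>hpoly n.
    f = (\<lambda>x y. (a x y + a y x) + (b x y + b (- x) y) + (c x y - c (x - y) x))"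
proof -
  define D where "D a b c = (\<lambda>x y. (a x y + a y x) + (b x y + b (- x) y) + (c x y - c (x - y) x))"
    for a b c :: "rat \<Rightarrow> rat \<Rightarrow> rat"
  define S where "S = {D a b c | a b c. a \<in> hpoly n \<and> b \<in> hpoly n \<and> c \<in> hpoly n}"
  have SI: "D a b c \<in> S" if "a \<in> hpoly n" "b \<in> hpoly n" "c \<in> hpoly n" for a b c
    using that unfolding S_def by blast
  have z: "0 \<in> hpoly n" by (rule fvs.subspace_0[OF subspace_hpoly])
  have sub: "fvs.subspace S"
  proof (rule fvs.subspaceI)
    have "D 0 0 0 = 0" by (simp add: D_def fun_eq_iff)
    then show "0 \<in> S" using SI[OF z z z] by simp
  next
    fix f g assume "f \<in> S" "g \<in> S"
    then obtain a b c a' b' c' where f: "f = D a b c" "a \<in> hpoly n" "b \<in> hpoly n" "c \<in> hpoly n"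
      and g: "g = D a' b' c'" "a' \<in> hpoly n" "b' \<in> hpoly n" "c' \<in> hpoly n" unfolding S_def by blast
    have "f + g = D (a + a') (b + b') (c + c')" unfolding f g by (simp add: D_def fun_eq_iff)
    then show "f + g \<in> S" using SI fvs.subspace_add[OF subspace_hpoly] f g by simp
  next
    fix r f assume "f \<in> S"
    then obtain a b c where f: "f = D a b c" "a \<in> hpoly n" "b \<in> hpoly n" "c \<in> hpoly n" unfolding S_def by blast
    have "fscale r f = D (fscale r a) (fscale r b) (fscale r c)"
      unfolding f by (simp add: D_def fun_eq_iff fscale_def algebra_simps)
    then show "fscale r f \<in> S" using SI fvs.subspace_scale[OF subspace_hpoly] f by simp
  qed
  define m where "m j = (\<lambda>x y :: rat. x ^ (n - j) * y ^ j)" for j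
  have mh: "m j \<in> hpoly n" if "j \<le> n" for j using mono_in_hpoly[of "n - j" j] that by (simp add: m_def)
  have less: "m j \<in> S" if "j < n" for j
    using that
  proof (induction j rule: less_induct)
    case (less j)
    let ?f = "m (Suc j)"
    have fh: "?f \<in> hpoly n" using mh less.prems by simp
    let ?b = "\<lambda>x y. ?f (1 * x + 0 * y) (1 * x + (- 1) * y)" and ?c = "\<lambda>x y. ?f (0 * x + 1 * y) (1 * x + 0 * y)"
    \<comment> \<open>These choices make everything cancel except
      \<open>?f x (x + y) - ?f x y\<close>, the degree being even. In its binomial expansion the
      term with \<open>m j\<close> has coefficient \<open>j + 1\<close> and the others come earlier,
      so it can be solved for \<open>m j\<close>.\<close>
    define d where "d = D (fscale (- 1) ?f) ?b ?c"
    have dS: "d \<in> S"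
      unfolding d_def by (intro SI hpoly_subst fh fvs.subspace_scale[OF subspace_hpoly])
    have "d x y = (\<Sum>i\<le>j. of_nat (Suc j choose i) * m i x y)" for x y
    proof -
      have "?f (- x) (- (x + y)) = ?f x (x + y)" by (rule hpoly_even[OF fh n(1)])
      then have "d x y = ?f x (y + x) - ?f x y" by (simp add: d_def D_def fscale_def add.commute)
      also have "\<dots> = x ^ (n - Suc j) * ((y + x) ^ Suc j - y ^ Suc j)"
        by (simp only: m_def right_diff_distrib)
      also have "(y + x) ^ Suc j - y ^ Suc j = (\<Sum>i\<le>j. of_nat (Suc j choose i) * y ^ i * x ^ (Suc j - i))"
        unfolding binomial_ring by simp
      also have "x ^ (n - Suc j) * \<dots> = (\<Sum>i\<le>j. of_nat (Suc j choose i) * m i x y)"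
        unfolding sum_distrib_left
      proof (intro sum.cong refl)
        fix i assume "i \<in> {..j}"
        then have "n - i = (n - Suc j) + (Suc j - i)" using less.prems by simp
        then show "x ^ (n - Suc j) * (of_nat (Suc j choose i) * y ^ i * x ^ (Suc j - i)) = of_nat (Suc j choose i) * m i x y"
          by (simp only: m_def power_add mult_ac)
      qed
      finally show ?thesis .
    qed
    then have "d x y - (\<Sum>i<j. of_nat (Suc j choose i) * m i x y) = of_nat (Suc j) * m j x y" for x y
      by (simp add: lessThan_Suc_atMost[symmetric])
    then have "m j = fscale (1 / of_nat (Suc j)) (d - (\<Sum>i<j. fscale (of_nat (Suc j choose i)) (m i)))"
      by (simp add: fun_eq_iff fscale_def sum_fun_apply2 del: of_nat_Suc)
    moreover have "fscale (1 / of_nat (Suc j)) (d - (\<Sum>i<j. fscale (of_nat (Suc j choose i)) (m i))) \<in> S"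
      using less by (intro fvs.subspace_scale fvs.subspace_diff fvs.subspace_sum sub dS) auto
    ultimately show ?case by simp
  qed
  have "m j \<in> S" if "j \<le> n" for j
  proof (cases "j = n")
    case True
    \<comment> \<open>The recursion does not reach the pure power of y; the exchange of variables
      takes it to the pure power of x.\<close>
    have "m n = D (m 0) 0 0 - m 0" by (simp add: D_def m_def fun_eq_iff)
    also have "\<dots> \<in> S" by (intro fvs.subspace_diff[OF sub] SI mh z less) (use n in auto)
    finally show ?thesis using True by simp
  qed (use that less in simp)
  then have "eval2 (bas (i, j)) \<in> S" if "i + j = n" for i j
  proof -
    have "eval2 (bas (i, j)) = m j" using that by (auto simp: m_def fun_eq_iff)
    then show ?thesis using \<open>\<And>j. j \<le> n \<Longrightarrow> m j \<in> S\<close>[of j] that by simp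
  qed
  then have "fvs.span (eval2 ` bas ` monomials n) \<subseteq> S"
    by (intro fvs.span_minimal sub) (auto simp: monomials_def)
  then have "f \<in> S" using hpoly_finite_span[of n] f by blast
  then show ?thesis unfolding S_def D_def by blast
qed

text \<open>For surjectivity, decompose \<open>q\<close> and add the six equations at the images of
  (x, y) under the group, with signs. The left sides give \<open>6 * q\<close>; the \<open>a\<close>
  terms cancel in pairs, the \<open>c\<close> terms telescope along the rotation, and the
  \<open>b\<close> terms form a value of \<open>period_map\<close>. The 1/6 in \<open>g\<close> is
  one over the order of the group.\<close>

lemma period_map_image:
  assumes n: "even n" "0 < n"
  shows "(\<lambda>p. period_map (eval2 p)) ` even_alternating n = sign_invariants n"
proof (intro equalityI subsetI)
  fix q assume "q \<in> (\<lambda>p. period_map (eval2 p)) ` even_alternating n"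
  then obtain p where p: "p \<in> even_alternating n" "q = period_map (eval2 p)" by auto
  define f where "f = eval2 p"
  have k: "keys p \<subseteq> monomials n" using p(1) by (simp add: even_alternating_def)
  then have fh: "f \<in> hpoly n" by (simp add: f_def eval2_in_hpoly)
  have "\<forall>x y. f (- x) y = f x y" "\<forall>x y. f y x = - f x y" using even_alternating_iff[OF k] p(1) unfolding f_def by blast+
  then have ev: "f (- x) y = f x y" and alt: "f y x = - f x y" for x y by blast+
  have total: "f (- x) (- y) = f x y" for x y by (rule hpoly_even[OF fh n(1)])
  have "q y x = - q x y" for x y
  proof -
    have "f (y - x) y = - f (- y) (x - y)" using alt[of "- y" "x - y"] total[of "x - y" "- y"] by simp
    moreover have "f (- x) (y - x) = - f (x - y) x" using alt[of x "x - y"] total[of x "x - y"] by simp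
    ultimately show ?thesis using alt[of x y] by (simp add: p(2) period_map_def flip: f_def)
  qed
  moreover have "q (x - y) x = q x y" for x y
    using total[of x y] by (simp add: p(2) period_map_def flip: f_def)
  moreover have "q \<in> hpoly n"
  proof -
    have "(\<lambda>x y. f (1 * x + 0 * y) (0 * x + 1 * y) + f (1 * x + (- 1) * y) (1 * x + 0 * y)
        + f (0 * x + (- 1) * y) (1 * x + (- 1) * y)) \<in> hpoly n"
      by (intro hpoly_add hpoly_subst fh)
    then show ?thesis by (simp add: p(2) period_map_def flip: f_def)
  qed
  ultimately show "q \<in> sign_invariants n" unfolding sign_invariants_def by blast
next
  fix q assume q: "q \<in> sign_invariants n"
  then have qh: "q \<in> hpoly n" and alt: "q y x = - q x y" and cyc: "q (x - y) x = q x y" for x y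
    unfolding sign_invariants_def by blast+
  obtain a b c where abc: "a \<in> hpoly n" "b \<in> hpoly n" "c \<in> hpoly n"
    and qe: "q = (\<lambda>x y. (a x y + a y x) + (b x y + b (- x) y) + (c x y - c (x - y) x))"
    using hpoly_decomposition[OF qh n] by blast
  define g where "g = (\<lambda>x y. (1 / 6) * ((b x y + b (- x) y) - (b y x + b (- y) x)))"
  have tb: "b (- x) (- y) = b x y" for x y by (rule hpoly_even[OF abc(2) n(1)])
  have ta: "a (- x) (- y) = a x y" and tc: "c (- x) (- y) = c x y" for x y
    using hpoly_even[OF abc(1) n(1)] hpoly_even[OF abc(3) n(1)] by blast+
  have "(\<lambda>x y. (1 / 6) * ((b (1 * x + 0 * y) (0 * x + 1 * y) + b ((- 1) * x + 0 * y) (0 * x + 1 * y))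
      - (b (0 * x + 1 * y) (1 * x + 0 * y) + b (0 * x + (- 1) * y) (1 * x + 0 * y)))) \<in> hpoly n"
    by (intro hpoly_scale hpoly_diff hpoly_add hpoly_subst abc(2))
  then have gh: "g \<in> hpoly n" by (simp add: g_def)
  obtain p where p: "keys p \<subseteq> monomials n" "g = eval2 p" using hpoly_eq_eval2[OF gh] by blast
  have g1: "g (- x) y = g x y" for x y
    using tb[of y x] tb[of y "- x"] by (simp add: g_def)
  have g2: "g y x = - g x y" for x y by (simp add: g_def field_simps)
  have "p \<in> even_alternating n"
    unfolding even_alternating_iff[OF p(1)] p(2)[symmetric] by (intro conjI allI g1 g2)
  moreover have "q x y = period_map g x y" for x y
  proof -
    have E: "q u v = (a u v + a v u) + (b u v + b (- u) v) + (c u v - c (u - v) u)" for u v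
      by (simp only: qe)
    have Q: "q (- y) (x - y) = q x y" "q x (x - y) = - q x y" "q (x - y) (- y) = - q x y"
      using cyc[of x y] cyc[of "x - y" x] alt[of x "x - y"] alt[of "x - y" "- y"] by simp_all
    have 1: "q x y = (a x y + a y x) + (b x y + b (- x) y) + (c x y - c (x - y) x)" by (rule E)
    have 2: "q x y = (a (x - y) x + a x (x - y)) + (b (x - y) x + b (- (x - y)) x) + (c (x - y) x - c (- y) (x - y))"
      using E[of "x - y" x] cyc[of x y] by simp
    have 3: "q x y = (a (- y) (x - y) + a (x - y) (- y)) + (b (- y) (x - y) + b y (x - y)) + (c (- y) (x - y) - c x y)"
      using E[of "- y" "x - y"] Q(1) tc[of x y] by simp
    have 4: "- q x y = (a y x + a x y) + (b y x + b (- y) x) + (c y x - c (y - x) y)"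
      using E[of y x] alt[of y x] by simp
    have 5: "- q x y = (a x (x - y) + a (x - y) x) + (b x (x - y) + b (- x) (x - y)) + (c x (x - y) - c y x)"
      using E[of x "x - y"] Q(2) by simp
    have 6: "- q x y = (a (x - y) (- y) + a (- y) (x - y)) + (b (x - y) (- y) + b (- (x - y)) (- y)) + (c (y - x) y - c x (x - y))"
      using E[of "x - y" "- y"] Q(3) tc[of "y - x" y] by simp
    have "6 * period_map g x y =
        ((b x y + b (- x) y) - (b y x + b (- y) x))
        + ((b (x - y) x + b (- (x - y)) x) - (b x (x - y) + b (- x) (x - y)))
        + ((b (- y) (x - y) + b y (x - y)) - (b (x - y) (- y) + b (- (x - y)) (- y)))"
      unfolding period_map_def g_def distrib_left mult.assoc[symmetric] by simp
    then show ?thesis using 1 2 3 4 5 6 by linarith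
  qed
  then have "q = period_map (eval2 p)" by (simp add: p(2) fun_eq_iff)
  ultimately show "q \<in> (\<lambda>p. period_map (eval2 p)) ` even_alternating n" by blast
qed

text \<open>The polynomial x^n - y^n satisfies the three-term relation but not the condition on the
  x-axis; it accounts for the 1 in the dimension formula.\<close>

lemma period_polys_axis:
  assumes "0 < n" "even n"
  shows "bas (n, 0) - bas (0, n) \<in> even_alternating n" (is "?p \<in> _")
    and "period_map (eval2 (bas (n, 0) - bas (0, n))) = 0"
    and "lookup (bas (n, 0) - bas (0, n)) (n, 0) = (1 :: rat)"
proof -
  have e: "eval2 ?p x y = x ^ n - y ^ n" for x y
    using qfunctional_add[OF qfunctional_eval2, of "bas (n, 0) - bas (0, n)" "bas (0, n)" x y] by simp
  have k: "keys ?p \<subseteq> monomials n"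
    using qvs.subspace_diff[OF subspace_keys, of "bas (n, 0)" "monomials n" "bas (0, n)"] by (simp add: monomials_def)
  show "?p \<in> even_alternating n"
    unfolding even_alternating_iff[OF k] using assms by (simp add: e)
  show "period_map (eval2 ?p) = 0"
    using assms by (simp add: period_map_def fun_eq_iff e)
  show "lookup ?p (n, 0) = 1" using assms by (simp add: lookup_minus lookup_single)
qed

text \<open>Out of the \<open>(d + 1) div 2\<close> dimensions of even alternating polynomials, the
  image of \<open>period_map\<close> takes \<open>d div 3\<close>, and the condition on the axis
  takes one more.\<close>

lemma dim_period_polys_even:
  assumes d: "0 < d"
  shows "Suc (qvs.dim (period_polys (2 * d + 2)) + d div 3) = (d + 1) div 2"
proof -
  let ?n = "2 * d" and ?E = "even_alternating (2 * d)" and ?S = "bas ` monomials (2 * d)"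
  let ?W = "{p \<in> ?E. period_map (eval2 p) = 0}"
  have n: "even ?n" "0 < ?n" using d by auto
  have sub: "?E \<subseteq> qvs.span ?S" "finite ?S" by (auto simp: even_alternating_def span_bas finite_monomials)
  have "qvs.dim ?E = fvs.dim ((\<lambda>p. period_map (eval2 p)) ` ?E) + qvs.dim ?W"
    by (rule qfp.rank_nullity[OF linear_period_map_eval2 subspace_even_alternating sub])
  then have 1: "(d + 1) div 2 = d div 3 + qvs.dim ?W"
    using dim_sign_invariants[OF n(1)] by (simp add: period_map_image[OF n] dim_even_alternating)
  let ?f = "\<lambda>p :: nat \<times> nat \<Rightarrow>\<^sub>0 rat. qscale (lookup p (?n, 0)) (bas (?n, 0 :: nat))"
  have subW: "qvs.subspace ?W"
    using qvs.subspace_inter[OF subspace_even_alternating subspace_period_map_kernel] by (simp add: Int_def)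
  have "qvs.dim ?W = qvs.dim (?f ` ?W) + qvs.dim {p \<in> ?W. ?f p = 0}"
  proof (rule qvp.rank_nullity)
    show "qlinear ?f" by (rule qlinear_scale_functional[OF qfunctional_lookup])
    show "?W \<subseteq> qvs.span ?S" using sub by auto
  qed (rule subW sub)+
  moreover have "{p \<in> ?W. ?f p = 0} = period_polys (?n + 2)"
  proof -
    have "?f p = 0 \<longleftrightarrow> lookup p (?n, 0) = 0" for p :: "nat \<times> nat \<Rightarrow>\<^sub>0 rat"
      using arg_cong[of "?f p" 0 "\<lambda>q. lookup q (?n, 0)"] by auto
    then show ?thesis unfolding period_polys_even[OF n(1)] by auto
  qed
  moreover have "?f ` ?W = qvs.span {bas (?n, 0 :: nat)}"
  proof (intro equalityI subsetI)
    fix q assume "q \<in> qvs.span {bas (?n, 0 :: nat)}"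
    then obtain c where c: "q = qscale c (bas (?n, 0))" by (auto simp: qvs.span_singleton)
    let ?p = "qscale c (bas (?n, 0) - bas (0, ?n))"
    have "bas (?n, 0) - bas (0, ?n) \<in> ?W" using period_polys_axis(1,2)[OF n(2,1)] by blast
    then have "?p \<in> ?W" by (rule qvs.subspace_scale[OF subW])
    moreover have "q = ?f ?p" using period_polys_axis(3)[OF n(2,1)] by (simp only: c lookup_qscale mult_1_right)
    ultimately show "q \<in> ?f ` ?W" by blast
  qed (auto simp: qvs.span_singleton)
  moreover have "qvs.dim (qvs.span {bas (?n, 0 :: nat)}) = 1"
    using dim_keys[of "{(?n, 0)}"] span_bas[of "{(?n, 0 :: nat)}"] by simp
  ultimately show ?thesis using 1 by simp
qed

lemma dim_period_polys:
  "qvs.dim (period_polys (n + 2)) = (if even n then (n div 2 + 1) div 2 - 1 - n div 2 div 3 else 0)" if "0 < n"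
proof (cases "even n")
  case True
  then obtain d where d: "n = 2 * d" by (elim evenE)
  then show ?thesis using dim_period_polys_even[of d] that by simp
next
  case False
  have "qvs.dim {0 :: nat \<times> nat \<Rightarrow>\<^sub>0 rat} = 0" using qvs.dim_le_card[of "{0}" "{}"] by simp
  then show ?thesis unfolding period_polys_odd[OF False] using False by simp
qed

section \<open>The graded dual of the period polynomials\<close>

lemma pairing_homog_part:
  assumes "p \<in> homog w N"
  shows "pairing (homog_part w M l) p = (if M = N then pairing l p else 0)"
  using assms unfolding pairing_commute[of _ p]
  by (auto simp: pairing_def homog_def lookup_homog_part intro: sum.cong)

lemma period_polys_homog: "3 \<le> N \<Longrightarrow> period_polys N \<subseteq> homog (\<lambda>(i, j). i + j + 2) N"
  by (auto simp: period_polys_def homog_def)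

lemma dim_homog: "finite {k. w k = N} \<Longrightarrow> qvs.dim (homog w N) = card {k. w k = N}"
  unfolding homog_eq_span span_bas by (rule dim_keys)

lemma finite_P_dual_weights: "finite {k. (\<lambda>(i, j). i + j + 2 :: nat) k = N}"
  by (rule finite_subset[of _ "{..N} \<times> {..N}"]) auto

lemma den_P_dual_iff:
  assumes "l \<in> homog (\<lambda>(i, j). i + j + 2) N"
  shows "l \<in> den P_dual \<longleftrightarrow> (3 \<le> N \<longrightarrow> (\<forall>p\<in>period_polys N. pairing l p = 0))"
proof
  assume "3 \<le> N \<longrightarrow> (\<forall>p\<in>period_polys N. pairing l p = 0)"
  moreover have "pairing l p = 0" if "3 \<le> M" "p \<in> period_polys M" "M \<noteq> N" for M p
  proof -
    have "p \<in> homog (\<lambda>(i, j). i + j + 2) M" using period_polys_homog that by blast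
    from pairing_homog_part[OF this, of N l] show ?thesis using that(3) unfolding homog_part_homog[OF assms] by simp
  qed
  ultimately show "l \<in> den P_dual" by (auto simp: P_dual_def)
qed (simp add: P_dual_def)

lemma graded_subquot_P_dual: "graded_subquot P_dual"
proof -
  have "qvs.subspace (den P_dual)"
    unfolding qvs.subspace_def P_dual_def
    by (simp add: qfunctional_zero[OF qfunctional_pairing_left] qfunctional_add[OF qfunctional_pairing_left]
        qfunctional_scale[OF qfunctional_pairing_left])
  moreover have "homog_part (wt P_dual) M l \<in> den P_dual" if "l \<in> den P_dual" for M l
  proof -
    have "pairing (homog_part (wt P_dual) M l) p = 0" if "3 \<le> M" "p \<in> period_polys M" for p
      using pairing_homog_part[of p "wt P_dual" M M l] period_polys_homog[of M] \<open>l \<in> den P_dual\<close> that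
      by (auto simp: P_dual_def)
    then show ?thesis
      using den_P_dual_iff[of "homog_part (wt P_dual) M l" M] homog_part_in_homog[of "wt P_dual" M l] by (auto simp: P_dual_def)
  qed
  ultimately show ?thesis
    using finite_P_dual_weights by (simp add: graded_subquot_def graded_subspace_def) (simp add: P_dual_def)
qed

text \<open>A finite-dimensional weight space modulo the annihilator of
  \<open>period_polys N\<close> is the dual of the latter.\<close>

lemma wt_dim_P_dual: "wt_dim P_dual N = (if 3 \<le> N then qvs.dim (period_polys N) else 0)"
proof -
  let ?w = "\<lambda>(i, j). i + j + 2 :: nat"
  have eq: "wt_dim P_dual N = qvs.dim (homog ?w N) - qvs.dim (den P_dual \<inter> homog ?w N)"
    by (simp add: wt_dim_def) (simp add: P_dual_def)
  have den: "den P_dual \<inter> homog ?w N = {l \<in> homog ?w N. 3 \<le> N \<longrightarrow> (\<forall>p\<in>period_polys N. pairing l p = 0)}"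
    using den_P_dual_iff[of _ N] by auto
  show ?thesis
  proof (cases "3 \<le> N")
    case True
    then have n: "N = (N - 2) + 2" by simp
    let ?K = "{k. ?w k = N}"
    have hom: "homog ?w N = {p. keys p \<subseteq> ?K}" by (auto simp: homog_def)
    have "{l \<in> homog ?w N. \<forall>p\<in>period_polys N. pairing l p = 0} = {l. keys l \<subseteq> ?K \<and> (\<forall>p\<in>period_polys N. pairing l p = 0)}"
      unfolding hom by auto
    moreover have "qvs.dim {l. keys l \<subseteq> ?K \<and> (\<forall>p\<in>period_polys N. pairing l p = 0)} + qvs.dim (period_polys N) = card ?K"
    proof (rule dim_annihilator[OF finite_P_dual_weights])
      show "qvs.subspace (period_polys N)" using subspace_period_polys[of "N - 2"] n by simp
      show "period_polys N \<subseteq> {p. keys p \<subseteq> ?K}" using period_polys_homog[OF True] unfolding hom .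
    qed
    ultimately show ?thesis using True dim_homog[OF finite_P_dual_weights, of N] by (simp only: eq den) simp
  next
    case False
    then show ?thesis unfolding eq den by simp
  qed
qed

section \<open>Relations between double zeta values and period polynomials\<close>

context mixed_tate_Z
begin

text \<open>The dual of the word f_m f_n becomes the monomial x^(m-1) y^(n-1). The scalars absorb
  those of \<open>lookup_psi_double_zeta\<close>, so that the choice of generators drops out of the
  relation.\<close>

definition double_poly :: "(nat list \<Rightarrow>\<^sub>0 rat) \<Rightarrow> (nat \<times> nat \<Rightarrow>\<^sub>0 rat)" where
  "double_poly = lin_ext (\<lambda>u. qscale (zeta_coeff (u ! 0) * zeta_coeff (u ! 1)) (bas (u ! 0 - 1, u ! 1 - 1)))"

lemma qlinear_double_poly: "qlinear double_poly"
  unfolding double_poly_def by (rule qlinear_lin_ext)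

lemma qfunctional_eq_on_keys:
  assumes "qfunctional f" "qfunctional g" "\<And>k. k \<in> keys p \<Longrightarrow> f (bas k) = g (bas k)"
  shows "f p = g p"
  using assms(3) by (simp add: qfunctional_expand[OF assms(1), of p] qfunctional_expand[OF assms(2), of p])

lemma lookup_double_poly:
  assumes l: "keys l \<subseteq> pair_words N"
  shows "lookup (double_poly l) (i, j) = zeta_coeff (Suc i) * zeta_coeff (Suc j) * lookup l [Suc i, Suc j]"
proof (rule qfunctional_eq_on_keys[of "\<lambda>l. lookup (double_poly l) (i, j)" "\<lambda>l. zeta_coeff (Suc i) * zeta_coeff (Suc j) * lookup l [Suc i, Suc j]" l])
  show "qfunctional (\<lambda>l. lookup (double_poly l) (i, j))"
    by (rule qfunctional_compose[OF qlinear_double_poly qfunctional_lookup])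
  show "qfunctional (\<lambda>l. zeta_coeff (Suc i) * zeta_coeff (Suc j) * lookup l [Suc i, Suc j])"
    by (rule qfunctionalI) (simp_all add: lookup_add algebra_simps)
  fix u assume "u \<in> keys l"
  then obtain m n where u: "u = [m, n]" "3 \<le> m" "3 \<le> n" using l pair_words_iff by blast
  then obtain i' j' where "m = Suc i'" "n = Suc j'" by (metis not_numeral_le_zero old.nat.exhaust)
  then show "lookup (double_poly (bas u)) (i, j) = zeta_coeff (Suc i) * zeta_coeff (Suc j) * lookup (bas u) [Suc i, Suc j]"
    by (auto simp: double_poly_def u(1) lookup_single when_def)
qed

text \<open>The polynomials \<open>(x - y)\<^bsup>m-1\<^esup> x\<^bsup>n-1\<^esup>\<close> and \<open>(x - y)\<^bsup>m-1\<^esup> y\<^bsup>n-1\<^esup>\<close> of the period relation are generating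
  functions of the binomial coefficients in the coaction on double zeta values.\<close>

lemma period_relation_double_poly:
  assumes l: "keys l \<subseteq> pair_words (k + 2)"
  shows "eval2 (double_poly l) x y + eval2 (double_poly l) (x - y) x - eval2 (double_poly l) (x - y) y =
    (\<Sum>i\<le>k. pairing l (\<psi> (zeta_elt [Suc i, Suc (k - i)])) * x ^ i * y ^ (k - i))" (is "?f l = ?g l")
proof (rule qfunctional_eq_on_keys[of ?f ?g l])
  have q: "qfunctional (\<lambda>l. eval2 (double_poly l) x y)" for x y
    by (rule qfunctional_compose[OF qlinear_double_poly qfunctional_eval2])
  show "qfunctional ?f"
    by (rule qfunctionalI) (simp_all add: qfunctional_add[OF q] qfunctional_scale[OF q] algebra_simps)
  show "qfunctional ?g"
    by (rule qfunctionalI) (simp_all add: qfunctional_add[OF qfunctional_pairing_left] qfunctional_scale[OF qfunctional_pairing_left]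
        sum.distrib sum_distrib_left algebra_simps)
  fix u assume "u \<in> keys l"
  then obtain m' n' where u: "u = [m', n']" and mn': "odd m'" "3 \<le> m'" "odd n'" "3 \<le> n'" "m' + n' = k + 2"
    using l pair_words_iff by blast
  then obtain m n where mn: "m' = Suc m" "n' = Suc n" by (metis not_numeral_le_zero old.nat.exhaust)
  have k: "k = m + n" and em: "even m" using mn' mn by auto
  let ?c = "zeta_coeff m' * zeta_coeff n'"
  have pair: "pairing (bas u) p = lookup p u" for p :: "nat list \<Rightarrow>\<^sub>0 rat" by (simp add: pairing_def)
  have z: "lookup (\<psi> (zeta_elt [Suc i, Suc (k - i)])) u = ?c *
      ((if i = m then 1 else 0) + (- 1) ^ (k - i) * of_nat (m choose (k - i)) - (- 1) ^ i * of_nat (m choose i))"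
    if "i \<le> k" for i
    using that mn' unfolding u
    by (subst lookup_psi_double_zeta) (auto simp: mn)
  have "?g (bas u) = ?c * ((\<Sum>i\<le>k. if i = m then x ^ i * y ^ (k - i) else 0)
      + (\<Sum>i\<le>k. (- 1) ^ (k - i) * of_nat (m choose (k - i)) * x ^ i * y ^ (k - i))
      - (\<Sum>i\<le>k. (- 1) ^ i * of_nat (m choose i) * x ^ i * y ^ (k - i)))"
    unfolding sum.distrib[symmetric] sum_subtractf[symmetric] sum_distrib_left
    by (intro sum.cong refl) (simp add: pair z algebra_simps)
  also have "(\<Sum>i\<le>k. if i = m then x ^ i * y ^ (k - i) else 0) = x ^ m * y ^ n"
    by (simp add: k)
  also have "(\<Sum>i\<le>k. (- 1) ^ (k - i) * of_nat (m choose (k - i)) * x ^ i * y ^ (k - i)) = (x - y) ^ m * x ^ n"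
  proof -
    have "(\<Sum>i\<le>k. (- 1) ^ (k - i) * of_nat (m choose (k - i)) * x ^ i * y ^ (k - i))
        = (\<Sum>i\<le>k. (- 1) ^ i * of_nat (m choose i) * x ^ (k - i) * y ^ i)"
      by (rule sum.reindex_bij_witness[of _ "\<lambda>i. k - i" "\<lambda>i. k - i"]) auto
    also have "\<dots> = (\<Sum>i\<le>m. (- 1) ^ i * of_nat (m choose i) * x ^ (k - i) * y ^ i)"
      by (rule sum.mono_neutral_right) (auto simp: binomial_eq_0 k)
    also have "\<dots> = (\<Sum>i\<le>m. of_nat (m choose i) * (- y) ^ i * x ^ (m - i)) * x ^ n"
      unfolding sum_distrib_right by (rule sum.cong) (auto simp: k power_add[symmetric] power_minus[of y] algebra_simps)
    also have "\<dots> = (- y + x) ^ m * x ^ n" by (simp only: binomial_ring)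
    finally show ?thesis by (simp add: algebra_simps)
  qed
  also have "(\<Sum>i\<le>k. (- 1) ^ i * of_nat (m choose i) * x ^ i * y ^ (k - i)) = (x - y) ^ m * y ^ n"
  proof -
    have "(\<Sum>i\<le>k. (- 1) ^ i * of_nat (m choose i) * x ^ i * y ^ (k - i)) = (\<Sum>i\<le>m. (- 1) ^ i * of_nat (m choose i) * x ^ i * y ^ (k - i))"
      by (rule sum.mono_neutral_right) (auto simp: binomial_eq_0 k)
    also have "\<dots> = (\<Sum>i\<le>m. of_nat (m choose i) * (- x) ^ i * y ^ (m - i)) * y ^ n"
      unfolding sum_distrib_right by (rule sum.cong) (auto simp: k power_add[symmetric] power_minus[of x] algebra_simps)
    also have "\<dots> = (- x + y) ^ m * y ^ n" by (simp only: binomial_ring)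
    also have "(- x + y) ^ m = (x - y) ^ m" using power_minus_even[OF em, of "x - y"] by simp
    finally show ?thesis .
  qed
  finally show "?f (bas u) = ?g (bas u)"
    by (simp add: double_poly_def u mn qfunctional_scale[OF qfunctional_eval2] algebra_simps)
qed

text \<open>Evenness and vanishing on the axis are automatic, as the letters are odd and at least 3.
  There remains the three-term relation, whose coefficients are the pairings with the double zeta
  values of weight \<open>k + 2\<close>.\<close>

lemma double_poly_in_period_polys_iff:
  assumes l: "keys l \<subseteq> pair_words (k + 2)"
  shows "double_poly l \<in> period_polys (k + 2) \<longleftrightarrow> l \<in> double_relations (k + 2)"
proof -
  let ?p = "double_poly l" and ?c = "\<lambda>i. pairing l (\<psi> (zeta_elt [Suc i, Suc (k - i)]))"
  define r where "r = (\<Sum>i\<le>k. qscale (?c i) (bas (i, k - i)))"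
  have keys: "i + j = k \<and> even i \<and> even j \<and> 2 \<le> i \<and> 2 \<le> j" if "(i, j) \<in> keys ?p" for i j
  proof -
    have "[Suc i, Suc j] \<in> pair_words (k + 2)"
      using that l lookup_double_poly[OF l, of i j] by (auto simp: in_keys_iff)
    then show ?thesis by (auto simp: pair_words_iff)
  qed
  have ev: "eval2 ?p (- x) y = eval2 ?p x y" "eval2 ?p x (- y) = eval2 ?p x y" for x y
    unfolding eval2_def by (auto intro!: sum.cong dest: keys)
  have axis: "eval2 ?p x 0 = 0" for x
    unfolding eval2_def by (auto intro!: sum.neutral dest: keys)
  have r: "eval2 r x y = (\<Sum>i\<le>k. ?c i * x ^ i * y ^ (k - i))" for x y
    by (simp add: r_def qfunctional_sum[OF qfunctional_eval2] qfunctional_scale[OF qfunctional_eval2] mult.assoc)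
  have kr: "keys r \<subseteq> monomials k"
  proof -
    have "r \<in> {r. keys r \<subseteq> monomials k}"
      unfolding r_def by (intro qvs.subspace_sum qvs.subspace_scale subspace_keys) (auto simp: monomials_def)
    then show ?thesis by simp
  qed
  have lr: "lookup r (i, k - i) = ?c i" if "i \<le> k" for i
  proof -
    have "lookup r (i, k - i) = (\<Sum>j\<le>k. if j = i then ?c i else 0)"
      unfolding r_def lookup_sum by (intro sum.cong) (auto simp: lookup_single when_def)
    then show ?thesis using that by simp
  qed
  have "?p \<in> period_polys (k + 2) \<longleftrightarrow> (\<forall>x y. eval2 r x y = 0)"
    unfolding period_polys_def mem_Collect_eq r period_relation_double_poly[OF l]
    using keys ev axis by auto
  also have "\<dots> \<longleftrightarrow> r = 0"
    using eval2_eq_0[OF kr] by (auto simp: eval2_def)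
  also have "\<dots> \<longleftrightarrow> (\<forall>i\<le>k. ?c i = 0)"
  proof
    assume "r = 0"
    then show "\<forall>i\<le>k. ?c i = 0" using lr by simp
  qed (simp add: r_def)
  also have "\<dots> \<longleftrightarrow> l \<in> double_relations (k + 2)"
  proof
    assume *: "\<forall>i\<le>k. ?c i = 0"
    have "pairing l (\<psi> (zeta_elt [a, b])) = 0" if "1 \<le> a" "1 \<le> b" "a + b = k + 2" for a b
    proof -
      have "a = Suc (a - 1)" "b = Suc (k - (a - 1))" "a - 1 \<le> k" using that by auto
      then show ?thesis using * by metis
    qed
    then show "l \<in> double_relations (k + 2)" using l by (simp add: double_relations_def)
  qed (auto simp: double_relations_def)
  finally show ?thesis .
qed

text \<open>Conversely, a period polynomial involves only monomials with both exponents even and at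
  least 2, which are those of pairs of letters; in odd weight it is zero.\<close>

lemma double_poly_image: "double_poly ` double_relations (k + 2) = period_polys (k + 2)"
proof (intro equalityI subsetI)
  fix p assume "p \<in> double_poly ` double_relations (k + 2)"
  then show "p \<in> period_polys (k + 2)"
    using double_poly_in_period_polys_iff by (auto simp: double_relations_def)
next
  fix p assume p: "p \<in> period_polys (k + 2)"
  define l where "l = (\<Sum>u\<in>pair_words (k + 2).
    qscale (lookup p (u ! 0 - 1, u ! 1 - 1) / (zeta_coeff (u ! 0) * zeta_coeff (u ! 1))) (bas u))"
  have lu: "lookup l u = (if u \<in> pair_words (k + 2) then lookup p (u ! 0 - 1, u ! 1 - 1) / (zeta_coeff (u ! 0) * zeta_coeff (u ! 1)) else 0)" for u
    by (simp add: l_def lookup_sum lookup_single when_def finite_pair_words if_distrib cong: if_cong)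
  have l: "keys l \<subseteq> pair_words (k + 2)" by (auto simp: in_keys_iff lu split: if_splits)
  have "lookup (double_poly l) (i, j) = lookup p (i, j)" for i j
  proof (cases "[Suc i, Suc j] \<in> pair_words (k + 2)")
    case True
    then have "zeta_coeff (Suc i) \<noteq> 0" "zeta_coeff (Suc j) \<noteq> 0" using zeta_coeff_nonzero by (auto simp: pair_words_iff)
    then show ?thesis using True by (simp add: lookup_double_poly[OF l] lu)
  next
    case False
    have "lookup p (i, j) = 0"
    proof (cases "even k")
      case True
      have p': "p \<in> even_alternating k" "lookup p (k, 0) = 0" using p unfolding period_polys_even[OF True] by auto
      have alt: "lookup p (b, a) = - lookup p (a, b)" for a b by (rule even_alternating_lookup(2)[OF p'(1)])
      have "lookup p (0, k) = 0" using alt[of 0 k] p'(2) by simp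
      have "\<not> (i + j = k \<and> even i \<and> 2 \<le> i \<and> 2 \<le> j)"
      proof
        assume *: "i + j = k \<and> even i \<and> 2 \<le> i \<and> 2 \<le> j"
        then have "even j" using True even_add by blast
        then show False using * False by (simp add: pair_words_iff)
      qed
      then consider "i + j \<noteq> k" | "odd i" | "i + j = k" "even i" "i = 0" | "i + j = k" "even i" "j = 0" | "i + j = k" "odd j" "even i"
        by (metis One_nat_def Suc_leI Suc_1 even_zero le_antisym not_less_eq_eq odd_one le_zero_eq not_gr_zero)
      then show ?thesis
      proof cases
        case 1
        then show ?thesis using p'(1) by (auto simp: even_alternating_def monomials_def in_keys_iff)
      next
        case 2
        then show ?thesis by (rule even_alternating_lookup(1)[OF p'(1)])
      next
        case 3
        then show ?thesis using \<open>lookup p (0, k) = 0\<close> by simp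
      next
        case 4
        then show ?thesis using p'(2) by simp
      next
        case 5
        then show ?thesis using True even_add by blast
      qed
    qed (use p period_polys_odd[of k] in simp)
    then show ?thesis using False l by (simp add: lookup_double_poly[OF l] lu)
  qed
  then have "p = double_poly l" by (intro poly_mapping_eqI) auto
  then show "p \<in> double_poly ` double_relations (k + 2)"
    using double_poly_in_period_polys_iff[OF l] p by auto
qed

lemma dim_double_relations: "qvs.dim (double_relations (k + 2)) = qvs.dim (period_polys (k + 2))"
proof -
  have "qvs.dim (double_poly ` double_relations (k + 2)) = qvs.dim (double_relations (k + 2))"
  proof (rule qvp.dim_image_injective[OF qlinear_double_poly])
    show "qvs.subspace (double_relations (k + 2))"
    proof -
      have "qvs.subspace {l. \<forall>a b. 1 \<le> a \<longrightarrow> 1 \<le> b \<longrightarrow> a + b = k + 2 \<longrightarrow> pairing l (\<psi> (zeta_elt [a, b])) = 0}"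
        unfolding qvs.subspace_def
        by (simp add: qfunctional_zero[OF qfunctional_pairing_left] qfunctional_add[OF qfunctional_pairing_left]
            qfunctional_scale[OF qfunctional_pairing_left])
      from qvs.subspace_inter[OF subspace_keys this] show ?thesis by (simp only: double_relations_def Int_def mem_Collect_eq)
    qed
    show "double_relations (k + 2) \<subseteq> qvs.span (bas ` pair_words (k + 2))"
      by (auto simp: double_relations_def span_bas)
    show "l = 0" if l: "l \<in> double_relations (k + 2)" "double_poly l = 0" for l
    proof -
      have kl: "keys l \<subseteq> pair_words (k + 2)" using l by (simp add: double_relations_def)
      have "lookup l u = 0" if u: "u \<in> pair_words (k + 2)" for u
      proof -
        obtain i j where ij: "u = [Suc i, Suc j]"
          using u unfolding pair_words_iff by (metis not_numeral_le_zero old.nat.exhaust)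
        then have "zeta_coeff (Suc i) \<noteq> 0" "zeta_coeff (Suc j) \<noteq> 0" using u zeta_coeff_nonzero by (auto simp: pair_words_iff)
        then show ?thesis using lookup_double_poly[OF kl, of i j] l(2) by (simp add: ij)
      qed
      then have "keys l = {}" using kl by (meson in_keys_iff subset_iff equals0I)
      then show ?thesis by simp
    qed
  qed (simp add: finite_pair_words)
  then show ?thesis unfolding double_poly_image by simp
qed

lemma wt_dim_gr_A_2_eq: "wt_dim (gr_A \<psi> 2) N + wt_dim P_dual N = card (pair_words N)"
proof (cases "3 \<le> N")
  case True
  then have n: "(N - 2) + 2 = N" by simp
  have "qvs.dim (double_relations N) = qvs.dim (period_polys N)" using dim_double_relations[of "N - 2"] unfolding n .
  then show ?thesis using wt_dim_gr_A_2[of N] True by (simp add: wt_dim_P_dual)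
next
  case False
  then have "pair_words N = {}" by (auto simp: pair_words_iff)
  then show ?thesis using wt_dim_gr_A_2[of N] False by (simp add: wt_dim_P_dual)
qed

end

subsection \<open>Generating series\<close>

lemma fps_unit_divide:
  fixes f g h :: "'a :: field fps"
  assumes "f * g = h" "fps_nth g 0 \<noteq> 0"
  shows "h / g = f"
proof -
  have "g \<noteq> 0" using assms(2) by auto
  then show ?thesis using assms(1) by (metis nonzero_mult_div_cancel_right)
qed

text \<open>The denominator is 1 - x^4 - x^6 + x^10, which amounts to a recursion for the
  dimensions. It is checked with the negative terms moved across, as an identity of natural
  numbers.\<close>

lemma Cusp_series_eq: "Cusp_series = Abs_fps (\<lambda>N. of_nat (wt_dim P_dual N))" (is "_ = Abs_fps ?f")
proof -
  define s where "s N = wt_dim P_dual N" for N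
  have s: "s N = (if even N \<and> 4 \<le> N then ((N - 2) div 2 + 1) div 2 - 1 - (N - 2) div 2 div 3 else 0)" for N
  proof (cases "3 \<le> N")
    case True
    then have n: "(N - 2) + 2 = N" "0 < N - 2" "even (N - 2) \<longleftrightarrow> even N" by auto
    show ?thesis using dim_period_polys[OF n(2)] True unfolding n by (auto simp: s_def wt_dim_P_dual)
  qed (simp add: s_def wt_dim_P_dual)
  have rec: "s N + (if 10 \<le> N then s (N - 10) else 0) =
      (if N = 12 then 1 else 0) + (if 4 \<le> N then s (N - 4) else 0) + (if 6 \<le> N then s (N - 6) else 0)" for N
  proof (cases "even N \<and> 14 \<le> N")
    case True
    then obtain d where d: "N = 2 * d" "7 \<le> d" by (auto elim!: evenE)
    have "s (2 * e) = e div 2 - 1 - (e - 1) div 3" if "2 \<le> e" for e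
    proof -
      have "(2 * e - 2) div 2 = e - 1" by simp
      then show ?thesis using that unfolding s by simp
    qed
    then have "s (2 * d) = d div 2 - 1 - (d - 1) div 3" "s (2 * (d - 5)) = (d - 5) div 2 - 1 - (d - 5 - 1) div 3"
        "s (2 * (d - 2)) = (d - 2) div 2 - 1 - (d - 2 - 1) div 3" "s (2 * (d - 3)) = (d - 3) div 2 - 1 - (d - 3 - 1) div 3"
      using d(2) by simp_all
    moreover have "d div 2 - 1 - (d - 1) div 3 + ((d - 5) div 2 - 1 - (d - 5 - 1) div 3)
        = (d - 2) div 2 - 1 - (d - 2 - 1) div 3 + ((d - 3) div 2 - 1 - (d - 3 - 1) div 3)"
    proof -
      \<comment> \<open>Dividing by 6 makes all halves and thirds explicit, up to the six values of
        the remainder; 7 is the least value of \<open>d\<close>.\<close>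
      define q r where "q = (d - 7) div 6" and "r = (d - 7) mod 6"
      have dqr: "d = 6 * q + r + 7" using d(2) by (simp add: q_def r_def)
      have "(6 * q + c) div 2 = 3 * q + c div 2" "(6 * q + c) div 3 = 2 * q + c div 3" for c
        by presburger+
      note half = this(1)[of "r + 7"] this(1)[of "r + 5"] this(1)[of "r + 4"] this(1)[of "r + 2"]
        this(2)[of "r + 6"] this(2)[of "r + 4"] this(2)[of "r + 3"] this(2)[of "r + 1"]
      have sub: "d = 6 * q + (r + 7)" "d - 2 = 6 * q + (r + 5)" "d - 3 = 6 * q + (r + 4)" "d - 5 = 6 * q + (r + 2)"
        "d - 1 = 6 * q + (r + 6)" "d - 2 - 1 = 6 * q + (r + 4)" "d - 3 - 1 = 6 * q + (r + 3)" "d - 5 - 1 = 6 * q + (r + 1)"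
        using dqr by simp_all
      have "r < 6" by (simp add: r_def)
      then have "r = 0 \<or> r = 1 \<or> r = 2 \<or> r = 3 \<or> r = 4 \<or> r = 5" by linarith
      then show ?thesis
        unfolding sub(6-8) unfolding sub(2-5) unfolding sub(1) half by (elim disjE; hypsubst; simp)
    qed
    ultimately show ?thesis using d by (simp add: diff_mult_distrib2)
  next
    case False
    show ?thesis
    proof (cases "odd N")
      case False
      then have "N \<in> {0, 2, 4, 6, 8, 10, 12}" using \<open>\<not> (even N \<and> 14 \<le> N)\<close>
        by (auto elim!: evenE)
      then show ?thesis by (auto simp: s)
    qed (auto simp: s)
  qed
  have "Abs_fps ?f * ((1 - fps_X ^ 4) * (1 - fps_X ^ 6)) = fps_X ^ 12"
  proof (rule fps_ext)
    fix N
    have "Abs_fps ?f * ((1 - fps_X ^ 4) * (1 - fps_X ^ 6)) =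
        Abs_fps ?f - Abs_fps ?f * fps_X ^ 4 - Abs_fps ?f * fps_X ^ 6 + Abs_fps ?f * fps_X ^ 10"
      by (simp add: algebra_simps power_add[symmetric])
    moreover have "rat_of_nat (s N) + (if 10 \<le> N then of_nat (s (N - 10)) else 0) =
        (if N = 12 then 1 else 0) + (if 4 \<le> N then of_nat (s (N - 4)) else 0) + (if 6 \<le> N then of_nat (s (N - 6)) else 0)"
      using arg_cong[OF rec[of N], of rat_of_nat] by (simp split: if_splits)
    ultimately show "fps_nth (Abs_fps ?f * ((1 - fps_X ^ 4) * (1 - fps_X ^ 6))) N = fps_nth (fps_X ^ 12 :: rat fps) N"
      by (simp add: fps_X_power_mult_right_nth s_def[symmetric] split: if_splits)
  qed
  then show ?thesis unfolding Cusp_series_def by (rule fps_unit_divide) simp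
qed

text \<open>The coefficients are power series and form no field; a constant term 1 still makes
  \<open>g\<close> invertible.\<close>

lemma fps_divide_constant_1:
  fixes f g h :: "'a :: field fps fps"
  assumes "f * g = h" "fps_nth g 0 = 1"
  shows "h / g = f"
proof -
  have "subdegree g = 0" using assms(2) by (simp add: subdegree_eq_0_iff)
  then have "h / g = h * inverse g" by (simp add: fps_divide_def)
  moreover have "g * inverse g = 1"
    unfolding fps_inverse_def[of g] assms(2) fps_inverse_one by (rule fps_right_inverse) (simp add: assms(2))
  ultimately show ?thesis using assms(1) by (metis mult.assoc mult_1_right)
qed

lemma Even_series_eq: "Even_series = Abs_fps (\<lambda>N. if even N \<and> 2 \<le> N then 1 else 0)" (is "_ = ?f")
proof -
  have "?f * (1 - fps_X ^ 2) = fps_X ^ 2"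
  proof (rule fps_ext)
    fix N :: nat
    have "?f * (1 - fps_X ^ 2) = ?f - ?f * fps_X ^ 2" by (simp add: algebra_simps)
    then show "fps_nth (?f * (1 - fps_X ^ 2)) N = fps_nth (fps_X ^ 2) N"
      by (auto simp: fps_X_power_mult_right_nth)
  qed
  then show ?thesis unfolding Even_series_def by (rule fps_unit_divide) simp
qed

lemma Odd_series_eq: "Odd_series = Abs_fps (\<lambda>N. if odd N \<and> 3 \<le> N then 1 else 0)" (is "_ = ?f")
proof -
  have "?f * (1 - fps_X ^ 2) = fps_X ^ 3"
  proof (rule fps_ext)
    fix N :: nat
    have "?f * (1 - fps_X ^ 2) = ?f - ?f * fps_X ^ 2" by (simp add: algebra_simps)
    moreover have "odd N \<and> 3 \<le> N \<longleftrightarrow> N = 3 \<or> 2 \<le> N \<and> odd (N - 2) \<and> 3 \<le> N - 2" by presburger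
    ultimately show "fps_nth (?f * (1 - fps_X ^ 2)) N = fps_nth (fps_X ^ 3) N"
      by (auto simp: fps_X_power_mult_right_nth)
  qed
  then show ?thesis unfolding Odd_series_def by (rule fps_unit_divide) simp
qed

section \<open>Dimension series of the graded pieces of \<A>\<close>

context mixed_tate_Z
begin

definition A_series :: "nat \<Rightarrow> rat fps" where
  "A_series r = Abs_fps (\<lambda>N. of_nat (wt_dim (gr_A \<psi> r) N))"

lemma A_series_0: "A_series 0 = 1"
  by (rule fps_ext) (simp add: A_series_def wt_dim_gr_A_0)

lemma A_series_1: "A_series 1 = Odd_series"
  by (rule fps_ext) (simp add: A_series_def wt_dim_gr_A_1[unfolded One_nat_def] Odd_series_eq)

lemma Odd_series_square: "fps_nth (Odd_series * Odd_series) N = of_nat (card (pair_words N))"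
proof -
  let ?K = "{i \<in> {0..N}. odd i \<and> 3 \<le> i \<and> odd (N - i) \<and> 3 \<le> N - i}"
  have "pair_words N = (\<lambda>i. [i, N - i]) ` ?K"
  proof (intro equalityI subsetI)
    fix u assume "u \<in> pair_words N"
    then obtain m n where "u = [m, n]" "odd m" "3 \<le> m" "odd n" "3 \<le> n" "m + n = N" unfolding pair_words_iff by blast
    then show "u \<in> (\<lambda>i. [i, N - i]) ` ?K" by (intro image_eqI[of _ _ m]) auto
  qed (auto simp: pair_words_iff)
  moreover have "inj_on (\<lambda>i. [i, N - i]) ?K" by (auto simp: inj_on_def)
  ultimately have "card (pair_words N) = card ?K" by (simp add: card_image)
  moreover have "fps_nth (Odd_series * Odd_series) N = (\<Sum>i\<in>{0..N}. if i \<in> ?K then 1 else 0)"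
    unfolding fps_mult_nth Odd_series_eq by (rule sum.cong) auto
  moreover have "{0..N} \<inter> ?K = ?K" by blast
  then have "(\<Sum>i\<in>{0..N}. if i \<in> ?K then 1 else 0) = rat_of_nat (card ?K)"
    by (simp only: sum.If_cases[OF finite_atLeastAtMost] Collect_mem_eq) simp
  ultimately show ?thesis by (simp only:)
qed

lemma A_series_2: "A_series 2 = Odd_series * Odd_series - Cusp_series"
proof (rule fps_ext)
  fix N
  show "fps_nth (A_series 2) N = fps_nth (Odd_series * Odd_series - Cusp_series) N"
    using arg_cong[OF wt_dim_gr_A_2_eq[of N], of rat_of_nat]
    by (simp add: A_series_def Odd_series_square Cusp_series_eq)
qed

lemma wt_dim_tensor_series:
  assumes "graded_subquot X" "graded_subquot Y"
  shows "Abs_fps (\<lambda>N. of_nat (wt_dim (X \<otimes>\<^sub>s Y) N)) =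
    Abs_fps (\<lambda>N. of_nat (wt_dim X N)) * (Abs_fps (\<lambda>N. of_nat (wt_dim Y N)) :: rat fps)"
  by (rule fps_ext) (simp add: wt_dim_tensor[OF assms] fps_mult_nth atMost_atLeast0)

lemma A_series_rec:
  assumes "exists_exact_seq (P_dual \<otimes>\<^sub>s gr_A \<psi> r) (gr_A \<psi> (r + 4))
    (gr1_A_odd \<psi> \<otimes>\<^sub>s gr_A \<psi> (r + 3)) (P_dual \<otimes>\<^sub>s gr_A \<psi> (r + 2))"
  shows "A_series (r + 4) = Odd_series * A_series (r + 3) - Cusp_series * A_series (r + 2) + Cusp_series * A_series r"
proof -
  note sq = graded_subquot_P_dual graded_subquot_gr_A graded_subquot_tensor
  have "wt_dim (P_dual \<otimes>\<^sub>s gr_A \<psi> r) N + wt_dim (gr_A \<psi> 1 \<otimes>\<^sub>s gr_A \<psi> (r + 3)) N =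
      wt_dim (gr_A \<psi> (r + 4)) N + wt_dim (P_dual \<otimes>\<^sub>s gr_A \<psi> (r + 2)) N" for N
    using assms unfolding gr1_A_odd_eq by (rule wt_dim_exact_seq) (intro sq)+
  then have "of_nat (wt_dim (P_dual \<otimes>\<^sub>s gr_A \<psi> r) N) + of_nat (wt_dim (gr_A \<psi> 1 \<otimes>\<^sub>s gr_A \<psi> (r + 3)) N) =
      (of_nat (wt_dim (gr_A \<psi> (r + 4)) N) + of_nat (wt_dim (P_dual \<otimes>\<^sub>s gr_A \<psi> (r + 2)) N) :: rat)" for N
    unfolding of_nat_add[symmetric] by (simp only:)
  then have "Abs_fps (\<lambda>N. of_nat (wt_dim (P_dual \<otimes>\<^sub>s gr_A \<psi> r) N)) + Abs_fps (\<lambda>N. of_nat (wt_dim (gr_A \<psi> 1 \<otimes>\<^sub>s gr_A \<psi> (r + 3)) N)) =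
      (A_series (r + 4) + Abs_fps (\<lambda>N. of_nat (wt_dim (P_dual \<otimes>\<^sub>s gr_A \<psi> (r + 2)) N)) :: rat fps)"
    by (intro fps_ext) (simp add: A_series_def)
  then have "Cusp_series * A_series r + Odd_series * A_series (r + 3) = A_series (r + 4) + Cusp_series * A_series (r + 2)"
    unfolding wt_dim_tensor_series[OF sq(1,2)] wt_dim_tensor_series[OF sq(2,2)]
      Cusp_series_eq[symmetric] A_series_def[symmetric] A_series_1 .
  then show ?thesis by (simp add: algebra_simps)
qed

definition total_series :: "rat fps" where
  "total_series = Abs_fps (\<lambda>N. of_nat (dim_A_total N))"

lemma Odd_total_nth:
  "fps_nth (Odd_series * total_series) M = of_nat (\<Sum>k\<in>odd_letters M. dim_A_total (M - k))"
proof -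
  have "fps_nth (Odd_series * total_series) M = (\<Sum>i\<in>{0..M}. if i \<in> odd_letters M then of_nat (dim_A_total (M - i)) else 0)"
    unfolding fps_mult_nth by (rule sum.cong) (auto simp: Odd_series_eq total_series_def odd_letters_def)
  also have "\<dots> = of_nat (\<Sum>k\<in>odd_letters M. dim_A_total (M - k))"
  proof -
    have "{0..M} \<inter> odd_letters M = odd_letters M" by (auto simp: odd_letters_def)
    then show ?thesis by (simp add: sum.If_cases)
  qed
  finally show ?thesis .
qed

text \<open>In weight \<open>N\<close> only depths up to \<open>N\<close> occur, so partial sums
  compute the infinite sum over all depths.\<close>

lemma sum_A_series_nth:
  assumes "N \<le> R"
  shows "fps_nth (\<Sum>r\<le>R. A_series r) N = fps_nth total_series N"
proof -
  have "fps_nth (\<Sum>r\<le>R. A_series r) N = of_nat (dim_A R N)"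
    by (simp add: fps_sum_nth A_series_def dim_A_eq_sum)
  then show ?thesis using psi_depth_total[OF assms] by (simp add: total_series_def dim_A_def dim_A_total_def)
qed

lemma gr_H_series:
  "1 + gen_series (\<lambda>N r. wt_dim (gr_H \<psi> r) N) = Abs_fps A_series * (1 + fps_const Even_series * fps_X)"
proof (intro fps_ext[of "_ :: rat fps fps"] fps_ext[of "_ :: rat fps"])
  fix r N
  have "fps_nth (fps_nth (Abs_fps A_series * (1 + fps_const Even_series * fps_X)) r) N =
      fps_nth (A_series r + Even_series * (if r = 0 then 0 else A_series (r - 1))) N"
  proof -
    have "Abs_fps A_series * (1 + fps_const Even_series * fps_X) =
        Abs_fps A_series + fps_const Even_series * (Abs_fps A_series * fps_X ^ 1)" by (simp add: algebra_simps)
    then show ?thesis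
      by (simp only: fps_add_nth fps_mult_left_const_nth fps_X_power_mult_right_nth fps_nth_Abs_fps less_one)
  qed
  moreover have "fps_nth (Even_series * A_series (r - 1)) N = (\<Sum>k\<in>{1..N div 2}. of_nat (wt_dim (gr_A \<psi> (r - 1)) (N - 2 * k)))"
  proof -
    have "fps_nth (Even_series * A_series (r - 1)) N =
        (\<Sum>i\<in>{i \<in> {0..N}. even i \<and> 2 \<le> i}. of_nat (wt_dim (gr_A \<psi> (r - 1)) (N - i)))"
      unfolding fps_mult_nth Even_series_eq A_series_def
      by (rule sum.mono_neutral_cong_right) auto
    also have "\<dots> = (\<Sum>k\<in>{1..N div 2}. of_nat (wt_dim (gr_A \<psi> (r - 1)) (N - 2 * k)))"
      by (rule sum.reindex_bij_witness[of _ "\<lambda>k. 2 * k" "\<lambda>i. i div 2"]) auto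
    finally show ?thesis .
  qed
  ultimately show "fps_nth (fps_nth (1 + gen_series (\<lambda>N r. wt_dim (gr_H \<psi> r) N)) r) N =
      fps_nth (fps_nth (Abs_fps A_series * (1 + fps_const Even_series * fps_X)) r) N"
    \<comment> \<open>\<open>gen_series\<close> omits \<open>N = 0\<close> and \<open>r = 0\<close>;
      the weight 0 part of \<A> is concentrated in depth 0 and matches the summand 1.\<close>
    using gr_A_eq_0[of N r]
    by (cases "r = 0"; cases "N = 0") (simp_all add: gen_series_def wt_dim_gr_H_eq wt_dim_gr_A_0 A_series_def)
qed

section \<open>Consequences of the recursion in depth\<close>

context
  assumes rec: "\<And>r. A_series (r + 4) = Odd_series * A_series (r + 3) - Cusp_series * A_series (r + 2) + Cusp_series * A_series r"
begin

text \<open>Partial sums stand in for the infinite sum over depths. As \<open>B (N + 2)\<close> and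
  \<open>B N\<close> agree up to weight \<open>N\<close>, their products with
  \<open>Cusp_series\<close> cancel there; besides \<O> B only boundary terms from depths below 4
  remain.\<close>

lemma total_series_rec:
  "total_series = 1 + A_series 3 - Odd_series * A_series 2 + Cusp_series * Odd_series + Odd_series * total_series"
proof (rule fps_ext)
  fix N
  define B where "B R = (\<Sum>r\<le>R. A_series r)" for R
  have B: "B (Suc R) = B R + A_series (Suc R)" for R by (simp add: B_def)
  have "B (R + 4) = 1 + A_series 3 - Odd_series * A_series 2 + Cusp_series * Odd_series + Odd_series * B (R + 3)
      - Cusp_series * B (R + 2) + Cusp_series * B R" for R
  proof (induction R)
    case 0
    have b: "B 0 = 1" "B 1 = 1 + Odd_series" "B 2 = 1 + Odd_series + A_series 2"
      "B 3 = 1 + Odd_series + A_series 2 + A_series 3" "B 4 = 1 + Odd_series + A_series 2 + A_series 3 + A_series 4"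
      using A_series_1 by (simp_all add: B_def A_series_0 eval_nat_numeral)
    have a: "A_series 4 = Odd_series * A_series 3 - Cusp_series * A_series 2 + Cusp_series"
      using rec[of 0] by (simp only: add_0 A_series_0 mult_1_right)
    show ?case unfolding add_0 b a A_series_2 by (simp add: algebra_simps)
  next
    case (Suc R)
    have "B (Suc R + 4) = B (R + 4) + A_series (Suc R + 4)" "B (Suc R + 3) = B (R + 3) + A_series (Suc R + 3)"
      "B (Suc R + 2) = B (R + 2) + A_series (Suc R + 2)"
      using B[of "R + 4"] B[of "R + 3"] B[of "R + 2"] by (simp_all add: algebra_simps)
    then show ?case by (simp only: Suc.IH rec B ring_distribs) (simp add: algebra_simps)
  qed
  from this[of N] have *: "B (N + 4) + Cusp_series * B (N + 2) + (Odd_series * A_series 2) =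
      1 + A_series 3 + Cusp_series * Odd_series + Odd_series * B (N + 3) + Cusp_series * B N" by (simp add: algebra_simps)
  have tot: "fps_nth (B R) n = fps_nth total_series n" if "n \<le> R" for n R
    unfolding B_def by (rule sum_A_series_nth[OF that])
  have mult: "fps_nth (F * B R) N = fps_nth (F * total_series) N" if "N \<le> R" for F R
    unfolding fps_mult_nth using that by (intro sum.cong refl) (simp add: tot)
  show "fps_nth total_series N =
    fps_nth (1 + A_series 3 - Odd_series * A_series 2 + Cusp_series * Odd_series + Odd_series * total_series) N"
    using arg_cong[OF *, of "\<lambda>f. fps_nth f N"] by (simp add: tot mult)
qed

text \<open>In positive weight \<O> B - B is \<O> A_2 minus A_3 and \<S> \<O>, both with nonnegative
  coefficients. The coefficient of \<O> A_2 is at most M (M + 1), there being at most N two-letter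
  words of weight N.\<close>

lemma growth_bound:
  assumes "0 < M"
  shows "(\<Sum>k\<in>odd_letters M. dim_A_total (M - k)) \<le> dim_A_total M + 2 * M\<^sup>2"
proof -
  have "0 \<le> fps_nth (Cusp_series * Odd_series) M"
    unfolding fps_mult_nth Cusp_series_eq Odd_series_eq by (intro sum_nonneg) auto
  moreover have "0 \<le> fps_nth (A_series 3) M" by (simp add: A_series_def)
  moreover have "fps_nth (Odd_series * A_series 2) M \<le> of_nat (2 * M\<^sup>2)"
  proof -
    have a2: "fps_nth (A_series 2) N \<le> of_nat N" for N
    proof -
      have "pair_words N \<subseteq> (\<lambda>i. [i, N - i]) ` {..<N}"
      proof
        fix u assume "u \<in> pair_words N"
        then obtain m n where "u = [m, n]" "3 \<le> n" "m + n = N" unfolding pair_words_iff by blast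
        then show "u \<in> (\<lambda>i. [i, N - i]) ` {..<N}" by (intro image_eqI[of _ _ m]) auto
      qed
      then have "card (pair_words N) \<le> card {..<N}" by (intro surj_card_le) auto
      then have "card (pair_words N) \<le> N" by simp
      then show ?thesis using wt_dim_gr_A_2_eq[of N] by (simp add: A_series_def)
    qed
    have "fps_nth (Odd_series * A_series 2) M \<le> (\<Sum>i\<in>{0..M}. of_nat M)"
      unfolding fps_mult_nth
    proof (rule sum_mono)
      fix i assume "i \<in> {0..M}"
      have "0 \<le> fps_nth (A_series 2) (M - i)" by (simp add: A_series_def)
      then have "fps_nth Odd_series i * fps_nth (A_series 2) (M - i) \<le> fps_nth (A_series 2) (M - i)"
        by (simp add: Odd_series_eq)
      also have "\<dots> \<le> of_nat (M - i)" by (rule a2)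
      also have "\<dots> \<le> of_nat M" by simp
      finally show "fps_nth Odd_series i * fps_nth (A_series 2) (M - i) \<le> of_nat M" .
    qed
    also have "\<dots> = of_nat (Suc M * M)" by (simp add: algebra_simps)
    also have "Suc M * M \<le> 2 * M\<^sup>2"
      using assms by (simp add: power2_eq_square)
    finally show ?thesis by simp
  qed
  moreover have "fps_nth total_series M = fps_nth (A_series 3) M - fps_nth (Odd_series * A_series 2) M
      + fps_nth (Cusp_series * Odd_series) M + fps_nth (Odd_series * total_series) M"
    using arg_cong[OF total_series_rec, of "\<lambda>f. fps_nth f M"] assms by simp
  ultimately have "fps_nth (Odd_series * total_series) M \<le> fps_nth total_series M + of_nat (2 * M\<^sup>2)" by linarith
  then have "rat_of_nat (\<Sum>k\<in>odd_letters M. dim_A_total (M - k)) \<le> of_nat (dim_A_total M + 2 * M\<^sup>2)"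
    unfolding Odd_total_nth by (simp add: total_series_def)
  then show ?thesis by (simp only: of_nat_le_iff)
qed

text \<open>The growth bound forces \<open>range \<psi> = OU\<close>, so the total series is that of the tensor algebra. This
  determines the series in depth three, which the exact sequences leave open.\<close>

lemma A_series_3: "A_series 3 = Odd_series * A_series 2 - Cusp_series * Odd_series"
proof -
  have OU: "OU \<subseteq> range \<psi>" by (rule OU_subset_range_psi[OF growth_bound])
  have "total_series = 1 + Odd_series * total_series"
  proof (rule fps_ext)
    fix M
    show "fps_nth total_series M = fps_nth (1 + Odd_series * total_series) M"
    proof (cases "M = 0")
      case True
      then show ?thesis using sum_A_series_nth[of 0 0] by (simp add: A_series_0 Odd_series_eq)
    next
      case False
      then show ?thesis
        unfolding fps_add_nth Odd_total_nth using card_odd_words[of M] by (simp add: total_series_def dim_A_total_eq_card[OF OU])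
    qed
  qed
  then have "total_series - Odd_series * total_series = 1" by (metis add_diff_cancel_right')
  moreover have "total_series - Odd_series * total_series = 1 + A_series 3 - Odd_series * A_series 2 + Cusp_series * Odd_series"
    using total_series_rec by (metis add_diff_cancel_right')
  ultimately have "1 + A_series 3 - Odd_series * A_series 2 + Cusp_series * Odd_series = 1" by simp
  then show ?thesis by (simp add: algebra_simps)
qed

lemma A_series_generating:
  "Abs_fps A_series * (1 - fps_const Odd_series * fps_X + fps_const Cusp_series * fps_X ^ 2 - fps_const Cusp_series * fps_X ^ 4) = 1"
proof (rule fps_ext)
  fix r
  let ?F = "Abs_fps A_series"
  have "?F * (1 - fps_const Odd_series * fps_X + fps_const Cusp_series * fps_X ^ 2 - fps_const Cusp_series * fps_X ^ 4)
    = ?F - fps_const Odd_series * (?F * fps_X ^ 1) + fps_const Cusp_series * (?F * fps_X ^ 2) - fps_const Cusp_series * (?F * fps_X ^ 4)"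
    by (simp add: algebra_simps)
  moreover have "A_series r - Odd_series * (if r < 1 then 0 else A_series (r - 1))
      + Cusp_series * (if r < 2 then 0 else A_series (r - 2)) - Cusp_series * (if r < 4 then 0 else A_series (r - 4)) =
      (if r = 0 then 1 else 0)"
  proof -
    have "r \<in> {0, 1, 2, 3} \<or> r = (r - 4) + 4" by auto
    then consider "r = 0" | "r = 1" | "r = 2" | "r = 3" | s where "r = s + 4" by blast
    then show ?thesis
    proof cases
      case 3
      have "A_series 2 - Odd_series * A_series 1 + Cusp_series * A_series 0 = 0"
        unfolding A_series_2 A_series_1 A_series_0 by simp
      then show ?thesis using 3 by simp
    next
      case 4
      have "A_series 3 - Odd_series * A_series 2 + Cusp_series * A_series 1 = 0"
        unfolding A_series_3 A_series_1 by (simp add: algebra_simps)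
      then show ?thesis using 4 by simp
    next
      case 5
      then have "r - 1 = s + 3" "r - 2 = s + 2" "r - 4 = s" by simp_all
      then have "A_series r - Odd_series * A_series (r - 1) + Cusp_series * A_series (r - 2) - Cusp_series * A_series (r - 4) = 0"
        unfolding 5 by (simp only: rec[of s]) simp
      moreover have "\<not> r < 1" "\<not> r < 2" "\<not> r < 4" "r \<noteq> 0" using 5 by simp_all
      ultimately show ?thesis by (simp only: if_False)
    qed (use A_series_0 A_series_1 in simp_all)
  qed
  ultimately show "fps_nth (?F * (1 - fps_const Odd_series * fps_X + fps_const Cusp_series * fps_X ^ 2 - fps_const Cusp_series * fps_X ^ 4)) r
      = fps_nth 1 r"
    by (simp only: fps_add_nth fps_sub_nth fps_mult_left_const_nth fps_X_power_mult_right_nth fps_nth_Abs_fps fps_one_nth)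
qed

end

end

theorem theorem6p1:
  fixes \<psi> :: "pialg \<Rightarrow> (nat list \<Rightarrow>\<^sub>0 rat)"
    and \<phi> :: "pialg \<Rightarrow> (nat list \<times> nat \<Rightarrow>\<^sub>0 rat)"
    and \<rho> :: "(nat list \<times> nat \<Rightarrow>\<^sub>0 rat) \<Rightarrow> real"
  assumes "mixed_tate_Z \<psi> \<phi> \<rho>"
    and "\<And>r. r \<ge> 4 \<Longrightarrow>
      exists_exact_seq (P_dual \<otimes>\<^sub>s gr_A \<psi> (r - 4)) (gr_A \<psi> r)
        (gr1_A_odd \<psi> \<otimes>\<^sub>s gr_A \<psi> (r - 1)) (P_dual \<otimes>\<^sub>s gr_A \<psi> (r - 2))"
  shows "1 + gen_series (\<lambda>N r. wt_dim (gr_H \<psi> r) N) =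
    (1 + fps_const Even_series * fps_X) /
    (1 - fps_const Odd_series * fps_X + fps_const Cusp_series * fps_X ^ 2 - fps_const Cusp_series * fps_X ^ 4)"
proof -
  interpret mixed_tate_Z \<psi> \<phi> \<rho> by fact
  have rec: "A_series (r + 4) = Odd_series * A_series (r + 3) - Cusp_series * A_series (r + 2) + Cusp_series * A_series r" for r
  proof (rule A_series_rec)
    have r: "r + 4 - 4 = r" "r + 4 - 1 = r + 3" "r + 4 - 2 = r + 2" "4 \<le> r + 4" by simp_all
    show "exists_exact_seq (P_dual \<otimes>\<^sub>s gr_A \<psi> r) (gr_A \<psi> (r + 4))
        (gr1_A_odd \<psi> \<otimes>\<^sub>s gr_A \<psi> (r + 3)) (P_dual \<otimes>\<^sub>s gr_A \<psi> (r + 2))"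
      by (rule assms(2)[of "r + 4", OF r(4), unfolded r(1-3)])
  qed
  let ?D = "1 - fps_const Odd_series * fps_X + fps_const Cusp_series * fps_X ^ 2 - fps_const Cusp_series * fps_X ^ 4"
  have "(1 + gen_series (\<lambda>N r. wt_dim (gr_H \<psi> r) N)) * ?D = (1 + fps_const Even_series * fps_X) * (Abs_fps A_series * ?D)"
    unfolding gr_H_series by (simp only: mult_ac)
  also have "\<dots> = 1 + fps_const Even_series * fps_X"
    unfolding A_series_generating[OF rec] by simp
  finally show ?thesis by (rule fps_divide_constant_1[symmetric]) simp
qed

end
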